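(* The modular function field $\mathcal A_0(\Gamma(14))$ is the splitting field over $\mathcal A_0(\Gamma(7))=\mathbf C(\psi,\upsilon)$ of the cubic \[ P_{\upsilon}(T)=T^3+T^2-\frac{\upsilon^2-1}{\upsilon}T+\frac{(\upsilon-1)^2}{\upsilon}. \] More precisely, \[ \mathcal A_0(\Gamma(14))=\mathbf C(\upsilon,\psi,g_1,\delta)=\mathbf C(\upsilon,\psi,g_1,g_2), \] where $g_1,g_2,g_3$ are the three roots of $P_\upsilon(T)$ and \[ \delta=\frac{\upsilon^2}{2(\upsilon-1)}(g_1-g_2)(g_2-g_3)(g_3-g_1) \] is a normalized square root of the discriminant of $P_\upsilon(T)$. Consequently an affine model of the modular curve $X(14)$ is given by \[ \left\{ \begin{aligned} &Y^7=X^4(X-1),\\ &XZ^3+XZ^2-(X^2-1)Z+(X-1)^2=0,\\ &W^2=X(X-1)(X^3-8X^2+5X+1), \end{aligned} \right. \] where $X=\upsilon$, $Y=\psi$, $Z=g_1$ and $W=\delta$.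
   Context: For a congruence subgroup $G\subset\mathrm{SL}_2(\mathbf Z)$, $\mathcal A_0(G)$ denotes the field of modular functions for $G$ over $\mathbf C$ (weight $0$, meromorphic on the upper half-plane and at the cusps), i.e. the function field of the associated compact modular curve. "Affine model" means an affine curve whose function field is that of the modular curve. For $k=1,2,3$ put $a_k(\tau)=\sum_{n\in\mathbf Z}(-1)^{n+k+1}q^{(14n+7-2k)^2/56}$, where $q^r=e^{2\pi i r\tau}$, and $\psi=-a_2a_3/a_1^2$, $\upsilon=a_2^2a_3/a_1^3$, $\phi_1=-a_3/a_2$, $\phi_2=-a_2/a_1$. Then $\psi^7=\upsilon^4(\upsilon-1)$ and $\mathcal A_0(\Gamma(7))=\mathbf C(\psi,\upsilon)$. The three roots of $P_{\upsilon(\tau)}(T)$ are $g_1(\tau)=\phi_1(\tau)^2/\phi_1(2\tau)$, $g_2(\tau)=\phi_1(\tau)\phi_1(\tau/2)\phi_1(2\tau)-\phi_1(2\tau)/\phi_2(\tau)$, $g_3(\tau)=-\phi_1(\tau)\phi_1(\tau/2)\phi_1(2\tau)-\phi_1(\tau)^2\phi_2(\tau)/\phi_2(2\tau)$. *)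

theory Defs
  imports
    "HOL-Complex_Analysis.Complex_Analysis"
    "HOL-Number_Theory.Cong"
    "HOL-Library.Poly_Mapping"
    "HOL-Library.Extended_Nat"
    "HOL-Algebra.Generated_Fields"
    "HOL-Algebra.Algebraic_Closure_Type"
begin

definition uhp :: "complex set" where
  "uhp = {z. Im z > 0}"

lemma open_uhp: "open uhp"
  unfolding uhp_def by (rule open_halfspace_Im_gt)

lemma connected_uhp: "connected uhp"
  unfolding uhp_def by (intro convex_connected convex_halfspace_Im_gt)

text \<open>
  The representative of a meromorphic function is normalised to have no removable singularities,
  to be 0 at its poles (both via \<^const>\<open>nicely_meromorphic_on\<close>) and to be 0 outside the upper
  half-plane. Hence equality of elements of the type is equality as meromorphic functions on the
  upper half-plane.
\<close>

typedef mero_uhp = "{f. f nicely_meromorphic_on uhp \<and> (\<forall>z. z \<notin> uhp \<longrightarrow> f z = 0)}"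
  morphisms eval_mero Abs_mero_uhp
  by (rule exI[of _ "\<lambda>_. 0"]) auto

setup_lifting type_definition_mero_uhp

text \<open>
  The element represented by a function that is meromorphic on the upper half-plane;
  functions that are not meromorphic there are sent to 0.
\<close>

lift_definition mero_of :: "(complex \<Rightarrow> complex) \<Rightarrow> mero_uhp" is
  "\<lambda>f z. if f meromorphic_on uhp \<and> z \<in> uhp then remove_sings f z else 0"
proof (intro CollectI conjI)
  fix f :: "complex \<Rightarrow> complex"
  show "(\<lambda>z. if f meromorphic_on uhp \<and> z \<in> uhp then remove_sings f z else 0)
          nicely_meromorphic_on uhp" (is "?g nicely_meromorphic_on _")
  proof (cases "f meromorphic_on uhp")
    case True
    have ev: "eventually (\<lambda>w. ?g w = remove_sings f w) (at z)" if "z \<in> uhp" for z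
      using eventually_at_in_open'[OF open_uhp that] by eventually_elim (use True in auto)
    have nice: "remove_sings f nicely_meromorphic_on uhp"
      using True by (rule remove_sings_nicely_meromorphic)
    have "?g meromorphic_on uhp \<longleftrightarrow> remove_sings f meromorphic_on uhp"
      by (intro meromorphic_on_cong ev) auto
    moreover have "(is_pole ?g z \<and> ?g z = 0) \<or> ?g \<midarrow>z\<rightarrow> ?g z" if z: "z \<in> uhp" for z
    proof -
      have "is_pole ?g z \<longleftrightarrow> is_pole (remove_sings f) z"
        by (intro is_pole_cong ev z refl)
      moreover have "(?g \<midarrow>z\<rightarrow> c) \<longleftrightarrow> (remove_sings f \<midarrow>z\<rightarrow> c)" for c
        by (intro filterlim_cong ev z refl)
      ultimately show ?thesis
        using nice z True unfolding nicely_meromorphic_on_def by auto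
    qed
    ultimately show ?thesis
      using nice unfolding nicely_meromorphic_on_def by blast
  next
    case False
    thus ?thesis by auto
  qed
qed auto

lemma nicely_meromorphic_eval_mero: "eval_mero f nicely_meromorphic_on uhp"
  using eval_mero[of f] by simp

lemma meromorphic_eval_mero: "eval_mero f meromorphic_on uhp"
  using nicely_meromorphic_eval_mero[of f] unfolding nicely_meromorphic_on_def by blast

lemma eval_mero_outside: "z \<notin> uhp \<Longrightarrow> eval_mero f z = 0"
  using eval_mero[of f] by simp

lemma remove_sings_eval_mero:
  assumes "z \<in> uhp"
  shows   "remove_sings (eval_mero f) z = eval_mero f z"
  using nicely_meromorphic_eval_mero[of f] assms
  unfolding nicely_meromorphic_on_def by (metis remove_sings_at_pole remove_sings_eqI)

lemma mero_uhp_eqI: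
  assumes "\<And>z. z \<in> uhp \<Longrightarrow> eventually (\<lambda>w. eval_mero f w = eval_mero g w) (at z)"
  shows   "f = g"
proof -
  have "eval_mero f z = eval_mero g z" for z
  proof (cases "z \<in> uhp")
    case True
    have "remove_sings (eval_mero f) z = remove_sings (eval_mero g) z"
      by (intro remove_sings_cong assms True refl)
    thus ?thesis using True by (simp add: remove_sings_eval_mero)
  qed (simp add: eval_mero_outside)
  thus ?thesis by (metis eval_mero_inject ext)
qed

lemma eventually_eval_mero_of:
  assumes "f meromorphic_on uhp" "z \<in> uhp"
  shows   "eventually (\<lambda>w. eval_mero (mero_of f) w = f w) (at z)"
proof -
  have "isolated_singularity_at f z"
    using assms by (meson meromorphic_onE)
  from eventually_remove_sings_eq_at[OF this] eventually_at_in_open'[OF open_uhp assms(2)]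
  show ?thesis
    by eventually_elim (simp add: mero_of.rep_eq assms(1))
qed

instantiation mero_uhp :: "{zero, one, plus, minus, uminus, times, inverse}"
begin

definition zero_mero_uhp :: mero_uhp where
  "zero_mero_uhp = mero_of (\<lambda>_. 0)"
definition one_mero_uhp :: mero_uhp where
  "one_mero_uhp = mero_of (\<lambda>_. 1)"
definition plus_mero_uhp :: "mero_uhp \<Rightarrow> mero_uhp \<Rightarrow> mero_uhp" where
  "plus_mero_uhp f g = mero_of (\<lambda>z. eval_mero f z + eval_mero g z)"
definition minus_mero_uhp :: "mero_uhp \<Rightarrow> mero_uhp \<Rightarrow> mero_uhp" where
  "minus_mero_uhp f g = mero_of (\<lambda>z. eval_mero f z - eval_mero g z)"
definition uminus_mero_uhp :: "mero_uhp \<Rightarrow> mero_uhp" where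
  "uminus_mero_uhp f = mero_of (\<lambda>z. - eval_mero f z)"
definition times_mero_uhp :: "mero_uhp \<Rightarrow> mero_uhp \<Rightarrow> mero_uhp" where
  "times_mero_uhp f g = mero_of (\<lambda>z. eval_mero f z * eval_mero g z)"
definition inverse_mero_uhp :: "mero_uhp \<Rightarrow> mero_uhp" where
  "inverse_mero_uhp f = mero_of (\<lambda>z. inverse (eval_mero f z))"
definition divide_mero_uhp :: "mero_uhp \<Rightarrow> mero_uhp \<Rightarrow> mero_uhp" where
  "divide_mero_uhp f g = mero_of (\<lambda>z. eval_mero f z / eval_mero g z)"

instance ..

end

lemma eventually_eval_mero_ops:
  fixes f g :: mero_uhp
  assumes "z \<in> uhp"
  shows "eventually (\<lambda>w. eval_mero 0 w = 0) (at z)"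
        "eventually (\<lambda>w. eval_mero 1 w = 1) (at z)"
        "eventually (\<lambda>w. eval_mero (f + g) w = eval_mero f w + eval_mero g w) (at z)"
        "eventually (\<lambda>w. eval_mero (f - g) w = eval_mero f w - eval_mero g w) (at z)"
        "eventually (\<lambda>w. eval_mero (- f) w = - eval_mero f w) (at z)"
        "eventually (\<lambda>w. eval_mero (f * g) w = eval_mero f w * eval_mero g w) (at z)"
        "eventually (\<lambda>w. eval_mero (inverse f) w = inverse (eval_mero f w)) (at z)"
        "eventually (\<lambda>w. eval_mero (f / g) w = eval_mero f w / eval_mero g w) (at z)"
  unfolding zero_mero_uhp_def one_mero_uhp_def plus_mero_uhp_def minus_mero_uhp_def
    uminus_mero_uhp_def times_mero_uhp_def inverse_mero_uhp_def divide_mero_uhp_def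
  by (intro eventually_eval_mero_of meromorphic_intros meromorphic_eval_mero assms)+

lemma eventually_eval_mero_nonzero:
  assumes "f \<noteq> 0" "z \<in> uhp"
  shows   "eventually (\<lambda>w. eval_mero f w \<noteq> 0) (at z)"
proof (rule ccontr)
  assume "\<not> ?thesis"
  hence "frequently (\<lambda>w. eval_mero f w = 0) (at z)"
    by (simp add: frequently_def)
  hence *: "eval_mero f w = 0" if "w \<in> uhp" for w
    using frequently_eq_meromorphic_imp_constant[OF _ nicely_meromorphic_eval_mero open_uhp
            connected_uhp assms(2)] that by blast
  have "f = 0"
  proof (rule mero_uhp_eqI)
    fix z assume z: "z \<in> uhp"
    from eventually_at_in_open'[OF open_uhp z] eventually_eval_mero_ops(1)[OF z]
    show "eventually (\<lambda>w. eval_mero f w = eval_mero 0 w) (at z)"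
      by eventually_elim (simp add: *)
  qed
  with assms(1) show False by contradiction
qed

instance mero_uhp :: field
proof
  fix f g h :: mero_uhp
  show "f + g + h = f + (g + h)"
  proof (rule mero_uhp_eqI)
    fix z assume z: "z \<in> uhp"
    note ops = eventually_eval_mero_ops[OF z]
    from ops(3)[of "f + g" h] ops(3)[of f g] ops(3)[of f "g + h"] ops(3)[of g h]
    show "\<forall>\<^sub>F w in at z. eval_mero (f + g + h) w = eval_mero (f + (g + h)) w"
      by eventually_elim simp
  qed
  show "f + g = g + f"
    by (simp add: plus_mero_uhp_def add.commute)
  show "0 + f = f"
  proof (rule mero_uhp_eqI)
    fix z assume z: "z \<in> uhp"
    note ops = eventually_eval_mero_ops[OF z]
    from ops(3)[of 0 f] ops(1)
    show "\<forall>\<^sub>F w in at z. eval_mero (0 + f) w = eval_mero f w"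
      by eventually_elim simp
  qed
  show "- f + f = 0"
  proof (rule mero_uhp_eqI)
    fix z assume z: "z \<in> uhp"
    note ops = eventually_eval_mero_ops[OF z]
    from ops(3)[of "- f" f] ops(5)[of f] ops(1)
    show "\<forall>\<^sub>F w in at z. eval_mero (- f + f) w = eval_mero 0 w"
      by eventually_elim simp
  qed
  show "f - g = f + - g"
  proof (rule mero_uhp_eqI)
    fix z assume z: "z \<in> uhp"
    note ops = eventually_eval_mero_ops[OF z]
    from ops(4)[of f g] ops(3)[of f "- g"] ops(5)[of g]
    show "\<forall>\<^sub>F w in at z. eval_mero (f - g) w = eval_mero (f + - g) w"
      by eventually_elim simp
  qed
  show "f * g * h = f * (g * h)"
  proof (rule mero_uhp_eqI)
    fix z assume z: "z \<in> uhp"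
    note ops = eventually_eval_mero_ops[OF z]
    from ops(6)[of "f * g" h] ops(6)[of f g] ops(6)[of f "g * h"] ops(6)[of g h]
    show "\<forall>\<^sub>F w in at z. eval_mero (f * g * h) w = eval_mero (f * (g * h)) w"
      by eventually_elim simp
  qed
  show "f * g = g * f"
    by (simp add: times_mero_uhp_def mult.commute)
  show "1 * f = f"
  proof (rule mero_uhp_eqI)
    fix z assume z: "z \<in> uhp"
    note ops = eventually_eval_mero_ops[OF z]
    from ops(6)[of 1 f] ops(2)
    show "\<forall>\<^sub>F w in at z. eval_mero (1 * f) w = eval_mero f w"
      by eventually_elim simp
  qed
  show "(f + g) * h = f * h + g * h"
  proof (rule mero_uhp_eqI)
    fix z assume z: "z \<in> uhp"
    note ops = eventually_eval_mero_ops[OF z]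
    from ops(6)[of "f + g" h] ops(3)[of f g] ops(3)[of "f * h" "g * h"] ops(6)[of f h] ops(6)[of g h]
    show "\<forall>\<^sub>F w in at z. eval_mero ((f + g) * h) w = eval_mero (f * h + g * h) w"
      by eventually_elim (simp add: algebra_simps)
  qed
  show "(0 :: mero_uhp) \<noteq> 1"
  proof
    assume eq: "(0 :: mero_uhp) = 1"
    have i: "\<i> \<in> uhp" by (simp add: uhp_def)
    from eventually_eval_mero_ops(1)[OF i] eventually_eval_mero_ops(2)[OF i]
    have "\<forall>\<^sub>F w in at \<i>. False"
      by eventually_elim (simp add: eq)
    thus False by simp
  qed
  show "inverse f * f = 1" if "f \<noteq> 0"
  proof (rule mero_uhp_eqI)
    fix z assume z: "z \<in> uhp"
    note ops = eventually_eval_mero_ops[OF z]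
    from ops(6)[of "inverse f" f] ops(7)[of f] ops(2) eventually_eval_mero_nonzero[OF that z]
    show "\<forall>\<^sub>F w in at z. eval_mero (inverse f * f) w = eval_mero 1 w"
      by eventually_elim simp
  qed
  show "f / g = f * inverse g"
  proof (rule mero_uhp_eqI)
    fix z assume z: "z \<in> uhp"
    note ops = eventually_eval_mero_ops[OF z]
    from ops(8)[of f g] ops(6)[of f "inverse g"] ops(7)[of g]
    show "\<forall>\<^sub>F w in at z. eval_mero (f / g) w = eval_mero (f * inverse g) w"
      by eventually_elim (simp add: field_simps)
  qed
  show "inverse (0 :: mero_uhp) = 0"
  proof (rule mero_uhp_eqI)
    fix z assume z: "z \<in> uhp"
    note ops = eventually_eval_mero_ops[OF z]
    from ops(7)[of 0] ops(1)
    show "\<forall>\<^sub>F w in at z. eval_mero (inverse 0) w = eval_mero 0 w"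
      by eventually_elim simp
  qed
qed

definition mero_const :: "complex \<Rightarrow> mero_uhp" where
  "mero_const c = mero_of (\<lambda>_. c)"

abbreviation mero_field :: "mero_uhp ring" where
  "mero_field \<equiv> ring_of_type_algebra"

definition adjoin_C :: "mero_uhp set \<Rightarrow> mero_uhp set"  (\<open>\<complex>'(_')\<close>) where
  "adjoin_C S = generate_field mero_field (range mero_const \<union> S)"

definition SL2Z :: "(int ^ 2 ^ 2) set" where
  "SL2Z = {A. det A = 1}"

definition principal_congruence_subgroup :: "nat \<Rightarrow> (int ^ 2 ^ 2) set"  (\<open>\<Gamma>'(_')\<close>) where
  "principal_congruence_subgroup N =
     {A \<in> SL2Z. \<forall>i j. [A $ i $ j = (mat 1 :: int ^ 2 ^ 2) $ i $ j] (mod int N)}"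

definition moebius_act :: "int ^ 2 ^ 2 \<Rightarrow> complex \<Rightarrow> complex" where
  "moebius_act A z = (of_int (A $ 1 $ 1) * z + of_int (A $ 1 $ 2)) /
                 (of_int (A $ 2 $ 1) * z + of_int (A $ 2 $ 2))"

text \<open>
  A function invariant under a congruence subgroup is meromorphic at the cusp \<open>A \<infinity>\<close> iff
  \<open>f \<circ> A\<close> is, near \<open>\<i>\<infinity>\<close>, a function of \<open>exp (2\<pi>\<i>z/N)\<close> that is meromorphic at 0, where
  \<open>N\<close> is some positive integer period of \<open>f \<circ> A\<close>. Every cusp is of the form \<open>A \<infinity>\<close>
  with \<open>A\<close> in the full modular group.
\<close>

definition meromorphic_at_cusps :: "mero_uhp \<Rightarrow> bool" where
  "meromorphic_at_cusps f \<longleftrightarrow>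
     (\<forall>A\<in>SL2Z. \<exists>(N::nat)>0. \<exists>F b. F meromorphic_on {0} \<and>
        (\<forall>z\<in>uhp. Im z > b \<longrightarrow>
           eval_mero f (moebius_act A z) = F (exp (2 * of_real pi * \<i> * z / of_nat N))))"

definition modular_functions :: "(int ^ 2 ^ 2) set \<Rightarrow> mero_uhp set"  (\<open>\<A>\<^sub>0\<close>) where
  "modular_functions G =
     {f. (\<forall>A\<in>G. \<forall>z\<in>uhp. eval_mero f (moebius_act A z) = eval_mero f z) \<and> meromorphic_at_cusps f}"

definition theta_a :: "int \<Rightarrow> complex \<Rightarrow> complex" where
  "theta_a k \<tau> = (\<Sum>\<^sub>\<infinity>n::int. (-1) powi (n + k + 1) *
      exp (2 * of_real pi * \<i> * (of_int ((14 * n + 7 - 2 * k)\<^sup>2) / 56) * \<tau>))"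

definition phi1 :: "complex \<Rightarrow> complex" where
  "phi1 \<tau> = - theta_a 3 \<tau> / theta_a 2 \<tau>"

definition phi2 :: "complex \<Rightarrow> complex" where
  "phi2 \<tau> = - theta_a 2 \<tau> / theta_a 1 \<tau>"

definition psi :: mero_uhp  (\<open>\<psi>\<close>) where
  "\<psi> = mero_of (\<lambda>\<tau>. - (theta_a 2 \<tau> * theta_a 3 \<tau>) / theta_a 1 \<tau> ^ 2)"

definition upsilon :: mero_uhp  (\<open>\<upsilon>\<close>) where
  "\<upsilon> = mero_of (\<lambda>\<tau>. theta_a 2 \<tau> ^ 2 * theta_a 3 \<tau> / theta_a 1 \<tau> ^ 3)"

definition g1 :: mero_uhp where
  "g1 = mero_of (\<lambda>\<tau>. phi1 \<tau> ^ 2 / phi1 (2 * \<tau>))"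

definition g2 :: mero_uhp where
  "g2 = mero_of (\<lambda>\<tau>. phi1 \<tau> * phi1 (\<tau> / 2) * phi1 (2 * \<tau>) - phi1 (2 * \<tau>) / phi2 \<tau>)"

definition g3 :: mero_uhp where
  "g3 = mero_of (\<lambda>\<tau>. - phi1 \<tau> * phi1 (\<tau> / 2) * phi1 (2 * \<tau>)
                      - phi1 \<tau> ^ 2 * phi2 \<tau> / phi2 (2 * \<tau>))"

definition P_upsilon :: "mero_uhp poly"  (\<open>P\<^sub>\<upsilon>\<close>) where
  "P\<^sub>\<upsilon> = [: (\<upsilon> - 1)\<^sup>2 / \<upsilon>, - ((\<upsilon>\<^sup>2 - 1) / \<upsilon>), 1, 1 :]"

definition delta :: mero_uhp  (\<open>\<delta>\<close>) where
  "\<delta> = \<upsilon>\<^sup>2 / (2 * (\<upsilon> - 1)) * ((g1 - g2) * (g2 - g3) * (g3 - g1))"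

definition splitting_field_over :: "'a :: field set \<Rightarrow> 'a poly \<Rightarrow> 'a set \<Rightarrow> bool" where
  "splitting_field_over K p L \<longleftrightarrow>
     subfield K ring_of_type_algebra \<and> p \<noteq> 0 \<and> set (coeffs p) \<subseteq> K \<and>
     (\<exists>rs. set rs \<subseteq> L \<and> p = Polynomial.smult (Polynomial.lead_coeff p) (\<Prod>r\<leftarrow>rs. [:- r, 1:]) \<and>
           L = generate_field ring_of_type_algebra (K \<union> set rs))"

definition cubic_discriminant :: "'a :: comm_ring_1 poly \<Rightarrow> 'a" where
  "cubic_discriminant p =
     (let a = poly.coeff p 3; b = poly.coeff p 2; c = poly.coeff p 1; d = poly.coeff p 0
      in b\<^sup>2 * c\<^sup>2 - 4 * a * c ^ 3 - 4 * b ^ 3 * d - 27 * a\<^sup>2 * d\<^sup>2 + 18 * a * b * c * d)"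

text \<open>A polynomial maps each monomial (an exponent vector) to its coefficient.\<close>

type_synonym 'n cpoly = "('n \<Rightarrow>\<^sub>0 nat) \<Rightarrow>\<^sub>0 complex"

definition cpoly_const :: "complex \<Rightarrow> 'n cpoly" where
  "cpoly_const c = Poly_Mapping.single 0 c"

definition cpoly_var :: "'n \<Rightarrow> 'n cpoly" where
  "cpoly_var i = Poly_Mapping.single (Poly_Mapping.single i 1) 1"

definition cpoly_eval :: "'n :: finite cpoly \<Rightarrow> complex ^ 'n \<Rightarrow> complex" where
  "cpoly_eval p x = (\<Sum>m\<in>Poly_Mapping.keys p.
     Poly_Mapping.lookup p m * (\<Prod>i\<in>UNIV. (x $ i) ^ Poly_Mapping.lookup m i))"

definition zariski_closed :: "(complex ^ 'n :: finite) set \<Rightarrow> bool" where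
  "zariski_closed V \<longleftrightarrow> (\<exists>S. V = {x. \<forall>p\<in>S. cpoly_eval p x = 0})"

definition affine_variety :: "(complex ^ 'n :: finite) set \<Rightarrow> bool" where
  "affine_variety V \<longleftrightarrow> zariski_closed V \<and> V \<noteq> {} \<and>
     (\<forall>A B. zariski_closed A \<longrightarrow> zariski_closed B \<longrightarrow> V \<subseteq> A \<union> B \<longrightarrow> V \<subseteq> A \<or> V \<subseteq> B)"

definition zariski_dim :: "(complex ^ 'n :: finite) set \<Rightarrow> enat" where
  "zariski_dim V = Sup {enat n | n. \<exists>C. (\<forall>i\<le>n. affine_variety (C i) \<and> C i \<subseteq> V) \<and>
                                       (\<forall>i<n. C i \<subset> C (Suc i))}"

definition affine_curve :: "(complex ^ 'n :: finite) set \<Rightarrow> bool" where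
  "affine_curve V \<longleftrightarrow> affine_variety V \<and> zariski_dim V = 1"

definition vanishing_ideal :: "(complex ^ 'n :: finite) set \<Rightarrow> 'n cpoly set" where
  "vanishing_ideal V = {p. \<forall>x\<in>V. cpoly_eval p x = 0}"

text \<open>
  The field of fractions of the coordinate ring of \<open>V\<close>. Its elements are represented by fractions
  of polynomials whose denominator does not vanish identically on \<open>V\<close>, two fractions being
  identified iff cross-multiplication yields an equality on \<open>V\<close>.
\<close>

definition ratfun_rel ::
    "(complex ^ 'n :: finite) set \<Rightarrow> (('n cpoly \<times> 'n cpoly) \<times> ('n cpoly \<times> 'n cpoly)) set" where
  "ratfun_rel V = {((p, q), (p', q')). q \<notin> vanishing_ideal V \<and> q' \<notin> vanishing_ideal V \<and>
                                       p * q' - p' * q \<in> vanishing_ideal V}"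

definition ratfun ::
    "(complex ^ 'n :: finite) set \<Rightarrow> 'n cpoly \<Rightarrow> 'n cpoly \<Rightarrow> ('n cpoly \<times> 'n cpoly) set" where
  "ratfun V p q = ratfun_rel V `` {(p, q)}"

definition function_field ::
    "(complex ^ 'n :: finite) set \<Rightarrow> ('n cpoly \<times> 'n cpoly) set ring" where
  "function_field V =
     \<lparr> carrier = (UNIV \<times> (- vanishing_ideal V)) // ratfun_rel V,
       mult = (\<lambda>A B. \<Union>(p, q)\<in>A. \<Union>(p', q')\<in>B. ratfun V (p * p') (q * q')),
       one = ratfun V 1 1,
       zero = ratfun V 0 1,
       add = (\<lambda>A B. \<Union>(p, q)\<in>A. \<Union>(p', q')\<in>B. ratfun V (p * q' + p' * q) (q * q')) \<rparr>"

text \<open>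
  \<open>V\<close> is an affine model of the curve with function field \<open>K\<close>, the coordinate functions on \<open>V\<close>
  corresponding to the given elements \<open>x\<close> of \<open>K\<close>.
\<close>

definition affine_model ::
    "mero_uhp set \<Rightarrow> (complex ^ 'n :: finite) set \<Rightarrow> mero_uhp ^ 'n \<Rightarrow> bool" where
  "affine_model K V x \<longleftrightarrow> affine_curve V \<and>
     (\<exists>h \<in> ring_iso (function_field V) (mero_field\<lparr>carrier := K\<rparr>).
        (\<forall>c. h (ratfun V (cpoly_const c) 1) = mero_const c) \<and>
        (\<forall>i. h (ratfun V (cpoly_var i) 1) = x $ i))"

definition X14_model :: "(complex ^ 4) set" where
  "X14_model = {p. let x = p $ 1; y = p $ 2; z = p $ 3; w = p $ 4 in
     y ^ 7 = x ^ 4 * (x - 1) \<and>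
     x * z ^ 3 + x * z\<^sup>2 - (x\<^sup>2 - 1) * z + (x - 1)\<^sup>2 = 0 \<and>
     w\<^sup>2 = x * (x - 1) * (x ^ 3 - 8 * x\<^sup>2 + 5 * x + 1)}"

end

theory Submission
  imports Defs
begin

text \<open>
  Up to constants, \<open>a\<^sub>k(\<tau>)\<close> is the Klein form of characteristic \<open>(k/7, 0)\<close> at \<open>7\<tau>\<close>. The transformation law
  of Klein forms shows that \<open>\<upsilon>\<close> is invariant under \<open>\<Gamma>\<^sub>1(7)\<close>, that \<open>\<psi>\<close> is multiplied by 7th roots of unity,
  and that the only pole of \<open>\<upsilon>\<close> is a simple one at the cusp \<open>\<infinity>\<close>. By Liouville's theorem the modular
  functions for \<open>\<Gamma>\<^sub>1(7)\<close> are therefore the rational functions of \<open>\<upsilon>\<close>, and Lagrange interpolation over the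
  conjugates of a primitive element reduces the fields of levels 7 and 14 to the computation of stabilisers.

  Riemann's theta relations give the cubic equation of \<open>g1\<close> over \<open>\<complex>(\<upsilon>)\<close>. The function \<open>g1\<close> is fixed by the
  matrices in \<open>\<Gamma>\<^sub>1(7)\<close> with even lower left entry, and \<open>\<Gamma>\<^sub>1(7)\<close> permutes its three conjugates
  \<open>g1, g2, g3\<close> as it permutes the lines of \<open>(\<int>/2\<int>)\<^sup>2\<close>; hence only \<open>\<Gamma>(14)\<close> fixes \<open>\<psi>\<close>, \<open>g1\<close> and \<open>g2\<close>.

  For the affine model, a polynomial vanishes on the curve iff it vanishes at \<open>(\<upsilon>, \<psi>, g1, \<delta>)\<close>: the values
  of \<open>\<upsilon>\<close> are dense in the plane, \<open>\<Gamma>\<^sub>1(7)\<close> acts transitively on the points of the curve above each value,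
  and roots depend continuously on coefficients. So the vanishing ideal is prime and its fraction field
  is generated by the four functions. Proper closed subsets are finite because norms to \<open>\<complex>(\<upsilon>)\<close>
  of nonzero functions are nonzero.
\<close>

section \<open>Theta series with characteristics\<close>

text \<open>Modular functions are handled only through their values on the upper half-plane and
  their limits at the cusps. The Klein forms are normalised so that a matrix changes the
  characteristic and contributes a factor \<open>C\<close> independent of the characteristic. In
  quotients of equal degree \<open>C\<close> cancels, so it is never computed and no eta multiplier
  enters. The zeros of theta come from the addition formula: a zero \<open>z0\<close> makes the
  orders of vanishing along \<open>p + k * z0\<close> a nonnegative arithmetic progression, hence
  constant, and the translate by \<open>z0\<close> must be theta itself up to an exponential. The
  cubic appears with an extraneous factor \<open>g1 + 1\<close>, excluded by the limit 1 of
  \<open>g1\<close> at infinity. Only the translate \<open>g3\<close> of \<open>g1\<close> is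
  computed by hand; \<open>g2\<close> is recognised as the remaining root because the three
  expressions add up to -1. On the model the obstacle is that \<upsilon> omits the values 0 and 1,
  so points above them are reached only as limits.\<close>

lemma summable_on_exp_minus_abs_int: "(\<lambda>n::int. exp (- \<bar>real_of_int n\<bar>)) summable_on UNIV"
proof -
  have *: "(\<lambda>n::nat. exp (- real n)) summable_on UNIV"
  proof (rule norm_summable_imp_summable_on)
    have "summable (\<lambda>n. exp (-1::real) ^ n)" by (rule summable_geometric) simp
    thus "summable (\<lambda>n. norm (exp (- real n)))" by (simp add: exp_of_nat_mult[symmetric])
  qed
  have 1: "(\<lambda>n::int. exp (- \<bar>real_of_int n\<bar>)) summable_on range int"
    by (subst summable_on_reindex) (use * in \<open>auto simp: o_def\<close>)
  have 2: "(\<lambda>n::int. exp (- \<bar>real_of_int n\<bar>)) summable_on range (\<lambda>n. - int n)"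
    by (subst summable_on_reindex) (use * in \<open>auto simp: o_def inj_def\<close>)
  have "(UNIV :: int set) = range int \<union> range (\<lambda>n. - int n)"
    by (auto simp: image_iff) (metis nonneg_int_cases nonpos_int_cases nle_le)
  thus ?thesis using summable_on_union[OF 1 2] by simp
qed

lemma summable_on_exp_quadratic:
  fixes p q a :: real
  assumes "p > 0"
  shows "(\<lambda>n::int. exp (- p * (of_int n + a)\<^sup>2 + q * (of_int n + a))) summable_on UNIV"
proof (rule summable_on_comparison_test)
  define C where "C = exp ((\<bar>q\<bar> + 1)\<^sup>2 / (4 * p) + \<bar>a\<bar>)"
  show "(\<lambda>n::int. C * exp (- \<bar>real_of_int n\<bar>)) summable_on UNIV"
    by (intro summable_on_cmult_right summable_on_exp_minus_abs_int)
  fix n :: int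
  define x where "x = real_of_int n + a"
  \<comment> \<open>Completing the square: the Gaussian absorbs a slope of
    \<open>\<bar>q\<bar> + 1\<close>, one more than the linear term has, and the surplus leaves the
    summable bound \<open>exp (- \<bar>x\<bar>)\<close>.\<close>
  have "0 \<le> (2 * p * \<bar>x\<bar> - (\<bar>q\<bar> + 1))\<^sup>2 / (4 * p)" using assms by simp
  also have "\<dots> = p * x\<^sup>2 - (\<bar>q\<bar> + 1) * \<bar>x\<bar> + (\<bar>q\<bar> + 1)\<^sup>2 / (4 * p)"
    using assms by (simp add: field_simps power2_eq_square)
  finally have "- p * x\<^sup>2 + \<bar>q\<bar> * \<bar>x\<bar> \<le> - \<bar>x\<bar> + (\<bar>q\<bar> + 1)\<^sup>2 / (4 * p)"
    by (simp add: algebra_simps)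
  moreover have "q * x \<le> \<bar>q\<bar> * \<bar>x\<bar>" by (metis abs_ge_self abs_mult)
  moreover have "\<bar>real_of_int n\<bar> \<le> \<bar>x\<bar> + \<bar>a\<bar>" by (auto simp: x_def)
  ultimately have "- p * x\<^sup>2 + q * x \<le> (\<bar>q\<bar> + 1)\<^sup>2 / (4 * p) + \<bar>a\<bar> - \<bar>real_of_int n\<bar>" by linarith
  thus "exp (- p * (of_int n + a)\<^sup>2 + q * (of_int n + a)) \<le> C * exp (- \<bar>real_of_int n\<bar>)"
    by (simp add: C_def exp_add[symmetric] x_def)
qed auto

text \<open>Weierstrass M-test on closed discs, followed by the theorem on uniform limits of
  holomorphic functions; the partial sums run over the finite subsets of the index set.\<close>

lemma infsum_holomorphic_on:
  fixes f :: "'i \<Rightarrow> complex \<Rightarrow> complex"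
  assumes "open S" and hol: "\<And>n. n \<in> I \<Longrightarrow> f n holomorphic_on S"
    and bd: "\<And>K. compact K \<Longrightarrow> K \<subseteq> S \<Longrightarrow>
               \<exists>M. M summable_on I \<and> (\<forall>n\<in>I. \<forall>z\<in>K. norm (f n z) \<le> M n)"
  shows "(\<lambda>z. \<Sum>\<^sub>\<infinity>n\<in>I. f n z) holomorphic_on S"
proof -
  have "(\<lambda>z. \<Sum>\<^sub>\<infinity>n\<in>I. f n z) analytic_on {z}" if z: "z \<in> S" for z
  proof -
    obtain r where r: "r > 0" "cball z r \<subseteq> S" using z \<open>open S\<close> open_contains_cball by metis
    obtain M where M: "M summable_on I" "\<And>n w. n \<in> I \<Longrightarrow> w \<in> cball z r \<Longrightarrow> norm (f n w) \<le> M n"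
      using bd[OF compact_cball r(2)] by blast
    have "uniform_limit (cball z r) (\<lambda>Y w. \<Sum>n\<in>Y. f n w) (\<lambda>w. \<Sum>\<^sub>\<infinity>n\<in>I. f n w) (finite_subsets_at_top I)"
      by (rule Weierstrass_m_test_general) (use M in auto)
    moreover have "\<forall>\<^sub>F Y in finite_subsets_at_top I. continuous_on (cball z r) (\<lambda>w. \<Sum>n\<in>Y. f n w) \<and>
        (\<lambda>w. \<Sum>n\<in>Y. f n w) holomorphic_on ball z r"
    proof (rule eventually_finite_subsets_at_top_weakI)
      fix Y assume "finite Y" "Y \<subseteq> I"
      hence "(\<lambda>w. \<Sum>n\<in>Y. f n w) holomorphic_on S" using hol by (intro holomorphic_intros) auto
      thus "continuous_on (cball z r) (\<lambda>w. \<Sum>n\<in>Y. f n w) \<and> (\<lambda>w. \<Sum>n\<in>Y. f n w) holomorphic_on ball z r"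
        using r ball_subset_cball[of z r] holomorphic_on_subset[of _ S]
          holomorphic_on_imp_continuous_on by blast
    qed
    ultimately have "(\<lambda>z. \<Sum>\<^sub>\<infinity>n\<in>I. f n z) holomorphic_on ball z r"
      using holomorphic_uniform_limit[of z r "\<lambda>Y w. \<Sum>n\<in>Y. f n w" "finite_subsets_at_top I"
          "\<lambda>w. \<Sum>\<^sub>\<infinity>n\<in>I. f n w"] finite_subsets_at_top_neq_bot by blast
    thus ?thesis using r(1) analytic_at_ball by blast
  qed
  thus ?thesis by (meson analytic_imp_holomorphic analytic_on_analytic_at)
qed

text \<open>The theta series of characteristic \<open>(a, 0)\<close>. A second characteristic is not
  carried along: it is a translation of \<open>z\<close> by a real number.\<close>

definition jt_term :: "real \<Rightarrow> complex \<Rightarrow> complex \<Rightarrow> int \<Rightarrow> complex" where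
  "jt_term a z \<tau> n = exp (of_real pi * \<i> * (of_real (of_int n + a))\<^sup>2 * \<tau>
                          + 2 * of_real pi * \<i> * of_real (of_int n + a) * z)"

definition jt :: "real \<Rightarrow> complex \<Rightarrow> complex \<Rightarrow> complex" where
  "jt a z \<tau> = (\<Sum>\<^sub>\<infinity>n. jt_term a z \<tau> n)"

lemma norm_jt_term:
  "norm (jt_term a z \<tau> n) = exp (- (pi * Im \<tau>) * (of_int n + a)\<^sup>2 + (- 2 * pi * Im z) * (of_int n + a))"
proof -
  have "norm (jt_term a z \<tau> n) = exp (Re (of_real pi * \<i> * (of_real (of_int n + a))\<^sup>2 * \<tau>
                          + 2 * of_real pi * \<i> * of_real (of_int n + a) * z))"
    by (simp only: jt_term_def norm_exp_eq_Re)
  also have "of_real pi * \<i> * (of_real (of_int n + a))\<^sup>2 * \<tau>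
                          + 2 * of_real pi * \<i> * of_real (of_int n + a) * z =
             of_real (pi * (of_int n + a)\<^sup>2) * (\<i> * \<tau>) + of_real (2 * pi * (of_int n + a)) * (\<i> * z)"
    by simp
  also have "Re \<dots> = - (pi * Im \<tau>) * (of_int n + a)\<^sup>2 + (- 2 * pi * Im z) * (of_int n + a)"
    by (simp only: plus_complex.sel complex_scaleR scaleR_conv_of_real[symmetric] scaleR_complex.sel) simp
  finally show ?thesis .
qed

lemma jt_term_abs_summable:
  assumes "Im \<tau> > 0"
  shows "(\<lambda>n. norm (jt_term a z \<tau> n)) summable_on UNIV"
  unfolding norm_jt_term by (rule summable_on_exp_quadratic) (use assms in auto)

lemma jt_entire:
  assumes "Im \<tau> > 0"
  shows "(\<lambda>z. jt a z \<tau>) holomorphic_on S"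
proof -
  have "(\<lambda>z. jt a z \<tau>) holomorphic_on UNIV"
    unfolding jt_def
  proof (rule infsum_holomorphic_on)
    fix n show "(\<lambda>z. jt_term a z \<tau> n) holomorphic_on UNIV"
      unfolding jt_term_def by (intro holomorphic_intros)
  next
    fix K :: "complex set" assume "compact K"
    then obtain B where B: "\<And>z. z \<in> K \<Longrightarrow> norm z \<le> B"
      using compact_imp_bounded bounded_iff by metis
    let ?e = "\<lambda>q n. exp (- (pi * Im \<tau>) * (of_int n + a)\<^sup>2 + q * (of_int n + a))"
    \<comment> \<open>The sign of \<open>of_int n + a\<close> varies with \<open>n\<close>, so the
      sum of the exponentials with slopes \<open>2 * pi * B\<close> and \<open>- 2 * pi * B\<close>
      serves as a majorant valid for both signs.\<close>
    have "norm (jt_term a z \<tau> n) \<le> ?e (2 * pi * B) n + ?e (- 2 * pi * B) n" if "z \<in> K" for z n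
    proof -
      have "\<bar>Im z\<bar> \<le> B" using B[OF that] abs_Im_le_cmod[of z] by linarith
      hence "- 2 * pi * Im z * x \<le> 2 * pi * B * \<bar>x\<bar>" for x
      proof -
        have "- Im z * x \<le> \<bar>Im z\<bar> * \<bar>x\<bar>" by (metis abs_ge_self abs_minus_cancel abs_mult)
        also have "\<dots> \<le> B * \<bar>x\<bar>" using \<open>\<bar>Im z\<bar> \<le> B\<close> by (intro mult_right_mono) auto
        finally have "2 * pi * (- Im z * x) \<le> 2 * pi * (B * \<bar>x\<bar>)" by (intro mult_left_mono) auto
        thus ?thesis by (simp add: mult_ac)
      qed
      from this[of "of_int n + a"] have "norm (jt_term a z \<tau> n) \<le> exp (- (pi * Im \<tau>) * (of_int n + a)\<^sup>2 + 2 * pi * B * \<bar>of_int n + a\<bar>)"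
        unfolding norm_jt_term by simp
      also have "\<dots> \<le> ?e (2 * pi * B) n + ?e (- 2 * pi * B) n"
      proof (cases "of_int n + a \<ge> 0")
        case False
        hence eq: "\<bar>of_int n + a\<bar> = - (of_int n + a)" by (simp add: abs_if)
        show ?thesis unfolding eq by (intro add_increasing) (auto simp: algebra_simps)
      qed (intro add_increasing2, auto)
      finally show ?thesis .
    qed
    moreover have "(\<lambda>n. ?e (2 * pi * B) n + ?e (- 2 * pi * B) n) summable_on UNIV"
      by (intro summable_on_add summable_on_exp_quadratic) (use assms in auto)
    ultimately show "\<exists>M. M summable_on UNIV \<and> (\<forall>n\<in>UNIV. \<forall>z\<in>K. norm (jt_term a z \<tau> n) \<le> M n)"
      by blast
  qed auto
  thus ?thesis using holomorphic_on_subset by blast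
qed

text \<open>Completing the square in \<open>n\<close>: a translation of \<open>z\<close> by a real
  multiple of \<tau> is a change of characteristic.\<close>

lemma jt_shift: "jt a (z + of_real b * \<tau>) \<tau> =
    exp (- (of_real pi * \<i> * (of_real b)\<^sup>2 * \<tau>) - 2 * of_real pi * \<i> * of_real b * z) * jt (a + b) z \<tau>"
proof -
  have "jt_term a (z + of_real b * \<tau>) \<tau> n =
    exp (- (of_real pi * \<i> * (of_real b)\<^sup>2 * \<tau>) - 2 * of_real pi * \<i> * of_real b * z) * jt_term (a + b) z \<tau> n" for n
    unfolding jt_term_def exp_add[symmetric]
    by (rule arg_cong[where f = exp]) (simp add: algebra_simps power2_eq_square)
  thus ?thesis by (simp add: jt_def infsum_cmult_right')
qed

lemma jt_char_add_int: "jt (a + of_int m) z \<tau> = jt a z \<tau>"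
proof -
  have "jt (a + of_int m) z \<tau> = (\<Sum>\<^sub>\<infinity>n. jt_term a z \<tau> (n + m))"
    unfolding jt_def jt_term_def by (simp add: algebra_simps)
  also have "\<dots> = infsum (jt_term a z \<tau>) (range (\<lambda>n. n + m))"
    by (subst infsum_reindex) (auto simp: o_def)
  also have "range (\<lambda>n::int. n + m) = UNIV" by simp
  finally show ?thesis by (simp add: jt_def)
qed

lemma jt_minus: "jt (- a) (- z) \<tau> = jt a z \<tau>"
proof -
  have "jt (- a) (- z) \<tau> = (\<Sum>\<^sub>\<infinity>n. jt_term a z \<tau> (- n))"
    unfolding jt_def jt_term_def by (simp add: algebra_simps power2_eq_square)
  also have "\<dots> = infsum (jt_term a z \<tau>) (range (\<lambda>n. - n))"
    by (subst infsum_reindex) (auto simp: o_def)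
  also have "range (\<lambda>n::int. - n) = UNIV" by (metis surj_uminus)
  finally show ?thesis by (simp add: jt_def)
qed

lemma jt_add_int: "jt a (z + of_int m) \<tau> = exp (2 * of_real pi * \<i> * of_real a * of_int m) * jt a z \<tau>"
proof -
  have "jt_term a (z + of_int m) \<tau> n = exp (2 * of_real pi * \<i> * of_real a * of_int m) * jt_term a z \<tau> n" for n
  proof -
    have "jt_term a (z + of_int m) \<tau> n =
       exp (2 * of_real pi * \<i> * of_int (n * m)) * (exp (2 * of_real pi * \<i> * of_real a * of_int m) * jt_term a z \<tau> n)"
      unfolding jt_term_def exp_add[symmetric]
      by (rule arg_cong[where f = exp]) (simp add: algebra_simps)
    also have "exp (2 * of_real pi * \<i> * of_int (n * m)) = 1"
      using exp_integer_2pi[of "of_int (n * m)"] by (simp add: mult_ac)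
    finally show ?thesis by simp
  qed
  thus ?thesis by (simp add: jt_def infsum_cmult_right')
qed

text \<open>The odd Jacobi theta function, with both characteristics equal to 1/2: the classical
  theta_1 up to sign.\<close>

definition th :: "complex \<Rightarrow> complex \<Rightarrow> complex" where
  "th z \<tau> = jt (1 / 2) (z + 1 / 2) \<tau>"

lemma exp_pi_i_times_int: "exp (of_real pi * \<i> * of_int m) = (- 1) powi m"
proof -
  have "exp (of_real pi * \<i> * of_int m) = exp (of_int m * (of_real pi * \<i>))"
    by (simp add: mult_ac)
  also have "\<dots> = exp (of_real pi * \<i>) powi m" by (rule exp_power_int[symmetric])
  finally show ?thesis by simp
qed

lemma th_entire: "Im \<tau> > 0 \<Longrightarrow> (\<lambda>z. th z \<tau>) holomorphic_on S"
proof -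
  assume "Im \<tau> > 0"
  hence "(\<lambda>z. jt (1 / 2) z \<tau>) \<circ> (\<lambda>z. z + 1 / 2) holomorphic_on S"
    by (intro holomorphic_on_compose holomorphic_intros jt_entire)
  thus ?thesis by (simp add: th_def o_def)
qed

lemma th_minus: "th (- z) \<tau> = - th z \<tau>"
proof -
  have "th (- z) \<tau> = jt (1/2) (-(z - 1/2)) \<tau>" by (simp add: th_def)
  also have "\<dots> = jt (- (1/2)) (z - 1/2) \<tau>" using jt_minus[of "- (1/2)" "z - 1/2" \<tau>] by simp
  also have "\<dots> = jt (1/2) (z - 1/2) \<tau>" using jt_char_add_int[of "-(1/2)" 1] by simp
  also have "\<dots> = - jt (1/2) (z - 1/2 + of_int 1) \<tau>"
    by (subst jt_add_int) simp
  finally show ?thesis by (simp add: th_def add.commute)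
qed

lemma minus_one_powi_minus: "(- 1 :: complex) powi (- m) = (- 1) powi m"
  by (cases "even m") (auto elim!: evenE oddE simp: power_int_add power_int_mult power_int_minus)

lemma th_quasi: "th (z + of_int m * \<tau> + of_int n) \<tau> =
    (- 1) powi (m + n) * exp (- (of_real pi * \<i> * of_int (m\<^sup>2) * \<tau>) - 2 * of_real pi * \<i> * of_int m * z) * th z \<tau>"
proof -
  have "th (z + of_int m * \<tau> + of_int n) \<tau> = jt (1/2) ((z + 1/2 + of_int n) + of_real (of_int m) * \<tau>) \<tau>"
    by (simp add: th_def algebra_simps)
  also have "\<dots> = exp (- (of_real pi * \<i> * (of_real (of_int m))\<^sup>2 * \<tau>) - 2 * of_real pi * \<i> * of_real (of_int m) * (z + 1/2 + of_int n))
      * (exp (of_real pi * \<i> * of_int n) * th z \<tau>)"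
    by (subst jt_shift, subst jt_char_add_int, subst jt_add_int) (simp add: th_def)
  also have "exp (- (of_real pi * \<i> * (of_real (of_int m))\<^sup>2 * \<tau>) - 2 * of_real pi * \<i> * of_real (of_int m) * (z + 1/2 + of_int n)) =
     exp (- (of_real pi * \<i> * of_int (m\<^sup>2) * \<tau>) - 2 * of_real pi * \<i> * of_int m * z) * exp (of_real pi * \<i> * of_int (- m)) * exp (2 * of_real pi * \<i> * of_int (- m * n))"
    unfolding exp_add[symmetric] by (rule arg_cong[where f = exp]) (simp add: algebra_simps)
  also have "exp (2 * of_real pi * \<i> * of_int (- m * n)) = (1 :: complex)"
    using exp_integer_2pi[of "of_int (- m * n)"] by (simp add: mult_ac)
  finally show ?thesis
    by (simp add: exp_pi_i_times_int power_int_add minus_one_powi_minus del: of_int_minus)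
qed

lemma th_zero [simp]: "th 0 \<tau> = 0"
  using th_minus[of 0 \<tau>] by simp

section \<open>The addition formula\<close>

lemma jt_term_product1:
  "jt_term (1/2) (x + y + 1/2) \<tau> (p + r) * jt_term (1/2) (x - y + 1/2) \<tau> (p - r - 1) =
   jt_term 0 (2 * x) (2 * \<tau>) p * jt_term (1/2) (2 * y) (2 * \<tau>) r"
proof -
  define P R k where "P = complex_of_int p" and "R = complex_of_int r" and "k = of_real pi * \<i>"
  \<comment> \<open>Stated for arbitrary \<open>h\<close>, later 1/2, so that the ring identity is
    free of fractions.\<close>
  have ring: "k * (P + R + h)\<^sup>2 * \<tau> + 2 * k * (P + R + h) * (x + y + h) +
      (k * (P - R - h)\<^sup>2 * \<tau> + 2 * k * (P - R - h) * (x - y + h)) =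
      2 * k * P * (2 * h) + (k * P\<^sup>2 * (2 * \<tau>) + 2 * k * P * (2 * x) +
      (k * (R + h)\<^sup>2 * (2 * \<tau>) + 2 * k * (R + h) * (2 * y)))" for h
    by (simp add: power2_eq_square algebra_simps)
  have e: "complex_of_real (of_int (p + r) + 1/2) = P + R + 1/2"
    "complex_of_real (of_int (p - r - 1) + 1/2) = P - R - 1/2"
    "complex_of_real (of_int p + 0) = P" "complex_of_real (of_int r + 1/2) = R + 1/2"
    by (simp_all add: P_def R_def)
  have "exp (2 * k * P) = 1"
    using exp_integer_2pi[of "of_int p"] by (simp add: k_def P_def mult_ac)
  hence "jt_term 0 (2 * x) (2 * \<tau>) p * jt_term (1/2) (2 * y) (2 * \<tau>) r =
      exp (2 * k * P) * (jt_term 0 (2 * x) (2 * \<tau>) p * jt_term (1/2) (2 * y) (2 * \<tau>) r)" by simp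
  also have "\<dots> = jt_term (1/2) (x + y + 1/2) \<tau> (p + r) * jt_term (1/2) (x - y + 1/2) \<tau> (p - r - 1)"
    unfolding jt_term_def e mult.assoc[of 2 "of_real pi" \<i>] k_def[symmetric] exp_add[symmetric]
    by (subst ring[of "1/2"]) simp
  finally show ?thesis by simp
qed

lemma jt_term_product2:
  "jt_term (1/2) (x + y + 1/2) \<tau> (p + r) * jt_term (1/2) (x - y + 1/2) \<tau> (p - r) =
   - (jt_term (1/2) (2 * x) (2 * \<tau>) p * jt_term 0 (2 * y) (2 * \<tau>) r)"
proof -
  define P R k where "P = complex_of_int p" and "R = complex_of_int r" and "k = of_real pi * \<i>"
  have ring: "k * (P + R + h)\<^sup>2 * \<tau> + 2 * k * (P + R + h) * (x + y + h) +
      (k * (P - R + h)\<^sup>2 * \<tau> + 2 * k * (P - R + h) * (x - y + h)) =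
      k * (2 * P + 2 * h) * (2 * h) + (k * (P + h)\<^sup>2 * (2 * \<tau>) + 2 * k * (P + h) * (2 * x) +
      (k * R\<^sup>2 * (2 * \<tau>) + 2 * k * R * (2 * y)))" for h
    by (simp add: power2_eq_square algebra_simps)
  have e: "complex_of_real (of_int (p + r) + 1/2) = P + R + 1/2"
    "complex_of_real (of_int (p - r) + 1/2) = P - R + 1/2"
    "complex_of_real (of_int r + 0) = R" "complex_of_real (of_int p + 1/2) = P + 1/2"
    by (simp_all add: P_def R_def)
  \<comment> \<open>The two translations by 1/2 in the arguments contribute this factor. It is
    trivial for the pairs of odd sum and -1 here, which gives the minus sign in the addition
    formula.\<close>
  have "exp (k * (2 * P + 1)) = (- 1) powi (2 * p + 1)"
    using exp_pi_i_times_int[of "2 * p + 1"] by (simp add: k_def P_def)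
  hence "exp (k * (2 * P + 1)) = - 1" by (simp add: power_int_add power_int_mult)
  hence "- (jt_term (1/2) (2 * x) (2 * \<tau>) p * jt_term 0 (2 * y) (2 * \<tau>) r) =
      exp (k * (2 * P + 1)) * (jt_term (1/2) (2 * x) (2 * \<tau>) p * jt_term 0 (2 * y) (2 * \<tau>) r)" by simp
  also have "\<dots> = jt_term (1/2) (x + y + 1/2) \<tau> (p + r) * jt_term (1/2) (x - y + 1/2) \<tau> (p - r)"
    unfolding jt_term_def e mult.assoc[of 2 "of_real pi" \<i>] k_def[symmetric] exp_add[symmetric]
    by (subst ring[of "1/2"]) simp
  finally show ?thesis by simp
qed

text \<open>The double series over \<open>(n, m)\<close> is split by the parity of
  \<open>n + m\<close>. On the odd pairs, the range of \<open>i1\<close>, and on the even pairs, the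
  range of \<open>i2\<close>, the parallelogram law separates the variables \<open>p\<close> and
  \<open>r\<close> and doubles \<tau>. The result is a two by two determinant in \<open>x\<close>
  and \<open>y\<close>, from which the zeros of \<open>th\<close> and the theta relations are
  derived.\<close>

lemma th_product:
  assumes "Im \<tau> > 0"
  shows "th (x + y) \<tau> * th (x - y) \<tau> =
     jt 0 (2 * x) (2 * \<tau>) * jt (1/2) (2 * y) (2 * \<tau>) - jt (1/2) (2 * x) (2 * \<tau>) * jt 0 (2 * y) (2 * \<tau>)"
proof -
  define f where "f = (\<lambda>(n, m). jt_term (1/2) (x + y + 1/2) \<tau> n * jt_term (1/2) (x - y + 1/2) \<tau> m)"
  have im2: "Im (2 * \<tau>) > 0" using assms by simp
  have prod_has_sum: "((\<lambda>(n, m). jt_term a z t n * jt_term b w t m) has_sum (jt a z t * jt b w t)) UNIV"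
      if "Im t > 0" for a b z w t
  proof -
    \<comment> \<open>Absolute summability over pairs turns the iterated sum into an unordered one,
      which can then be regrouped by parity.\<close>
    have "(\<lambda>p. norm ((\<lambda>(n, m). jt_term a z t n * jt_term b w t m) p)) summable_on UNIV \<times> UNIV"
    proof (subst Infinite_Sum.abs_summable_on_Sigma_iff, intro conjI ballI)
      fix n show "(\<lambda>m. norm ((\<lambda>(n, m). jt_term a z t n * jt_term b w t m) (n, m))) summable_on UNIV"
        unfolding prod.case norm_mult by (intro summable_on_cmult_right jt_term_abs_summable that)
    next
      define S where "S = (\<Sum>\<^sub>\<infinity>m. norm (jt_term b w t m))"
      have "S \<ge> 0" unfolding S_def by (rule infsum_nonneg) simp
      hence "norm (\<Sum>\<^sub>\<infinity>m. norm ((\<lambda>(n, m). jt_term a z t n * jt_term b w t m) (n, m))) =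
          norm (jt_term a z t n) * S" for n
        unfolding prod.case norm_mult infsum_cmult_right' S_def[symmetric] by (simp add: abs_mult)
      moreover have "(\<lambda>n. norm (jt_term a z t n) * S) summable_on UNIV"
        by (intro summable_on_cmult_left jt_term_abs_summable that)
      ultimately show "(\<lambda>n. norm (\<Sum>\<^sub>\<infinity>m. norm ((\<lambda>(n, m). jt_term a z t n * jt_term b w t m) (n, m)))) summable_on UNIV"
        by (simp only:)
    qed
    hence s: "(\<lambda>(n, m). jt_term a z t n * jt_term b w t m) summable_on UNIV \<times> UNIV"
      using abs_summable_summable by blast
    have "infsum (\<lambda>(n, m). jt_term a z t n * jt_term b w t m) (UNIV \<times> UNIV) =
        (\<Sum>\<^sub>\<infinity>n. \<Sum>\<^sub>\<infinity>m. jt_term a z t n * jt_term b w t m)"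
      by (subst infsum_Sigma'_banach[symmetric]) (use s in auto)
    also have "\<dots> = jt a z t * jt b w t"
      by (simp add: jt_def infsum_cmult_right' infsum_cmult_left')
    finally show ?thesis using s by (simp add: has_sum_infsum summable_iff_has_sum_infsum)
  qed
  have f_sum: "(f has_sum (th (x + y) \<tau> * th (x - y) \<tau>)) UNIV"
    unfolding f_def th_def by (rule prod_has_sum[OF assms])
  define i1 :: "int \<times> int \<Rightarrow> int \<times> int" where "i1 = (\<lambda>(p, r). (p + r, p - r - 1))"
  define i2 :: "int \<times> int \<Rightarrow> int \<times> int" where "i2 = (\<lambda>(p, r). (p + r, p - r))"
  have inj: "inj i1" "inj i2" by (auto simp: i1_def i2_def inj_def)
  have "((f \<circ> i1) has_sum (jt 0 (2 * x) (2 * \<tau>) * jt (1/2) (2 * y) (2 * \<tau>))) UNIV"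
  proof -
    have "f \<circ> i1 = (\<lambda>(n, m). jt_term 0 (2 * x) (2 * \<tau>) n * jt_term (1/2) (2 * y) (2 * \<tau>) m)"
      by (intro ext) (auto simp: f_def i1_def jt_term_product1)
    thus ?thesis using prod_has_sum[OF im2] by simp
  qed
  hence s1: "(f has_sum (jt 0 (2 * x) (2 * \<tau>) * jt (1/2) (2 * y) (2 * \<tau>))) (range i1)"
    by (subst has_sum_reindex) (use inj in auto)
  have "((f \<circ> i2) has_sum (- (jt (1/2) (2 * x) (2 * \<tau>) * jt 0 (2 * y) (2 * \<tau>)))) UNIV"
  proof -
    have "f \<circ> i2 = (\<lambda>z. - (case z of (n, m) \<Rightarrow> jt_term (1/2) (2 * x) (2 * \<tau>) n * jt_term 0 (2 * y) (2 * \<tau>) m))"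
      by (intro ext) (auto simp: f_def i2_def jt_term_product2)
    thus ?thesis using prod_has_sum[OF im2] by (simp add: has_sum_uminus)
  qed
  hence s2: "(f has_sum (- (jt (1/2) (2 * x) (2 * \<tau>) * jt 0 (2 * y) (2 * \<tau>)))) (range i2)"
    by (subst has_sum_reindex) (use inj in auto)
  have "i1 x \<noteq> i2 y" for x y
    by (cases x; cases y) (simp add: i1_def i2_def, presburger)
  hence disj: "range i1 \<inter> range i2 = {}" by blast
  have "(n, m) \<in> range i1 \<union> range i2" for n m
  proof (cases "even (n + m)")
    case True
    hence "(n + m) div 2 + (n - m) div 2 = n" "(n + m) div 2 - (n - m) div 2 = m" by presburger+
    hence "(n, m) = i2 ((n + m) div 2, (n - m) div 2)" unfolding i2_def by simp
    thus ?thesis by blast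
  next
    case False
    hence "(n + m + 1) div 2 + (n - m - 1) div 2 = n" "(n + m + 1) div 2 - (n - m - 1) div 2 - 1 = m"
      by presburger+
    hence "(n, m) = i1 ((n + m + 1) div 2, (n - m - 1) div 2)" unfolding i1_def by simp
    thus ?thesis by blast
  qed
  hence un: "range i1 \<union> range i2 = UNIV" by auto
  have "th (x + y) \<tau> * th (x - y) \<tau> = jt 0 (2 * x) (2 * \<tau>) * jt (1/2) (2 * y) (2 * \<tau>)
      + - (jt (1/2) (2 * x) (2 * \<tau>) * jt 0 (2 * y) (2 * \<tau>))"
    using has_sum_unique[OF f_sum] has_sum_Un_disjoint[OF s1 s2 disj] unfolding un by blast
  thus ?thesis by simp
qed

lemma jt_half_even: "jt (1/2) (- x) \<tau> = jt (1/2) x \<tau>"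
  using jt_minus[of "-(1/2)" x \<tau>] jt_char_add_int[of "-(1/2)" 1] by simp

lemma jt_zero_even: "jt 0 (- x) \<tau> = jt 0 x \<tau>"
  using jt_minus[of 0 x \<tau>] by simp

text \<open>The addition formula at \<open>z + 1/4\<close> and 1/4; one of its two products contains
  \<open>jt (1/2) (1/2)\<close>, which vanishes because it equals its own negative.\<close>

lemma th_duplication:
  assumes "Im \<tau> > 0"
  shows "th z \<tau> * th (z + 1/2) \<tau> = th (2 * z) (2 * \<tau>) * (- jt 0 (1/2) (2 * \<tau>))"
proof -
  have "jt (1/2) (1/2) (2 * \<tau>) = jt (1/2) (- (1/2) + of_int 1) (2 * \<tau>)" by simp
  also have "\<dots> = - jt (1/2) (1/2) (2 * \<tau>)" by (subst jt_add_int) (simp add: jt_half_even)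
  finally have 0: "jt (1/2) (1/2) (2 * \<tau>) = 0" by simp
  have "th z \<tau> * th (z + 1/2) \<tau> = th ((z + 1/4) + 1/4) \<tau> * th ((z + 1/4) - 1/4) \<tau>"
    by (simp add: mult.commute add.commute)
  also have "\<dots> = - (jt (1/2) (2 * (z + 1/4)) (2 * \<tau>) * jt 0 (2 * (1/4)) (2 * \<tau>))"
    by (subst th_product[OF assms]) (use 0 in simp)
  also have "jt (1/2) (2 * (z + 1/4)) (2 * \<tau>) = th (2 * z) (2 * \<tau>)"
    by (simp add: th_def algebra_simps)
  finally show ?thesis by simp
qed

section \<open>Zeros and modular transformation of the theta function\<close>

lemma entire_eventually_nonzero:
  assumes "f holomorphic_on UNIV" "f z0 \<noteq> 0"
  shows "eventually (\<lambda>w. f w \<noteq> 0) (at p)"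
  using non_zero_neighbour_alt[OF assms(1), of p z0] assms(2)
  by (auto elim!: eventually_mono)

lemma entire_zorder_facts:
  assumes "f holomorphic_on UNIV" "f z0 \<noteq> 0"
  shows "isolated_singularity_at f p" "not_essential f p" "frequently (\<lambda>w. f w \<noteq> 0) (at p)"
    "zorder f p \<ge> 0" "f meromorphic_on {p}"
proof -
  have an: "f analytic_on {p}" using assms(1) by (metis UNIV_I analytic_at open_UNIV)
  show "isolated_singularity_at f p" "not_essential f p"
    using an isolated_singularity_at_analytic not_essential_analytic by blast+
  show fr: "frequently (\<lambda>w. f w \<noteq> 0) (at p)"
    using entire_eventually_nonzero[OF assms] by (simp add: eventually_frequently)
  show "zorder f p \<ge> 0" by (rule zorder_ge_0[OF an fr])
  show "f meromorphic_on {p}" by (rule analytic_on_imp_meromorphic_on[OF an])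
qed

lemma zorder_translate: "zorder (\<lambda>z. f (z + c)) p = zorder f (p + c)" for c p :: complex
  by (subst (1 2) zorder_shift) (simp add: add_ac)

text \<open>The quotient has no poles and its absolute value is doubly periodic, so it is bounded.\<close>

lemma entire_ratio_constant:
  fixes f g :: "complex \<Rightarrow> complex"
  assumes f: "f holomorphic_on UNIV" and g: "g holomorphic_on UNIV" and "f z1 \<noteq> 0" "g z2 \<noteq> 0"
    and ord: "\<And>p. zorder g p \<le> zorder f p"
    and per: "\<And>z \<omega>. \<omega> \<in> {1, \<tau>} \<Longrightarrow> norm (f (z + \<omega>)) * norm (g z) = norm (g (z + \<omega>)) * norm (f z)"
    and \<tau>: "Im \<tau> > 0"
  obtains c where "\<And>z. f z = c * g z"
proof -
  note ff = entire_zorder_facts[OF f assms(3)] and gf = entire_zorder_facts[OF g assms(4)]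
  define h where "h = remove_sings (\<lambda>z. f z / g z)"
  have an_h: "h analytic_on {p}" for p
  proof -
    let ?q = "\<lambda>z. f z / g z"
    have iso: "isolated_singularity_at ?q p" and ness: "not_essential ?q p"
      using isolated_singularity_at_divide[of f p g] not_essential_divide[of f p g] ff gf by blast+
    have zo: "zorder ?q p = zorder f p - zorder g p"
      using zorder_divide ff gf by blast
    have "\<not> is_pole ?q p"
      using isolated_pole_imp_neg_zorder[OF iso] ord[of p] zo by fastforce
    with ness obtain l where "?q \<midarrow>p\<rightarrow> l" unfolding not_essential_def by blast
    thus ?thesis unfolding h_def using iso by (rule remove_sings_analytic_at[rotated])
  qed
  have h_hol: "h holomorphic_on UNIV"
    using an_h analytic_imp_holomorphic analytic_on_analytic_at by blast
  have h_cont: "isCont h p" for p using an_h analytic_at_imp_isCont by blast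
  have h_eq: "h w = f w / g w" if "g w \<noteq> 0" for w
  proof -
    have "(\<lambda>z. f z / g z) analytic_on {w}"
      using f g that by (intro analytic_intros) (auto simp: analytic_at_imp_isCont analytic_on_holomorphic intro: exI[of _ UNIV])
    thus ?thesis by (simp add: h_def)
  qed
  have nz: "eventually (\<lambda>w. g w \<noteq> 0) (at p)" for p using entire_eventually_nonzero[OF g assms(4)] .
  have h_per: "norm (h (p + \<omega>)) = norm (h p)" if "\<omega> \<in> {1, \<tau>}" for p \<omega>
  proof -
    have "eventually (\<lambda>w. g (w + \<omega>) \<noteq> 0) (at p)"
      using nz[of "p + \<omega>"] unfolding eventually_at_to_0[of _ "p + \<omega>"] eventually_at_to_0[of _ p]
      by (simp add: add_ac)
    with nz[of p] have "eventually (\<lambda>w. norm (h (w + \<omega>)) - norm (h w) = 0) (at p)"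
    proof eventually_elim
      case (elim w)
      thus ?case using per[OF that, of w] by (simp add: h_eq norm_divide field_simps)
    qed
    hence "((\<lambda>w. norm (h (w + \<omega>)) - norm (h w)) \<longlongrightarrow> 0) (at p)" by (rule tendsto_eventually)
    moreover have "isCont (\<lambda>w. norm (h (w + \<omega>)) - norm (h w)) p"
      by (intro continuous_intros isCont_o2[OF _ h_cont, of p "\<lambda>w. w + \<omega>"] h_cont)
    ultimately show ?thesis using LIM_unique isCont_def by fastforce
  qed
  have h_per_nat: "norm (h (p + of_nat n * \<omega>)) = norm (h p)" if "\<omega> \<in> {1, \<tau>}" for p \<omega> n
  proof (induction n)
    case (Suc n)
    thus ?case using h_per[OF that, of "p + of_nat n * \<omega>"] by (simp add: algebra_simps)
  qed simp
  have h_per_int: "norm (h (p + of_int n * \<omega>)) = norm (h p)" if "\<omega> \<in> {1, \<tau>}" for p \<omega> n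
  proof (cases "n \<ge> 0")
    case True
    thus ?thesis using h_per_nat[OF that, of p "nat n"] by simp
  next
    case False
    thus ?thesis using h_per_nat[OF that, of "p + of_int n * \<omega>" "nat (- n)"] by simp
  qed
  \<comment> \<open>The closed period parallelogram; the integral parts of the real coordinates
    \<open>x\<close> and \<open>y\<close> translate any point into it.\<close>
  define K where "K = (\<lambda>(x, y). of_real x + of_real y * \<tau>) ` ({0..1} \<times> {0..1::real})"
  have "compact K" unfolding K_def
    by (intro compact_continuous_image compact_Times compact_Icc)
       (auto simp: case_prod_unfold intro!: continuous_intros)
  hence "bounded (h ` K)"
    using h_hol by (meson compact_continuous_image compact_imp_bounded holomorphic_on_imp_continuous_on
        holomorphic_on_subset top_greatest)
  then obtain B where B: "\<And>w. w \<in> K \<Longrightarrow> norm (h w) \<le> B" unfolding bounded_iff by blast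
  have "norm (h z) \<le> B" for z
  proof -
    define y where "y = Im z / Im \<tau>"
    define x where "x = Re z - y * Re \<tau>"
    have z: "z = of_real x + of_real y * \<tau>"
      using \<tau> by (simp add: complex_eq_iff x_def y_def)
    have "z + of_int (- \<lfloor>x\<rfloor>) * 1 + of_int (- \<lfloor>y\<rfloor>) * \<tau> = of_real (frac x) + of_real (frac y) * \<tau>"
      by (simp add: z frac_def algebra_simps)
    also have "\<dots> \<in> K"
      unfolding K_def by (rule image_eqI[of _ _ "(frac x, frac y)"]) (auto simp: frac_ge_0 less_imp_le[OF frac_lt_1])
    finally show ?thesis
      using B h_per_int[of \<tau> "z + of_int (- \<lfloor>x\<rfloor>) * 1" "- \<lfloor>y\<rfloor>"] h_per_int[of 1 z "- \<lfloor>x\<rfloor>"] by fastforce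
  qed
  hence "bounded (range h)" unfolding bounded_iff by blast
  then obtain c where c: "\<And>z. h z = c" using Liouville_theorem[OF h_hol]
    unfolding constant_on_def by blast
  have "f p = c * g p" for p
  proof -
    have "eventually (\<lambda>w. f w - c * g w = 0) (at p)"
      using nz[of p] by eventually_elim (use h_eq c in \<open>auto simp: field_simps\<close>)
    hence "((\<lambda>w. f w - c * g w) \<longlongrightarrow> 0) (at p)" by (rule tendsto_eventually)
    moreover have "continuous_on UNIV (\<lambda>w. f w - c * g w)"
      using f g by (intro continuous_intros holomorphic_on_imp_continuous_on)
    hence "isCont (\<lambda>w. f w - c * g w) p" by (simp add: continuous_on_eq_continuous_at)
    ultimately show ?thesis using LIM_unique isCont_def by fastforce
  qed
  thus ?thesis using that by blast
qed

section \<open>The theta series is not identically zero\<close>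

lemma infsum_finite_sum:
  fixes f :: "'j \<Rightarrow> 'i \<Rightarrow> complex"
  assumes "finite J" "\<And>j. j \<in> J \<Longrightarrow> f j summable_on A"
  shows "(\<Sum>\<^sub>\<infinity>n\<in>A. \<Sum>j\<in>J. f j n) = (\<Sum>j\<in>J. infsum (f j) A)"
proof -
  have "(\<Sum>\<^sub>\<infinity>n\<in>A. \<Sum>j\<in>J. f j n) = (\<Sum>j\<in>J. infsum (f j) A) \<and> (\<lambda>n. \<Sum>j\<in>J. f j n) summable_on A"
    using assms by (induction rule: finite_induct) (auto simp: infsum_add summable_on_add)
  thus ?thesis by blast
qed

lemma sum_root_of_unity_powers:
  assumes "N > 0"
  shows "(\<Sum>j<N. exp (2 * of_real pi * \<i> * of_int n * of_nat j / of_nat N)) =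
         (if int N dvd n then of_nat N else 0 :: complex)"
proof -
  define x where "x = exp (2 * of_real pi * \<i> * of_int n / of_nat N)"
  have "(\<Sum>j<N. exp (2 * of_real pi * \<i> * of_int n * of_nat j / of_nat N)) = (\<Sum>j<N. x ^ j)"
    unfolding x_def exp_of_nat_mult[symmetric] by (intro sum.cong refl arg_cong[where f = exp]) simp
  also have "\<dots> = (if int N dvd n then of_nat N else 0)"
  proof (cases "int N dvd n")
    case True
    then obtain k where k: "n = int N * k" by (elim dvdE)
    have "x = 1" using assms exp_integer_2pi[of "of_int k"] by (simp add: x_def k mult_ac)
    thus ?thesis using True by simp
  next
    case False
    have "x \<noteq> 1"
    proof
      assume "x = 1"
      then obtain k :: int where k: "Im (2 * of_real pi * \<i> * of_int n / of_nat N) = of_int (2 * k) * pi"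
        unfolding x_def exp_eq_1 by blast
      have "Im (2 * of_real pi * \<i> * of_int n / of_nat N) = 2 * pi * of_int n / of_nat N"
        by (simp add: Im_divide_of_nat)
      hence "real_of_int n = of_int (k * int N)" using k assms by (simp add: field_simps)
      hence "n = k * int N" by (simp only: of_int_eq_iff)
      thus False using False by simp
    qed
    moreover have "x ^ N = 1"
    proof -
      have "x ^ N = exp (2 * of_real pi * \<i> * of_int n)"
        unfolding x_def exp_of_nat_mult[symmetric] using assms by simp
      thus ?thesis using exp_integer_2pi[of "of_int n"] by (simp add: mult_ac)
    qed
    ultimately show ?thesis using False by (simp add: sum_gp_strict)
  qed
  finally show ?thesis .
qed

text \<open>Averaging over \<open>N\<close>-th roots of unity isolates the terms with \<open>N dvd n\<close>, and
  for large \<open>N\<close> only the term \<open>n = 0\<close> matters.\<close>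

lemma jt_not_identically_zero:
  assumes "Im \<tau> > 0"
  obtains z where "jt a z \<tau> \<noteq> 0"
proof (rule ccontr)
  assume "\<not> thesis"
  hence zero: "jt a z \<tau> = 0" for z using that by blast
  define t where "t = jt_term a 0 \<tau>"
  have t_sum: "(\<lambda>n. norm (t n)) summable_on UNIV" unfolding t_def by (rule jt_term_abs_summable[OF assms])
  have A: "infsum t {n. int N dvd n} = 0" if "N > 0" for N :: nat
  proof -
    have "0 = (\<Sum>j<N. exp (- (2 * of_real pi * \<i> * of_real a * of_nat j / of_nat N)) * jt a (of_nat j / of_nat N) \<tau>)"
      by (simp add: zero)
    also have "\<dots> = (\<Sum>j<N. \<Sum>\<^sub>\<infinity>n. t n * exp (2 * of_real pi * \<i> * of_int n * of_nat j / of_nat N))"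
    proof (rule sum.cong[OF refl])
      fix j
      have "exp (- (2 * of_real pi * \<i> * of_real a * of_nat j / of_nat N)) * jt_term a (of_nat j / of_nat N) \<tau> n =
          t n * exp (2 * of_real pi * \<i> * of_int n * of_nat j / of_nat N)" for n
        unfolding t_def jt_term_def exp_add[symmetric]
        by (rule arg_cong[where f = exp]) (simp add: field_simps add_divide_distrib)
      thus "exp (- (2 * of_real pi * \<i> * of_real a * of_nat j / of_nat N)) * jt a (of_nat j / of_nat N) \<tau> =
         (\<Sum>\<^sub>\<infinity>n. t n * exp (2 * of_real pi * \<i> * of_int n * of_nat j / of_nat N))"
        unfolding jt_def by (simp add: infsum_cmult_right'[symmetric])
    qed
    also have "\<dots> = (\<Sum>\<^sub>\<infinity>n. \<Sum>j<N. t n * exp (2 * of_real pi * \<i> * of_int n * of_nat j / of_nat N))"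
    proof (rule infsum_finite_sum[symmetric])
      fix j
      show "(\<lambda>n. t n * exp (2 * of_real pi * \<i> * of_int n * of_nat j / of_nat N)) summable_on UNIV"
      proof (rule abs_summable_summable, rule summable_on_cong[THEN iffD2, OF _ t_sum])
        fix n :: int
        have "2 * of_real pi * \<i> * of_int n * of_nat j / of_nat N =
            \<i> * of_real (2 * pi * of_int n * of_nat j / of_nat N)" by simp
        hence "norm (exp (2 * of_real pi * \<i> * of_int n * of_nat j / of_nat N)) = 1"
          by (simp only: norm_exp_i_times)
        thus "norm (t n * exp (2 * of_real pi * \<i> * of_int n * of_nat j / of_nat N)) = norm (t n)"
          by (simp add: norm_mult)
      qed
    qed simp
    also have "\<dots> = (\<Sum>\<^sub>\<infinity>n. of_nat N * (if int N dvd n then t n else 0))"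
      unfolding sum_distrib_left[symmetric] sum_root_of_unity_powers[OF that]
      by (intro infsum_cong) simp
    also have "\<dots> = of_nat N * infsum (\<lambda>n. if int N dvd n then t n else 0) UNIV"
      by (rule infsum_cmult_right')
    also have "infsum (\<lambda>n. if int N dvd n then t n else 0) UNIV = infsum t {n. int N dvd n}"
      by (rule infsum_cong_neutral) auto
    finally show ?thesis using that by simp
  qed
  have t0: "t 0 \<noteq> 0" by (simp add: t_def jt_term_def)
  define S where "S = (\<Sum>\<^sub>\<infinity>n. norm (t n))"
  have "((\<lambda>n. norm (t n)) has_sum S) UNIV" unfolding S_def using t_sum by simp
  hence "\<forall>\<^sub>F F in finite_subsets_at_top UNIV. dist (\<Sum>n\<in>F. norm (t n)) S < norm (t 0)"
    unfolding has_sum_def tendsto_iff using t0 by simp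
  then obtain F where F: "finite F" "dist (\<Sum>n\<in>F. norm (t n)) S < norm (t 0)"
    unfolding eventually_finite_subsets_at_top by blast
  \<comment> \<open>\<open>N\<close> exceeds the absolute value of every index in \<open>F\<close>,
    so 0 is the only multiple of \<open>N\<close> that \<open>F\<close> can contain.\<close>
  define N where "N = nat (Max (insert 0 (abs ` F))) + 1"
  have N: "\<bar>n\<bar> < int N" if "n \<in> F" for n
  proof -
    have "\<bar>n\<bar> \<le> Max (insert 0 (abs ` F))" using F(1) that by (intro Max_ge) auto
    moreover have "0 \<le> Max (insert 0 (abs ` F))" using F(1) by (intro Max_ge) auto
    ultimately show ?thesis by (simp add: N_def)
  qed
  define D where "D = {n. int N dvd n} - {0}"
  have D: "D \<inter> F = {}"
  proof -
    have "int N \<le> \<bar>n\<bar>" if "n \<in> D" for n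
      using dvd_imp_le_int[of n "int N"] that by (simp add: D_def)
    thus ?thesis using N by force
  qed
  have "0 = infsum t (D \<union> {0})" using A[of N] by (simp add: D_def N_def insert_absorb)
  also have "\<dots> = infsum t D + t 0"
    using abs_summable_summable[OF t_sum] by (subst infsum_Un_disjoint) (auto simp: D_def intro: summable_on_subset_banach)
  \<comment> \<open>The sum over the multiples of \<open>N\<close> is 0, so the term at 0 would have
    to be cancelled by a tail that is smaller than it.\<close>
  finally have "norm (t 0) = norm (infsum t D)"
    by (metis add.inverse_unique norm_minus_cancel)
  also have "\<dots> \<le> infsum (\<lambda>n. norm (t n)) D"
    by (rule norm_infsum_bound) (use t_sum summable_on_subset_banach in blast)
  also have "\<dots> \<le> infsum (\<lambda>n. norm (t n)) (- F)"
    by (rule infsum_mono2) (use D summable_on_subset_banach[OF t_sum] in auto)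
  also have "\<dots> = S - (\<Sum>n\<in>F. norm (t n))"
    unfolding S_def Compl_eq_Diff_UNIV by (subst infsum_Diff) (use t_sum F in auto)
  also have "\<dots> < norm (t 0)" using F(2) by (simp add: dist_real_def abs_if split: if_splits)
  finally show False by simp
qed

lemma th_not_identically_zero:
  assumes "Im \<tau> > 0"
  obtains z where "th z \<tau> \<noteq> 0"
proof -
  obtain z where "jt (1/2) z \<tau> \<noteq> 0" using jt_not_identically_zero[OF assms] .
  hence "th (z - 1/2) \<tau> \<noteq> 0" by (simp add: th_def)
  thus ?thesis using that by blast
qed

text \<open>Vanishing second differences make \<open>d\<close> affine on all integers, and an affine
  function bounded below in both directions is constant. It is applied to orders of vanishing along
  the multiples of a zero.\<close>

lemma nonneg_arithmetic_progression_constant: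
  fixes d :: "int \<Rightarrow> int"
  assumes "\<And>k. d (k + 1) + d (k - 1) = 2 * d k" "\<And>k. d k \<ge> 0"
  shows "d 1 = d 0"
proof -
  define e where "e = d 1 - d 0"
  have "d (k + 1) - d k = e \<and> d k = d 0 + k * e" for k
  proof (induction k rule: int_induct[where k = 0])
    case (step1 i)
    thus ?case using assms(1)[of "i + 1"] by (simp add: algebra_simps)
  next
    case (step2 i)
    thus ?case using assms(1)[of i] by (simp add: algebra_simps)
  qed (simp add: e_def)
  hence d: "d k = d 0 + k * e" for k by blast
  have "e = 0"
  proof (rule ccontr)
    assume "e \<noteq> 0"
    \<comment> \<open>The change of \<open>d\<close> after \<open>d 0 + 1\<close> steps, at least
      \<open>d 0 + 1\<close> in absolute value for a nonzero integer \<open>e\<close>; in one of the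
      two directions \<open>d\<close> becomes negative.\<close>
    define x where "x = (d 0 + 1) * e"
    have "\<bar>x\<bar> = (d 0 + 1) * \<bar>e\<bar>" using assms(2)[of 0] by (simp add: x_def abs_mult)
    also have "\<dots> \<ge> (d 0 + 1) * 1" using assms(2)[of 0] \<open>e \<noteq> 0\<close> by (intro mult_left_mono) auto
    finally have "\<bar>x\<bar> \<ge> d 0 + 1" by simp
    moreover have "x \<ge> - d 0" using assms(2)[of "d 0 + 1"] unfolding d[of "d 0 + 1"] x_def by simp
    moreover have "x \<le> d 0" using assms(2)[of "- (d 0 + 1)"] unfolding d[of "- (d 0 + 1)"] x_def
      by (simp add: algebra_simps)
    ultimately show False by linarith
  qed
  thus ?thesis by (simp add: e_def)
qed

text \<open>A zero \<open>z0\<close> makes the vector \<open>(A, B)\<close> at \<open>z0\<close>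
  proportional to the one at 0, so the product of the translates of theta by \<open>z0\<close> and
  \<open>- z0\<close> is a multiple of its square. Orders of vanishing are therefore invariant under
  translation by \<open>z0\<close>, the translate is theta times an exponential, and comparing
  quasi-periods puts \<open>z0\<close> in the lattice.\<close>

theorem th_zeros:
  assumes "Im \<tau> > 0" "th z0 \<tau> = 0"
  shows "\<exists>m n. z0 = of_int m * \<tau> + of_int n"
proof -
  let ?t = "\<lambda>z. th z \<tau>"
  have hol: "?t holomorphic_on UNIV" using th_entire[OF assms(1)] .
  obtain z1 where z1: "th z1 \<tau> \<noteq> 0" using th_not_identically_zero[OF assms(1)] .
  note tf = entire_zorder_facts[OF hol z1]
  have shift_hol: "(\<lambda>z. th (z + c) \<tau>) holomorphic_on UNIV" for c
  proof -
    have "(\<lambda>z. z + c) holomorphic_on UNIV" by (intro holomorphic_intros)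
    from holomorphic_on_compose[OF this th_entire[OF assms(1)]] show ?thesis by (simp add: o_def)
  qed
  have shift_facts: "isolated_singularity_at (\<lambda>z. th (z + c) \<tau>) p" "not_essential (\<lambda>z. th (z + c) \<tau>) p"
      "eventually (\<lambda>z. th (z + c) \<tau> \<noteq> 0) (at p)" "frequently (\<lambda>z. th (z + c) \<tau> \<noteq> 0) (at p)"
      "(\<lambda>z. th (z + c) \<tau>) meromorphic_on {p}" for c p
    using entire_zorder_facts[OF shift_hol, of "z1 - c" c] entire_eventually_nonzero[OF shift_hol, of "z1 - c" c] z1
    by auto
  define A where "A = (\<lambda>x. jt 0 (2 * x) (2 * \<tau>))"
  define B where "B = (\<lambda>x. jt (1/2) (2 * x) (2 * \<tau>))"
  have prod: "th (x + y) \<tau> * th (x - y) \<tau> = A x * B y - B x * A y" for x y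
    unfolding A_def B_def by (rule th_product[OF assms(1)])
  have "A 0 * B z0 = B 0 * A z0" using prod[of 0 z0] assms(2) by simp
  moreover have "A 0 \<noteq> 0 \<or> B 0 \<noteq> 0" using prod[of z1 0] z1 by auto
  ultimately obtain c where c: "A z0 = c * A 0" "B z0 = c * B 0"
  proof (cases "A 0 = 0")
    case True
    thus ?thesis using that[of "B z0 / B 0"] \<open>A 0 * B z0 = B 0 * A z0\<close> \<open>A 0 \<noteq> 0 \<or> B 0 \<noteq> 0\<close> by simp
  next
    case False
    thus ?thesis using that[of "A z0 / A 0"] \<open>A 0 * B z0 = B 0 * A z0\<close> by (simp add: field_simps)
  qed
  have eq: "th (z + z0) \<tau> * th (z - z0) \<tau> = c * (th z \<tau> * th z \<tau>)" for z
  proof -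
    have "th (z + z0) \<tau> * th (z - z0) \<tau> = c * (A z * B 0 - B z * A 0)"
      unfolding prod c by (simp add: algebra_simps)
    thus ?thesis using prod[of z 0] by simp
  qed
  have fr: "frequently (\<lambda>z. th (z + u) \<tau> * th (z + v) \<tau> \<noteq> 0) (at p)" for u v p
  proof -
    have "eventually (\<lambda>z. th (z + u) \<tau> * th (z + v) \<tau> \<noteq> 0) (at p)"
      using shift_facts(3)[of u p] shift_facts(3)[of v p] by eventually_elim auto
    thus ?thesis by (simp add: eventually_frequently)
  qed
  have "c \<noteq> 0"
  proof
    assume "c = 0"
    have "frequently (\<lambda>z. False) (at 0)" using fr[of z0 "- z0" 0] eq \<open>c = 0\<close> by simp
    thus False by simp
  qed
  have zo: "zorder ?t (p + z0) + zorder ?t (p - z0) = 2 * zorder ?t p" for p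
  proof -
    have "zorder (\<lambda>z. th (z + z0) \<tau> * th (z + (- z0)) \<tau>) p = zorder ?t (p + z0) + zorder ?t (p - z0)"
      using zorder_mult[OF shift_facts(5,4) shift_facts(5,4), of z0 "- z0" p]
        zorder_translate[of ?t z0 p] zorder_translate[of ?t "- z0" p] by simp
    also have "(\<lambda>z. th (z + z0) \<tau> * th (z + (- z0)) \<tau>) = (\<lambda>z. c * (th z \<tau> * th z \<tau>))" using eq by simp
    also have "zorder (\<lambda>z. c * (th z \<tau> * th z \<tau>)) p = zorder (\<lambda>z. th z \<tau> * th z \<tau>) p"
      by (rule zorder_cmult[OF \<open>c \<noteq> 0\<close>])
    also have "\<dots> = zorder ?t p + zorder ?t p"
      using zorder_mult[OF tf(5,3) tf(5,3)] .
    finally show ?thesis by simp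
  qed
  have inv: "zorder ?t (p + z0) = zorder ?t p" for p
    using nonneg_arithmetic_progression_constant[of "\<lambda>k. zorder ?t (p + of_int k * z0)"]
      zo[of "p + of_int _ * z0"] tf(4) by (simp add: algebra_simps)
  \<comment> \<open>Real coordinates of \<open>z0\<close> with respect to \<tau> and 1. The
    exponential in \<open>f\<close> is chosen with \<rho>, so that the multipliers of
    \<open>f\<close> and of \<open>th\<close> under both periods differ only by factors of modulus
    1.\<close>
  define \<rho> where "\<rho> = Im z0 / Im \<tau>"
  define \<sigma> where "\<sigma> = Re z0 - \<rho> * Re \<tau>"
  have z0: "z0 = of_real \<rho> * \<tau> + of_real \<sigma>"
    using assms(1) by (simp add: complex_eq_iff \<rho>_def \<sigma>_def)
  define f where "f = (\<lambda>z. exp (2 * of_real pi * \<i> * of_real \<rho> * z) * th (z + z0) \<tau>)"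
  have f_hol: "f holomorphic_on UNIV" unfolding f_def by (intro holomorphic_intros shift_hol)
  have f_zo: "zorder f p = zorder ?t p" for p
  proof -
    have "(\<lambda>z. exp (2 * of_real pi * \<i> * of_real \<rho> * z)) holomorphic_on UNIV" by (intro holomorphic_intros)
    note ef = entire_zorder_facts[OF this, of 0, simplified]
    have "zorder f p = zorder (\<lambda>z. exp (2 * of_real pi * \<i> * of_real \<rho> * z)) p + zorder (\<lambda>z. th (z + z0) \<tau>) p"
      unfolding f_def by (rule zorder_mult) (use ef shift_facts in auto)
    moreover have "zorder (\<lambda>z. exp (2 * of_real pi * \<i> * of_real \<rho> * z)) p = 0"
      by (rule zorder_eq_0I) (auto intro!: analytic_intros)
    ultimately show ?thesis using inv[of p] by (simp add: zorder_translate[of ?t])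
  qed
  have f1: "f (z + 1) = - exp (2 * of_real pi * \<i> * of_real \<rho>) * f z" for z
    using th_quasi[of "z + z0" 0 \<tau> 1] unfolding f_def by (simp add: algebra_simps exp_add)
  have f2: "f (z + \<tau>) = - exp (- (of_real pi * \<i> * \<tau>) - 2 * of_real pi * \<i> * z) * exp (- (2 * of_real pi * \<i> * of_real \<sigma>)) * f z" for z
  proof -
    have "f (z + \<tau>) = - (exp (2 * of_real pi * \<i> * of_real \<rho> * (z + \<tau>)) *
        exp (- (of_real pi * \<i> * \<tau>) - 2 * of_real pi * \<i> * (z + z0))) * th (z + z0) \<tau>"
      using th_quasi[of "z + z0" 1 \<tau> 0] unfolding f_def by (simp add: algebra_simps)
    also have "exp (2 * of_real pi * \<i> * of_real \<rho> * (z + \<tau>)) * exp (- (of_real pi * \<i> * \<tau>) - 2 * of_real pi * \<i> * (z + z0))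
      = exp (- (of_real pi * \<i> * \<tau>) - 2 * of_real pi * \<i> * z) * exp (- (2 * of_real pi * \<i> * of_real \<sigma>)) *
        exp (2 * of_real pi * \<i> * of_real \<rho> * z)"
      unfolding exp_add[symmetric] by (rule arg_cong[where f = exp]) (subst z0, simp add: algebra_simps)
    finally show ?thesis by (simp add: f_def)
  qed
  have t1: "th (z + 1) \<tau> = - th z \<tau>" for z using th_quasi[of z 0 \<tau> 1] by simp
  have t2: "th (z + \<tau>) \<tau> = - exp (- (of_real pi * \<i> * \<tau>) - 2 * of_real pi * \<i> * z) * th z \<tau>" for z
    using th_quasi[of z 1 \<tau> 0] by simp
  have u1: "norm (exp (2 * of_real pi * \<i> * of_real \<rho>)) = 1"
    using norm_exp_i_times[of "2 * pi * \<rho>"] by (simp add: mult_ac)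
  have u2: "norm (exp (- (2 * of_real pi * \<i> * of_real \<sigma>))) = 1"
    using norm_exp_i_times[of "- (2 * pi * \<sigma>)"] by (simp add: mult_ac)
  have "f (z1 - z0) \<noteq> 0" using z1 by (simp add: f_def)
  then obtain c' where c': "\<And>z. f z = c' * th z \<tau>"
  proof (rule entire_ratio_constant[OF f_hol hol _ z1])
    show "norm (f (z + \<omega>)) * norm (th z \<tau>) = norm (th (z + \<omega>) \<tau>) * norm (f z)" if "\<omega> \<in> {1, \<tau>}" for z \<omega>
      using that f1[of z] f2[of z] t1[of z] t2[of z] u1 u2 by (auto simp: norm_mult)
  qed (use f_zo assms(1) in auto)
  have "c' \<noteq> 0" using c' \<open>f (z1 - z0) \<noteq> 0\<close> by fastforce
  have fz1: "f z1 \<noteq> 0" using c'[of z1] \<open>c' \<noteq> 0\<close> z1 by simp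
  \<comment> \<open>Since \<open>f\<close> is a nonzero multiple of \<open>th\<close>, the
    unimodular factors are 1, and \<rho> and \<sigma> are integers.\<close>
  have "exp (2 * of_real pi * \<i> * of_real \<rho>) = 1"
    using f1[of z1] c'[of z1] c'[of "z1 + 1"] t1[of z1] fz1 by (simp add: c')
  moreover have "exp (- (2 * of_real pi * \<i> * of_real \<sigma>)) = 1"
    using f2[of z1] c'[of z1] c'[of "z1 + \<tau>"] t2[of z1] fz1 by (simp add: c')
  ultimately have "(\<exists>m::int. 2 * pi * \<rho> = of_int (2 * m) * pi) \<and> (\<exists>n::int. - (2 * pi * \<sigma>) = of_int (2 * n) * pi)"
    unfolding exp_eq_1 by simp
  then obtain m n :: int where "2 * pi * \<rho> = of_int (2 * m) * pi" "- (2 * pi * \<sigma>) = of_int (2 * n) * pi"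
    by blast
  hence "pi * \<rho> = pi * of_int m" "pi * \<sigma> = pi * of_int (- n)" by (simp_all add: algebra_simps)
  hence "\<rho> = of_int m" "\<sigma> = of_int (- n)" unfolding mult_cancel_left by simp_all
  hence "z0 = of_int m * \<tau> + of_int (- n)" by (simp add: z0)
  thus ?thesis by blast
qed

text \<open>The properties that pin down \<open>th\<close> up to a constant. The multiplicity of the
  zeros is left open, so that for a transformed theta function only their location has to be
  known.\<close>

definition theta_quasi :: "complex \<Rightarrow> (complex \<Rightarrow> complex) \<Rightarrow> bool" where
  "theta_quasi \<tau> f \<longleftrightarrow> f holomorphic_on UNIV \<and> (\<exists>z. f z \<noteq> 0) \<and> (\<forall>z. f (z + 1) = - f z) \<and>
     (\<forall>z. f (z + \<tau>) = - exp (- (of_real pi * \<i> * \<tau>) - 2 * of_real pi * \<i> * z) * f z) \<and>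
     (\<forall>z. f z = 0 \<longrightarrow> (\<exists>m n. z = of_int m * \<tau> + of_int n))"

lemma theta_quasi_th: "Im \<tau> > 0 \<Longrightarrow> theta_quasi \<tau> (\<lambda>z. th z \<tau>)"
  unfolding theta_quasi_def
  using th_entire th_not_identically_zero th_zeros th_quasi[of _ 0 \<tau> 1] th_quasi[of _ 1 \<tau> 0] by fastforce

lemma theta_quasi_zorder_lattice:
  assumes "theta_quasi \<tau> f"
  shows "zorder f (of_int m * \<tau> + of_int n) = zorder f 0"
proof -
  note f = assms[unfolded theta_quasi_def]
  obtain z1 where z1: "f z1 \<noteq> 0" using f by blast
  have mult: "zorder f (p + \<omega>) = zorder f p"
    if e: "\<And>z. f (z + \<omega>) = e z * f z" "e holomorphic_on UNIV" "\<And>z. e z \<noteq> 0" for p \<omega> e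
  proof -
    have "f holomorphic_on UNIV" using f by blast
    note ff = entire_zorder_facts[OF this z1, of p] and ef = entire_zorder_facts[OF e(2) e(3), of p]
    have "zorder f (p + \<omega>) = zorder (\<lambda>z. e z * f z) p"
      by (subst zorder_translate[symmetric]) (simp add: e(1))
    also have "\<dots> = zorder e p + zorder f p"
      by (rule zorder_mult) (use ff ef in auto)
    also have "zorder e p = 0"
      by (rule zorder_eq_0I) (use e in \<open>auto simp: analytic_on_holomorphic intro: exI[of _ UNIV]\<close>)
    finally show ?thesis by simp
  qed
  have p1: "zorder f (p + 1) = zorder f p" for p
    by (rule mult[of 1 "\<lambda>_. -1"]) (use f in auto)
  have p2: "zorder f (p + \<tau>) = zorder f p" for p
    by (rule mult[of \<tau> "\<lambda>z. - exp (- (of_real pi * \<i> * \<tau>) - 2 * of_real pi * \<i> * z)"])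
       (use f in \<open>auto intro!: holomorphic_intros\<close>)
  have "zorder f (of_int n) = zorder f 0" for n
  proof (induction n rule: int_induct[where k = 0])
    case (step1 i) thus ?case using p1[of "of_int i"] by simp
  next
    case (step2 i) thus ?case using p1[of "of_int (i - 1)"] by simp
  qed simp
  moreover have "zorder f (of_int m * \<tau> + of_int n) = zorder f (of_int n)"
  proof (induction m rule: int_induct[where k = 0])
    case (step1 i) thus ?case using p2[of "of_int i * \<tau> + of_int n"] by (simp add: algebra_simps)
  next
    case (step2 i) thus ?case using p2[of "of_int (i - 1) * \<tau> + of_int n"] by (simp add: algebra_simps)
  qed simp
  ultimately show ?thesis by simp
qed

text \<open>Both functions vanish at lattice points only, each with the same order at all of them,
  so one of the quotients \<open>f / g\<close> and \<open>g / f\<close> has no poles and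
  \<open>entire_ratio_constant\<close> applies to it.\<close>

lemma theta_quasi_unique:
  assumes f: "theta_quasi \<tau> f" and g: "theta_quasi \<tau> g" and \<tau>: "Im \<tau> > 0"
  obtains c where "c \<noteq> 0" "\<And>z. f z = c * g z"
proof -
  have *: "\<exists>c. c \<noteq> 0 \<and> (\<forall>z. f z = c * g z)"
    if f: "theta_quasi \<tau> f" and g: "theta_quasi \<tau> g" and le: "zorder g 0 \<le> zorder f 0" for f g
  proof -
    obtain z1 z2 where z12: "f z1 \<noteq> 0" "g z2 \<noteq> 0" using f g unfolding theta_quasi_def by blast
    have fh: "f holomorphic_on UNIV" and gh: "g holomorphic_on UNIV" using f g unfolding theta_quasi_def by blast+
    have zo: "zorder g p \<le> zorder f p" for p
    proof (cases "g p = 0")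
      case True
      then obtain m n where "p = of_int m * \<tau> + of_int n" using g unfolding theta_quasi_def by blast
      thus ?thesis using theta_quasi_zorder_lattice[OF f] theta_quasi_zorder_lattice[OF g] le by simp
    next
      case False
      have "zorder g p = 0"
        by (rule zorder_eq_0I) (use gh False in \<open>auto simp: analytic_on_holomorphic intro: exI[of _ UNIV]\<close>)
      thus ?thesis using entire_zorder_facts(4)[OF fh z12(1)] by simp
    qed
    obtain c where c: "\<And>z. f z = c * g z"
    proof (rule entire_ratio_constant[OF fh gh z12 zo _ \<tau>])
      show "norm (f (z + \<omega>)) * norm (g z) = norm (g (z + \<omega>)) * norm (f z)" if "\<omega> \<in> {1, \<tau>}" for z \<omega>
        using that f g unfolding theta_quasi_def by (auto simp: norm_mult)
    qed auto
    thus ?thesis using z12(1) by (metis mult_zero_left)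
  qed
  show ?thesis
  proof (cases "zorder g 0 \<le> zorder f 0")
    case True
    thus ?thesis using *[OF f g] that by blast
  next
    case False
    then obtain c where c: "c \<noteq> 0" "\<And>z. g z = c * f z" using *[OF g f] by auto
    show ?thesis by (rule that[of "1 / c"]) (use c in auto)
  qed
qed

text \<open>The Gaussian factor turns \<open>th (z / j)\<close> for the transformed modulus into a
  function with the quasi-periods of \<open>th\<close> for \<tau>, and uniqueness gives the formula.
  Classically \<open>C\<close> is an eighth root of unity times a square root of \<open>j\<close>;
  here only its independence of \<open>z\<close> is retained.\<close>

theorem th_modular:
  fixes a b c d :: int
  assumes det: "a * d - b * c = 1" and \<tau>: "Im \<tau> > 0" and \<tau>': "Im ((of_int a * \<tau> + of_int b) / (of_int c * \<tau> + of_int d)) > 0"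
  obtains C where "C \<noteq> 0" "\<And>z. th (z / (of_int c * \<tau> + of_int d)) ((of_int a * \<tau> + of_int b) / (of_int c * \<tau> + of_int d)) =
        C * exp (of_real pi * \<i> * of_int c * z\<^sup>2 / (of_int c * \<tau> + of_int d)) * th z \<tau>"
proof -
  define j where "j = of_int c * \<tau> + of_int d"
  define t' where "t' = (of_int a * \<tau> + of_int b) / j"
  have j: "j \<noteq> 0" using \<tau>' by (auto simp: j_def)
  have jt': "t' * j = of_int a * \<tau> + of_int b" using j by (simp add: t'_def)
  have im': "Im t' > 0" using \<tau>' by (simp add: t'_def j_def)
  define F where "F = (\<lambda>z. exp (- (of_real pi * \<i> * of_int c * z\<^sup>2 / j)) * th (z / j) t')"
  have detc: "of_int a * of_int d - of_int b * of_int c = (1::complex)"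
    using arg_cong[OF det, of of_int] by simp
  have quasi: "theta_quasi \<tau> F"
    unfolding theta_quasi_def
  proof (intro conjI allI impI)
    have "(\<lambda>z. th z t') \<circ> (\<lambda>z. z / j) holomorphic_on UNIV"
      by (intro holomorphic_on_compose holomorphic_intros th_entire[OF im']) (use j in auto)
    thus "F holomorphic_on UNIV" unfolding F_def o_def by (intro holomorphic_intros) (use j in auto)
    obtain z1 where "th z1 t' \<noteq> 0" using th_not_identically_zero[OF im'] .
    thus "\<exists>z. F z \<noteq> 0" using j by (intro exI[of _ "z1 * j"]) (simp add: F_def)
  next
    fix z
    \<comment> \<open>1 and \<tau> are \<open>j\<close> times the lattice vectors
      \<open>- c * t' + a\<close> and \<open>d * t' - b\<close>, so the quasi-periodicity for
      \<open>t'\<close> applies to both.\<close>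
    have z1: "(z + 1) / j = z / j + of_int (- c) * t' + of_int a"
    proof -
      have "(of_int (- c) * t' + of_int a) * j = of_int (- c) * (t' * j) + of_int a * j" by (simp add: algebra_simps)
      also have "\<dots> = 1" unfolding jt' using detc by (simp add: j_def algebra_simps)
      finally have "of_int (- c) * t' + of_int a = 1 / j" using j by (simp add: eq_divide_eq)
      thus ?thesis by (simp add: add_divide_distrib add.assoc)
    qed
    have "F (z + 1) = (- 1) powi (- c + a) * (exp (- (of_real pi * \<i> * of_int c * (z + 1)\<^sup>2 / j)) *
        exp (- (of_real pi * \<i> * of_int ((- c)\<^sup>2) * t') - 2 * of_real pi * \<i> * of_int (- c) * (z / j))) * th (z / j) t'"
      unfolding F_def z1 th_quasi by (simp add: mult_ac)
    also have "exp (- (of_real pi * \<i> * of_int c * (z + 1)\<^sup>2 / j)) *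
        exp (- (of_real pi * \<i> * of_int ((- c)\<^sup>2) * t') - 2 * of_real pi * \<i> * of_int (- c) * (z / j)) =
        exp (- (of_real pi * \<i> * of_int c * z\<^sup>2 / j)) * exp (of_real pi * \<i> * of_int (- (a * c)))"
    proof -
      have "of_int c * (z + 1)\<^sup>2 + of_int c ^ 2 * (t' * j) - 2 * of_int c * z = of_int c * z\<^sup>2 + of_int (a * c) * j"
      proof -
        have "of_int (a * c) * j = of_int a * of_int c * of_int c * \<tau> + of_int c * (of_int a * of_int d)"
          by (simp add: j_def algebra_simps)
        also have "of_int a * of_int d = 1 + of_int b * (of_int c :: complex)"
          using detc by (simp add: algebra_simps)
        finally show ?thesis unfolding jt' by (simp add: power2_eq_square algebra_simps)
      qed
      hence "(of_int c * (z + 1)\<^sup>2 + of_int c ^ 2 * (t' * j) - 2 * of_int c * z) / j = (of_int c * z\<^sup>2 + of_int (a * c) * j) / j"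
        by simp
      hence "of_int c * (z + 1)\<^sup>2 / j + of_int c ^ 2 * t' - 2 * of_int c * (z / j) = of_int c * z\<^sup>2 / j + of_int (a * c)"
        using j by (simp only: add_divide_distrib diff_divide_distrib times_divide_eq_right[symmetric] divide_self mult_1_right mult.assoc[symmetric] not_False_eq_True)
      hence "- (of_real pi * \<i>) * (of_int c * (z + 1)\<^sup>2 / j + of_int c ^ 2 * t' - 2 * of_int c * (z / j)) = - (of_real pi * \<i>) * (of_int c * z\<^sup>2 / j + of_int (a * c))"
        by simp
      thus ?thesis unfolding exp_add[symmetric]
        by (intro arg_cong[where f = exp]) (simp add: algebra_simps)
    qed
    also have "exp (of_real pi * \<i> * of_int (- (a * c))) = (- 1) powi (- (a * c))" by (rule exp_pi_i_times_int)
    finally have "F (z + 1) = ((- 1) powi (- c + a) * (- 1) powi (- (a * c))) * F z" by (simp add: F_def mult_ac)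
    also have "(- 1 :: complex) powi (- c + a) * (- 1) powi (- (a * c)) = (- 1) powi (- c + a - a * c)"
      by (simp add: power_int_add[symmetric])
    \<comment> \<open>By the determinant \<open>a\<close> and \<open>c\<close> are not both even,
      and in the three remaining cases the sign is -1.\<close>
    also have "\<not> (even a \<and> even c)" using det by (metis dvd_diff dvd_mult dvd_mult2 odd_one)
    hence "odd (- c + a - a * c)" by auto
    hence "(- 1 :: complex) powi (- c + a - a * c) = - 1" by (elim oddE) (simp add: power_int_add power_int_mult)
    finally show "F (z + 1) = - F z" by simp
  next
    fix z
    have z1: "(z + \<tau>) / j = z / j + of_int d * t' + of_int (- b)"
    proof -
      have "(of_int d * t' + of_int (- b)) * j = of_int d * (t' * j) + of_int (- b) * j" by (simp add: algebra_simps)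
      also have "\<dots> = (of_int a * of_int d - of_int b * of_int c) * \<tau>" unfolding jt' by (simp add: j_def algebra_simps)
      finally have "of_int d * t' + of_int (- b) = \<tau> / j" using j detc by (simp add: eq_divide_eq)
      thus ?thesis by (simp add: add_divide_distrib add.assoc)
    qed
    have "F (z + \<tau>) = (- 1) powi (d - b) * (exp (- (of_real pi * \<i> * of_int c * (z + \<tau>)\<^sup>2 / j)) *
        exp (- (of_real pi * \<i> * of_int (d\<^sup>2) * t') - 2 * of_real pi * \<i> * of_int d * (z / j))) * th (z / j) t'"
      unfolding F_def z1 th_quasi by (simp add: mult_ac)
    also have "exp (- (of_real pi * \<i> * of_int c * (z + \<tau>)\<^sup>2 / j)) *
        exp (- (of_real pi * \<i> * of_int (d\<^sup>2) * t') - 2 * of_real pi * \<i> * of_int d * (z / j)) =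
        exp (- (of_real pi * \<i> * of_int c * z\<^sup>2 / j)) * exp (- (of_real pi * \<i> * \<tau>) - 2 * of_real pi * \<i> * z) * exp (of_real pi * \<i> * of_int (- (b * d)))"
    proof -
      have "of_int c * (z + \<tau>)\<^sup>2 + of_int d ^ 2 * (t' * j) + 2 * of_int d * z = of_int c * z\<^sup>2 + (\<tau> + 2 * z + of_int (b * d)) * j"
      proof -
        have "(\<tau> + 2 * z + of_int (b * d)) * j = of_int c * \<tau>\<^sup>2 + 2 * z * of_int c * \<tau> + 2 * z * of_int d
            + of_int b * of_int d ^ 2 + \<tau> * of_int d * (1 + of_int b * of_int c)"
          by (simp add: j_def power2_eq_square algebra_simps)
        also have "1 + of_int b * (of_int c :: complex) = of_int a * of_int d"
          using detc by (simp add: algebra_simps)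
        finally show ?thesis unfolding jt' by (simp add: power2_eq_square algebra_simps)
      qed
      hence "(of_int c * (z + \<tau>)\<^sup>2 + of_int d ^ 2 * (t' * j) + 2 * of_int d * z) / j = (of_int c * z\<^sup>2 + (\<tau> + 2 * z + of_int (b * d)) * j) / j"
        by simp
      hence "of_int c * (z + \<tau>)\<^sup>2 / j + of_int d ^ 2 * t' + 2 * of_int d * (z / j) = of_int c * z\<^sup>2 / j + (\<tau> + 2 * z + of_int (b * d))"
        using j by (simp only: add_divide_distrib[of _ _ j] times_divide_eq_right[symmetric] divide_self mult_1_right mult.assoc[symmetric] not_False_eq_True)
      hence "- (of_real pi * \<i>) * (of_int c * (z + \<tau>)\<^sup>2 / j + of_int d ^ 2 * t' + 2 * of_int d * (z / j)) = - (of_real pi * \<i>) * (of_int c * z\<^sup>2 / j + (\<tau> + 2 * z + of_int (b * d)))"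
        by simp
      thus ?thesis unfolding exp_add[symmetric]
        by (intro arg_cong[where f = exp]) (simp add: algebra_simps)
    qed
    also have "exp (of_real pi * \<i> * of_int (- (b * d))) = (- 1) powi (- (b * d))" by (rule exp_pi_i_times_int)
    finally have "F (z + \<tau>) = ((- 1) powi (d - b) * (- 1) powi (- (b * d))) * exp (- (of_real pi * \<i> * \<tau>) - 2 * of_real pi * \<i> * z) * F z" by (simp add: F_def mult_ac)
    also have "(- 1 :: complex) powi (d - b) * (- 1) powi (- (b * d)) = (- 1) powi (d - b - b * d)"
      by (simp add: power_int_add[symmetric])
    also have "\<not> (even b \<and> even d)" using det by (metis dvd_diff dvd_mult dvd_mult2 odd_one)
    hence "odd (d - b - b * d)" by auto
    hence "(- 1 :: complex) powi (d - b - b * d) = - 1" by (elim oddE) (simp add: power_int_add power_int_mult)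
    finally show "F (z + \<tau>) = - exp (- (of_real pi * \<i> * \<tau>) - 2 * of_real pi * \<i> * z) * F z" by simp
  next
    fix z assume "F z = 0"
    hence "th (z / j) t' = 0" by (simp add: F_def)
    then obtain m n where "z / j = of_int m * t' + of_int n" using th_zeros[OF im'] by blast
    hence "z = of_int m * (t' * j) + of_int n * j" using j by (simp add: field_simps)
    hence "z = of_int (m * a + n * c) * \<tau> + of_int (m * b + n * d)"
      unfolding jt' by (simp add: j_def algebra_simps)
    thus "\<exists>m n. z = of_int m * \<tau> + of_int n" by blast
  qed
  obtain C where C: "C \<noteq> 0" "\<And>z. F z = C * th z \<tau>"
    using theta_quasi_unique[OF quasi theta_quasi_th[OF \<tau>] \<tau>] by blast
  show ?thesis
  proof (rule that[OF C(1)])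
    fix z
    have "th (z / j) t' = exp (of_real pi * \<i> * of_int c * z\<^sup>2 / j) * F z"
      by (simp add: F_def exp_minus)
    thus "th (z / (of_int c * \<tau> + of_int d)) ((of_int a * \<tau> + of_int b) / (of_int c * \<tau> + of_int d)) =
        C * exp (of_real pi * \<i> * of_int c * z\<^sup>2 / (of_int c * \<tau> + of_int d)) * th z \<tau>"
      unfolding j_def[symmetric] t'_def[symmetric] by (simp add: C(2))
  qed
qed

section \<open>Meromorphy at infinity and Klein forms\<close>

text \<open>Convergence as the imaginary part tends to infinity, uniformly in the real part: the
  approach to the cusp in all limits below.\<close>

abbreviation ioo :: "complex filter" where "ioo \<equiv> filtercomap Im at_top"

lemma eventually_ioo: "eventually P ioo \<longleftrightarrow> (\<exists>b>0. \<forall>z. Im z > b \<longrightarrow> P z)"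
proof
  assume "eventually P ioo"
  then obtain b where b: "\<And>z. Im z \<ge> b \<Longrightarrow> P z"
    unfolding eventually_filtercomap eventually_at_top_linorder by auto
  show "\<exists>b>0. \<forall>z. Im z > b \<longrightarrow> P z" by (rule exI[of _ "max b 1"]) (auto intro: b)
next
  assume "\<exists>b>0. \<forall>z. Im z > b \<longrightarrow> P z"
  then obtain b where b: "\<And>z. Im z > b \<Longrightarrow> P z" by blast
  show "eventually P ioo" unfolding eventually_filtercomap
    by (rule exI[of _ "\<lambda>y. y > b"]) (auto intro: b simp: eventually_gt_at_top)
qed

lemma ioo_neq_bot [simp]: "ioo \<noteq> bot"
proof -
  have "\<exists>z. Im z > b" for b by (rule exI[of _ "Complex 0 (b + 1)"]) simp
  hence "\<not> eventually (\<lambda>_. False) ioo" unfolding eventually_ioo by blast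
  thus ?thesis by (auto simp: trivial_limit_def)
qed

definition qx :: "nat \<Rightarrow> complex \<Rightarrow> complex" where
  "qx N \<tau> = exp (2 * of_real pi * \<i> * \<tau> / of_nat N)"

lemma qx_nonzero [simp]: "qx N \<tau> \<noteq> 0" by (simp add: qx_def)

lemma norm_qx: "norm (qx N \<tau>) = exp (- (2 * pi * Im \<tau> / of_nat N))"
  by (simp add: qx_def Im_divide_of_nat Re_divide_of_nat)

lemma norm_qx_less_1: "Im \<tau> > 0 \<Longrightarrow> N > 0 \<Longrightarrow> norm (qx N \<tau>) < 1"
  by (simp add: norm_qx)

lemma qx_power: "N > 0 \<Longrightarrow> M > 0 \<Longrightarrow> qx (N * M) \<tau> ^ M = qx N \<tau>"
  unfolding qx_def exp_of_nat_mult[symmetric] by simp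

lemma qx_tendsto_0: assumes "N > 0" shows "filterlim (qx N) (at 0) ioo"
proof -
  have 1: "filterlim (\<lambda>y::real. exp (- (2 * pi * y / of_nat N))) (nhds 0) at_top"
  proof -
    have "filterlim (\<lambda>y::real. 2 * pi / of_nat N * y) at_top at_top"
      using assms by (intro filterlim_tendsto_pos_mult_at_top[OF tendsto_const] filterlim_ident) auto
    hence "filterlim (\<lambda>y::real. - (2 * pi * y / of_nat N)) at_bot at_top"
      by (subst filterlim_uminus_at_top[symmetric]) (simp add: filterlim_uminus_at_bot)
    thus ?thesis by (intro filterlim_compose[OF exp_at_bot])
  qed
  have "((\<lambda>\<tau>. norm (qx N \<tau>)) \<longlongrightarrow> 0) ioo"
    unfolding norm_qx by (rule filterlim_compose[OF 1 filterlim_filtercomap])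
  hence "(qx N \<longlongrightarrow> 0) ioo" by (rule tendsto_norm_zero_cancel)
  thus ?thesis by (simp add: filterlim_at)
qed

lemma filterlim_ioo_linear:
  assumes "p > 0" "m > 0"
  shows "filterlim (\<lambda>\<tau>. (of_nat p * \<tau> + of_int r) / of_nat m) ioo ioo"
proof -
  have "filterlim (\<lambda>y::real. real p / real m * y) at_top at_top"
    using assms by (intro filterlim_tendsto_pos_mult_at_top[OF tendsto_const] filterlim_ident) auto
  hence "filterlim (\<lambda>\<tau>. real p / real m * Im \<tau>) at_top ioo"
    by (rule filterlim_compose[OF _ filterlim_filtercomap])
  hence "filterlim (\<lambda>\<tau>. Im ((of_nat p * \<tau> + of_int r) / of_nat m)) at_top ioo"
    by (simp add: Im_divide_of_nat)
  thus ?thesis by (simp add: filterlim_filtercomap_iff o_def)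
qed

text \<open>The width \<open>N\<close> is quantified so that the class is closed under sums of
  functions of different widths and under
  \<open>\<tau> \<mapsto> (p \<tau> + r) / m\<close>.\<close>

definition mero_ioo :: "(complex \<Rightarrow> complex) \<Rightarrow> bool" where
  "mero_ioo f \<longleftrightarrow> (\<exists>N>0. \<exists>F. F meromorphic_on {0} \<and> eventually (\<lambda>\<tau>. f \<tau> = F (qx N \<tau>)) ioo)"

lemma mero_iooI: "N > 0 \<Longrightarrow> F meromorphic_on {0} \<Longrightarrow> (\<And>\<tau>. Im \<tau> > 0 \<Longrightarrow> f \<tau> = F (qx N \<tau>)) \<Longrightarrow> mero_ioo f"
  unfolding mero_ioo_def eventually_ioo by (metis zero_less_one order_less_trans)

lemma mero_ioo_cong:
  assumes "mero_ioo f" "eventually (\<lambda>\<tau>. f \<tau> = g \<tau>) ioo"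
  shows "mero_ioo g"
proof -
  obtain N F where "N > 0" "F meromorphic_on {0}" and ev: "eventually (\<lambda>\<tau>. f \<tau> = F (qx N \<tau>)) ioo"
    using assms(1) unfolding mero_ioo_def by blast
  moreover have "eventually (\<lambda>\<tau>. g \<tau> = F (qx N \<tau>)) ioo" using ev assms(2) by eventually_elim simp
  ultimately show ?thesis unfolding mero_ioo_def by blast
qed

lemma meromorphic_scaled_power:
  assumes "F meromorphic_on {0}" "c \<noteq> 0" "p > 0"
  shows "(\<lambda>w. F (c * w ^ p)) meromorphic_on {0}"
proof (rule meromorphic_on_compose[OF assms(1)])
  show "(\<lambda>w. c * w ^ p) analytic_on {0}" by (intro analytic_intros)
qed (use assms in auto)

lemma mero_ioo_common:
  assumes "mero_ioo f" "mero_ioo g"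
  obtains N F G where "N > 0" "F meromorphic_on {0}" "G meromorphic_on {0}"
    "eventually (\<lambda>\<tau>. f \<tau> = F (qx N \<tau>)) ioo" "eventually (\<lambda>\<tau>. g \<tau> = G (qx N \<tau>)) ioo"
proof -
  obtain N F where F: "N > 0" "F meromorphic_on {0}" "eventually (\<lambda>\<tau>. f \<tau> = F (qx N \<tau>)) ioo"
    using assms(1) unfolding mero_ioo_def by blast
  obtain M G where G: "M > 0" "G meromorphic_on {0}" "eventually (\<lambda>\<tau>. g \<tau> = G (qx M \<tau>)) ioo"
    using assms(2) unfolding mero_ioo_def by blast
  show ?thesis
  proof (rule that[of "N * M" "\<lambda>w. F (w ^ M)" "\<lambda>w. G (w ^ N)"])
    show "(\<lambda>w. F (w ^ M)) meromorphic_on {0}" "(\<lambda>w. G (w ^ N)) meromorphic_on {0}"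
      using meromorphic_scaled_power[OF F(2), of 1 M] meromorphic_scaled_power[OF G(2), of 1 N] F G by auto
    show "\<forall>\<^sub>F \<tau> in ioo. f \<tau> = F (qx (N * M) \<tau> ^ M)" "\<forall>\<^sub>F \<tau> in ioo. g \<tau> = G (qx (N * M) \<tau> ^ N)"
      using F G qx_power[OF F(1) G(1)] qx_power[OF G(1) F(1)] by (simp_all add: mult.commute)
  qed (use F G in auto)
qed

lemma mero_ioo_const: "mero_ioo (\<lambda>_. c)"
  by (rule mero_iooI[of 1 "\<lambda>_. c"]) auto

lemma mero_ioo_binop:
  assumes "mero_ioo f" "mero_ioo g"
    and "\<And>F G. F meromorphic_on {0} \<Longrightarrow> G meromorphic_on {0} \<Longrightarrow> (\<lambda>w. op (F w) (G w)) meromorphic_on {0}"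
  shows "mero_ioo (\<lambda>\<tau>. op (f \<tau>) (g \<tau>))"
proof -
  obtain N F G where *: "N > 0" "F meromorphic_on {0}" "G meromorphic_on {0}"
    "eventually (\<lambda>\<tau>. f \<tau> = F (qx N \<tau>)) ioo" "eventually (\<lambda>\<tau>. g \<tau> = G (qx N \<tau>)) ioo"
    using mero_ioo_common[OF assms(1,2)] by metis
  have "eventually (\<lambda>\<tau>. op (f \<tau>) (g \<tau>) = (\<lambda>w. op (F w) (G w)) (qx N \<tau>)) ioo"
    using *(4,5) by eventually_elim simp
  thus ?thesis using * assms(3) unfolding mero_ioo_def by blast
qed

lemma mero_ioo_add: "mero_ioo f \<Longrightarrow> mero_ioo g \<Longrightarrow> mero_ioo (\<lambda>\<tau>. f \<tau> + g \<tau>)"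
  and mero_ioo_mult: "mero_ioo f \<Longrightarrow> mero_ioo g \<Longrightarrow> mero_ioo (\<lambda>\<tau>. f \<tau> * g \<tau>)"
  and mero_ioo_divide: "mero_ioo f \<Longrightarrow> mero_ioo g \<Longrightarrow> mero_ioo (\<lambda>\<tau>. f \<tau> / g \<tau>)"
  by (rule mero_ioo_binop; auto intro!: meromorphic_intros)+

lemma mero_ioo_linear:
  assumes "mero_ioo f" "p > 0" "m > 0"
  shows "mero_ioo (\<lambda>\<tau>. f ((of_nat p * \<tau> + of_int r) / of_nat m))"
proof -
  obtain N F where F: "N > 0" "F meromorphic_on {0}" "eventually (\<lambda>\<tau>. f \<tau> = F (qx N \<tau>)) ioo"
    using assms(1) unfolding mero_ioo_def by blast
  define c where "c = qx (N * m) (of_int r)"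
  have "qx N ((of_nat p * \<tau> + of_int r) / of_nat m) = c * qx (N * m) \<tau> ^ p" for \<tau>
    unfolding qx_def c_def exp_of_nat_mult[symmetric] exp_add[symmetric]
    by (rule arg_cong[where f = exp]) (simp add: add_divide_distrib algebra_simps)
  hence "eventually (\<lambda>\<tau>. f ((of_nat p * \<tau> + of_int r) / of_nat m) = (\<lambda>w. F (c * w ^ p)) (qx (N * m) \<tau>)) ioo"
    using eventually_compose_filterlim[OF F(3) filterlim_ioo_linear[OF assms(2,3), of r]] by simp
  moreover have "(\<lambda>w. F (c * w ^ p)) meromorphic_on {0}"
    using F(2) assms by (intro meromorphic_scaled_power) (auto simp: c_def)
  ultimately show ?thesis using F(1) assms(3) unfolding mero_ioo_def by (intro exI[of _ "N * m"] conjI exI[of _ "\<lambda>w. F (c * w ^ p)"]) auto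
qed

lemma mero_ioo_analytic:
  assumes "mero_ioo f"
  shows "eventually (\<lambda>\<tau>. f analytic_on {\<tau>}) ioo"
proof -
  obtain N F where F: "N > 0" "F meromorphic_on {0}" and ev: "eventually (\<lambda>\<tau>. f \<tau> = F (qx N \<tau>)) ioo"
    using assms unfolding mero_ioo_def by blast
  have "isolated_singularity_at F 0" using F(2) by (meson meromorphic_onE insertI1)
  then obtain r where r: "r > 0" "F analytic_on ball 0 r - {0}"
    unfolding isolated_singularity_at_def by blast
  have "eventually (\<lambda>\<tau>. norm (qx N \<tau>) < r) ioo"
    using qx_tendsto_0[OF F(1)] r(1) unfolding filterlim_at tendsto_iff by auto
  then obtain b where b: "\<And>\<tau>. Im \<tau> > b \<Longrightarrow> norm (qx N \<tau>) < r" unfolding eventually_ioo by blast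
  obtain b' where b': "\<And>\<tau>. Im \<tau> > b' \<Longrightarrow> f \<tau> = F (qx N \<tau>)" using ev unfolding eventually_ioo by blast
  have "f analytic_on {\<tau>}" if \<tau>: "Im \<tau> > max b b'" for \<tau>
  proof -
    have "qx N analytic_on {\<tau>}" unfolding qx_def using F(1) by (intro analytic_intros) auto
    moreover have "F analytic_on qx N ` {\<tau>}"
      by (rule analytic_on_subset[OF r(2)]) (use b[of \<tau>] \<tau> in auto)
    ultimately have "(F \<circ> qx N) analytic_on {\<tau>}" by (rule analytic_on_compose)
    moreover have "eventually (\<lambda>t. f t = (F \<circ> qx N) t) (nhds \<tau>)"
    proof -
      have "open {t. Im t > max b b'}" by (rule open_halfspace_Im_gt)
      hence "eventually (\<lambda>t. t \<in> {t. Im t > max b b'}) (nhds \<tau>)" using \<tau> by (intro eventually_nhds_in_open) auto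
      thus ?thesis by eventually_elim (use b' in auto)
    qed
    ultimately show ?thesis using analytic_at_cong by blast
  qed
  thus ?thesis unfolding eventually_ioo by (intro exI[of _ "max (max b b') 1"]) auto
qed

text \<open>With \<open>w = exp (\<pi> i \<tau> / m ^ 2)\<close> the \<open>n\<close>-th term is a
  unimodular constant times \<open>w ^ ((m * n + p) ^ 2)\<close>. Any \<open>e ^ 2\<close> below all
  these exponents can be split off: \<open>e = 0\<close> is enough for meromorphy, while the minimal
  exponent makes \<open>H 0\<close> the leading coefficient.\<close>

lemma jt_qexp:
  fixes p e :: int and m :: nat and \<beta> :: real
  assumes "m > 0" and e: "\<And>n. e\<^sup>2 \<le> (int m * n + p)\<^sup>2"
  obtains H where "H holomorphic_on ball 0 1"
    "H 0 = (\<Sum>\<^sub>\<infinity>n\<in>{n. (int m * n + p)\<^sup>2 = e\<^sup>2}. exp (2 * of_real pi * \<i> * of_real ((of_int n + of_int p / of_nat m) * \<beta>)))"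
    "\<And>\<tau>. Im \<tau> > 0 \<Longrightarrow> jt (of_int p / of_nat m) (of_real \<beta>) \<tau> =
       exp (of_real pi * \<i> * \<tau> * of_int (e\<^sup>2) / of_nat (m\<^sup>2)) * H (qx (2 * m\<^sup>2) \<tau>)"
proof -
  define c where "c n = exp (2 * of_real pi * \<i> * of_real ((of_int n + of_int p / of_nat m) * \<beta>))" for n
  define k where "k n = nat ((int m * n + p)\<^sup>2 - e\<^sup>2)" for n
  define H where "H w = (\<Sum>\<^sub>\<infinity>n. c n * w ^ k n)" for w
  have norm_c: "norm (c n) = 1" for n
    using norm_exp_i_times[of "2 * pi * ((of_int n + of_int p / of_nat m) * \<beta>)"] by (simp add: c_def mult_ac)
  have k: "real (k n) = (real m)\<^sup>2 * (of_int n + of_int p / of_nat m)\<^sup>2 - of_int (e\<^sup>2)" for n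
  proof -
    have "real (k n) = of_int ((int m * n + p)\<^sup>2 - e\<^sup>2)" using e[of n] by (simp add: k_def)
    also have "\<dots> = (real m * (of_int n + of_int p / of_nat m))\<^sup>2 - of_int (e\<^sup>2)"
      using assms(1) by (simp add: distrib_left)
    finally show ?thesis by (simp add: power_mult_distrib)
  qed
  show ?thesis
  proof (rule that[of H])
    show "H holomorphic_on ball 0 1"
      unfolding H_def
    proof (rule infsum_holomorphic_on)
      fix K :: "complex set" assume K: "compact K" "K \<subseteq> ball 0 1"
      obtain r where r: "0 < r" "r < 1" "\<And>w. w \<in> K \<Longrightarrow> norm w \<le> r"
      proof (cases "K = {}")
        case True
        thus ?thesis using that[of "1/2"] by auto
      next
        case False
        then obtain w0 where w0: "w0 \<in> K" "\<And>w. w \<in> K \<Longrightarrow> norm w \<le> norm w0"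
          using continuous_attains_sup[of K norm] K(1) continuous_on_norm_id by blast
        show ?thesis by (rule that[of "max (norm w0) (1/2)"]) (use w0 K(2) in \<open>auto simp: le_max_iff_disj\<close>)
      qed
      \<comment> \<open>\<open>ln r\<close> is negative, so \<open>r ^ k n\<close> is again a
        Gaussian in \<open>n\<close>.\<close>
      have "norm (c n * w ^ k n) \<le> exp (- ln r * of_int (e\<^sup>2)) *
          exp (- (- ln r * (real m)\<^sup>2) * (of_int n + of_int p / of_nat m)\<^sup>2 + 0 * (of_int n + of_int p / of_nat m))"
        if "w \<in> K" for n w
      proof -
        have "norm (c n * w ^ k n) \<le> r ^ k n" using r(3)[OF that] by (simp add: norm_mult norm_c norm_power power_mono)
        also have "\<dots> = exp (real (k n) * ln r)" using r(1) by (simp add: exp_of_nat_mult)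
        also have "\<dots> = exp (- ln r * of_int (e\<^sup>2)) *
          exp (- (- ln r * (real m)\<^sup>2) * (of_int n + of_int p / of_nat m)\<^sup>2 + 0 * (of_int n + of_int p / of_nat m))"
          unfolding k exp_add[symmetric] by (rule arg_cong[where f = exp]) (simp add: algebra_simps)
        finally show ?thesis .
      qed
      moreover have "(\<lambda>n. exp (- ln r * of_int (e\<^sup>2)) *
          exp (- (- ln r * (real m)\<^sup>2) * (of_int n + of_int p / of_nat m)\<^sup>2 + 0 * (of_int n + of_int p / of_nat m)))
          summable_on UNIV"
        by (intro summable_on_cmult_right summable_on_exp_quadratic) (use r assms in \<open>auto simp: mult_neg_pos\<close>)
      ultimately show "\<exists>M. M summable_on UNIV \<and> (\<forall>n\<in>UNIV. \<forall>z\<in>K. norm (c n * z ^ k n) \<le> M n)" by blast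
    qed (auto intro!: holomorphic_intros)
    \<comment> \<open>At 0 only the terms with \<open>k n = 0\<close> survive, because
      \<open>0 ^ 0 = 1\<close>.\<close>
    have "H 0 = infsum c {n. (int m * n + p)\<^sup>2 = e\<^sup>2}"
      unfolding H_def by (rule infsum_cong_neutral) (use e in \<open>auto simp: k_def power_0_left intro: antisym\<close>)
    thus "H 0 = (\<Sum>\<^sub>\<infinity>n\<in>{n. (int m * n + p)\<^sup>2 = e\<^sup>2}. exp (2 * of_real pi * \<i> * of_real ((of_int n + of_int p / of_nat m) * \<beta>)))"
      unfolding c_def .
  next
    fix \<tau> :: complex assume "Im \<tau> > 0"
    have "jt_term (of_int p / of_nat m) (of_real \<beta>) \<tau> n =
        exp (of_real pi * \<i> * \<tau> * of_int (e\<^sup>2) / of_nat (m\<^sup>2)) * (c n * qx (2 * m\<^sup>2) \<tau> ^ k n)" for n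
    proof -
      define x where "x = real_of_int n + of_int p / of_nat m"
      have "complex_of_real (real (k n)) = (of_nat m)\<^sup>2 * (of_real x)\<^sup>2 - of_int (e\<^sup>2)"
        unfolding k x_def[symmetric] by simp
      hence k': "(of_nat (k n) :: complex) = (of_nat m)\<^sup>2 * (of_real x)\<^sup>2 - of_int (e\<^sup>2)" by simp
      show ?thesis
        unfolding jt_term_def c_def qx_def exp_of_nat_mult[symmetric] exp_add[symmetric] x_def[symmetric] k'
        using assms(1) by (intro arg_cong[where f = exp]) (simp add: field_simps)
    qed
    thus "jt (of_int p / of_nat m) (of_real \<beta>) \<tau> =
       exp (of_real pi * \<i> * \<tau> * of_int (e\<^sup>2) / of_nat (m\<^sup>2)) * H (qx (2 * m\<^sup>2) \<tau>)"
      unfolding jt_def H_def infsum_cmult_right'[symmetric] by (intro infsum_cong) (simp only:)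
  qed
qed

text \<open>Klein forms up to a factor independent of the characteristic: the normalisation makes the
  transformation law under the modular group a mere substitution of characteristics.\<close>

definition kl :: "real \<Rightarrow> real \<Rightarrow> complex \<Rightarrow> complex" where
  "kl \<alpha> \<beta> \<tau> = exp (of_real pi * \<i> * of_real \<alpha> * (of_real \<alpha> * \<tau> + of_real \<beta>)) * th (of_real \<alpha> * \<tau> + of_real \<beta>) \<tau>"

lemma Im_moebius:
  fixes a b c d :: int
  assumes "a * d - b * c = 1" "Im \<tau> > 0"
  shows "Im ((of_int a * \<tau> + of_int b) / (of_int c * \<tau> + of_int d)) = Im \<tau> / (norm (of_int c * \<tau> + of_int d))\<^sup>2"
    "of_int c * \<tau> + of_int d \<noteq> 0" "Im ((of_int a * \<tau> + of_int b) / (of_int c * \<tau> + of_int d)) > 0"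
proof -
  have det: "real_of_int a * of_int d - of_int b * of_int c = 1"
    using arg_cong[OF assms(1), of real_of_int] by simp
  show nz: "of_int c * \<tau> + of_int d \<noteq> 0"
  proof
    assume *: "of_int c * \<tau> + of_int d = 0"
    hence "Im (of_int c * \<tau> + of_int d) = 0" by simp
    hence "of_int c * Im \<tau> = 0" by simp
    hence "c = 0" using assms(2) by simp
    thus False using * assms(1) by auto
  qed
  have "Im ((of_int a * \<tau> + of_int b) * cnj (of_int c * \<tau> + of_int d)) =
      (of_int a * of_int d - of_int b * of_int c) * Im \<tau>"
    by (simp add: algebra_simps)
  thus 1: "Im ((of_int a * \<tau> + of_int b) / (of_int c * \<tau> + of_int d)) = Im \<tau> / (norm (of_int c * \<tau> + of_int d))\<^sup>2"
    unfolding det by (subst complex_div_cnj) (simp add: Im_divide_of_real flip: of_real_power)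
  show "Im ((of_int a * \<tau> + of_int b) / (of_int c * \<tau> + of_int d)) > 0"
    unfolding 1 using assms(2) nz by simp
qed

text \<open>The Gaussian factor of \<open>th_modular\<close> combines with the normalising
  exponential by \<open>\<alpha> + c * z = \<alpha>' * j\<close>. One \<open>C\<close> serves all
  characteristics, which is why it drops out of quotients.\<close>

lemma kl_modular:
  fixes a b c d :: int
  assumes det: "a * d - b * c = 1" and \<tau>: "Im \<tau> > 0"
  obtains C where "C \<noteq> 0" "\<And>\<alpha> \<beta>. kl \<alpha> \<beta> ((of_int a * \<tau> + of_int b) / (of_int c * \<tau> + of_int d)) =
     C * kl (\<alpha> * of_int a + \<beta> * of_int c) (\<alpha> * of_int b + \<beta> * of_int d) \<tau>"
proof -
  define j where "j = of_int c * \<tau> + of_int d"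
  define t' where "t' = (of_int a * \<tau> + of_int b) / j"
  note im = Im_moebius[OF assms]
  have j: "j \<noteq> 0" using im(2) by (simp add: j_def)
  obtain C where C: "C \<noteq> 0" "\<And>z. th (z / j) t' = C * exp (of_real pi * \<i> * of_int c * z\<^sup>2 / j) * th z \<tau>"
    using th_modular[OF det \<tau> im(3)] unfolding j_def t'_def by blast
  have detc: "of_int a * of_int d = 1 + of_int b * (of_int c :: complex)"
    using arg_cong[OF det, of complex_of_int] by (simp add: algebra_simps)
  show ?thesis
  proof (rule that[OF C(1)])
    fix \<alpha> \<beta> :: real
    define \<alpha>' where "\<alpha>' = \<alpha> * of_int a + \<beta> * of_int c"
    define \<beta>' where "\<beta>' = \<alpha> * of_int b + \<beta> * of_int d"
    define z where "z = of_real \<alpha>' * \<tau> + of_real \<beta>'"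
    have zj: "of_real \<alpha> * t' + of_real \<beta> = z / j"
    proof -
      have "(of_real \<alpha> * t' + of_real \<beta>) * j = of_real \<alpha> * (t' * j) + of_real \<beta> * j" by (simp add: algebra_simps)
      also have "t' * j = of_int a * \<tau> + of_int b" using j by (simp add: t'_def)
      also have "of_real \<alpha> * (of_int a * \<tau> + of_int b) + of_real \<beta> * j = z"
        by (simp add: z_def j_def \<alpha>'_def \<beta>'_def algebra_simps)
      finally show ?thesis using j by (simp add: eq_divide_eq)
    qed
    have "of_real \<alpha> + of_int c * z = of_real \<alpha>' * j"
    proof -
      have "of_real \<alpha>' * j - of_int c * z = of_real \<alpha> * (of_int a * of_int d) - of_real \<alpha> * of_int b * of_int c"
        by (simp add: j_def z_def \<alpha>'_def \<beta>'_def algebra_simps)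
      thus ?thesis unfolding detc by (simp add: algebra_simps)
    qed
    hence "(of_real \<alpha> + of_int c * z) * (z / j) = of_real \<alpha>' * z" using j by simp
    hence ex: "of_real \<alpha> * (z / j) + of_int c * z\<^sup>2 / j = of_real \<alpha>' * z"
      by (simp add: algebra_simps power2_eq_square)
    have "kl \<alpha> \<beta> t' = exp (of_real pi * \<i> * of_real \<alpha> * (z / j)) * (C * exp (of_real pi * \<i> * of_int c * z\<^sup>2 / j) * th z \<tau>)"
      unfolding kl_def zj C(2) ..
    also have "\<dots> = C * (exp (of_real pi * \<i> * of_real \<alpha> * (z / j)) * exp (of_real pi * \<i> * of_int c * z\<^sup>2 / j)) * th z \<tau>"
      by (simp only: mult_ac)
    also have "exp (of_real pi * \<i> * of_real \<alpha> * (z / j)) * exp (of_real pi * \<i> * of_int c * z\<^sup>2 / j) =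
        exp (of_real pi * \<i> * (of_real \<alpha> * (z / j) + of_int c * z\<^sup>2 / j))"
      unfolding exp_add[symmetric] by (rule arg_cong[where f = exp]) (simp add: distrib_left mult.assoc)
    finally show "kl \<alpha> \<beta> ((of_int a * \<tau> + of_int b) / (of_int c * \<tau> + of_int d)) =
       C * kl (\<alpha> * of_int a + \<beta> * of_int c) (\<alpha> * of_int b + \<beta> * of_int d) \<tau>"
      unfolding ex kl_def \<alpha>'_def[symmetric] \<beta>'_def[symmetric] z_def[symmetric] t'_def[symmetric] j_def[symmetric]
      by (simp add: mult.assoc)
  qed
qed

text \<open>The factor does not depend on \<tau>, so reducing characteristics modulo integers
  changes quotients by constants only.\<close>

lemma kl_add_int:
  "kl (\<alpha> + of_int m) (\<beta> + of_int n) \<tau> =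
   (- 1) powi (m + n + m * n) * exp (of_real pi * \<i> * of_real (of_int n * \<alpha> - of_int m * \<beta>)) * kl \<alpha> \<beta> \<tau>"
proof -
  define z where "z = of_real \<alpha> * \<tau> + of_real \<beta>"
  have "kl (\<alpha> + of_int m) (\<beta> + of_int n) \<tau> =
     exp (of_real pi * \<i> * of_real (\<alpha> + of_int m) * (z + of_int m * \<tau> + of_int n)) * th (z + of_int m * \<tau> + of_int n) \<tau>"
    by (simp add: kl_def z_def algebra_simps)
  also have "\<dots> = (- 1) powi (m + n) * (exp (of_real pi * \<i> * of_real (\<alpha> + of_int m) * (z + of_int m * \<tau> + of_int n)) *
     exp (- (of_real pi * \<i> * of_int (m\<^sup>2) * \<tau>) - 2 * of_real pi * \<i> * of_int m * z)) * th z \<tau>"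
    unfolding th_quasi by (simp only: mult_ac)
  also have "exp (of_real pi * \<i> * of_real (\<alpha> + of_int m) * (z + of_int m * \<tau> + of_int n)) *
     exp (- (of_real pi * \<i> * of_int (m\<^sup>2) * \<tau>) - 2 * of_real pi * \<i> * of_int m * z) =
     exp (of_real pi * \<i> * of_int (m * n)) * exp (of_real pi * \<i> * of_real (of_int n * \<alpha> - of_int m * \<beta>)) * exp (of_real pi * \<i> * of_real \<alpha> * z)"
    unfolding exp_add[symmetric] z_def
    by (rule arg_cong[where f = exp]) (simp add: algebra_simps power2_eq_square)
  also have "exp (of_real pi * \<i> * of_int (m * n)) = (- 1) powi (m * n)" by (rule exp_pi_i_times_int)
  finally show ?thesis by (simp add: kl_def z_def power_int_add mult_ac)
qed

lemma kl_minus: "kl (- \<alpha>) (- \<beta>) \<tau> = - kl \<alpha> \<beta> \<tau>"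
proof -
  have "of_real (- \<alpha>) * \<tau> + of_real (- \<beta>) = - (of_real \<alpha> * \<tau> + of_real \<beta>)" by simp
  thus ?thesis unfolding kl_def by (simp only: th_minus) (simp add: algebra_simps)
qed

text \<open>The part of the argument along \<tau> moves into the characteristic; the argument
  becomes real and the expansion \<open>jt_qexp\<close> applies.\<close>

lemma kl_eq_jt:
  "kl \<alpha> \<beta> \<tau> = exp (- (of_real pi * \<i> * of_real (\<alpha> * (\<beta> + 1)))) * jt (1/2 + \<alpha>) (of_real (\<beta> + 1/2)) \<tau>"
proof -
  have "th (of_real \<alpha> * \<tau> + of_real \<beta>) \<tau> = jt (1/2) (of_real (\<beta> + 1/2) + of_real \<alpha> * \<tau>) \<tau>"
    by (simp add: th_def add_ac)
  also have "\<dots> = exp (- (of_real pi * \<i> * (of_real \<alpha>)\<^sup>2 * \<tau>) - 2 * of_real pi * \<i> * of_real \<alpha> * of_real (\<beta> + 1/2)) *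
      jt (1/2 + \<alpha>) (of_real (\<beta> + 1/2)) \<tau>" by (rule jt_shift)
  finally have "kl \<alpha> \<beta> \<tau> = (exp (of_real pi * \<i> * of_real \<alpha> * (of_real \<alpha> * \<tau> + of_real \<beta>)) *
     exp (- (of_real pi * \<i> * (of_real \<alpha>)\<^sup>2 * \<tau>) - 2 * of_real pi * \<i> * of_real \<alpha> * of_real (\<beta> + 1/2))) *
      jt (1/2 + \<alpha>) (of_real (\<beta> + 1/2)) \<tau>" by (simp add: kl_def)
  also have "exp (of_real pi * \<i> * of_real \<alpha> * (of_real \<alpha> * \<tau> + of_real \<beta>)) *
     exp (- (of_real pi * \<i> * (of_real \<alpha>)\<^sup>2 * \<tau>) - 2 * of_real pi * \<i> * of_real \<alpha> * of_real (\<beta> + 1/2)) =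
     exp (- (of_real pi * \<i> * of_real (\<alpha> * (\<beta> + 1))))"
    unfolding exp_add[symmetric] by (rule arg_cong[where f = exp]) (simp add: algebra_simps power2_eq_square)
  finally show ?thesis .
qed

lemma kl_nonzero:
  assumes "Im \<tau> > 0" "\<alpha> \<notin> \<int> \<or> \<beta> \<notin> \<int>"
  shows "kl \<alpha> \<beta> \<tau> \<noteq> 0"
proof
  assume "kl \<alpha> \<beta> \<tau> = 0"
  hence "th (of_real \<alpha> * \<tau> + of_real \<beta>) \<tau> = 0" by (simp add: kl_def)
  then obtain m n where *: "of_real \<alpha> * \<tau> + of_real \<beta> = of_int m * \<tau> + of_int n"
    using th_zeros[OF assms(1)] by blast
  hence "\<alpha> * Im \<tau> = of_int m * Im \<tau>" by (simp add: complex_eq_iff)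
  hence "\<alpha> = of_int m" using assms(1) by simp
  moreover from this * have "\<beta> = of_int n" by (simp add: complex_eq_iff)
  ultimately show False using assms(2) by simp
qed

text \<open>The characteristic is \<open>1/2 + j/7 = (7 + 2 * j) / 14\<close>; hence
  \<open>m = 14\<close>, with \<open>196 = 14 ^ 2\<close> and
  \<open>392 = 2 * 14 ^ 2\<close>.\<close>

lemma kl_qexp:
  fixes j :: int and \<beta> :: real
  assumes e: "\<And>n. e\<^sup>2 \<le> (14 * n + (7 + 2 * j))\<^sup>2"
  obtains H where "H holomorphic_on ball 0 1"
    "H 0 = exp (- (of_real pi * \<i> * of_real (of_int j / 7 * (\<beta> + 1)))) *
        (\<Sum>\<^sub>\<infinity>n\<in>{n. (14 * n + (7 + 2 * j))\<^sup>2 = e\<^sup>2}. exp (2 * of_real pi * \<i> * of_real ((of_int n + of_int (7 + 2 * j) / 14) * (\<beta> + 1/2))))"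
    "\<And>\<tau>. Im \<tau> > 0 \<Longrightarrow> kl (of_int j / 7) \<beta> \<tau> = exp (of_real pi * \<i> * \<tau> * of_int (e\<^sup>2) / 196) * H (qx 392 \<tau>)"
proof -
  obtain H where H: "H holomorphic_on ball 0 1"
    "H 0 = (\<Sum>\<^sub>\<infinity>n\<in>{n. (int 14 * n + (7 + 2 * j))\<^sup>2 = e\<^sup>2}. exp (2 * of_real pi * \<i> * of_real ((of_int n + of_int (7 + 2 * j) / of_nat 14) * (\<beta> + 1/2))))"
    "\<And>\<tau>. Im \<tau> > 0 \<Longrightarrow> jt (of_int (7 + 2 * j) / of_nat 14) (of_real (\<beta> + 1/2)) \<tau> =
       exp (of_real pi * \<i> * \<tau> * of_int (e\<^sup>2) / of_nat (14\<^sup>2)) * H (qx (2 * 14\<^sup>2) \<tau>)"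
    by (rule jt_qexp[of 14 e "7 + 2 * j" "\<beta> + 1/2"]) (use e in simp_all)
  define K where "K = exp (- (of_real pi * \<i> * of_real (of_int j / 7 * (\<beta> + 1))))"
  show ?thesis
  proof (rule that[of "\<lambda>w. K * H w"])
    show "(\<lambda>w. K * H w) holomorphic_on ball 0 1" by (intro holomorphic_intros H(1))
    fix \<tau> :: complex assume "Im \<tau> > 0"
    have "1 / 2 + real_of_int j / 7 = of_int (7 + 2 * j) / of_nat 14" by simp
    thus "kl (of_int j / 7) \<beta> \<tau> = exp (of_real pi * \<i> * \<tau> * of_int (e\<^sup>2) / 196) * (K * H (qx 392 \<tau>))"
      using H(3)[OF \<open>Im \<tau> > 0\<close>] unfolding kl_eq_jt K_def[symmetric] by (simp only:) (simp add: mult_ac)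
  qed (use H(2) in \<open>simp add: K_def\<close>)
qed

lemma holomorphic_ball_qx_tendsto:
  assumes "H holomorphic_on ball 0 1" "N > 0"
  shows "((\<lambda>\<tau>. H (qx N \<tau>)) \<longlongrightarrow> H 0) ioo"
proof -
  have "isCont H 0"
    using assms(1) by (meson centre_in_ball continuous_on_eq_continuous_at holomorphic_on_imp_continuous_on open_ball zero_less_one)
  thus ?thesis using filterlim_compose[OF _ qx_tendsto_0[OF assms(2)], of H] by (simp add: isCont_def)
qed

lemma kl_mero_ioo: "mero_ioo (kl (of_int j / 7) \<beta>)"
proof -
  \<comment> \<open>The crude choice \<open>e = 0\<close> loses the leading exponent but keeps a
    holomorphic factor, which is all that meromorphy asks for.\<close>
  have "(0::int)\<^sup>2 \<le> (14 * n + (7 + 2 * j))\<^sup>2" for n by simp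
  from kl_qexp[OF this, of \<beta>] obtain H where H: "H holomorphic_on ball 0 1"
    "\<And>\<tau>. Im \<tau> > 0 \<Longrightarrow> kl (of_int j / 7) \<beta> \<tau> = exp (of_real pi * \<i> * \<tau> * of_int (0\<^sup>2) / 196) * H (qx 392 \<tau>)"
    by blast
  have "H analytic_on {0}" using H(1) by (meson analytic_at centre_in_ball open_ball zero_less_one)
  thus ?thesis by (intro mero_iooI[of 392 H]) (use H(2) analytic_on_imp_meromorphic_on in auto)
qed

lemma kl_holomorphic: "kl (of_int j / 7) \<beta> holomorphic_on uhp"
proof -
  have "(0::int)\<^sup>2 \<le> (14 * n + (7 + 2 * j))\<^sup>2" for n by simp
  from kl_qexp[OF this, of \<beta>] obtain H where H: "H holomorphic_on ball 0 1"
    "\<And>\<tau>. Im \<tau> > 0 \<Longrightarrow> kl (of_int j / 7) \<beta> \<tau> = exp (of_real pi * \<i> * \<tau> * of_int (0\<^sup>2) / 196) * H (qx 392 \<tau>)"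
    by blast
  have "(H \<circ> qx 392) holomorphic_on uhp"
  proof (rule holomorphic_on_compose_gen[OF _ H(1)])
    show "qx 392 holomorphic_on uhp" unfolding qx_def by (intro holomorphic_intros) auto
    show "qx 392 ` uhp \<subseteq> ball 0 1" using norm_qx_less_1 by (auto simp: uhp_def)
  qed
  thus ?thesis by (rule holomorphic_transform) (use H(2) in \<open>auto simp: uhp_def\<close>)
qed

lemma kl_leading:
  assumes "j \<in> {1, 2, 3::int}"
  shows "((\<lambda>\<tau>. kl (of_int j / 7) 0 \<tau> * exp (- (of_real pi * \<i> * \<tau> * of_int ((7 - 2 * j)\<^sup>2) / 196))) \<longlongrightarrow> - \<i>) ioo"
proof -
  have e: "(7 - 2 * j)\<^sup>2 \<le> (14 * n + (7 + 2 * j))\<^sup>2" for n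
  proof -
    have "14 * n + (7 + 2 * j) \<ge> 7 - 2 * j \<or> 14 * n + (7 + 2 * j) \<le> - (7 - 2 * j)"
      using assms by (cases "n \<ge> 0") auto
    hence "\<bar>7 - 2 * j\<bar> \<le> \<bar>14 * n + (7 + 2 * j)\<bar>" using assms by auto
    thus ?thesis by (simp add: abs_le_square_iff)
  qed
  \<comment> \<open>The minimum is attained once, at \<open>n = - 1\<close>, where the base is
    \<open>- (7 - 2 * j)\<close>; the limit is therefore a single nonzero coefficient.\<close>
  have set: "{n. (14 * n + (7 + 2 * j))\<^sup>2 = (7 - 2 * j)\<^sup>2} = {-1}"
  proof -
    have "14 * n + (7 + 2 * j) = 7 - 2 * j \<or> 14 * n + (7 + 2 * j) = - (7 - 2 * j) \<longleftrightarrow> n = - 1" for n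
      using assms by (elim insertE emptyE) (hypsubst, presburger)+
    thus ?thesis unfolding power2_eq_iff by auto
  qed
  obtain H where H: "H holomorphic_on ball 0 1"
    "H 0 = exp (- (of_real pi * \<i> * of_real (of_int j / 7 * (0 + 1)))) *
        (\<Sum>\<^sub>\<infinity>n\<in>{n. (14 * n + (7 + 2 * j))\<^sup>2 = (7 - 2 * j)\<^sup>2}. exp (2 * of_real pi * \<i> * of_real ((of_int n + of_int (7 + 2 * j) / 14) * (0 + 1/2))))"
    "\<And>\<tau>. Im \<tau> > 0 \<Longrightarrow> kl (of_int j / 7) 0 \<tau> = exp (of_real pi * \<i> * \<tau> * of_int ((7 - 2 * j)\<^sup>2) / 196) * H (qx 392 \<tau>)"
    using kl_qexp[OF e] by blast
  have "H 0 = exp (- (of_real pi * \<i> * of_real (of_int j / 7 * (0 + 1)))) *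
      exp (2 * of_real pi * \<i> * of_real ((of_int (-1) + of_int (7 + 2 * j) / 14) * (0 + 1/2)))"
    unfolding H(2) set by simp
  also have "\<dots> = exp (- (of_real (pi / 2) * \<i>))"
    unfolding exp_add[symmetric] by (rule arg_cong[where f = exp]) (simp add: field_simps)
  also have "\<dots> = cis (- (pi / 2))" by (simp add: cis_conv_exp mult.commute)
  also have "\<dots> = - \<i>" by (simp add: complex_eq_iff)
  finally have H0: "H 0 = - \<i>" .
  have "((\<lambda>\<tau>. H (qx 392 \<tau>)) \<longlongrightarrow> - \<i>) ioo" using holomorphic_ball_qx_tendsto[OF H(1), of 392] H0 by simp
  thus ?thesis
  proof (rule Lim_transform_eventually)
    show "\<forall>\<^sub>F \<tau> in ioo. H (qx 392 \<tau>) =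
       kl (of_int j / 7) 0 \<tau> * exp (- (of_real pi * \<i> * \<tau> * of_int ((7 - 2 * j)\<^sup>2) / 196))"
      unfolding eventually_ioo by (rule exI[of _ 1]) (auto simp: H(3) exp_minus field_simps)
  qed
qed

lemma kl_zero_leading:
  assumes "\<beta> \<notin> \<int>"
  obtains c where "c \<noteq> 0" "((\<lambda>\<tau>. kl 0 \<beta> \<tau> * exp (- (of_real pi * \<i> * \<tau> / 4))) \<longlongrightarrow> c) ioo"
proof -
  have e: "7\<^sup>2 \<le> (14 * n + (7 + 2 * 0))\<^sup>2" for n :: int
  proof -
    have "\<bar>7\<bar> \<le> \<bar>14 * n + (7 + 2 * 0)\<bar>" by (cases "n \<ge> 0") auto
    thus ?thesis unfolding abs_le_square_iff .
  qed
  \<comment> \<open>Two indices share the minimal exponent. Their coefficients add up to a cosine,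
    equal to \<open>- 2 * sin (pi * \<beta>)\<close>, which is nonzero as \<beta> is not an
    integer.\<close>
  have set: "{n::int. (14 * n + (7 + 2 * 0))\<^sup>2 = 7\<^sup>2} = {0, -1}"
    unfolding power2_eq_iff by auto
  obtain H where H: "H holomorphic_on ball 0 1"
    "H 0 = exp (- (of_real pi * \<i> * of_real (of_int 0 / 7 * (\<beta> + 1)))) *
        (\<Sum>\<^sub>\<infinity>n\<in>{n. (14 * n + (7 + 2 * 0))\<^sup>2 = 7\<^sup>2}. exp (2 * of_real pi * \<i> * of_real ((of_int n + of_int (7 + 2 * 0) / 14) * (\<beta> + 1/2))))"
    "\<And>\<tau>. Im \<tau> > 0 \<Longrightarrow> kl (of_int 0 / 7) \<beta> \<tau> = exp (of_real pi * \<i> * \<tau> * of_int (7\<^sup>2) / 196) * H (qx 392 \<tau>)"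
    using kl_qexp[OF e] by blast
  have "H 0 = exp (2 * of_real pi * \<i> * of_real (1/2 * (\<beta> + 1/2))) + exp (2 * of_real pi * \<i> * of_real (- (1/2) * (\<beta> + 1/2)))"
    unfolding H(2) set by (subst infsum_finite) simp_all
  also have "\<dots> = exp (\<i> * of_real (pi * (\<beta> + 1/2))) + exp (- (\<i> * of_real (pi * (\<beta> + 1/2))))"
    by (simp add: algebra_simps)
  also have "\<dots> = 2 * cos (of_real (pi * (\<beta> + 1/2)))" by (simp add: cos_exp_eq)
  also have "\<dots> = of_real (2 * cos (pi * \<beta> + pi / 2))" by (simp add: cos_of_real[symmetric] algebra_simps)
  also have "cos (pi * \<beta> + pi / 2) = - sin (pi * \<beta>)" by (simp add: cos_add)
  finally have H0: "H 0 = of_real (- 2 * sin (pi * \<beta>))" by simp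
  have "sin (pi * \<beta>) \<noteq> 0"
  proof
    assume "sin (pi * \<beta>) = 0"
    then obtain i :: int where "pi * \<beta> = of_int i * pi" unfolding sin_zero_iff_int2 by blast
    hence "\<beta> = of_int i" by simp
    thus False using assms by simp
  qed
  hence "H 0 \<noteq> 0" by (simp add: H0)
  moreover have "((\<lambda>\<tau>. kl 0 \<beta> \<tau> * exp (- (of_real pi * \<i> * \<tau> / 4))) \<longlongrightarrow> H 0) ioo"
  proof (rule Lim_transform_eventually[OF holomorphic_ball_qx_tendsto[OF H(1), of 392]])
    show "\<forall>\<^sub>F \<tau> in ioo. H (qx 392 \<tau>) = kl 0 \<beta> \<tau> * exp (- (of_real pi * \<i> * \<tau> / 4))"
      unfolding eventually_ioo by (rule exI[of _ 1]) (use H(3) in \<open>auto simp: exp_minus field_simps\<close>)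
  qed simp
  ultimately show ?thesis using that by blast
qed

section \<open>The modular action on meromorphic functions\<close>

definition mat2 :: "int \<Rightarrow> int \<Rightarrow> int \<Rightarrow> int \<Rightarrow> int ^ 2 ^ 2" where
  "mat2 a b c d = vector [vector [a, b], vector [c, d]]"

lemma mat2_entries [simp]:
  "mat2 a b c d $ 1 $ 1 = a" "mat2 a b c d $ 1 $ 2 = b" "mat2 a b c d $ 2 $ 1 = c" "mat2 a b c d $ 2 $ 2 = d"
  by (simp_all add: mat2_def vector_2)

lemma mat2_eqI:
  fixes A B :: "int ^ 2 ^ 2"
  assumes "A $ 1 $ 1 = B $ 1 $ 1" "A $ 1 $ 2 = B $ 1 $ 2" "A $ 2 $ 1 = B $ 2 $ 1" "A $ 2 $ 2 = B $ 2 $ 2"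
  shows "A = B"
  using assms by (simp add: vec_eq_iff forall_2)

lemma mat1_entries [simp]:
  "(mat 1 :: int ^ 2 ^ 2) $ 1 $ 1 = 1" "(mat 1 :: int ^ 2 ^ 2) $ 1 $ 2 = 0"
  "(mat 1 :: int ^ 2 ^ 2) $ 2 $ 1 = 0" "(mat 1 :: int ^ 2 ^ 2) $ 2 $ 2 = 1"
  by (simp_all add: mat_def)

lemma matmul_entry: "((A :: int ^ 2 ^ 2) ** B) $ i $ j = A $ i $ 1 * B $ 1 $ j + A $ i $ 2 * B $ 2 $ j"
  by (simp add: matrix_matrix_mult_def sum_2)

lemma SL2Z_iff: "A \<in> SL2Z \<longleftrightarrow> A $ 1 $ 1 * A $ 2 $ 2 - A $ 1 $ 2 * A $ 2 $ 1 = 1"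
  by (simp add: SL2Z_def det_2)

definition minv :: "int ^ 2 ^ 2 \<Rightarrow> int ^ 2 ^ 2" where
  "minv A = mat2 (A $ 2 $ 2) (- A $ 1 $ 2) (- A $ 2 $ 1) (A $ 1 $ 1)"

lemma minv_entries [simp]:
  "minv A $ 1 $ 1 = A $ 2 $ 2" "minv A $ 1 $ 2 = - A $ 1 $ 2"
  "minv A $ 2 $ 1 = - A $ 2 $ 1" "minv A $ 2 $ 2 = A $ 1 $ 1"
  by (simp_all add: minv_def)

lemma SL2Z_mult: "A \<in> SL2Z \<Longrightarrow> B \<in> SL2Z \<Longrightarrow> A ** B \<in> SL2Z"
  by (simp add: SL2Z_def det_mul)

lemma SL2Z_one [simp]: "mat 1 \<in> SL2Z" by (simp add: SL2Z_iff)

lemma SL2Z_minv: "A \<in> SL2Z \<Longrightarrow> minv A \<in> SL2Z"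
  by (simp add: SL2Z_iff algebra_simps)

lemma minv_right: "A \<in> SL2Z \<Longrightarrow> A ** minv A = mat 1"
  and minv_left: "A \<in> SL2Z \<Longrightarrow> minv A ** A = mat 1"
  by (intro mat2_eqI; simp add: matmul_entry SL2Z_iff algebra_simps)+

lemma mult_minv_cancel: "B \<in> SL2Z \<Longrightarrow> (A ** minv B) ** B = A"
  by (simp add: matrix_mul_assoc[symmetric] minv_left)

abbreviation moeb_den :: "int ^ 2 ^ 2 \<Rightarrow> complex \<Rightarrow> complex" where
  "moeb_den A z \<equiv> of_int (A $ 2 $ 1) * z + of_int (A $ 2 $ 2)"

lemma moebius_facts:
  assumes "A \<in> SL2Z" "z \<in> uhp"
  shows "moeb_den A z \<noteq> 0" "moebius_act A z \<in> uhp"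
    "Im (moebius_act A z) = Im z / (norm (moeb_den A z))\<^sup>2"
  using Im_moebius[of "A $ 1 $ 1" "A $ 2 $ 2" "A $ 1 $ 2" "A $ 2 $ 1" z] assms
  by (auto simp: SL2Z_iff uhp_def moebius_act_def)

lemma moebius_mult:
  assumes "A \<in> SL2Z" "B \<in> SL2Z" "z \<in> uhp"
  shows "moebius_act (A ** B) z = moebius_act A (moebius_act B z)"
proof -
  note B = moebius_facts[OF assms(2,3)]
  note A = moebius_facts[OF assms(1) B(2)]
  have num: "of_int (A $ i $ 1) * moebius_act B z + of_int (A $ i $ 2) =
      (of_int ((A ** B) $ i $ 1) * z + of_int ((A ** B) $ i $ 2)) / moeb_den B z" for i
    using B(1) by (simp add: moebius_act_def matmul_entry eq_divide_eq distrib_right) (simp add: algebra_simps)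
  show ?thesis unfolding moebius_act_def[of A] num
    using B(1) unfolding moebius_act_def[of "A ** B"] by simp
qed

lemma moebius_one [simp]: "moebius_act (mat 1) z = z"
  by (simp add: moebius_act_def)

lemma moebius_inv:
  assumes "A \<in> SL2Z" "z \<in> uhp"
  shows "moebius_act (minv A) (moebius_act A z) = z" "moebius_act A (moebius_act (minv A) z) = z"
  using moebius_mult[OF SL2Z_minv[OF assms(1)] assms] moebius_mult[OF assms(1) SL2Z_minv[OF assms(1)] assms(2)]
  by (simp_all add: minv_left[OF assms(1)] minv_right[OF assms(1)])

lemma moebius_inj: "A \<in> SL2Z \<Longrightarrow> inj_on (moebius_act A) uhp"
  by (rule inj_on_inverseI[of _ "moebius_act (minv A)"]) (rule moebius_inv)

lemma moebius_analytic: "A \<in> SL2Z \<Longrightarrow> moebius_act A analytic_on uhp"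
  unfolding moebius_act_def by (intro analytic_intros) (use moebius_facts(1) in auto)

lemma moebius_filterlim:
  assumes "A \<in> SL2Z" "z \<in> uhp"
  shows "filterlim (moebius_act A) (at (moebius_act A z)) (at z)"
proof -
  have "isCont (moebius_act A) z"
    using moebius_analytic[OF assms(1)] assms(2) by (meson analytic_at_imp_isCont analytic_on_analytic_at)
  moreover have "eventually (\<lambda>w. moebius_act A w \<noteq> moebius_act A z) (at z)"
    using eventually_at_in_open[OF open_uhp assms(2)]
    by eventually_elim (use moebius_inj[OF assms(1)] assms(2) in \<open>auto simp: inj_on_def\<close>)
  ultimately show ?thesis by (simp add: filterlim_at isCont_def)
qed

section \<open>The action on normalised meromorphic functions\<close>

lemma mero_eqI: "(\<And>z. z \<in> uhp \<Longrightarrow> eval_mero f z = eval_mero g z) \<Longrightarrow> f = g"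
  by (metis eval_mero_inject eval_mero_outside ext)

lemma eval_mero_eqI:
  assumes "w \<in> uhp" "eventually (\<lambda>z. eval_mero f z = h z) (at w)" "h analytic_on {w}"
  shows "eval_mero f w = h w"
proof -
  have "remove_sings (eval_mero f) w = remove_sings h w"
    by (intro remove_sings_cong assms(2) refl)
  thus ?thesis using assms by (simp add: remove_sings_eval_mero)
qed

lemma eval_mero_of_holomorphic:
  assumes "h holomorphic_on uhp" "z \<in> uhp"
  shows "eval_mero (mero_of h) z = h z"
proof (rule eval_mero_eqI[OF assms(2)])
  show "h analytic_on {z}" using assms open_uhp analytic_at by blast
  show "\<forall>\<^sub>F w in at z. eval_mero (mero_of h) w = h w"
    using assms open_uhp by (intro eventually_eval_mero_of analytic_on_imp_meromorphic_on) (auto simp: analytic_on_open)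
qed

lemma eval_const: "z \<in> uhp \<Longrightarrow> eval_mero (mero_const c) z = c"
  unfolding mero_const_def by (rule eval_mero_of_holomorphic) auto

definition act :: "int ^ 2 ^ 2 \<Rightarrow> mero_uhp \<Rightarrow> mero_uhp" where
  "act A f = mero_of (\<lambda>z. eval_mero f (moebius_act A z))"

text \<open>A Moebius map is a local homeomorphism, so the composite has its poles at the preimages,
  with value 0 there, and is continuous elsewhere. It is already normalised, and the equation holds
  at every point, poles included.\<close>

lemma eval_act:
  assumes "A \<in> SL2Z" "z \<in> uhp"
  shows "eval_mero (act A f) z = eval_mero f (moebius_act A z)"
proof -
  let ?g = "\<lambda>z. eval_mero f (moebius_act A z)"
  have mer: "?g meromorphic_on uhp"
    by (rule meromorphic_on_compose[OF meromorphic_eval_mero moebius_analytic[OF assms(1)]])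
       (use moebius_facts[OF assms(1)] in auto)
  have "(is_pole (eval_mero f) (moebius_act A z) \<and> eval_mero f (moebius_act A z) = 0) \<or>
      eval_mero f \<midarrow>moebius_act A z\<rightarrow> eval_mero f (moebius_act A z)"
    using nicely_meromorphic_eval_mero[of f] moebius_facts(2)[OF assms] unfolding nicely_meromorphic_on_def by blast
  hence "remove_sings ?g z = ?g z"
  proof
    assume p: "is_pole (eval_mero f) (moebius_act A z) \<and> eval_mero f (moebius_act A z) = 0"
    hence "is_pole ?g z"
      unfolding is_pole_def using filterlim_compose[OF _ moebius_filterlim[OF assms]] by blast
    thus ?thesis using p by simp
  next
    assume "eval_mero f \<midarrow>moebius_act A z\<rightarrow> eval_mero f (moebius_act A z)"
    hence "?g \<midarrow>z\<rightarrow> ?g z" using filterlim_compose[OF _ moebius_filterlim[OF assms]] by blast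
    thus ?thesis by (rule remove_sings_eqI)
  qed
  thus ?thesis by (simp add: act_def mero_of.rep_eq mer assms(2))
qed

lemma act_op:
  assumes A: "A \<in> SL2Z"
    and ev: "\<And>f g z. z \<in> uhp \<Longrightarrow> eventually (\<lambda>w. eval_mero (op f g) w = op' (eval_mero f w) (eval_mero g w)) (at z)"
  shows "act A (op f g) = op (act A f) (act A g)"
proof (rule mero_uhp_eqI)
  fix z assume z: "z \<in> uhp"
  have "eventually (\<lambda>w. eval_mero (op f g) (moebius_act A w) =
      op' (eval_mero f (moebius_act A w)) (eval_mero g (moebius_act A w))) (at z)"
    using eventually_compose_filterlim[OF ev[OF moebius_facts(2)[OF A z]] moebius_filterlim[OF A z]] .
  with ev[OF z, of "act A f" "act A g"] eventually_at_in_open'[OF open_uhp z]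
  show "eventually (\<lambda>w. eval_mero (act A (op f g)) w = eval_mero (op (act A f) (act A g)) w) (at z)"
    by eventually_elim (simp add: eval_act[OF A])
qed

lemma act_add: "A \<in> SL2Z \<Longrightarrow> act A (f + g) = act A f + act A g"
  by (rule act_op[of _ "(+)" "(+)"]) (assumption, rule eventually_eval_mero_ops)

lemma act_mult: "A \<in> SL2Z \<Longrightarrow> act A (f * g) = act A f * act A g"
  by (rule act_op[of _ times times]) (assumption, rule eventually_eval_mero_ops)

lemma act_diff: "A \<in> SL2Z \<Longrightarrow> act A (f - g) = act A f - act A g"
  by (rule act_op[of _ "(-)" "(-)"]) (assumption, rule eventually_eval_mero_ops)

lemma act_divide: "A \<in> SL2Z \<Longrightarrow> act A (f / g) = act A f / act A g"
  by (rule act_op[of _ "(/)" "(/)"]) (assumption, rule eventually_eval_mero_ops)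

lemma act_const: "A \<in> SL2Z \<Longrightarrow> act A (mero_const c) = mero_const c"
  by (rule mero_eqI) (simp add: eval_act eval_const moebius_facts)

lemma mero_const_0: "mero_const 0 = 0" and mero_const_1: "mero_const 1 = 1"
  by (simp_all add: mero_const_def zero_mero_uhp_def one_mero_uhp_def)

lemma act_0 [simp]: "A \<in> SL2Z \<Longrightarrow> act A 0 = 0" and act_1 [simp]: "A \<in> SL2Z \<Longrightarrow> act A 1 = 1"
  using act_const[of A 0] act_const[of A 1] by (simp_all add: mero_const_0 mero_const_1)

lemma act_uminus: "A \<in> SL2Z \<Longrightarrow> act A (- f) = - act A f"
  using act_diff[of A 0 f] by simp

lemma act_power: "A \<in> SL2Z \<Longrightarrow> act A (f ^ n) = act A f ^ n"
  by (induction n) (simp_all add: act_mult)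

lemma act_sum: "A \<in> SL2Z \<Longrightarrow> act A (sum f I) = (\<Sum>i\<in>I. act A (f i))"
  by (induction I rule: infinite_finite_induct) (simp_all add: act_add)

lemma act_comp:
  assumes "A \<in> SL2Z" "B \<in> SL2Z"
  shows "act (A ** B) f = act B (act A f)"
  by (rule mero_eqI) (use assms in \<open>simp add: eval_act SL2Z_mult moebius_mult moebius_facts\<close>)

lemma act_mat1 [simp]: "act (mat 1) f = f"
  by (rule mero_eqI) (simp add: eval_act)

lemma act_inj: "A \<in> SL2Z \<Longrightarrow> act A f = act A g \<Longrightarrow> f = g"
  by (metis act_comp act_mat1 SL2Z_minv minv_right)

lemma act_eq_0_iff: "A \<in> SL2Z \<Longrightarrow> act A f = 0 \<longleftrightarrow> f = 0"
  using act_inj[of A f 0] by auto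

text \<open>Field operations are computed only away from isolated points. A function meromorphic at
  infinity is analytic far up, and there the normalised values agree at every point.\<close>

lemma mero_ioo_eval:
  assumes "mero_ioo h" "\<And>z. z \<in> uhp \<Longrightarrow> eventually (\<lambda>w. eval_mero f w = h w) (at z)"
  shows "mero_ioo (eval_mero f)"
proof (rule mero_ioo_cong[OF assms(1)])
  have "eventually (\<lambda>z. Im z > 0) ioo" unfolding eventually_ioo by (rule exI[of _ 1]) auto
  with mero_ioo_analytic[OF assms(1)] show "eventually (\<lambda>z. h z = eval_mero f z) ioo"
    by eventually_elim (intro eval_mero_eqI[symmetric] assms(2), auto simp: uhp_def)
qed

section \<open>Meromorphy at the cusps and fields of modular functions\<close>

definition cusps :: "mero_uhp \<Rightarrow> bool" where
  "cusps f \<longleftrightarrow> (\<forall>A\<in>SL2Z. mero_ioo (eval_mero (act A f)))"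

lemma meromorphic_at_cusps_iff: "meromorphic_at_cusps f \<longleftrightarrow> cusps f"
proof -
  have "(\<exists>N>0. \<exists>F b. F meromorphic_on {0} \<and> (\<forall>z\<in>uhp. Im z > b \<longrightarrow>
           eval_mero f (moebius_act A z) = F (exp (2 * of_real pi * \<i> * z / of_nat N)))) \<longleftrightarrow>
        mero_ioo (eval_mero (act A f))" (is "?L \<longleftrightarrow> ?R") if A: "A \<in> SL2Z" for A
  proof
    assume ?L
    then obtain N F b where *: "N > 0" "F meromorphic_on {0}"
      "\<And>z. z \<in> uhp \<Longrightarrow> Im z > b \<Longrightarrow> eval_mero f (moebius_act A z) = F (exp (2 * of_real pi * \<i> * z / of_nat N))" by blast
    have "eventually (\<lambda>z. eval_mero (act A f) z = F (qx N z)) ioo" unfolding eventually_ioo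
      by (rule exI[of _ "max b 1"]) (auto simp: eval_act[OF A] uhp_def *(3) qx_def)
    thus ?R using * unfolding mero_ioo_def by blast
  next
    assume ?R
    then obtain N F b where *: "N > 0" "F meromorphic_on {0}" "b > 0"
      "\<And>z. Im z > b \<Longrightarrow> eval_mero (act A f) z = F (qx N z)" unfolding mero_ioo_def eventually_ioo by blast
    thus ?L by (intro exI[of _ N] conjI exI[of _ F] exI[of _ b]) (auto simp: eval_act[OF A, symmetric] qx_def)
  qed
  thus ?thesis unfolding meromorphic_at_cusps_def cusps_def by simp
qed

lemma cusps_add: "cusps f \<Longrightarrow> cusps g \<Longrightarrow> cusps (f + g)"
  and cusps_mult: "cusps f \<Longrightarrow> cusps g \<Longrightarrow> cusps (f * g)"
  and cusps_divide: "cusps f \<Longrightarrow> cusps g \<Longrightarrow> cusps (f / g)"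
  unfolding cusps_def
  by (auto simp: act_add act_mult act_divide intro!: mero_ioo_eval[OF mero_ioo_add eventually_eval_mero_ops(3)]
      mero_ioo_eval[OF mero_ioo_mult eventually_eval_mero_ops(6)] mero_ioo_eval[OF mero_ioo_divide eventually_eval_mero_ops(8)])

lemma cusps_const: "cusps (mero_const c)"
proof -
  have "mero_ioo (eval_mero (mero_const c))"
    by (rule mero_ioo_cong[OF mero_ioo_const[of c]]) (unfold eventually_ioo, rule exI[of _ 1], auto simp: eval_const uhp_def)
  thus ?thesis by (simp add: cusps_def act_const)
qed

lemma cusps_act: "A \<in> SL2Z \<Longrightarrow> cusps f \<Longrightarrow> cusps (act A f)"
  unfolding cusps_def by (metis act_comp SL2Z_mult)

lemma modular_functions_iff:
  assumes "G \<subseteq> SL2Z"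
  shows "f \<in> \<A>\<^sub>0 G \<longleftrightarrow> (\<forall>A\<in>G. act A f = f) \<and> cusps f"
proof -
  have "(\<forall>z\<in>uhp. eval_mero f (moebius_act A z) = eval_mero f z) \<longleftrightarrow> act A f = f" if "A \<in> SL2Z" for A
    using that by (metis eval_act mero_eqI)
  thus ?thesis using assms unfolding modular_functions_def by (auto simp: meromorphic_at_cusps_iff)
qed

text \<open>Quotients are unrestricted since \<open>x / 0 = 0\<close>; negatives come from the
  constant -1.\<close>

definition C_subfield :: "mero_uhp set \<Rightarrow> bool" where
  "C_subfield K \<longleftrightarrow> range mero_const \<subseteq> K \<and> (\<forall>x\<in>K. \<forall>y\<in>K. x + y \<in> K \<and> x * y \<in> K \<and> x / y \<in> K)"

lemma C_subfieldD:
  assumes "C_subfield K"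
  shows "mero_const c \<in> K" "0 \<in> K" "1 \<in> K" "x \<in> K \<Longrightarrow> y \<in> K \<Longrightarrow> x + y \<in> K"
    "x \<in> K \<Longrightarrow> y \<in> K \<Longrightarrow> x * y \<in> K" "x \<in> K \<Longrightarrow> y \<in> K \<Longrightarrow> x / y \<in> K"
    "x \<in> K \<Longrightarrow> - x \<in> K" "x \<in> K \<Longrightarrow> y \<in> K \<Longrightarrow> x - y \<in> K" "x \<in> K \<Longrightarrow> inverse x \<in> K"
    "x \<in> K \<Longrightarrow> x ^ n \<in> K"
proof -
  show c: "mero_const c \<in> K" for c using assms by (auto simp: C_subfield_def)
  show 01: "0 \<in> K" "1 \<in> K" using c[of 0] c[of 1] by (simp_all add: mero_const_0 mero_const_1)
  show add: "x + y \<in> K" and mult: "x * y \<in> K" and div: "x / y \<in> K" if "x \<in> K" "y \<in> K" for x y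
    using assms that by (auto simp: C_subfield_def)
  have "mero_const (- 1) = - 1"
  proof -
    have "mero_const (- 1) + 1 = 0"
    proof (rule mero_eqI)
      fix z assume z: "z \<in> uhp"
      show "eval_mero (mero_const (- 1) + 1) z = eval_mero 0 z"
      proof (rule eval_mero_eqI[OF z])
        have "eventually (\<lambda>w. w \<in> uhp) (at z)" using eventually_at_in_open'[OF open_uhp z] .
        with eventually_eval_mero_ops(3)[OF z, of "mero_const (- 1)" 1]
        show "eventually (\<lambda>w. eval_mero (mero_const (- 1) + 1) w = eval_mero 0 w) (at z)"
          by eventually_elim (simp add: eval_const mero_const_0[symmetric] mero_const_1[symmetric])
        have "eventually (\<lambda>w. eval_mero 0 w = 0) (nhds z)"
          using eventually_nhds_in_open[OF open_uhp z] by eventually_elim (simp add: eval_const mero_const_0[symmetric])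
        thus "eval_mero 0 analytic_on {z}" using analytic_at_cong[of "eval_mero 0" "\<lambda>_. 0" z] by auto
      qed
    qed
    thus ?thesis by (simp add: eq_neg_iff_add_eq_0)
  qed
  thus um: "x \<in> K \<Longrightarrow> - x \<in> K" for x using mult[OF c[of "- 1"], of x] by simp
  show "x \<in> K \<Longrightarrow> y \<in> K \<Longrightarrow> x - y \<in> K" using add[OF _ um, of x y] by simp
  show "x \<in> K \<Longrightarrow> inverse x \<in> K" using div[OF 01(2), of x] by (simp add: inverse_eq_divide)
  show "x \<in> K \<Longrightarrow> x ^ n \<in> K" by (induction n) (auto intro: mult 01)
qed

lemma modular_functions_C_subfield:
  assumes "G \<subseteq> SL2Z"
  shows "C_subfield (\<A>\<^sub>0 G)"
  unfolding C_subfield_def using assms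
  by (auto simp: modular_functions_iff act_const cusps_const act_add act_mult act_divide cusps_add cusps_mult cusps_divide subset_iff)

lemma mero_field_simps:
  "carrier mero_field = UNIV" "mult mero_field = times" "one mero_field = 1" "zero mero_field = 0" "add mero_field = (+)"
  by (simp_all add: ring_of_type_algebra_def)

lemma mero_field_a_inv: "\<ominus>\<^bsub>mero_field\<^esub> x = - x"
proof -
  interpret field mero_field by (rule field_from_type_algebra)
  show ?thesis by (rule minus_equality) (simp_all add: mero_field_simps)
qed

lemma mero_field_m_inv: "x \<noteq> 0 \<Longrightarrow> inv\<^bsub>mero_field\<^esub> x = inverse x"
proof -
  interpret field mero_field by (rule field_from_type_algebra)
  assume "x \<noteq> 0"
  thus ?thesis by (intro comm_inv_char) (simp_all add: mero_field_simps)
qed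

lemma generate_field_least:
  assumes "C_subfield K" "H \<subseteq> K"
  shows "generate_field mero_field H \<subseteq> K"
proof
  fix x assume "x \<in> generate_field mero_field H"
  thus "x \<in> K"
    by induction (use assms C_subfieldD[OF assms(1)] in \<open>auto simp: mero_field_simps mero_field_a_inv mero_field_m_inv\<close>)
qed

lemma adjoin_C_least:
  assumes "C_subfield K" "S \<subseteq> K"
  shows "\<complex>(S) \<subseteq> K"
  unfolding adjoin_C_def by (rule generate_field_least) (use assms C_subfieldD(1) in auto)

lemma generate_field_C_subfield:
  assumes "range mero_const \<subseteq> H"
  shows "C_subfield (generate_field mero_field H)"
proof -
  have inv: "inverse x \<in> generate_field mero_field H" if "x \<in> generate_field mero_field H" for x
  proof (cases "x = 0")
    case False
    thus ?thesis using generate_field.m_inv[OF that] mero_field_m_inv by (simp add: mero_field_simps)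
  qed (use that in simp)
  show ?thesis unfolding C_subfield_def divide_inverse
    using subsetD[OF assms] inv generate_field.incl[of _ H mero_field] generate_field.eng_add[of _ mero_field H] generate_field.eng_mult[of _ mero_field H]
    by (auto simp: mero_field_simps image_subset_iff)
qed

lemma adjoin_C_C_subfield: "C_subfield \<complex>(S)"
  unfolding adjoin_C_def by (rule generate_field_C_subfield) auto

lemma adjoin_C_superset: "S \<subseteq> \<complex>(S)"
  unfolding adjoin_C_def by (auto intro: generate_field.incl)

definition mcong :: "nat \<Rightarrow> int ^ 2 ^ 2 \<Rightarrow> int ^ 2 ^ 2 \<Rightarrow> bool" where
  "mcong N A B \<longleftrightarrow> (\<forall>i j. [A $ i $ j = B $ i $ j] (mod int N))"

lemma mcong_mult: "mcong N A A' \<Longrightarrow> mcong N B B' \<Longrightarrow> mcong N (A ** B) (A' ** B')"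
  unfolding mcong_def matmul_entry by (auto intro!: cong_add cong_mult)

lemma mcong_refl [simp]: "mcong N A A" by (simp add: mcong_def)
lemma mcong_sym: "mcong N A B \<Longrightarrow> mcong N B A" by (simp add: mcong_def cong_sym)
lemma mcong_trans: "mcong N A B \<Longrightarrow> mcong N B C \<Longrightarrow> mcong N A C" unfolding mcong_def by (meson cong_trans)

lemma Gamma_iff: "A \<in> \<Gamma>(N) \<longleftrightarrow> A \<in> SL2Z \<and> mcong N A (mat 1)"
  by (simp add: principal_congruence_subgroup_def mcong_def)

lemma Gamma_subset: "\<Gamma>(N) \<subseteq> SL2Z" by (auto simp: Gamma_iff)

lemma mcong_imp_Gamma:
  assumes "A \<in> SL2Z" "B \<in> SL2Z" "mcong N A B"
  shows "A ** minv B \<in> \<Gamma>(N)"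
  using mcong_mult[OF assms(3) mcong_refl[of N "minv B"]] assms
  by (auto simp: Gamma_iff SL2Z_mult SL2Z_minv minv_right)

text \<open>\<open>A ** minv B\<close> lies in the principal congruence subgroup and acts first, so
  the action on functions of level \<open>N\<close> factors through reduction modulo
  \<open>N\<close>.\<close>

lemma act_Gamma_mcong:
  assumes f: "f \<in> \<A>\<^sub>0 \<Gamma>(N)" and "A \<in> SL2Z" "B \<in> SL2Z" "mcong N A B"
  shows "act A f = act B f"
proof -
  have G: "A ** minv B \<in> \<Gamma>(N)" by (rule mcong_imp_Gamma[OF assms(2-4)])
  have "act A f = act ((A ** minv B) ** B) f" using assms by (simp add: mult_minv_cancel)
  also have "\<dots> = act B (act (A ** minv B) f)" using assms G Gamma_subset by (intro act_comp) auto
  finally show ?thesis using f G by (simp add: modular_functions_iff[OF Gamma_subset])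
qed

text \<open>Normality of the principal congruence subgroup, in the form that \<open>A ** B\<close>
  and \<open>A\<close> agree modulo \<open>N\<close>.\<close>

lemma act_Gamma_closed:
  assumes f: "f \<in> \<A>\<^sub>0 \<Gamma>(N)" and A: "A \<in> SL2Z"
  shows "act A f \<in> \<A>\<^sub>0 \<Gamma>(N)"
proof -
  have "act B (act A f) = act A f" if B: "B \<in> \<Gamma>(N)" for B
  proof -
    have "mcong N (A ** B) (A ** mat 1)" using B by (intro mcong_mult) (auto simp: Gamma_iff)
    thus ?thesis using act_Gamma_mcong[OF f, of "A ** B" A] A B Gamma_subset
      by (simp add: SL2Z_mult act_comp subset_iff)
  qed
  thus ?thesis using f A by (auto simp: modular_functions_iff[OF Gamma_subset] cusps_act)
qed

lemma finite_mcong_reps: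
  assumes "N > 0"
  obtains R where "finite R" "R \<subseteq> G" "\<And>A. A \<in> G \<Longrightarrow> \<exists>!B. B \<in> R \<and> mcong N A B"
proof -
  \<comment> \<open>Reduced matrices only index the classes; their determinant may differ from 1, so
    for each class that meets \<open>G\<close> a representative in \<open>G\<close> is
    chosen.\<close>
  define red where "red A = mat2 (A $ 1 $ 1 mod int N) (A $ 1 $ 2 mod int N) (A $ 2 $ 1 mod int N) (A $ 2 $ 2 mod int N)" for A :: "int ^ 2 ^ 2"
  have red: "mcong N A B \<longleftrightarrow> red A = red B" for A B
    unfolding mcong_def forall_2 cong_def red_def
    by (metis (no_types) mat2_entries)
  have "finite ((\<lambda>(a, b, c, d). mat2 a b c d) ` ({0..<int N} \<times> {0..<int N} \<times> {0..<int N} \<times> {0..<int N}))"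
    by (intro finite_imageI finite_cartesian_product) auto
  moreover have "red ` G \<subseteq> (\<lambda>(a, b, c, d). mat2 a b c d) ` ({0..<int N} \<times> {0..<int N} \<times> {0..<int N} \<times> {0..<int N})"
    using assms by (auto simp: red_def image_iff intro!: bexI)
  ultimately have fin: "finite (red ` G)" by (rule rev_finite_subset)
  define s where "s r = (SOME A. A \<in> G \<and> red A = r)" for r
  have s: "s r \<in> G \<and> red (s r) = r" if "r \<in> red ` G" for r
    unfolding s_def by (rule someI_ex) (use that in auto)
  show ?thesis
  proof (rule that[of "s ` red ` G"])
    fix A assume "A \<in> G"
    thus "\<exists>!B. B \<in> s ` red ` G \<and> mcong N A B" unfolding red
      by (intro ex1I[of _ "s (red A)"]) (use s in auto)
  qed (use fin s in auto)
qed

section \<open>Liouville's theorem for modular functions\<close>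

text \<open>Larger than the standard fundamental domain, so every orbit meets it; the rectangular
  shape makes its bounded parts compact boxes.\<close>

definition fund_strip :: "complex set" where
  "fund_strip = {z. \<bar>Re z\<bar> \<le> 1/2 \<and> Im z \<ge> 1/2}"

lemma fund_strip_subset: "fund_strip \<subseteq> uhp"
  by (auto simp: fund_strip_def uhp_def)

lemma norm_lattice_ge:
  "norm (of_int c * z + of_int d) \<ge> \<bar>of_int c\<bar> * \<bar>Im z\<bar>"
  "norm (of_int c * z + of_int d) \<ge> \<bar>of_int d\<bar> - \<bar>of_int c\<bar> * norm z" for c d :: int
proof -
  have "\<bar>Im (of_int c * z + of_int d)\<bar> \<le> norm (of_int c * z + of_int d)" by (rule abs_Im_le_cmod)
  thus "norm (of_int c * z + of_int d) \<ge> \<bar>of_int c\<bar> * \<bar>Im z\<bar>" by (simp add: abs_mult)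
  have "norm (of_int d :: complex) \<le> norm (of_int c * z + of_int d) + norm (of_int c * z)"
    using norm_triangle_ineq4[of "of_int c * z + of_int d" "of_int c * z"] by simp
  thus "norm (of_int c * z + of_int d) \<ge> \<bar>of_int d\<bar> - \<bar>of_int c\<bar> * norm z" by (simp add: norm_mult)
qed

text \<open>Reduction theory: among the nonzero lattice vectors \<open>c * z + d\<close> a shortest
  one is chosen. Its coordinates are coprime, so they form the bottom row of a matrix in
  \<open>SL2Z\<close>, and by minimality every integral translate of the image has absolute value at
  least 1.\<close>

lemma exists_fund_strip_rep:
  assumes "z \<in> uhp"
  obtains A where "A \<in> SL2Z" "moebius_act A z \<in> fund_strip"
proof -
  define n where "n = (\<lambda>(c::int, d::int). norm (of_int c * z + of_int d))"
  define S where "S = {p. p \<noteq> (0, 0) \<and> n p \<le> 1}"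
  have imz: "Im z > 0" using assms by (simp add: uhp_def)
  have "finite S"
  proof (rule finite_subset)
    define cm where "cm = \<lceil>1 / Im z\<rceil>"
    define dm where "dm = \<lceil>1 + of_int cm * norm z\<rceil>"
    show "S \<subseteq> {-cm..cm} \<times> {-dm..dm}"
    proof
      fix p assume pS: "p \<in> S"
      obtain c d where p: "p = (c, d)" by force
      have le: "norm (of_int c * z + of_int d) \<le> 1" using pS by (simp add: S_def n_def p)
      have "\<bar>of_int c\<bar> * Im z \<le> 1" using norm_lattice_ge(1)[of c z d] le imz by simp
      hence "\<bar>real_of_int c\<bar> \<le> 1 / Im z" using imz by (simp add: field_simps)
      hence c: "\<bar>c\<bar> \<le> cm" unfolding cm_def by linarith
      have "\<bar>of_int d\<bar> \<le> 1 + \<bar>of_int c\<bar> * norm z" using norm_lattice_ge(2)[of d c z] le by simp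
      also have "\<dots> \<le> 1 + of_int cm * norm z" using c by (intro add_left_mono mult_right_mono) auto
      finally have "\<bar>d\<bar> \<le> dm" unfolding dm_def by linarith
      thus "p \<in> {-cm..cm} \<times> {-dm..dm}" using c by (auto simp: p)
    qed
  qed auto
  moreover have "(0, 1) \<in> S" by (simp add: S_def n_def)
  ultimately obtain p where p: "p \<in> S" "\<And>r. r \<in> S \<Longrightarrow> n p \<le> n r"
    using arg_min_if_finite[of S n] by (metis empty_iff linorder_not_le)
  obtain c d where cd: "p = (c, d)" by force
  have min: "norm (of_int c * z + of_int d) \<le> norm (of_int m * z + of_int k)" if "(m, k) \<noteq> (0, 0)" for m k
    using p(2)[of "(m, k)"] p(1) that by (cases "n (m, k) \<le> 1") (auto simp: S_def cd n_def)
  have nz: "of_int m * z + of_int k \<noteq> 0" if "(m, k) \<noteq> (0, 0)" for m k :: int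
  proof
    assume *: "of_int m * z + of_int k = 0"
    hence "Im (of_int m * z + of_int k) = 0" by simp
    hence "m = 0" using imz by simp
    thus False using * that by simp
  qed
  define g where "g = gcd c d"
  have g0: "g > 0" using p(1) by (auto simp: g_def S_def cd)
  obtain c' d' where c': "c = g * c'" "d = g * d'" by (metis g_def gcd_dvd1 gcd_dvd2 dvdE)
  have "g = 1"
  proof -
    have c'0: "(c', d') \<noteq> (0, 0)" using p(1) c' by (auto simp: S_def cd)
    have "norm (of_int c * z + of_int d) = of_int g * norm (of_int c' * z + of_int d')"
    proof -
      have "of_int c * z + of_int d = of_int g * (of_int c' * z + of_int d')" by (simp add: c' algebra_simps)
      thus ?thesis using g0 by (simp add: norm_mult)
    qed
    hence "of_int g * norm (of_int c' * z + of_int d') \<le> 1 * norm (of_int c' * z + of_int d')" using min[OF c'0] by simp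
    hence "of_int g \<le> (1::real)" using nz[OF c'0] by (subst (asm) mult_le_cancel_right) auto
    thus ?thesis using g0 by simp
  qed
  then obtain u v where uv: "u * c + v * d = 1" using bezout_int[of c d] unfolding g_def by metis
  define A0 where "A0 = mat2 v (- u) c d"
  have A0: "A0 \<in> SL2Z" using uv by (simp add: A0_def SL2Z_iff algebra_simps)
  define w where "w = moebius_act A0 z"
  have wuhp: "w \<in> uhp" using moebius_facts(2)[OF A0 assms] by (simp add: w_def)
  have ge1: "norm (w + of_int k) \<ge> 1" for k
  proof -
    have den: "of_int c * z + of_int d \<noteq> 0" using p(1) nz[of c d] by (auto simp: S_def cd)
    have "(v + k * c, - u + k * d) \<noteq> (0, 0)"
    proof
      assume "(v + k * c, - u + k * d) = (0, 0)"
      hence "v = - k * c" "u = k * d" by auto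
      thus False using uv by simp
    qed
    from min[OF this] have "norm (of_int c * z + of_int d) \<le> norm (of_int (v + k * c) * z + of_int (- u + k * d))" .
    moreover have "w + of_int k = (of_int (v + k * c) * z + of_int (- u + k * d)) / (of_int c * z + of_int d)"
      using den by (simp add: w_def moebius_act_def A0_def field_simps)
    ultimately show ?thesis using den by (simp add: norm_divide)
  qed
  define k where "k = - round (Re w)"
  define A where "A = mat2 1 k 0 1 ** A0"
  have T: "mat2 1 k 0 1 \<in> SL2Z" by (simp add: SL2Z_iff)
  have A: "A \<in> SL2Z" using T A0 by (simp add: A_def SL2Z_mult)
  have act: "moebius_act A z = w + of_int k"
    unfolding A_def moebius_mult[OF T A0 assms] w_def[symmetric] by (simp add: moebius_act_def)
  have re: "\<bar>Re (w + of_int k)\<bar> \<le> 1/2"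
    using of_int_round_abs_le[of "Re w"] by (simp add: k_def abs_minus_commute)
  \<comment> \<open>Absolute value at least 1 and real part at most 1/2 force an imaginary part of
    at least \<open>sqrt 3 / 2\<close>, more than the 1/2 that the strip asks for.\<close>
  have "1 \<le> (norm (w + of_int k))\<^sup>2" using ge1[of k] by (simp add: one_le_power)
  also have "\<dots> = (Re (w + of_int k))\<^sup>2 + (Im (w + of_int k))\<^sup>2" by (rule cmod_power2)
  also have "(Re (w + of_int k))\<^sup>2 \<le> (1/2)\<^sup>2" using re abs_le_square_iff[of "Re (w + of_int k)" "1/2"] by simp
  finally have "(1/2)\<^sup>2 \<le> (Im (w + of_int k))\<^sup>2" by (simp add: power2_eq_square)
  moreover have "Im (w + of_int k) > 0" using wuhp by (simp add: uhp_def)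
  ultimately have "1/2 \<le> Im (w + of_int k)" using abs_le_square_iff[of "1/2" "Im (w + of_int k)"] by simp
  with re have "moebius_act A z \<in> fund_strip" by (simp add: fund_strip_def act)
  thus ?thesis using that A by blast
qed

lemma Gamma_rep_fund_strip:
  assumes R: "\<And>A. A \<in> SL2Z \<Longrightarrow> \<exists>!B. B \<in> R \<and> mcong N A B" "R \<subseteq> SL2Z" and "z \<in> uhp"
  obtains A A' w where "A \<in> R" "A' \<in> SL2Z" "mcong N A' A" "w \<in> fund_strip" "z = moebius_act A' w"
proof -
  obtain B where B: "B \<in> SL2Z" "moebius_act B z \<in> fund_strip" using exists_fund_strip_rep[OF assms(3)] .
  obtain A where "A \<in> R" "mcong N (minv B) A" using R(1)[OF SL2Z_minv[OF B(1)]] by blast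
  thus ?thesis using that[of A "minv B" "moebius_act B z"] B SL2Z_minv moebius_inv(1)[OF B(1) assms(3)] by simp
qed

lemma compact_strip_part: "compact {z. \<bar>Re z\<bar> \<le> 1/2 \<and> 1/2 \<le> Im z \<and> Im z \<le> b}"
proof -
  have "{z. \<bar>Re z\<bar> \<le> 1/2 \<and> 1/2 \<le> Im z \<and> Im z \<le> b} = cbox (Complex (- 1/2) (1/2)) (Complex (1/2) b)"
    by (auto simp: in_cbox_complex_iff)
  thus ?thesis by simp
qed

lemma qx_surj:
  assumes "N > 0" "w \<noteq> 0"
  obtains \<tau> where "qx N \<tau> = w"
proof (rule that[of "of_nat N * Ln w / (2 * of_real pi * \<i>)"])
  have "2 * of_real pi * \<i> * (of_nat N * Ln w / (2 * of_real pi * \<i>)) / of_nat N = Ln w"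
    using assms(1) by simp
  thus "qx N (of_nat N * Ln w / (2 * of_real pi * \<i>)) = w"
    unfolding qx_def using assms(2) by (simp only: exp_Ln not_False_eq_True)
qed

lemma meromorphic_limit_of_qx:
  assumes "F meromorphic_on {0}" "N > 0"
    and bd: "eventually (\<lambda>\<tau>. norm (F (qx N \<tau>)) \<le> B) ioo"
  obtains l where "F \<midarrow>0\<rightarrow> l"
proof -
  have "\<not> is_pole F 0"
  proof
    assume "is_pole F 0"
    hence "filterlim (\<lambda>\<tau>. F (qx N \<tau>)) at_infinity ioo"
      unfolding is_pole_def by (rule filterlim_compose[OF _ qx_tendsto_0[OF assms(2)]])
    hence "eventually (\<lambda>\<tau>. norm (F (qx N \<tau>)) \<ge> B + 1) ioo"
      unfolding filterlim_at_infinity_conv_norm_at_top filterlim_at_top by auto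
    with bd have "eventually (\<lambda>\<tau>. False) ioo" by eventually_elim auto
    thus False by simp
  qed
  moreover have "not_essential F 0" using assms(1) by (meson insertI1 meromorphic_onE)
  ultimately show ?thesis using that unfolding not_essential_def by blast
qed

lemma bounded_mero_ioo_analytic:
  assumes "mero_ioo h" and bd: "eventually (\<lambda>\<tau>. norm (h \<tau>) \<le> B) ioo"
  obtains N F where "N > 0" "F analytic_on {0}" "eventually (\<lambda>\<tau>. h \<tau> = F (qx N \<tau>)) ioo" "(h \<longlongrightarrow> F 0) ioo"
proof -
  obtain N F where F: "N > 0" "F meromorphic_on {0}" "eventually (\<lambda>\<tau>. h \<tau> = F (qx N \<tau>)) ioo"
    using assms(1) unfolding mero_ioo_def by blast
  have "eventually (\<lambda>\<tau>. norm (F (qx N \<tau>)) \<le> B) ioo" using bd F(3) by eventually_elim simp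
  then obtain l where l: "F \<midarrow>0\<rightarrow> l" using meromorphic_limit_of_qx[OF F(2,1)] by blast
  have iso: "isolated_singularity_at F 0" using F(2) by (meson insertI1 meromorphic_onE)
  define F' where "F' = remove_sings F"
  have an: "F' analytic_on {0}" unfolding F'_def using iso l by (rule remove_sings_analytic_at)
  have "eventually (\<lambda>\<tau>. F' (qx N \<tau>) = F (qx N \<tau>)) ioo"
    using eventually_compose_filterlim[OF eventually_remove_sings_eq_at[OF iso] qx_tendsto_0[OF F(1)]] by (simp add: F'_def)
  with F(3) have ev: "eventually (\<lambda>\<tau>. h \<tau> = F' (qx N \<tau>)) ioo" by eventually_elim simp
  have "F' \<midarrow>0\<rightarrow> F' 0" using an analytic_at_imp_isCont isCont_def by blast
  hence "((\<lambda>\<tau>. F' (qx N \<tau>)) \<longlongrightarrow> F' 0) ioo" by (rule filterlim_compose[OF _ qx_tendsto_0[OF F(1)]])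
  hence "(h \<longlongrightarrow> F' 0) ioo" by (rule Lim_transform_eventually) (use ev in eventually_elim, simp)
  thus ?thesis using that[OF F(1) an ev] by blast
qed

lemma eval_act_holomorphic:
  assumes "A \<in> SL2Z" "eval_mero f holomorphic_on uhp"
  shows "eval_mero (act A f) holomorphic_on uhp"
proof -
  have "eval_mero f \<circ> moebius_act A holomorphic_on uhp"
    by (rule holomorphic_on_compose_gen[OF analytic_imp_holomorphic[OF moebius_analytic[OF assms(1)]] assms(2)])
       (use moebius_facts[OF assms(1)] in auto)
  thus ?thesis by (rule holomorphic_transform) (simp add: eval_act[OF assms(1)])
qed

text \<open>The supremum of \<open>\<bar>f\<bar>\<close> is approached inside the strip by one of finitely many conjugates,
  either at an interior point or at the cusp; both contradict the maximum modulus principle.\<close>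

theorem modular_Liouville:
  assumes f: "f \<in> \<A>\<^sub>0 \<Gamma>(N)" and "N > 0" and hol: "eval_mero f holomorphic_on uhp"
    and bd: "\<And>A. A \<in> SL2Z \<Longrightarrow> \<exists>B. eventually (\<lambda>\<tau>. norm (eval_mero (act A f) \<tau>) \<le> B) ioo"
  shows "\<exists>c. f = mero_const c"
proof -
  obtain R where R: "finite R" "R \<subseteq> SL2Z" "\<And>A. A \<in> SL2Z \<Longrightarrow> \<exists>!B. B \<in> R \<and> mcong N A B"
    using finite_mcong_reps[OF assms(2), of SL2Z] by blast
  define g where "g A = eval_mero (act A f)" for A
  have hol_g: "g A holomorphic_on uhp" if "A \<in> SL2Z" for A
    unfolding g_def by (rule eval_act_holomorphic[OF that hol])
  have mero_g: "mero_ioo (g A)" if "A \<in> SL2Z" for A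
    using f that by (simp add: g_def modular_functions_iff[OF Gamma_subset] cusps_def)
  \<comment> \<open>Every value of a conjugate is taken inside the strip by one of the finitely many
    conjugates indexed by \<open>R\<close>.\<close>
  have rep: "\<exists>B\<in>R. \<exists>w\<in>fund_strip. g A z = g B w" if A: "A \<in> SL2Z" and z: "z \<in> uhp" for A z
  proof -
    obtain B A' w where *: "B \<in> R" "A' \<in> SL2Z" "mcong N A' B" "w \<in> fund_strip" "moebius_act A z = moebius_act A' w"
      using Gamma_rep_fund_strip[OF R(3,2) moebius_facts(2)[OF A z]] by metis
    have "g A z = eval_mero f (moebius_act A' w)" using * by (simp add: g_def eval_act[OF A z])
    also have "\<dots> = g A' w" using * fund_strip_subset by (auto simp: g_def eval_act)
    also have "\<dots> = g B w" unfolding g_def using act_Gamma_mcong[OF f *(2) _ *(3)] R(2) *(1) by auto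
    finally show ?thesis using * by blast
  qed
  have bound: "\<exists>M. \<forall>w\<in>fund_strip. norm (g A w) \<le> M" if A: "A \<in> SL2Z" for A
  proof -
    obtain B b where B: "\<And>\<tau>. Im \<tau> > b \<Longrightarrow> norm (g A \<tau>) \<le> B"
      using bd[OF A] unfolding g_def eventually_ioo by blast
    let ?K = "{z. \<bar>Re z\<bar> \<le> 1/2 \<and> 1/2 \<le> Im z \<and> Im z \<le> b}"
    have "?K \<subseteq> uhp" by (auto simp: uhp_def)
    hence "continuous_on ?K (g A)" using hol_g[OF A] holomorphic_on_imp_continuous_on holomorphic_on_subset by blast
    hence "bounded (g A ` ?K)" using compact_continuous_image compact_strip_part compact_imp_bounded by blast
    then obtain B' where "\<And>w. w \<in> ?K \<Longrightarrow> norm (g A w) \<le> B'" unfolding bounded_iff by blast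
    hence "norm (g A w) \<le> max B B'" if "w \<in> fund_strip" for w
      using B[of w] that by (cases "Im w > b") (auto simp: fund_strip_def le_max_iff_disj)
    thus ?thesis by blast
  qed
  then obtain MA where MA: "\<And>A w. A \<in> SL2Z \<Longrightarrow> w \<in> fund_strip \<Longrightarrow> norm (g A w) \<le> MA A" by metis
  define V where "V = {norm (g A w) | A w. A \<in> R \<and> w \<in> fund_strip}"
  have "bdd_above V"
  proof (rule bdd_aboveI)
    fix x assume "x \<in> V"
    then obtain A w where "A \<in> R" "w \<in> fund_strip" "x = norm (g A w)" by (auto simp: V_def)
    thus "x \<le> Max (MA ` R)" using MA[of A w] R(1,2) by (intro order_trans[OF _ Max_ge[of "MA ` R" "MA A"]]) auto
  qed
  define M where "M = Sup V"
  have M_ub: "norm (g A w) \<le> M" if "A \<in> R" "w \<in> fund_strip" for A w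
    unfolding M_def by (rule cSup_upper[OF _ \<open>bdd_above V\<close>]) (use that in \<open>auto simp: V_def\<close>)
  have M_all: "norm (g A z) \<le> M" if "A \<in> SL2Z" "z \<in> uhp" for A z
    using rep[OF that] M_ub by metis
  have ii: "\<i> \<in> fund_strip" by (simp add: fund_strip_def)
  have V_ne: "V \<noteq> {}" using R(3)[of "mat 1"] ii by (force simp: V_def)
  \<comment> \<open>Otherwise each conjugate would stay below \<open>M\<close> by some margin, and
    the least of the finitely many margins would lower the supremum.\<close>
  have "\<exists>A\<in>R. \<forall>e>0. \<exists>w\<in>fund_strip. norm (g A w) > M - e"
  proof (rule ccontr)
    assume "\<not> ?thesis"
    then obtain e where e: "\<And>A. A \<in> R \<Longrightarrow> e A > 0" "\<And>A w. A \<in> R \<Longrightarrow> w \<in> fund_strip \<Longrightarrow> norm (g A w) \<le> M - e A"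
      by (metis linorder_not_le)
    have R_ne: "R \<noteq> {}" using R(3)[of "mat 1"] by auto
    define e0 where "e0 = Min (e ` R)"
    have "e0 > 0" using R(1) R_ne e(1) by (simp add: e0_def)
    have "e0 \<le> e A" if "A \<in> R" for A using that R(1) by (simp add: e0_def)
    hence "norm (g A w) \<le> M - e0" if "A \<in> R" "w \<in> fund_strip" for A w using e(2)[OF that] that by force
    hence "Sup V \<le> M - e0" by (intro cSup_least[OF V_ne]) (auto simp: V_def)
    thus False using \<open>e0 > 0\<close> by (simp add: M_def)
  qed
  then obtain A where A: "A \<in> R" and appr: "\<And>e. e > 0 \<Longrightarrow> \<exists>w\<in>fund_strip. norm (g A w) > M - e" by blast
  have AS: "A \<in> SL2Z" using A R(2) by blast
  have "g A constant_on uhp"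
  proof (cases "\<exists>z0\<in>uhp. norm (g A z0) = M")
    case True
    then obtain z0 where "z0 \<in> uhp" "norm (g A z0) = M" by blast
    thus ?thesis
      using maximum_modulus_principle[OF hol_g[OF AS] open_uhp connected_uhp open_uhp order_refl, of z0] M_all[OF AS] by auto
  next
    case False
    obtain B where "eventually (\<lambda>\<tau>. norm (g A \<tau>) \<le> B) ioo" using bd[OF AS] unfolding g_def by blast
    then obtain N' F where F: "N' > 0" "F analytic_on {0}" "eventually (\<lambda>\<tau>. g A \<tau> = F (qx N' \<tau>)) ioo" "(g A \<longlongrightarrow> F 0) ioo"
      using bounded_mero_ioo_analytic[OF mero_g[OF AS]] by metis
    \<comment> \<open>If the value at the cusp were smaller than \<open>M\<close>, the supremum
      would be approached on a compact part of the strip and hence attained.\<close>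
    have "norm (F 0) \<ge> M"
    proof (rule ccontr)
      assume "\<not> norm (F 0) \<ge> M"
      define m where "m = (norm (F 0) + M) / 2"
      have m: "norm (F 0) < m" "m < M" using \<open>\<not> norm (F 0) \<ge> M\<close> by (auto simp: m_def)
      have "eventually (\<lambda>\<tau>. norm (g A \<tau>) < m) ioo" using order_tendstoD(2)[OF tendsto_norm[OF F(4)] m(1)] .
      then obtain b where b: "b > 0" "\<And>\<tau>. Im \<tau> > b \<Longrightarrow> norm (g A \<tau>) < m" unfolding eventually_ioo by blast
      let ?K = "{z. \<bar>Re z\<bar> \<le> 1/2 \<and> 1/2 \<le> Im z \<and> Im z \<le> max b 1}"
      have Kuhp: "?K \<subseteq> uhp" by (auto simp: uhp_def)
      hence "continuous_on ?K (\<lambda>w. norm (g A w))"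
        using hol_g[OF AS] holomorphic_on_imp_continuous_on holomorphic_on_subset by (intro continuous_on_norm) blast
      moreover have "?K \<noteq> {}" by (rule ex_in_conv[THEN iffD1], rule exI[of _ \<i>]) auto
      ultimately obtain w0 where w0: "w0 \<in> ?K" "\<And>w. w \<in> ?K \<Longrightarrow> norm (g A w) \<le> norm (g A w0)"
        using continuous_attains_sup[OF compact_strip_part] by blast
      have "norm (g A w0) < M" using M_all[OF AS] w0(1) Kuhp False by (metis (no_types, lifting) in_mono less_eq_real_def)
      define e where "e = M - max m (norm (g A w0))"
      have "e > 0" using \<open>norm (g A w0) < M\<close> m(2) by (simp add: e_def)
      then obtain w where w: "w \<in> fund_strip" "norm (g A w) > M - e" using appr by blast
      show False
      proof (cases "Im w > b")
        case True
        thus False using b(2)[of w] w(2) by (simp add: e_def)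
      next
        case False
        hence "w \<in> ?K" using w(1) by (auto simp: fund_strip_def)
        thus False using w0(2)[of w] w(2) by (simp add: e_def)
      qed
    qed
    obtain r where r: "r > 0" "F holomorphic_on ball 0 r"
      using F(2) analytic_on_def by blast
    obtain b where b: "b > 0" "\<And>\<tau>. Im \<tau> > b \<Longrightarrow> g A \<tau> = F (qx N' \<tau>)" using F(3) unfolding eventually_ioo by blast
    \<comment> \<open>Small enough that a parameter of absolute value below \<open>r'\<close> places
      \<tau> above the height \<open>b\<close>, where \<open>g A\<close> is given by
      \<open>F\<close>.\<close>
    define r' where "r' = min r (exp (- (2 * pi * b / of_nat N')))"
    have "r' > 0" using r by (simp add: r'_def)
    have big: "Im \<tau> > b" if "norm (qx N' \<tau>) < r'" for \<tau>
    proof -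
      have "exp (- (2 * pi * Im \<tau> / of_nat N')) < exp (- (2 * pi * b / of_nat N'))" using that by (simp add: norm_qx r'_def)
      thus ?thesis using F(1) by (simp add: field_simps)
    qed
    have le: "norm (F w) \<le> norm (F 0)" if "w \<in> ball 0 r'" for w
    proof (cases "w = 0")
      case False
      then obtain \<tau> where \<tau>: "qx N' \<tau> = w" using qx_surj[OF F(1)] by blast
      have "Im \<tau> > b" using big[of \<tau>] that \<tau> by simp
      hence "norm (F w) = norm (g A \<tau>)" using b(2) \<tau> by simp
      also have "\<dots> \<le> M" using M_all[OF AS] \<open>Im \<tau> > b\<close> b(1) by (simp add: uhp_def)
      finally show ?thesis using \<open>norm (F 0) \<ge> M\<close> by simp
    qed simp
    have "F constant_on ball 0 r'"
      by (rule maximum_modulus_principle[of _ _ "ball 0 r'" 0])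
         (use r \<open>r' > 0\<close> le in \<open>auto simp: r'_def intro: holomorphic_on_subset\<close>)
    then obtain c where c: "\<And>w. w \<in> ball 0 r' \<Longrightarrow> F w = c" unfolding constant_on_def by blast
    have "eventually (\<lambda>\<tau>. norm (qx N' \<tau>) < r') ioo"
      using qx_tendsto_0[OF F(1)] \<open>r' > 0\<close> unfolding filterlim_at tendsto_iff by auto
    then obtain b' where b': "b' > 0" "\<And>\<tau>. Im \<tau> > b' \<Longrightarrow> norm (qx N' \<tau>) < r'" unfolding eventually_ioo by blast
    have eqc: "g A \<tau> = c" if "Im \<tau> > b'" for \<tau>
      using b(2)[OF big[OF b'(2)[OF that]]] c[of "qx N' \<tau>"] b'(2)[OF that] by simp
    define \<xi> where "\<xi> = Complex 0 (b' + 1)"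
    have "g A z = c" if "z \<in> uhp" for z
    proof (rule analytic_continuation[of "\<lambda>z. g A z - c" uhp "{\<tau>. Im \<tau> > b'}" \<xi> z, THEN eq_iff_diff_eq_0[THEN iffD2]])
      have "open {\<tau>. Im \<tau> > b'}" by (rule open_halfspace_Im_gt)
      thus "\<xi> islimpt {\<tau>. Im \<tau> > b'}" by (intro interior_limit_point) (simp add: interior_open \<xi>_def)
    qed (use hol_g[OF AS] open_uhp connected_uhp that b' eqc in \<open>auto intro!: holomorphic_intros simp: uhp_def \<xi>_def\<close>)
    thus ?thesis unfolding constant_on_def by blast
  qed
  then obtain c where c: "\<And>z. z \<in> uhp \<Longrightarrow> g A z = c" unfolding constant_on_def by blast
  have "act A f = mero_const c" by (rule mero_eqI) (simp add: eval_const c[unfolded g_def])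
  hence "act A f = act A (mero_const c)" by (simp add: act_const[OF AS])
  thus ?thesis using act_inj[OF AS] by blast
qed

section \<open>Polynomials in a function and removal of poles\<close>

definition peval :: "complex poly \<Rightarrow> mero_uhp \<Rightarrow> mero_uhp" where
  "peval p x = poly (map_poly mero_const p) x"

lemma mero_const_eq_iff: "mero_const a = mero_const b \<longleftrightarrow> a = b"
proof
  assume "mero_const a = mero_const b"
  hence "eval_mero (mero_const a) \<i> = eval_mero (mero_const b) \<i>" by simp
  thus "a = b" by (simp add: eval_const uhp_def)
qed simp

lemma eval_op_holomorphic:
  assumes "eval_mero f analytic_on {z}" "eval_mero g analytic_on {z}" "z \<in> uhp"
  shows "eval_mero (f + g) z = eval_mero f z + eval_mero g z"
    "eval_mero (f * g) z = eval_mero f z * eval_mero g z"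
    "eval_mero (f - g) z = eval_mero f z - eval_mero g z"
    "eval_mero g z \<noteq> 0 \<Longrightarrow> eval_mero (f / g) z = eval_mero f z / eval_mero g z"
  by (rule eval_mero_eqI[OF assms(3) eventually_eval_mero_ops(3)[OF assms(3)]]
           eval_mero_eqI[OF assms(3) eventually_eval_mero_ops(6)[OF assms(3)]]
           eval_mero_eqI[OF assms(3) eventually_eval_mero_ops(4)[OF assms(3)]]
           eval_mero_eqI[OF assms(3) eventually_eval_mero_ops(8)[OF assms(3)]];
      use assms in \<open>auto intro!: analytic_intros\<close>)+

lemma eval_const_analytic: "z \<in> uhp \<Longrightarrow> eval_mero (mero_const c) analytic_on {z}"
proof -
  assume z: "z \<in> uhp"
  have "eventually (\<lambda>w. eval_mero (mero_const c) w = c) (nhds z)"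
    using eventually_nhds_in_open[OF open_uhp z] by eventually_elim (simp add: eval_const)
  thus ?thesis using analytic_at_cong[of "eval_mero (mero_const c)" "\<lambda>_. c" z] by auto
qed

lemma mero_const_add: "mero_const (a + b) = mero_const a + mero_const b"
  and mero_const_mult: "mero_const (a * b) = mero_const a * mero_const b"
  by (rule mero_eqI; simp add: eval_op_holomorphic eval_const_analytic eval_const)+

lemma peval_simps [simp]:
  "peval 0 x = 0" "peval (pCons c p) x = mero_const c + x * peval p x" "peval 1 x = 1"
  by (simp_all add: peval_def map_poly_pCons mero_const_0 mero_const_1 one_pCons)

lemma map_poly_mero_const_add: "map_poly mero_const (p + q) = map_poly mero_const p + map_poly mero_const q"
  by (rule poly_eqI) (simp add: coeff_map_poly mero_const_0 mero_const_add)

lemma peval_add: "peval (p + q) x = peval p x + peval q x"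
  by (simp add: peval_def map_poly_mero_const_add)

lemma peval_smult: "peval (Polynomial.smult c p) x = mero_const c * peval p x"
  by (induction p) (simp_all add: mero_const_mult algebra_simps)

lemma peval_mult: "peval (p * q) x = peval p x * peval q x"
  by (induction p) (simp_all add: peval_add peval_smult mero_const_0 algebra_simps)

lemma peval_C_subfield: "C_subfield K \<Longrightarrow> x \<in> K \<Longrightarrow> peval p x \<in> K"
  by (induction p) (auto intro: C_subfieldD)

lemma meromorphic_order_bound:
  assumes "F meromorphic_on {w}"
  obtains k l where "(\<lambda>z. (z - w) ^ k * F z) \<midarrow>w\<rightarrow> l"
proof (cases "eventually (\<lambda>z. F z = 0) (at w)")
  case True
  hence "(\<lambda>z. (z - w) ^ 0 * F z) \<midarrow>w\<rightarrow> 0" by (intro tendsto_eventually) simp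
  thus ?thesis using that by blast
next
  case False
  hence fr: "frequently (\<lambda>z. F z \<noteq> 0) (at w)" by (simp add: frequently_def)
  have "isolated_singularity_at F w" "not_essential F w" using assms by (meson insertI1 meromorphic_onE)+
  from zorder_exist[OF this fr] obtain r where r: "r > 0" "zor_poly F w holomorphic_on cball w r"
    "\<And>z. z \<in> cball w r - {w} \<Longrightarrow> F z = zor_poly F w z * (z - w) powi zorder F w" by metis
  define n where "n = zorder F w"
  define k where "k = nat (- n)"
  have cont: "isCont (zor_poly F w) w"
    using r(1,2) by (meson ball_subset_cball centre_in_ball continuous_on_eq_continuous_at holomorphic_on_imp_continuous_on holomorphic_on_subset open_ball)
  have "(\<lambda>z. zor_poly F w z * (z - w) ^ nat (n + int k)) \<midarrow>w\<rightarrow> zor_poly F w w * (w - w) ^ nat (n + int k)"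
    using cont unfolding isCont_def by (intro tendsto_intros)
  moreover have "eventually (\<lambda>z. zor_poly F w z * (z - w) ^ nat (n + int k) = (z - w) ^ k * F z) (at w)"
  proof -
    have "eventually (\<lambda>z. z \<in> cball w r - {w}) (at w)"
      using eventually_at_in_open[OF open_ball, of w w r] r(1) by (auto elim!: eventually_mono)
    thus ?thesis
    proof eventually_elim
      case (elim z)
      have "(z - w) ^ nat (n + int k) = (z - w) powi (n + int k)" by (simp add: power_int_def k_def)
      also have "\<dots> = (z - w) powi n * (z - w) ^ k" using elim by (subst power_int_add) auto
      finally show ?case using r(3)[OF elim] by (simp add: n_def mult_ac)
    qed
  qed
  ultimately have "(\<lambda>z. (z - w) ^ k * F z) \<midarrow>w\<rightarrow> zor_poly F w w * (w - w) ^ nat (n + int k)"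
    by (rule Lim_transform_eventually)
  thus ?thesis by (rule that)
qed

text \<open>\<open>U z / (z - w)\<close> tends to the derivative of \<open>U\<close> at
  \<open>w\<close>, so \<open>U ^ m\<close> makes up for a pole of order at most \<open>m\<close>.
  The bound \<open>k\<close> covers all larger exponents, which permits one common exponent for
  several poles.\<close>

lemma meromorphic_zero_kills_pole:
  assumes "F meromorphic_on {w}" "U analytic_on {w}" "U w = 0"
  obtains k where "\<And>m. m \<ge> k \<Longrightarrow> \<exists>l. (\<lambda>z. U z ^ m * F z) \<midarrow>w\<rightarrow> l"
proof -
  obtain k l where kl: "(\<lambda>z. (z - w) ^ k * F z) \<midarrow>w\<rightarrow> l" using meromorphic_order_bound[OF assms(1)] .
  obtain d where d: "(U has_field_derivative d) (at w)"
    using analytic_on_imp_differentiable_at[OF assms(2)] unfolding field_differentiable_def by blast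
  have lim: "(\<lambda>z. U z / (z - w)) \<midarrow>w\<rightarrow> d"
    using d assms(3) unfolding has_field_derivative_iff by simp
  have U0: "U \<midarrow>w\<rightarrow> 0" using assms(2,3) analytic_at_imp_isCont isCont_def by metis
  show ?thesis
  proof (rule that[of k])
    fix m assume "m \<ge> k"
    have "(\<lambda>z. U z ^ (m - k) * ((U z / (z - w)) ^ k * ((z - w) ^ k * F z))) \<midarrow>w\<rightarrow> 0 ^ (m - k) * (d ^ k * l)"
      by (intro tendsto_intros U0 lim kl)
    moreover have "eventually (\<lambda>z. U z ^ (m - k) * ((U z / (z - w)) ^ k * ((z - w) ^ k * F z)) = U z ^ m * F z) (at w)"
      unfolding eventually_at_filter
    proof (rule always_eventually, intro allI impI)
      fix z assume "z \<noteq> w"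
      have "U z ^ (m - k) * ((U z / (z - w)) ^ k * ((z - w) ^ k * F z)) = U z ^ (m - k) * (U z ^ k) * F z"
        using \<open>z \<noteq> w\<close> by (simp add: power_divide)
      thus "U z ^ (m - k) * ((U z / (z - w)) ^ k * ((z - w) ^ k * F z)) = U z ^ m * F z"
        using \<open>m \<ge> k\<close> by (simp add: power_add[symmetric])
    qed
    ultimately have "(\<lambda>z. U z ^ m * F z) \<midarrow>w\<rightarrow> 0 ^ (m - k) * (d ^ k * l)" by (rule Lim_transform_eventually)
    thus "\<exists>l. (\<lambda>z. U z ^ m * F z) \<midarrow>w\<rightarrow> l" by blast
  qed
qed

text \<open>An accumulation point of poles would lie in \<open>K\<close> and be a singularity that
  is not isolated.\<close>

lemma finite_poles_on_compact:
  assumes "eval_mero f = h" "compact K" "K \<subseteq> uhp"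
  shows "finite {w \<in> K. is_pole h w}"
proof (rule ccontr)
  assume inf: "infinite {w \<in> K. is_pole h w}"
  then obtain p where p: "p \<in> K" "p islimpt {w \<in> K. is_pole h w}"
    using assms(2) unfolding compact_eq_Bolzano_Weierstrass by (metis (no_types, lifting) mem_Collect_eq subsetI)
  have "isolated_singularity_at h p"
    using meromorphic_eval_mero[of f] assms p(1) by (meson in_mono meromorphic_onE)
  then obtain r where r: "r > 0" "h analytic_on ball p r - {p}" unfolding isolated_singularity_at_def by blast
  then obtain w where w: "w \<in> {w \<in> K. is_pole h w}" "w \<in> ball p r" "w \<noteq> p"
    using p(2) unfolding islimpt_def by (meson centre_in_ball open_ball)
  hence "h analytic_on {w}" using r(2) analytic_on_subset by blast
  thus False using w(1) analytic_at_imp_no_pole by blast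
qed

section \<open>Hauptmoduln\<close>

lemma holomorphic_eval_iff: "eval_mero f holomorphic_on uhp \<longleftrightarrow> (\<forall>z\<in>uhp. eval_mero f analytic_on {z})"
  using open_uhp by (meson analytic_on_analytic_at analytic_on_open)

lemma eval_hol_ops:
  assumes f: "eval_mero f holomorphic_on uhp" and g: "eval_mero g holomorphic_on uhp"
  shows "eval_mero (f + g) holomorphic_on uhp" "eval_mero (f * g) holomorphic_on uhp"
    "eval_mero (f - g) holomorphic_on uhp"
    "(\<And>z. z \<in> uhp \<Longrightarrow> eval_mero g z \<noteq> 0) \<Longrightarrow> eval_mero (f / g) holomorphic_on uhp"
    "z \<in> uhp \<Longrightarrow> eval_mero (f + g) z = eval_mero f z + eval_mero g z"
    "z \<in> uhp \<Longrightarrow> eval_mero (f * g) z = eval_mero f z * eval_mero g z"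
    "z \<in> uhp \<Longrightarrow> eval_mero (f - g) z = eval_mero f z - eval_mero g z"
    "z \<in> uhp \<Longrightarrow> eval_mero g z \<noteq> 0 \<Longrightarrow> eval_mero (f / g) z = eval_mero f z / eval_mero g z"
proof -
  have an: "eval_mero f analytic_on {z}" "eval_mero g analytic_on {z}" if "z \<in> uhp" for z
    using f g that holomorphic_eval_iff by blast+
  show "z \<in> uhp \<Longrightarrow> eval_mero (f + g) z = eval_mero f z + eval_mero g z"
    "z \<in> uhp \<Longrightarrow> eval_mero (f * g) z = eval_mero f z * eval_mero g z"
    "z \<in> uhp \<Longrightarrow> eval_mero (f - g) z = eval_mero f z - eval_mero g z"
    "z \<in> uhp \<Longrightarrow> eval_mero g z \<noteq> 0 \<Longrightarrow> eval_mero (f / g) z = eval_mero f z / eval_mero g z"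
    using eval_op_holomorphic[OF an] by blast+
  have "(\<lambda>z. eval_mero f z + eval_mero g z) holomorphic_on uhp" using f g by (intro holomorphic_intros)
  thus "eval_mero (f + g) holomorphic_on uhp"
    by (rule holomorphic_transform) (use eval_op_holomorphic(1)[OF an] in simp)
  have "(\<lambda>z. eval_mero f z * eval_mero g z) holomorphic_on uhp" using f g by (intro holomorphic_intros)
  thus "eval_mero (f * g) holomorphic_on uhp"
    by (rule holomorphic_transform) (use eval_op_holomorphic(2)[OF an] in simp)
  have "(\<lambda>z. eval_mero f z - eval_mero g z) holomorphic_on uhp" using f g by (intro holomorphic_intros)
  thus "eval_mero (f - g) holomorphic_on uhp"
    by (rule holomorphic_transform) (use eval_op_holomorphic(3)[OF an] in simp)
  assume nz: "\<And>z. z \<in> uhp \<Longrightarrow> eval_mero g z \<noteq> 0"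
  have "(\<lambda>z. eval_mero f z / eval_mero g z) holomorphic_on uhp"
    using f g nz by (auto intro!: holomorphic_intros)
  thus "eval_mero (f / g) holomorphic_on uhp"
    by (rule holomorphic_transform) (use eval_op_holomorphic(4)[OF an] nz in auto)
qed

lemma eval_const_holomorphic: "eval_mero (mero_const c) holomorphic_on uhp"
  using eval_const_analytic holomorphic_eval_iff by blast

lemma eval_peval:
  assumes "eval_mero u holomorphic_on uhp"
  shows "eval_mero (peval q u) holomorphic_on uhp" "z \<in> uhp \<Longrightarrow> eval_mero (peval q u) z = poly q (eval_mero u z)"
proof -
  have "eval_mero (peval q u) holomorphic_on uhp \<and> (\<forall>z\<in>uhp. eval_mero (peval q u) z = poly q (eval_mero u z))"
  proof (induction q)
    case 0
    show ?case using eval_const_holomorphic[of 0] eval_const[of _ 0] by (simp add: mero_const_0)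
  next
    case (pCons c q)
    thus ?case using eval_const_holomorphic[of c] eval_const[of _ c] assms by (simp add: eval_hol_ops)
  qed
  thus "eval_mero (peval q u) holomorphic_on uhp" "z \<in> uhp \<Longrightarrow> eval_mero (peval q u) z = poly q (eval_mero u z)" by auto
qed

lemma act_peval: "A \<in> SL2Z \<Longrightarrow> act A (peval q u) = peval q (act A u)"
  by (induction q) (simp_all add: act_add act_mult act_const)

text \<open>If the coefficient of order \<open>Suc k\<close> vanishes, then
  \<open>w ^ Suc k * F w\<close> extends by 0 to the puncture, and its difference quotient is
  \<open>w ^ k * F w\<close>. This lowers the pole order in the induction for the
  Hauptmodul.\<close>

lemma ioo_pole_order_lower:
  assumes "N > 0" "F meromorphic_on {0}" and ev: "eventually (\<lambda>\<tau>. h \<tau> = F (qx N \<tau>)) ioo"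
    and lim: "((\<lambda>\<tau>. qx N \<tau> ^ Suc k * h \<tau>) \<longlongrightarrow> 0) ioo"
  shows "\<exists>L. ((\<lambda>\<tau>. qx N \<tau> ^ k * h \<tau>) \<longlongrightarrow> L) ioo"
proof -
  define G where "G = (\<lambda>w. w ^ Suc k * F w)"
  have mer: "G meromorphic_on {0}" unfolding G_def by (intro meromorphic_intros assms(2))
  have lim': "((\<lambda>\<tau>. G (qx N \<tau>)) \<longlongrightarrow> 0) ioo"
    by (rule Lim_transform_eventually[OF lim]) (use ev in eventually_elim, simp add: G_def)
  hence "eventually (\<lambda>\<tau>. norm (G (qx N \<tau>)) < 1) ioo" using order_tendstoD(2)[OF tendsto_norm] by fastforce
  hence "eventually (\<lambda>\<tau>. norm (G (qx N \<tau>)) \<le> 1) ioo" by (rule eventually_mono) simp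
  then obtain l where l: "G \<midarrow>0\<rightarrow> l" using meromorphic_limit_of_qx[OF mer assms(1)] by blast
  have "((\<lambda>\<tau>. G (qx N \<tau>)) \<longlongrightarrow> l) ioo" by (rule filterlim_compose[OF l qx_tendsto_0[OF assms(1)]])
  hence l0: "l = 0" using tendsto_unique[OF ioo_neq_bot _ lim'] by blast
  have iso: "isolated_singularity_at G 0" using mer by (meson insertI1 meromorphic_onE)
  define g where "g = remove_sings G"
  have an: "g analytic_on {0}" unfolding g_def using iso l by (rule remove_sings_analytic_at)
  have g0: "g 0 = 0" unfolding g_def using l l0 by (simp add: remove_sings_eqI)
  obtain d where "(g has_field_derivative d) (at 0)"
    using analytic_on_imp_differentiable_at[OF an] unfolding field_differentiable_def by blast
  hence "(\<lambda>w. g w / w) \<midarrow>0\<rightarrow> d" using g0 unfolding has_field_derivative_iff by simp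
  moreover have "eventually (\<lambda>w. g w / w = w ^ k * F w) (at 0)"
    using eventually_remove_sings_eq_at[OF iso] eventually_neq_at_within[of 0 0 UNIV]
    by eventually_elim (simp add: g_def G_def)
  ultimately have "(\<lambda>w. w ^ k * F w) \<midarrow>0\<rightarrow> d" by (rule Lim_transform_eventually)
  hence "((\<lambda>\<tau>. qx N \<tau> ^ k * F (qx N \<tau>)) \<longlongrightarrow> d) ioo" by (rule filterlim_compose[OF _ qx_tendsto_0[OF assms(1)]])
  hence "((\<lambda>\<tau>. qx N \<tau> ^ k * h \<tau>) \<longlongrightarrow> d) ioo"
    by (rule Lim_transform_eventually) (use ev in eventually_elim, simp)
  thus ?thesis by blast
qed

lemma tendsto_ioo_bounded:
  fixes h :: "complex \<Rightarrow> complex"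
  assumes "(h \<longlongrightarrow> L) ioo"
  shows "\<exists>B. eventually (\<lambda>\<tau>. norm (h \<tau>) \<le> B) ioo"
proof -
  have "eventually (\<lambda>\<tau>. norm (h \<tau>) < norm L + 1) ioo"
    using order_tendstoD(2)[OF tendsto_norm[OF assms], of "norm L + 1"] by simp
  hence "eventually (\<lambda>\<tau>. norm (h \<tau>) \<le> norm L + 1) ioo" by (rule eventually_mono) simp
  thus ?thesis by blast
qed

lemma qx_eq_1_imp_dvd:
  assumes "N > 0" "qx N 1 ^ k = 1"
  shows "N dvd k"
proof -
  have "exp (2 * of_real pi * \<i> * of_nat k / of_nat N) = 1"
    using assms(2) unfolding qx_def exp_of_nat_mult[symmetric] by (simp add: mult_ac)
  then obtain n :: int where "Im (2 * of_real pi * \<i> * of_nat k / of_nat N) = of_int (2 * n) * pi" unfolding exp_eq_1 by blast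
  hence "2 * pi * real k / real N = of_int (2 * n) * pi" by (simp add: Im_divide_of_nat)
  hence "real k = of_int n * real N" using assms(1) by (simp add: field_simps)
  hence "int k = n * int N" by (metis of_int_eq_iff of_int_mult of_int_of_nat_eq)
  thus ?thesis by (metis dvd_triv_right int_dvd_int_iff)
qed

lemma eval_translate:
  assumes "act (mat2 1 1 0 1) f = f" "z \<in> uhp"
  shows "eval_mero f (z + 1) = eval_mero f z"
  using eval_act[of "mat2 1 1 0 1" z f] assms by (simp add: SL2Z_iff moebius_act_def)

lemma modular_functions_antimono: "G \<subseteq> H \<Longrightarrow> \<A>\<^sub>0 H \<subseteq> \<A>\<^sub>0 G"
  by (auto simp: modular_functions_def)

text \<open>A modular function \<open>u\<close> whose only pole is a simple one at the cusp \<open>\<infinity>\<close>. The alternative in the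
  last assumption says that the cusp \<open>A \<infinity>\<close> is either equivalent to \<open>\<infinity>\<close> or not a pole of \<open>u\<close>.\<close>

locale hauptmodul =
  fixes G :: "(int ^ 2 ^ 2) set" and N :: nat and u :: mero_uhp
  assumes GS: "G \<subseteq> SL2Z" and Npos: "N > 0" and GN: "\<Gamma>(N) \<subseteq> G" and TG: "mat2 1 1 0 1 \<in> G"
    and uA: "u \<in> \<A>\<^sub>0 G" and uhol: "eval_mero u holomorphic_on uhp"
    and upole: "\<exists>l. l \<noteq> 0 \<and> ((\<lambda>\<tau>. eval_mero u \<tau> * qx 1 \<tau>) \<longlongrightarrow> l) ioo"
    and ucusp: "\<And>A. A \<in> SL2Z \<Longrightarrow> (\<forall>f\<in>\<A>\<^sub>0 G. act A f = f) \<or> (\<exists>L. (eval_mero (act A u) \<longlongrightarrow> L) ioo)"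
begin

lemma AG_AN: "\<A>\<^sub>0 G \<subseteq> \<A>\<^sub>0 \<Gamma>(N)" by (rule modular_functions_antimono[OF GN])

lemma AG_field: "C_subfield (\<A>\<^sub>0 G)" by (rule modular_functions_C_subfield[OF GS])

lemma AG_cusps: "f \<in> \<A>\<^sub>0 G \<Longrightarrow> cusps f" using modular_functions_iff[OF GS] by blast

text \<open>A relation would confine \<open>u\<close> to the finitely many roots of
  \<open>q\<close>, while \<open>u\<close> is unbounded at the cusp.\<close>

lemma peval_u_nonzero:
  assumes "q \<noteq> 0"
  shows "peval q u \<noteq> 0"
proof
  assume "peval q u = 0"
  hence root: "poly q (eval_mero u z) = 0" if "z \<in> uhp" for z
    using eval_peval(2)[OF uhol that, of q] eval_const[OF that, of 0] by (simp add: mero_const_0)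
  have "finite {x. poly q x = 0}" by (rule poly_roots_finite[OF assms])
  hence "bounded {x. poly q x = 0}" by (rule finite_imp_bounded)
  then obtain B where B: "\<And>x. poly q x = 0 \<Longrightarrow> norm x \<le> B" unfolding bounded_iff by blast
  obtain l where l: "l \<noteq> 0" "((\<lambda>\<tau>. eval_mero u \<tau> * qx 1 \<tau>) \<longlongrightarrow> l) ioo" using upole by blast
  have q0: "(qx 1 \<longlongrightarrow> 0) ioo" using qx_tendsto_0[of 1] by (simp add: filterlim_at)
  have "((\<lambda>\<tau>. B * norm (qx 1 \<tau>)) \<longlongrightarrow> B * norm (0::complex)) ioo" by (intro tendsto_intros q0)
  hence lim0: "((\<lambda>\<tau>. B * norm (qx 1 \<tau>)) \<longlongrightarrow> 0) ioo" by simp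
  have "((\<lambda>\<tau>. eval_mero u \<tau> * qx 1 \<tau>) \<longlongrightarrow> 0) ioo"
  proof (rule Lim_null_comparison[OF _ lim0])
    show "\<forall>\<^sub>F \<tau> in ioo. norm (eval_mero u \<tau> * qx 1 \<tau>) \<le> B * norm (qx 1 \<tau>)"
      unfolding eventually_ioo using B[OF root] by (intro exI[of _ 1]) (auto simp: norm_mult uhp_def intro!: mult_right_mono)
  qed
  thus False using l tendsto_unique[OF ioo_neq_bot] by blast
qed

definition only_pole_infinity :: "mero_uhp \<Rightarrow> bool" where
  "only_pole_infinity f \<longleftrightarrow> f \<in> \<A>\<^sub>0 G \<and> eval_mero f holomorphic_on uhp \<and>
     (\<forall>A\<in>SL2Z. (\<forall>h\<in>\<A>\<^sub>0 G. act A h = h) \<or> (\<exists>B. eventually (\<lambda>\<tau>. norm (eval_mero (act A f) \<tau>) \<le> B) ioo))"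

lemma only_pole_infinity_diff:
  assumes f: "only_pole_infinity f"
  shows "only_pole_infinity (f - mero_const c * u ^ m)"
proof -
  note fD = f[unfolded only_pole_infinity_def]
  define w where "w = mero_const c * u ^ m"
  have w: "w = peval (Polynomial.monom c m) u"
    by (simp add: w_def peval_def map_poly_monom mero_const_0 poly_monom)
  have wA: "w \<in> \<A>\<^sub>0 G" unfolding w by (rule peval_C_subfield[OF AG_field uA])
  have whol: "eval_mero w holomorphic_on uhp" unfolding w by (rule eval_peval(1)[OF uhol])
  have cusp: "(\<forall>h\<in>\<A>\<^sub>0 G. act A h = h) \<or> (\<exists>B. eventually (\<lambda>\<tau>. norm (eval_mero (act A (f - w)) \<tau>) \<le> B) ioo)" if A: "A \<in> SL2Z" for A
  proof (cases "\<forall>h\<in>\<A>\<^sub>0 G. act A h = h")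
    case False
    obtain B where B: "eventually (\<lambda>\<tau>. norm (eval_mero (act A f) \<tau>) \<le> B) ioo" using fD A False by blast
    obtain L where L: "(eval_mero (act A u) \<longlongrightarrow> L) ioo" using ucusp[OF A] False by blast
    have "((\<lambda>\<tau>. poly (Polynomial.monom c m) (eval_mero (act A u) \<tau>)) \<longlongrightarrow> poly (Polynomial.monom c m) L) ioo"
      by (intro tendsto_intros L)
    then obtain B' where B': "eventually (\<lambda>\<tau>. norm (poly (Polynomial.monom c m) (eval_mero (act A u) \<tau>)) \<le> B') ioo"
      using tendsto_ioo_bounded by blast
    have "eventually (\<lambda>\<tau>. \<tau> \<in> uhp) ioo" unfolding eventually_ioo uhp_def by (rule exI[of _ 1]) auto
    with B B' have "eventually (\<lambda>\<tau>. norm (eval_mero (act A (f - w)) \<tau>) \<le> B + B') ioo"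
    proof eventually_elim
      case (elim \<tau>)
      have "eval_mero (act A (f - w)) \<tau> = eval_mero (act A f) \<tau> - poly (Polynomial.monom c m) (eval_mero (act A u) \<tau>)"
        using elim(3) fD uhol A by (simp add: act_diff w act_peval eval_hol_ops eval_peval eval_act_holomorphic)
      thus ?case using elim(1,2) norm_triangle_ineq4[of "eval_mero (act A f) \<tau>" "poly (Polynomial.monom c m) (eval_mero (act A u) \<tau>)"]
        by simp
    qed
    thus ?thesis by blast
  qed simp
  show ?thesis unfolding w_def[symmetric] only_pole_infinity_def
    using cusp fD wA whol C_subfieldD(8)[OF AG_field] eval_hol_ops(3) by blast
qed

text \<open>Induction on a bound \<open>k\<close> for the pole order in a parameter of width
  \<open>N'\<close> common to \<open>f\<close> and \<open>u\<close>. Invariance under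
  \<open>\<tau> + 1\<close> makes an exact order a multiple of \<open>N'\<close>, so it can be
  lowered by subtracting a multiple of a power of \<open>u\<close>.\<close>

lemma only_pole_infinity_polynomial_aux:
  assumes "N' > 0" "U meromorphic_on {0}" "eventually (\<lambda>\<tau>. eval_mero u \<tau> = U (qx N' \<tau>)) ioo"
  shows "only_pole_infinity f \<Longrightarrow> F meromorphic_on {0} \<Longrightarrow> eventually (\<lambda>\<tau>. eval_mero f \<tau> = F (qx N' \<tau>)) ioo \<Longrightarrow>
    ((\<lambda>\<tau>. qx N' \<tau> ^ k * eval_mero f \<tau>) \<longlongrightarrow> L) ioo \<Longrightarrow> \<exists>p. f = peval p u"
proof (induction k arbitrary: f F L)
  case 0
  note fD = 0(1)[unfolded only_pole_infinity_def]
  obtain B where B: "eventually (\<lambda>\<tau>. norm (eval_mero f \<tau>) \<le> B) ioo"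
    using tendsto_ioo_bounded 0(4) by fastforce
  have "\<exists>c. f = mero_const c"
  proof (rule modular_Liouville[OF _ Npos])
    show "f \<in> \<A>\<^sub>0 \<Gamma>(N)" "eval_mero f holomorphic_on uhp" using fD AG_AN by blast+
    fix A assume A: "A \<in> SL2Z"
    show "\<exists>B. eventually (\<lambda>\<tau>. norm (eval_mero (act A f) \<tau>) \<le> B) ioo"
    proof (cases "\<forall>h\<in>\<A>\<^sub>0 G. act A h = h")
      case True
      hence "act A f = f" using fD by blast
      thus ?thesis using B by auto
    next
      case False
      thus ?thesis using fD A by blast
    qed
  qed
  then obtain c where "f = mero_const c" by blast
  hence "f = peval [:c:] u" by simp
  thus ?case by blast
next
  case (Suc k)
  note fD = Suc.prems(1)[unfolded only_pole_infinity_def]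
  show ?case
  proof (cases "L = 0")
    case True
    then obtain L' where "((\<lambda>\<tau>. qx N' \<tau> ^ k * eval_mero f \<tau>) \<longlongrightarrow> L') ioo"
      using ioo_pole_order_lower[OF assms(1) Suc.prems(2,3)] Suc.prems(4) by blast
    thus ?thesis using Suc.IH Suc.prems by blast
  next
    case False
    define h where "h = (\<lambda>\<tau>. qx N' \<tau> ^ Suc k * eval_mero f \<tau>)"
    have h: "(h \<longlongrightarrow> L) ioo" unfolding h_def by (rule Suc.prems(4))
    have "filterlim (\<lambda>\<tau>. \<tau> + 1) ioo ioo" using filterlim_ioo_linear[of 1 1 1] by simp
    hence "((\<lambda>\<tau>. h (\<tau> + 1)) \<longlongrightarrow> L) ioo" by (rule filterlim_compose[OF h])
    moreover have "eventually (\<lambda>\<tau>. h (\<tau> + 1) = qx N' 1 ^ Suc k * h \<tau>) ioo"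
      unfolding eventually_ioo
    proof (intro exI[of _ 1] conjI allI impI)
      fix \<tau> :: complex assume "Im \<tau> > 1"
      have "act (mat2 1 1 0 1) f = f" using fD TG modular_functions_iff[OF GS] by blast
      hence "eval_mero f (\<tau> + 1) = eval_mero f \<tau>" using eval_translate[of f \<tau>] \<open>Im \<tau> > 1\<close> by (simp add: uhp_def)
      moreover have "qx N' (\<tau> + 1) = qx N' 1 * qx N' \<tau>"
        unfolding qx_def exp_add[symmetric] by (rule arg_cong[where f = exp]) (simp add: add_divide_distrib distrib_left)
      ultimately show "h (\<tau> + 1) = qx N' 1 ^ Suc k * h \<tau>" unfolding h_def by (simp only: power_mult_distrib mult.assoc)
    qed simp
    ultimately have "((\<lambda>\<tau>. qx N' 1 ^ Suc k * h \<tau>) \<longlongrightarrow> L) ioo" by (rule Lim_transform_eventually)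
    moreover have "((\<lambda>\<tau>. qx N' 1 ^ Suc k * h \<tau>) \<longlongrightarrow> qx N' 1 ^ Suc k * L) ioo" by (intro tendsto_intros h)
    \<comment> \<open>The translation multiplies the leading coefficient by a root of unity; as
      \<open>L\<close> is nonzero, \<open>N'\<close> divides \<open>Suc k\<close>.\<close>
    ultimately have "L = qx N' 1 ^ Suc k * L" using tendsto_unique[OF ioo_neq_bot] by blast
    hence "qx N' 1 ^ Suc k = 1" using False by simp
    then obtain m where m: "Suc k = N' * m" using qx_eq_1_imp_dvd[OF assms(1)] by (metis dvdE)
    obtain l where l: "l \<noteq> 0" "((\<lambda>\<tau>. eval_mero u \<tau> * qx 1 \<tau>) \<longlongrightarrow> l) ioo" using upole by blast
    \<comment> \<open>\<open>l\<close> is the leading coefficient of \<open>u\<close>, so this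
      \<open>c\<close> cancels the term of order \<open>Suc k\<close>.\<close>
    define c where "c = L / l ^ m"
    define f' where "f' = f - mero_const c * u ^ m"
    have good': "only_pole_infinity f'" unfolding f'_def by (rule only_pole_infinity_diff[OF Suc.prems(1)])
    have ev_f': "eval_mero f' \<tau> = eval_mero f \<tau> - c * eval_mero u \<tau> ^ m" if "\<tau> \<in> uhp" for \<tau>
    proof -
      have "mero_const c * u ^ m = peval (Polynomial.monom c m) u"
        by (simp add: peval_def map_poly_monom mero_const_0 poly_monom)
      thus ?thesis using that fD uhol by (simp add: f'_def eval_hol_ops eval_peval poly_monom)
    qed
    have ev_uhp: "eventually (\<lambda>\<tau>. \<tau> \<in> uhp) ioo" unfolding eventually_ioo uhp_def by (rule exI[of _ 1]) auto
    have "((\<lambda>\<tau>. h \<tau> - c * (eval_mero u \<tau> * qx 1 \<tau>) ^ m) \<longlongrightarrow> L - c * l ^ m) ioo"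
      by (intro tendsto_intros h l(2))
    moreover have "L - c * l ^ m = 0" using l(1) by (simp add: c_def)
    moreover have "eventually (\<lambda>\<tau>. h \<tau> - c * (eval_mero u \<tau> * qx 1 \<tau>) ^ m = qx N' \<tau> ^ Suc k * eval_mero f' \<tau>) ioo"
      using ev_uhp
    proof eventually_elim
      case (elim \<tau>)
      have "qx 1 \<tau> ^ m = qx N' \<tau> ^ Suc k" using qx_power[of 1 N' \<tau>] assms(1) unfolding m by (simp add: power_mult)
      show ?case unfolding h_def ev_f'[OF elim] power_mult_distrib \<open>qx 1 \<tau> ^ m = qx N' \<tau> ^ Suc k\<close>
        by (simp add: algebra_simps del: power_Suc)
    qed
    ultimately have lim': "((\<lambda>\<tau>. qx N' \<tau> ^ Suc k * eval_mero f' \<tau>) \<longlongrightarrow> 0) ioo"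
      using Lim_transform_eventually by fastforce
    define F' where "F' = (\<lambda>w. F w - c * U w ^ m)"
    have F': "F' meromorphic_on {0}" unfolding F'_def using Suc.prems(2) assms(2) by (intro meromorphic_intros)
    have ev': "eventually (\<lambda>\<tau>. eval_mero f' \<tau> = F' (qx N' \<tau>)) ioo"
      using Suc.prems(3) assms(3) ev_uhp by eventually_elim (simp add: ev_f' F'_def)
    obtain L' where "((\<lambda>\<tau>. qx N' \<tau> ^ k * eval_mero f' \<tau>) \<longlongrightarrow> L') ioo"
      using ioo_pole_order_lower[OF assms(1) F' ev' lim'] by blast
    then obtain p where p: "f' = peval p u" using Suc.IH[OF good' F' ev'] by blast
    have "f = f' + mero_const c * u ^ m" by (simp add: f'_def)
    also have "\<dots> = peval (p + Polynomial.monom c m) u"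
      by (simp add: p peval_add) (simp add: peval_def map_poly_monom mero_const_0 poly_monom)
    finally show ?thesis by blast
  qed
qed

lemma only_pole_infinity_polynomial:
  assumes f: "only_pole_infinity f"
  obtains p where "f = peval p u"
proof -
  have "mero_ioo (eval_mero f)" "mero_ioo (eval_mero u)"
    using f uA AG_cusps unfolding only_pole_infinity_def cusps_def by (metis SL2Z_one act_mat1)+
  then obtain N' F U where *: "N' > 0" "F meromorphic_on {0}" "U meromorphic_on {0}"
    "eventually (\<lambda>\<tau>. eval_mero f \<tau> = F (qx N' \<tau>)) ioo" "eventually (\<lambda>\<tau>. eval_mero u \<tau> = U (qx N' \<tau>)) ioo"
    using mero_ioo_common by blast
  obtain k l where "(\<lambda>w. (w - 0) ^ k * F w) \<midarrow>0\<rightarrow> l" using meromorphic_order_bound[OF *(2)] .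
  hence "((\<lambda>\<tau>. (qx N' \<tau> - 0) ^ k * F (qx N' \<tau>)) \<longlongrightarrow> l) ioo"
    by (rule filterlim_compose[OF _ qx_tendsto_0[OF *(1)]])
  hence "((\<lambda>\<tau>. qx N' \<tau> ^ k * eval_mero f \<tau>) \<longlongrightarrow> l) ioo"
    by (rule Lim_transform_eventually) (use *(4) in eventually_elim, simp)
  thus ?thesis using only_pole_infinity_polynomial_aux[OF *(1,3,5) f *(2,4)] that by blast
qed

text \<open>Multiplying by a high power of \<open>\<Prod>(u - v)\<close>, with \<open>v\<close> running over the values of \<open>u\<close> at the
  finitely many poles and cusps, leaves a pole at the cusp \<open>\<infinity>\<close> only.\<close>

theorem hauptmodul_generates:
  assumes f: "f \<in> \<A>\<^sub>0 G"
  obtains p q where "peval q u \<noteq> 0" "f = peval p u / peval q u"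
proof -
  obtain R where R: "finite R" "R \<subseteq> SL2Z" "\<And>A. A \<in> SL2Z \<Longrightarrow> \<exists>!B. B \<in> R \<and> mcong N A B"
    using finite_mcong_reps[OF Npos, of SL2Z] by blast
  have fN: "f \<in> \<A>\<^sub>0 \<Gamma>(N)" and uN: "u \<in> \<A>\<^sub>0 \<Gamma>(N)" using f uA AG_AN by blast+
  define fA where "fA A = eval_mero (act A f)" for A
  define ua where "ua A = eval_mero (act A u)" for A
  have ua_hol: "ua A holomorphic_on uhp" if "A \<in> SL2Z" for A
    unfolding ua_def by (rule eval_act_holomorphic[OF that uhol])
  have ua_an: "ua A analytic_on {z}" if "A \<in> SL2Z" "z \<in> uhp" for A z
    using ua_hol[OF that(1)] that(2) unfolding ua_def holomorphic_eval_iff by blast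
  have fA_mero: "mero_ioo (fA A)" and ua_mero: "mero_ioo (ua A)" if "A \<in> SL2Z" for A
    using AG_cusps[OF f] AG_cusps[OF uA] that unfolding fA_def ua_def cusps_def by blast+
  have "\<exists>b. \<forall>\<tau>. Im \<tau> > b \<longrightarrow> fA A analytic_on {\<tau>}" if "A \<in> SL2Z" for A
    using mero_ioo_analytic[OF fA_mero[OF that]] unfolding eventually_ioo by blast
  then obtain b where b: "\<And>A \<tau>. A \<in> SL2Z \<Longrightarrow> Im \<tau> > b A \<Longrightarrow> fA A analytic_on {\<tau>}" by metis
  \<comment> \<open>Above the height \<open>b A\<close> there are no poles, so those in the strip
    lie in a compact box and are finite in number.\<close>
  define P where "P A = {w \<in> {z. \<bar>Re z\<bar> \<le> 1/2 \<and> 1/2 \<le> Im z \<and> Im z \<le> b A}. is_pole (fA A) w}" for A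
  have P_fin: "finite (P A)" for A
    unfolding P_def fA_def by (rule finite_poles_on_compact[OF refl compact_strip_part]) (auto simp: uhp_def)
  have P_uhp: "w \<in> uhp" if "w \<in> P A" for w A using that by (auto simp: P_def uhp_def)
  define fixed where "fixed A \<longleftrightarrow> (\<forall>h\<in>\<A>\<^sub>0 G. act A h = h)" for A
  have "\<exists>L. \<not> fixed A \<longrightarrow> (ua A \<longlongrightarrow> L) ioo" if "A \<in> SL2Z" for A
    using ucusp[OF that] unfolding fixed_def ua_def by blast
  then obtain Lf where Lf: "\<And>A. A \<in> SL2Z \<Longrightarrow> \<not> fixed A \<Longrightarrow> (ua A \<longlongrightarrow> Lf A) ioo" by metis
  \<comment> \<open>The values to be cancelled: those of the conjugates of \<open>u\<close> at the
    poles of \<open>f\<close>, and the limits of the conjugates at the cusps other than infinity.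
    For a fixed class \<open>Lf A\<close> is arbitrary and only adds a harmless factor.\<close>
  define V where "V = (\<Union>A\<in>R. ua A ` P A) \<union> Lf ` R"
  have V_fin: "finite V" unfolding V_def using R(1) P_fin by blast
  have "\<exists>k. \<forall>m\<ge>k. \<exists>l. (\<lambda>z. (ua A z - ua A w) ^ m * fA A z) \<midarrow>w\<rightarrow> l" if "A \<in> SL2Z" "w \<in> uhp" for A w
  proof -
    have "fA A meromorphic_on {w}" unfolding fA_def using meromorphic_eval_mero that(2) by (meson empty_subsetI insert_subset meromorphic_on_subset)
    moreover have "(\<lambda>z. ua A z - ua A w) analytic_on {w}" using ua_an[OF that] by (intro analytic_intros)
    ultimately obtain k where "\<And>m. m \<ge> k \<Longrightarrow> \<exists>l. (\<lambda>z. (ua A z - ua A w) ^ m * fA A z) \<midarrow>w\<rightarrow> l"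
      using meromorphic_zero_kills_pole[of "fA A" w "\<lambda>z. ua A z - ua A w"] by auto
    thus ?thesis by blast
  qed
  then obtain k1 where k1: "\<And>A w m. A \<in> SL2Z \<Longrightarrow> w \<in> uhp \<Longrightarrow> m \<ge> k1 A w \<Longrightarrow> \<exists>l. (\<lambda>z. (ua A z - ua A w) ^ m * fA A z) \<midarrow>w\<rightarrow> l"
    by metis
  have "\<exists>k. \<forall>m\<ge>k. \<not> fixed A \<longrightarrow> (\<exists>l. ((\<lambda>\<tau>. (ua A \<tau> - Lf A) ^ m * fA A \<tau>) \<longlongrightarrow> l) ioo)" if A: "A \<in> SL2Z" for A
  proof (cases "fixed A")
    case False
    obtain N1 F U where *: "N1 > 0" "F meromorphic_on {0}" "U meromorphic_on {0}"
      "eventually (\<lambda>\<tau>. fA A \<tau> = F (qx N1 \<tau>)) ioo" "eventually (\<lambda>\<tau>. ua A \<tau> = U (qx N1 \<tau>)) ioo"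
      using mero_ioo_common[OF fA_mero[OF A] ua_mero[OF A]] by blast
    have lim: "((\<lambda>\<tau>. U (qx N1 \<tau>)) \<longlongrightarrow> Lf A) ioo"
      by (rule Lim_transform_eventually[OF Lf[OF A False]]) (use *(5) in eventually_elim, simp)
    then obtain B where "eventually (\<lambda>\<tau>. norm (U (qx N1 \<tau>)) \<le> B) ioo" using tendsto_ioo_bounded by blast
    then obtain l where l: "U \<midarrow>0\<rightarrow> l" using meromorphic_limit_of_qx[OF *(3,1)] by blast
    have "((\<lambda>\<tau>. U (qx N1 \<tau>)) \<longlongrightarrow> l) ioo" by (rule filterlim_compose[OF l qx_tendsto_0[OF *(1)]])
    hence lL: "l = Lf A" using tendsto_unique[OF ioo_neq_bot _ lim] by blast
    have iso: "isolated_singularity_at U 0" using *(3) by (meson insertI1 meromorphic_onE)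
    define U' where "U' = (\<lambda>w. remove_sings U w - Lf A)"
    have "remove_sings U analytic_on {0}" using iso l by (rule remove_sings_analytic_at)
    hence "U' analytic_on {0}" unfolding U'_def by (intro analytic_intros)
    moreover have "U' 0 = 0" unfolding U'_def using l lL by (simp add: remove_sings_eqI)
    ultimately obtain k where k: "\<And>m. m \<ge> k \<Longrightarrow> \<exists>l. (\<lambda>z. U' z ^ m * F z) \<midarrow>0\<rightarrow> l"
      using meromorphic_zero_kills_pole[OF *(2)] by blast
    have evU: "eventually (\<lambda>\<tau>. U' (qx N1 \<tau>) = ua A \<tau> - Lf A) ioo"
      using eventually_compose_filterlim[OF eventually_remove_sings_eq_at[OF iso] qx_tendsto_0[OF *(1)]] *(5)
      by eventually_elim (simp add: U'_def)
    have "\<exists>l. ((\<lambda>\<tau>. (ua A \<tau> - Lf A) ^ m * fA A \<tau>) \<longlongrightarrow> l) ioo" if m: "m \<ge> k" for m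
    proof -
      obtain l' where "(\<lambda>z. U' z ^ m * F z) \<midarrow>0\<rightarrow> l'" using k[OF m] by blast
      hence "((\<lambda>\<tau>. U' (qx N1 \<tau>) ^ m * F (qx N1 \<tau>)) \<longlongrightarrow> l') ioo"
        by (rule filterlim_compose[OF _ qx_tendsto_0[OF *(1)]])
      hence "((\<lambda>\<tau>. (ua A \<tau> - Lf A) ^ m * fA A \<tau>) \<longlongrightarrow> l') ioo"
        by (rule Lim_transform_eventually) (use evU *(4) in eventually_elim, simp)
      thus ?thesis by blast
    qed
    thus ?thesis by blast
  qed simp
  then obtain k2 where k2: "\<And>A m. A \<in> SL2Z \<Longrightarrow> \<not> fixed A \<Longrightarrow> m \<ge> k2 A \<Longrightarrow>
      \<exists>l. ((\<lambda>\<tau>. (ua A \<tau> - Lf A) ^ m * fA A \<tau>) \<longlongrightarrow> l) ioo" by metis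
  \<comment> \<open>One exponent for every pole and every cusp, possible because the bounds
    \<open>k1\<close> and \<open>k2\<close> hold for all larger exponents.\<close>
  define m where "m = Max (insert 0 ((\<Union>A\<in>R. k1 A ` P A) \<union> k2 ` R))"
  have fin: "finite (insert 0 ((\<Union>A\<in>R. k1 A ` P A) \<union> k2 ` R))" using R(1) P_fin by blast
  have m1: "k1 A w \<le> m" if "A \<in> R" "w \<in> P A" for A w
    unfolding m_def by (rule Max_ge[OF fin]) (use that in blast)
  have m2: "k2 A \<le> m" if "A \<in> R" for A
    unfolding m_def by (rule Max_ge[OF fin]) (use that in blast)
  define q where "q = (\<Prod>v\<in>V. [:- v, 1:] ^ m)"
  have q0: "q \<noteq> 0" unfolding q_def using V_fin by simp
  have poly_q: "poly q x = (\<Prod>v\<in>V. (x - v) ^ m)" for x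
    by (simp add: q_def poly_prod poly_power algebra_simps)
  have poly_q': "poly q x = (x - v) ^ m * (\<Prod>v\<in>V - {v}. (x - v) ^ m)" if "v \<in> V" for x v
    unfolding poly_q using V_fin that by (simp add: prod.remove)
  define h where "h = f * peval q u"
  have hA: "h \<in> \<A>\<^sub>0 G" unfolding h_def using f uA by (intro C_subfieldD[OF AG_field] peval_C_subfield[OF AG_field])
  hence hN: "h \<in> \<A>\<^sub>0 \<Gamma>(N)" using AG_AN by blast
  have act_h: "act A h = act A f * peval q (act A u)" if "A \<in> SL2Z" for A
    unfolding h_def by (simp add: act_mult act_peval that)
  have ev_q: "eval_mero (peval q (act A u)) z = poly q (ua A z)" if "A \<in> SL2Z" "z \<in> uhp" for A z
    unfolding ua_def by (rule eval_peval(2)[OF eval_act_holomorphic[OF that(1) uhol] that(2)])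
  have ev_h: "eventually (\<lambda>z. eval_mero (act A h) z = fA A z * poly q (ua A z)) (at w)" if A: "A \<in> SL2Z" and w: "w \<in> uhp" for A w
    using eventually_eval_mero_ops(6)[OF w, of "act A f" "peval q (act A u)"] eventually_at_in_open'[OF open_uhp w]
    by eventually_elim (simp add: act_h[OF A] ev_q[OF A] fA_def)
  have not_pole: "\<not> is_pole (eval_mero (act A h)) w" if A: "A \<in> R" and w: "w \<in> fund_strip" for A w
  proof -
    have AS: "A \<in> SL2Z" using A R(2) by blast
    have wu: "w \<in> uhp" using w fund_strip_subset by blast
    have ua_lim: "ua A \<midarrow>w\<rightarrow> ua A w" using ua_an[OF AS wu] analytic_at_imp_isCont isCont_def by blast
    have "\<exists>l. (\<lambda>z. fA A z * poly q (ua A z)) \<midarrow>w\<rightarrow> l"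
    proof (cases "w \<in> P A")
      case True
      obtain l where l: "(\<lambda>z. (ua A z - ua A w) ^ m * fA A z) \<midarrow>w\<rightarrow> l" using k1[OF AS wu m1[OF A True]] by blast
      have "ua A w \<in> V" using A True by (auto simp: V_def)
      hence eq: "fA A z * poly q (ua A z) = ((ua A z - ua A w) ^ m * fA A z) * (\<Prod>v\<in>V - {ua A w}. (ua A z - v) ^ m)" for z
        using poly_q'[of "ua A w" "ua A z"] by (simp add: mult_ac)
      have "(\<lambda>z. \<Prod>v\<in>V - {ua A w}. (ua A z - v) ^ m) \<midarrow>w\<rightarrow> (\<Prod>v\<in>V - {ua A w}. (ua A w - v) ^ m)"
        by (intro tendsto_intros ua_lim)
      from tendsto_mult[OF l this] show ?thesis unfolding eq by blast
    next
      case False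
      have "fA A analytic_on {w}"
      proof (cases "Im w > b A")
        case True
        thus ?thesis using b[OF AS] by blast
      next
        case F: False
        hence "\<not> is_pole (fA A) w" using False w by (auto simp: P_def fund_strip_def)
        thus ?thesis unfolding fA_def using nicely_meromorphic_on_imp_analytic_at[OF nicely_meromorphic_eval_mero wu] by blast
      qed
      hence "fA A \<midarrow>w\<rightarrow> fA A w" using analytic_at_imp_isCont isCont_def by blast
      moreover have "(\<lambda>z. poly q (ua A z)) \<midarrow>w\<rightarrow> poly q (ua A w)" by (intro tendsto_intros ua_lim)
      ultimately show ?thesis using tendsto_mult by blast
    qed
    then obtain l where "(\<lambda>z. fA A z * poly q (ua A z)) \<midarrow>w\<rightarrow> l" by blast
    hence "eval_mero (act A h) \<midarrow>w\<rightarrow> l"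
      by (rule Lim_transform_eventually) (use ev_h[OF AS wu] in eventually_elim, simp)
    thus ?thesis using not_tendsto_and_filterlim_at_infinity[of "at w" "eval_mero (act A h)" l] unfolding is_pole_def by auto
  qed
  \<comment> \<open>A pole anywhere is carried into the strip by a matrix congruent to some
    \<open>A\<close> in \<open>R\<close>, where poles have been excluded.\<close>
  have "\<not> is_pole (eval_mero h) z" if z: "z \<in> uhp" for z
  proof
    assume pole: "is_pole (eval_mero h) z"
    obtain A A' w where *: "A \<in> R" "A' \<in> SL2Z" "mcong N A' A" "w \<in> fund_strip" "z = moebius_act A' w"
      using Gamma_rep_fund_strip[OF R(3,2) z] by metis
    have wu: "w \<in> uhp" using * fund_strip_subset by blast
    have fl: "filterlim (\<lambda>w. eval_mero h (moebius_act A' w)) at_infinity (at w)"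
      using pole unfolding is_pole_def *(5) by (rule filterlim_compose[OF _ moebius_filterlim[OF *(2) wu]])
    have ev: "eventually (\<lambda>w. eval_mero h (moebius_act A' w) = eval_mero (act A' h) w) (at w)"
      using eventually_at_in_open'[OF open_uhp wu] by eventually_elim (simp add: eval_act[OF *(2)])
    have "is_pole (eval_mero (act A' h)) w"
      unfolding is_pole_def using fl filterlim_cong[OF refl refl ev] by blast
    moreover have "act A' h = act A h" using act_Gamma_mcong[OF hN *(2) _ *(3)] *(1) R(2) by blast
    ultimately show False using not_pole[OF *(1,4)] by simp
  qed
  hence h_hol: "eval_mero h holomorphic_on uhp"
    using nicely_meromorphic_without_singularities[OF nicely_meromorphic_eval_mero] analytic_imp_holomorphic by blast
  have "only_pole_infinity h"
    unfolding only_pole_infinity_def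
  proof (intro conjI ballI hA h_hol)
    fix A assume A: "A \<in> SL2Z"
    show "(\<forall>h\<in>\<A>\<^sub>0 G. act A h = h) \<or> (\<exists>B. eventually (\<lambda>\<tau>. norm (eval_mero (act A h) \<tau>) \<le> B) ioo)"
    proof (cases "\<forall>h\<in>\<A>\<^sub>0 G. act A h = h")
      case False
      obtain B where B: "B \<in> R" "mcong N A B" using R(3)[OF A] by blast
      have BS: "B \<in> SL2Z" using B R(2) by blast
      have same: "act A h' = act B h'" if "h' \<in> \<A>\<^sub>0 G" for h'
        using act_Gamma_mcong[OF _ A BS B(2)] that AG_AN by blast
      hence nf: "\<not> fixed B" using False unfolding fixed_def by auto
      obtain l where l: "((\<lambda>\<tau>. (ua B \<tau> - Lf B) ^ m * fA B \<tau>) \<longlongrightarrow> l) ioo" using k2[OF BS nf m2[OF B(1)]] by blast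
      have "Lf B \<in> V" using B(1) by (auto simp: V_def)
      hence eq: "fA B z * poly q (ua B z) = ((ua B z - Lf B) ^ m * fA B z) * (\<Prod>v\<in>V - {Lf B}. (ua B z - v) ^ m)" for z
        using poly_q'[of "Lf B" "ua B z"] by (simp add: mult_ac)
      have lim: "((\<lambda>z. fA B z * poly q (ua B z)) \<longlongrightarrow> l * (\<Prod>v\<in>V - {Lf B}. (Lf B - v) ^ m)) ioo"
        unfolding eq by (intro tendsto_intros l Lf[OF BS nf])
      have "eventually (\<lambda>\<tau>. \<tau> \<in> uhp) ioo" unfolding eventually_ioo uhp_def by (rule exI[of _ 1]) auto
      with mero_ioo_analytic[OF fA_mero[OF BS]]
      have "eventually (\<lambda>\<tau>. fA B \<tau> * poly q (ua B \<tau>) = eval_mero (act A h) \<tau>) ioo"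
      proof eventually_elim
        case (elim \<tau>)
        have "eval_mero (act A h) \<tau> = eval_mero (act B f * peval q (act B u)) \<tau>" using same[OF hA] act_h[OF BS] by simp
        also have "\<dots> = fA B \<tau> * eval_mero (peval q (act B u)) \<tau>"
          unfolding fA_def
        proof (rule eval_op_holomorphic(2))
          show "eval_mero (act B f) analytic_on {\<tau>}" using elim by (simp add: fA_def)
          show "eval_mero (peval q (act B u)) analytic_on {\<tau>}"
            using eval_peval(1)[OF eval_act_holomorphic[OF BS uhol], of q] elim(2) unfolding holomorphic_eval_iff by blast
        qed (rule elim(2))
        finally show ?case using ev_q[OF BS elim(2)] by simp
      qed
      with lim have "(eval_mero (act A h) \<longlongrightarrow> l * (\<Prod>v\<in>V - {Lf B}. (Lf B - v) ^ m)) ioo" by (rule Lim_transform_eventually)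
      thus ?thesis using tendsto_ioo_bounded by blast
    qed simp
  qed
  then obtain p where p: "h = peval p u" using only_pole_infinity_polynomial by blast
  have "peval q u \<noteq> 0" by (rule peval_u_nonzero[OF q0])
  moreover from this have "f = peval p u / peval q u" using p by (simp add: h_def field_simps)
  ultimately show ?thesis using that by blast
qed

end

section \<open>Galois descent along congruence subgroups\<close>

lemma coeff_act_poly: "A \<in> SL2Z \<Longrightarrow> poly.coeff (map_poly (act A) p) i = act A (poly.coeff p i)"
  by (simp add: coeff_map_poly)

lemma act_poly_add: "A \<in> SL2Z \<Longrightarrow> map_poly (act A) (p + q) = map_poly (act A) p + map_poly (act A) q"
  by (rule poly_eqI) (simp add: coeff_act_poly act_add)

lemma act_poly_mult: "A \<in> SL2Z \<Longrightarrow> map_poly (act A) (p * q) = map_poly (act A) p * map_poly (act A) q"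
  by (rule poly_eqI) (simp add: coeff_act_poly coeff_mult act_sum act_mult)

lemma act_poly_smult: "A \<in> SL2Z \<Longrightarrow> map_poly (act A) (Polynomial.smult c p) = Polynomial.smult (act A c) (map_poly (act A) p)"
  by (rule poly_eqI) (simp add: coeff_act_poly act_mult)

lemma act_poly_sum: "A \<in> SL2Z \<Longrightarrow> map_poly (act A) (sum p I) = (\<Sum>i\<in>I. map_poly (act A) (p i))"
  by (induction I rule: infinite_finite_induct) (simp_all add: act_poly_add)

lemma act_poly_linear: "A \<in> SL2Z \<Longrightarrow> map_poly (act A) [:- c, 1:] = [:- act A c, 1:]"
  by (simp add: map_poly_pCons act_uminus)

lemma act_poly_prod: "A \<in> SL2Z \<Longrightarrow> map_poly (act A) (prod p I) = (\<Prod>i\<in>I. map_poly (act A) (p i))"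
  by (induction I rule: infinite_finite_induct) (simp_all add: act_poly_mult map_poly_1)

lemma C_subfield_sum: "C_subfield K \<Longrightarrow> (\<And>i. i \<in> I \<Longrightarrow> f i \<in> K) \<Longrightarrow> sum f I \<in> K"
  by (induction I rule: infinite_finite_induct) (auto intro: C_subfieldD)

lemma C_subfield_coeff_mult:
  assumes K: "C_subfield K" and "\<And>i. poly.coeff p i \<in> K" "\<And>i. poly.coeff q i \<in> K"
  shows "poly.coeff (p * q) i \<in> K"
  unfolding coeff_mult by (intro C_subfield_sum[OF K] C_subfieldD[OF K] assms)

lemma C_subfield_coeff_linear:
  assumes K: "C_subfield K" and "c \<in> K"
  shows "poly.coeff [:- c, 1:] i \<in> K"
  using assms(2) C_subfieldD[OF K] by (auto simp: coeff_pCons split: nat.splits)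

lemma C_subfield_coeff_prod:
  assumes K: "C_subfield K" and "\<And>j i. j \<in> I \<Longrightarrow> poly.coeff (p j) i \<in> K"
  shows "poly.coeff (prod p I) i \<in> K"
  using assms(2)
proof (induction I arbitrary: i rule: infinite_finite_induct)
  case (insert x F)
  thus ?case by (simp add: C_subfield_coeff_mult[OF K])
qed (use C_subfieldD[OF K] in auto)

lemma C_subfield_poly:
  assumes K: "C_subfield K" and "\<And>i. poly.coeff p i \<in> K" "x \<in> K"
  shows "poly p x \<in> K"
  unfolding poly_altdef by (intro C_subfield_sum[OF K] C_subfieldD[OF K] assms)

text \<open>\<open>R\<close> represents the quotient of \<open>G\<close> by \<open>\<Gamma>(N)\<close>, through which \<open>G\<close> acts on the modular functions of level \<open>N\<close>.\<close>

locale congruence_group =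
  fixes G :: "(int ^ 2 ^ 2) set" and N :: nat and R :: "(int ^ 2 ^ 2) set"
  assumes GS: "G \<subseteq> SL2Z" and Npos: "N > 0" and GN: "\<Gamma>(N) \<subseteq> G"
    and G_mult: "A \<in> G \<Longrightarrow> B \<in> G \<Longrightarrow> A ** B \<in> G" and G_minv: "A \<in> G \<Longrightarrow> minv A \<in> G"
    and R_fin: "finite R" and R_sub: "R \<subseteq> G" and R_ex1: "A \<in> G \<Longrightarrow> \<exists>!B. B \<in> R \<and> mcong N A B"
begin

lemma AN_field: "C_subfield (\<A>\<^sub>0 \<Gamma>(N))" by (rule modular_functions_C_subfield[OF Gamma_subset])

lemma G_one: "mat 1 \<in> G" using GN by (auto simp: Gamma_iff)

lemma AG_iff: "f \<in> \<A>\<^sub>0 G \<longleftrightarrow> f \<in> \<A>\<^sub>0 \<Gamma>(N) \<and> (\<forall>A\<in>G. act A f = f)"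
  using modular_functions_iff[OF GS] modular_functions_iff[OF Gamma_subset] GN by blast

text \<open>Right multiplication by \<open>C\<close> permutes the classes modulo \<open>N\<close>;
  since the action is a right action, this is the effect of \<open>act C\<close> on
  conjugates.\<close>

lemma translation_permutes_reps:
  assumes C: "C \<in> G"
  obtains \<pi> where "bij_betw \<pi> R R" "\<And>A f. A \<in> R \<Longrightarrow> f \<in> \<A>\<^sub>0 \<Gamma>(N) \<Longrightarrow> act C (act A f) = act (\<pi> A) f"
proof -
  define \<pi> where "\<pi> A = (THE B. B \<in> R \<and> mcong N (A ** C) B)" for A
  have \<pi>: "\<pi> A \<in> R" "mcong N (A ** C) (\<pi> A)" if "A \<in> R" for A
    using theI'[OF R_ex1[of "A ** C"]] that R_sub C G_mult unfolding \<pi>_def by blast+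
  have "inj_on \<pi> R"
  proof (rule inj_onI)
    fix A B assume AB: "A \<in> R" "B \<in> R" "\<pi> A = \<pi> B"
    have "mcong N (A ** C) (B ** C)" using \<pi>(2)[OF AB(1)] \<pi>(2)[OF AB(2)] AB(3) by (metis mcong_sym mcong_trans)
    hence "mcong N (A ** C ** minv C) (B ** C ** minv C)" by (rule mcong_mult) simp
    hence "mcong N A B" using C GS by (auto simp: matrix_mul_assoc[symmetric] minv_right)
    thus "A = B" using R_ex1[of A] AB R_sub mcong_refl[of N A] by blast
  qed
  moreover from this have "\<pi> ` R = R" using \<pi>(1) R_fin by (intro endo_inj_surj) auto
  ultimately have "bij_betw \<pi> R R" by (simp add: bij_betw_def)
  moreover have "act C (act A f) = act (\<pi> A) f" if "A \<in> R" "f \<in> \<A>\<^sub>0 \<Gamma>(N)" for A f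
  proof -
    have S: "A \<in> SL2Z" "C \<in> SL2Z" "\<pi> A \<in> SL2Z" using that C \<pi>(1)[OF that(1)] R_sub GS by auto
    have "act C (act A f) = act (A ** C) f" using S by (simp add: act_comp)
    also have "\<dots> = act (\<pi> A) f" using act_Gamma_mcong[OF that(2) _ S(3) \<pi>(2)[OF that(1)]] S SL2Z_mult by blast
    finally show ?thesis .
  qed
  ultimately show ?thesis using that by blast
qed

text \<open>The Lagrange interpolation polynomial taking the values \<open>f \<circ> A\<close> at \<open>\<theta> \<circ> A\<close>, up to the
  factor \<open>M'\<close>, \<open>M\<close> being the characteristic polynomial of \<open>\<theta>\<close>.\<close>

definition conj_poly :: "mero_uhp \<Rightarrow> mero_uhp \<Rightarrow> mero_uhp poly" where
  "conj_poly f \<theta> = (\<Sum>A\<in>R. Polynomial.smult (act A f) (\<Prod>B\<in>R - {A}. [:- act B \<theta>, 1:]))"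

definition char_poly :: "mero_uhp \<Rightarrow> mero_uhp poly" where
  "char_poly f = (\<Prod>A\<in>R. [:- act A f, 1:])"

lemma conj_closed: "f \<in> \<A>\<^sub>0 \<Gamma>(N) \<Longrightarrow> A \<in> R \<Longrightarrow> act A f \<in> \<A>\<^sub>0 \<Gamma>(N)"
  using act_Gamma_closed R_sub GS by blast

text \<open>\<open>act C\<close> permutes the summands together with the factors inside each of
  them, so the polynomial is invariant and its coefficients are fixed by \<open>G\<close>.\<close>

lemma coeff_conj_poly:
  assumes f: "f \<in> \<A>\<^sub>0 \<Gamma>(N)" and \<theta>: "\<theta> \<in> \<A>\<^sub>0 \<Gamma>(N)"
  shows "poly.coeff (conj_poly f \<theta>) i \<in> \<A>\<^sub>0 G"
proof -
  have "poly.coeff (conj_poly f \<theta>) i \<in> \<A>\<^sub>0 \<Gamma>(N)"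
    unfolding conj_poly_def coeff_sum coeff_smult
    by (intro C_subfield_sum[OF AN_field] C_subfieldD(5)[OF AN_field] conj_closed[OF f]
        C_subfield_coeff_prod[OF AN_field] C_subfield_coeff_linear[OF AN_field] conj_closed[OF \<theta>]) auto
  moreover have "act C (poly.coeff (conj_poly f \<theta>) i) = poly.coeff (conj_poly f \<theta>) i" if C: "C \<in> G" for C
  proof -
    have CS: "C \<in> SL2Z" using C GS by blast
    obtain \<pi> where \<pi>: "bij_betw \<pi> R R" "\<And>A f. A \<in> R \<Longrightarrow> f \<in> \<A>\<^sub>0 \<Gamma>(N) \<Longrightarrow> act C (act A f) = act (\<pi> A) f"
      using translation_permutes_reps[OF C] by blast
    have "map_poly (act C) (conj_poly f \<theta>) =
        (\<Sum>A\<in>R. Polynomial.smult (act C (act A f)) (\<Prod>B\<in>R - {A}. [:- act C (act B \<theta>), 1:]))"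
      by (simp add: conj_poly_def act_poly_sum[OF CS] act_poly_smult[OF CS] act_poly_prod[OF CS] act_poly_linear[OF CS])
    also have "\<dots> = (\<Sum>A\<in>R. Polynomial.smult (act (\<pi> A) f) (\<Prod>B\<in>R - {\<pi> A}. [:- act B \<theta>, 1:]))"
    proof (rule sum.cong[OF refl])
      fix A assume A: "A \<in> R"
      have "bij_betw \<pi> (R - {A}) (R - {\<pi> A})"
        using \<pi>(1) A by (auto simp: bij_betw_def inj_on_diff inj_on_image_set_diff[of \<pi> R])
      hence "(\<Prod>B\<in>R - {A}. [:- act (\<pi> B) \<theta>, 1:]) = (\<Prod>B\<in>R - {\<pi> A}. [:- act B \<theta>, 1:])"
        by (rule prod.reindex_bij_betw)
      thus "Polynomial.smult (act C (act A f)) (\<Prod>B\<in>R - {A}. [:- act C (act B \<theta>), 1:]) =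
          Polynomial.smult (act (\<pi> A) f) (\<Prod>B\<in>R - {\<pi> A}. [:- act B \<theta>, 1:])"
        using \<pi>(2) A f \<theta> by simp
    qed
    also have "\<dots> = conj_poly f \<theta>"
      unfolding conj_poly_def by (rule sum.reindex_bij_betw[OF \<pi>(1)])
    finally show ?thesis using coeff_act_poly[OF CS, of "conj_poly f \<theta>" i] by simp
  qed
  ultimately show ?thesis by (simp add: AG_iff)
qed

lemma coeff_char_poly:
  assumes f: "f \<in> \<A>\<^sub>0 \<Gamma>(N)"
  shows "poly.coeff (char_poly f) i \<in> \<A>\<^sub>0 G"
proof -
  have "poly.coeff (char_poly f) i \<in> \<A>\<^sub>0 \<Gamma>(N)"
    unfolding char_poly_def
    by (intro C_subfield_coeff_prod[OF AN_field] C_subfield_coeff_linear[OF AN_field] conj_closed[OF f])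
  moreover have "act C (poly.coeff (char_poly f) i) = poly.coeff (char_poly f) i" if C: "C \<in> G" for C
  proof -
    have CS: "C \<in> SL2Z" using C GS by blast
    obtain \<pi> where \<pi>: "bij_betw \<pi> R R" "\<And>A f. A \<in> R \<Longrightarrow> f \<in> \<A>\<^sub>0 \<Gamma>(N) \<Longrightarrow> act C (act A f) = act (\<pi> A) f"
      using translation_permutes_reps[OF C] by blast
    have "map_poly (act C) (char_poly f) = (\<Prod>A\<in>R. [:- act (\<pi> A) f, 1:])"
      using \<pi>(2) f by (simp add: char_poly_def act_poly_prod[OF CS] act_poly_linear[OF CS])
    also have "\<dots> = char_poly f" unfolding char_poly_def by (rule prod.reindex_bij_betw[OF \<pi>(1)])
    finally show ?thesis using coeff_act_poly[OF CS, of "char_poly f" i] by simp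
  qed
  ultimately show ?thesis by (simp add: AG_iff)
qed

lemma identity_rep: obtains A1 where "A1 \<in> R" "\<And>f. f \<in> \<A>\<^sub>0 \<Gamma>(N) \<Longrightarrow> act A1 f = f" "mcong N (mat 1) A1"
proof -
  obtain A1 where A1: "A1 \<in> R" "mcong N (mat 1) A1" using R_ex1[OF G_one] by blast
  have "act A1 f = f" if "f \<in> \<A>\<^sub>0 \<Gamma>(N)" for f
    using act_Gamma_mcong[OF that, of "mat 1" A1] A1 R_sub GS by auto
  thus ?thesis using that A1 by blast
qed

text \<open>Up to sign \<open>c\<close> is the constant term of the characteristic polynomial, the
  norm of \<open>f\<close>, and \<open>f * poly q f\<close> is the rest of the equation that
  \<open>f\<close> satisfies. This exhibits the norm as a multiple of \<open>f\<close> within the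
  ring generated by \<open>f\<close> over the base field.\<close>

lemma norm_relation:
  assumes f: "f \<in> \<A>\<^sub>0 \<Gamma>(N)" "f \<noteq> 0"
  obtains q c where "\<And>i. poly.coeff q i \<in> \<A>\<^sub>0 G" "c \<in> \<A>\<^sub>0 G" "c \<noteq> 0" "f * poly q f = c"
proof -
  obtain A1 where A1: "A1 \<in> R" "act A1 f = f" using identity_rep f(1) by metis
  obtain c q where cq: "char_poly f = pCons c q" by (cases "char_poly f")
  have "poly (char_poly f) f = 0"
    unfolding char_poly_def poly_prod using A1 R_fin by (simp add: prod_zero_iff) force
  hence "f * poly q f = - c" unfolding cq by (simp add: eq_neg_iff_add_eq_0 add.commute)
  moreover have "poly (char_poly f) 0 \<noteq> 0"
    unfolding char_poly_def poly_prod using R_fin R_sub GS f(2) by (auto simp: prod_zero_iff act_eq_0_iff)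
  hence "- c \<noteq> 0" unfolding cq by simp
  moreover have "poly.coeff q i \<in> \<A>\<^sub>0 G" for i using coeff_char_poly[OF f(1), of "Suc i"] unfolding cq by simp
  moreover have "c \<in> \<A>\<^sub>0 G" using coeff_char_poly[OF f(1), of 0] unfolding cq by simp
  hence "- c \<in> \<A>\<^sub>0 G" by (rule C_subfieldD(7)[OF modular_functions_C_subfield[OF GS]])
  ultimately show ?thesis using that by blast
qed

text \<open>At \<theta> every summand of \<open>conj_poly f \<theta>\<close> except the one for the
  identity vanishes, leaving \<open>f * D\<close>; the same evaluation for the function 1 leaves
  \<open>D\<close>. Their quotient is \<open>f\<close>, and both polynomials have coefficients in
  \<open>\<A>\<^sub>0 G\<close>.\<close>

theorem primitive_element_generates:
  assumes f: "f \<in> \<A>\<^sub>0 \<Gamma>(N)" and \<theta>: "\<theta> \<in> \<A>\<^sub>0 \<Gamma>(N)"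
    and stab: "\<And>A. A \<in> G \<Longrightarrow> act A \<theta> = \<theta> \<Longrightarrow> A \<in> \<Gamma>(N)"
    and L: "C_subfield L" "\<A>\<^sub>0 G \<subseteq> L" "\<theta> \<in> L"
  shows "f \<in> L"
proof -
  obtain A1 where A1: "A1 \<in> R" "\<And>f. f \<in> \<A>\<^sub>0 \<Gamma>(N) \<Longrightarrow> act A1 f = f" "mcong N (mat 1) A1" using identity_rep by blast
  define D where "D = (\<Prod>B\<in>R - {A1}. \<theta> - act B \<theta>)"
  have val: "poly (conj_poly g \<theta>) \<theta> = g * D" if g: "g \<in> \<A>\<^sub>0 \<Gamma>(N)" for g
  proof -
    have "poly (conj_poly g \<theta>) \<theta> = (\<Sum>A\<in>R. act A g * (\<Prod>B\<in>R - {A}. \<theta> - act B \<theta>))"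
      by (simp add: conj_poly_def poly_sum poly_prod)
    also have "\<dots> = (\<Sum>A\<in>{A1}. act A g * (\<Prod>B\<in>R - {A}. \<theta> - act B \<theta>))"
    proof (rule sum.mono_neutral_right[OF R_fin])
      show "\<forall>A\<in>R - {A1}. act A g * (\<Prod>B\<in>R - {A}. \<theta> - act B \<theta>) = 0"
      proof
        fix A assume "A \<in> R - {A1}"
        hence "(\<Prod>B\<in>R - {A}. \<theta> - act B \<theta>) = 0"
          using R_fin A1(1) A1(2)[OF \<theta>] by (subst prod_zero_iff) (auto intro!: bexI[of _ A1])
        thus "act A g * (\<Prod>B\<in>R - {A}. \<theta> - act B \<theta>) = 0" by simp
      qed
    qed (use A1 in auto)
    finally show ?thesis using A1(2)[OF g] by (simp add: D_def)
  qed
  \<comment> \<open>A second representative fixing \<theta> would be congruent to the identity,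
    against uniqueness in \<open>R\<close>.\<close>
  have "D \<noteq> 0"
  proof
    assume "D = 0"
    then obtain B where "B \<in> R - {A1}" "\<theta> - act B \<theta> = 0"
      unfolding D_def using R_fin by (subst (asm) prod_zero_iff) auto
    hence B: "B \<in> R" "B \<noteq> A1" "act B \<theta> = \<theta>" by auto
    hence "B \<in> \<Gamma>(N)" using stab R_sub by blast
    hence "mcong N (mat 1) B" by (simp add: Gamma_iff mcong_sym)
    thus False using R_ex1[OF G_one] A1 B by blast
  qed
  have in_L: "poly (conj_poly g \<theta>) \<theta> \<in> L" if "g \<in> \<A>\<^sub>0 \<Gamma>(N)" for g
    using C_subfield_poly[OF L(1) _ L(3)] coeff_conj_poly[OF that \<theta>] L(2) by blast
  have "f = poly (conj_poly f \<theta>) \<theta> / poly (conj_poly 1 \<theta>) \<theta>"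
    using val[OF f] val[OF C_subfieldD(3)[OF AN_field]] \<open>D \<noteq> 0\<close> by simp
  thus ?thesis using C_subfieldD(6)[OF L(1) in_L[OF f] in_L[OF C_subfieldD(3)[OF AN_field]]] by simp
qed

text \<open>Each representative outside \<open>\<Gamma>(N)\<close> moves one of the three functions,
  so it fixes the combination for only finitely many \<open>c\<close>, the roots of a nonzero
  polynomial \<open>d A\<close>; and there are finitely many representatives.\<close>

lemma primitive_element_exists:
  assumes x: "x1 \<in> \<A>\<^sub>0 \<Gamma>(N)" "x2 \<in> \<A>\<^sub>0 \<Gamma>(N)" "x3 \<in> \<A>\<^sub>0 \<Gamma>(N)"
    and stab: "\<And>A. A \<in> G \<Longrightarrow> act A x1 = x1 \<Longrightarrow> act A x2 = x2 \<Longrightarrow> act A x3 = x3 \<Longrightarrow> A \<in> \<Gamma>(N)"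
  obtains c where "\<And>A. A \<in> G \<Longrightarrow> act A (x1 + mero_const c * (x2 + mero_const c * x3)) = x1 + mero_const c * (x2 + mero_const c * x3) \<Longrightarrow> A \<in> \<Gamma>(N)"
proof -
  define d where "d A = [:act A x1 - x1, act A x2 - x2, act A x3 - x3:]" for A
  define bad where "bad = (\<Union>A\<in>R - \<Gamma>(N). {y. poly (d A) y = 0})"
  have "d A \<noteq> 0" if "A \<in> R - \<Gamma>(N)" for A
    using stab[of A] that R_sub by (auto simp: d_def)
  hence "finite bad" unfolding bad_def using R_fin by (intro finite_UN_I) (auto intro: poly_roots_finite)
  hence "finite (mero_const -` bad)" by (rule finite_vimageI) (simp add: inj_def mero_const_eq_iff)
  then obtain c where c: "c \<notin> mero_const -` bad" by (metis ex_new_if_finite infinite_UNIV_char_0)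
  show ?thesis
  proof (rule that[of c])
    fix A assume A: "A \<in> G" and eq: "act A (x1 + mero_const c * (x2 + mero_const c * x3)) = x1 + mero_const c * (x2 + mero_const c * x3)"
    obtain B where B: "B \<in> R" "mcong N A B" using R_ex1[OF A] by blast
    have S: "A \<in> SL2Z" "B \<in> SL2Z" using A B R_sub GS by auto
    have same: "act A f = act B f" if "f \<in> \<A>\<^sub>0 \<Gamma>(N)" for f by (rule act_Gamma_mcong[OF that S B(2)])
    have "poly (d B) (mero_const c) = act B (x1 + mero_const c * (x2 + mero_const c * x3)) - (x1 + mero_const c * (x2 + mero_const c * x3))"
      using S by (simp add: d_def act_add act_mult act_const algebra_simps)
    also have "\<dots> = 0" using eq same[OF C_subfieldD(4)[OF AN_field x(1) C_subfieldD(5)[OF AN_field C_subfieldD(1)[OF AN_field]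
        C_subfieldD(4)[OF AN_field x(2) C_subfieldD(5)[OF AN_field C_subfieldD(1)[OF AN_field] x(3)]]]]] by simp
    finally have "B \<in> \<Gamma>(N)" using c B unfolding bad_def by auto
    hence "mcong N A (mat 1)" using B(2) by (meson Gamma_iff mcong_trans)
    thus "A \<in> \<Gamma>(N)" using S by (simp add: Gamma_iff)
  qed
qed

end

section \<open>Division values of level 7\<close>

definition sk :: "int \<Rightarrow> complex \<Rightarrow> complex" where
  "sk k \<tau> = kl (of_int k / 7) 0 (7 * \<tau>)"

definition zeta7 :: "int \<Rightarrow> complex" where
  "zeta7 x = exp (2 * of_real pi * \<i> * of_int x / 7)"

lemma zeta7_nonzero [simp]: "zeta7 x \<noteq> 0" by (simp add: zeta7_def)

lemma zeta7_add: "zeta7 (x + y) = zeta7 x * zeta7 y"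
  unfolding zeta7_def exp_add[symmetric] by (rule arg_cong[where f = exp]) (simp add: algebra_simps add_divide_distrib)

lemma zeta7_0 [simp]: "zeta7 0 = 1" by (simp add: zeta7_def)

lemma zeta7_eq_1_iff: "zeta7 x = 1 \<longleftrightarrow> 7 dvd x"
proof
  assume "zeta7 x = 1"
  then obtain n :: int where "Im (2 * of_real pi * \<i> * of_int x / 7) = of_int (2 * n) * pi" unfolding zeta7_def exp_eq_1 by blast
  hence "real_of_int x = of_int (7 * n)" by simp
  thus "7 dvd x" unfolding of_int_eq_iff by simp
next
  assume "7 dvd x"
  then obtain n where "x = 7 * n" by (elim dvdE)
  thus "zeta7 x = 1" using exp_integer_2pi[of "of_int n"] by (simp add: zeta7_def mult_ac)
qed

lemma zeta7_cong: "7 dvd x - y \<Longrightarrow> zeta7 x = zeta7 y"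
  using zeta7_add[of "x - y" y] zeta7_eq_1_iff[of "x - y"] by simp

lemma zeta7_power: "zeta7 x ^ n = zeta7 (int n * x)"
  by (induction n) (simp_all add: zeta7_add algebra_simps)

text \<open>\<open>14 * n + 7 - 2 * k = 14 * (n + x0)\<close> with \<open>x0 = 1/2 - k/7\<close>:
  the series has the characteristic that belongs to \<open>- k/7\<close>, and oddness of the Klein
  form changes the sign. The remaining constant depends on \<open>k\<close> through a sign only,
  which accounts for the signs in the definitions of \<open>phi1\<close> and
  \<open>phi2\<close>.\<close>

lemma theta_a_eq_sk: "theta_a k \<tau> = (- 1) powi k * (- \<i>) * sk k \<tau>"
proof -
  define x0 where "x0 = 1/2 - real_of_int k / 7"
  define c where "c = (- 1) powi (k + 1) * exp (- (of_real pi * \<i> * of_real x0))"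
  have "(-1) powi (n + k + 1) * exp (2 * of_real pi * \<i> * (of_int ((14 * n + 7 - 2 * k)\<^sup>2) / 56) * \<tau>) =
      c * jt_term x0 (of_real (0 + 1/2)) (7 * \<tau>) n" for n
  proof -
    define x where "x = complex_of_real (of_int n + x0)"
    have x14: "complex_of_int (14 * n + 7 - 2 * k) = 14 * x" by (simp add: x_def x0_def algebra_simps)
    have "complex_of_int ((14 * n + 7 - 2 * k)\<^sup>2) = (complex_of_int (14 * n + 7 - 2 * k))\<^sup>2" by simp
    hence sq: "complex_of_int ((14 * n + 7 - 2 * k)\<^sup>2) = 196 * x\<^sup>2" unfolding x14 by (simp add: power_mult_distrib)
    have "(- 1) powi n * exp (2 * of_real pi * \<i> * (196 * x\<^sup>2 / 56) * \<tau>) =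
        exp (- (of_real pi * \<i> * of_real x0)) * exp (of_real pi * \<i> * x\<^sup>2 * (7 * \<tau>) + 2 * of_real pi * \<i> * x * of_real (0 + 1/2))"
      unfolding exp_pi_i_times_int[symmetric] exp_add[symmetric]
      by (rule arg_cong[where f = exp]) (simp add: x_def algebra_simps)
    thus ?thesis unfolding sq c_def jt_term_def x_def[symmetric]
      by (simp add: power_int_add mult.assoc)
  qed
  hence "theta_a k \<tau> = c * jt x0 (of_real (0 + 1/2)) (7 * \<tau>)"
    unfolding theta_a_def jt_def by (simp only: infsum_cmult_right')
  moreover have "kl (- (of_int k / 7)) (- 0) (7 * \<tau>) = exp (of_real pi * \<i> * of_real (of_int k / 7)) * jt x0 (of_real (0 + 1/2)) (7 * \<tau>)"
    unfolding kl_eq_jt by (simp add: x0_def)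
  hence "jt x0 (of_real (0 + 1/2)) (7 * \<tau>) = - exp (- (of_real pi * \<i> * of_real (of_int k / 7))) * sk k \<tau>"
    unfolding kl_minus sk_def by (simp add: exp_minus field_simps)
  moreover have "exp (- (of_real pi * \<i> * of_real x0)) * exp (- (of_real pi * \<i> * of_real (of_int k / 7))) = - \<i>"
  proof -
    have "exp (- (of_real pi * \<i> * of_real x0)) * exp (- (of_real pi * \<i> * of_real (of_int k / 7))) = cis (- (pi / 2))"
      unfolding exp_add[symmetric] cis_conv_exp by (rule arg_cong[where f = exp]) (simp add: x0_def algebra_simps)
    thus ?thesis by (simp add: complex_eq_iff)
  qed
  ultimately show ?thesis by (simp add: c_def power_int_add mult_ac)
qed

lemma phi1_eq: "phi1 \<tau> = sk 3 \<tau> / sk 2 \<tau>"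
  by (simp add: phi1_def theta_a_eq_sk)

lemma phi2_eq: "phi2 \<tau> = sk 2 \<tau> / sk 1 \<tau>"
  by (simp add: phi2_def theta_a_eq_sk)

lemma sk_minus: "sk (- k) \<tau> = - sk k \<tau>"
  using kl_minus[of "of_int k / 7" 0 "7 * \<tau>"] by (simp add: sk_def)

lemma sk_add_7: "sk (k + 7 * m) \<tau> = (- 1) powi m * sk k \<tau>"
  using kl_add_int[of "of_int k / 7" m 0 0 "7 * \<tau>"] by (simp add: sk_def add_divide_distrib)

lemma sk_reduce:
  "sk 4 \<tau> = sk 3 \<tau>" "sk 5 \<tau> = sk 2 \<tau>" "sk 6 \<tau> = sk 1 \<tau>"
  using sk_add_7[of "- 3" 1 \<tau>] sk_add_7[of "- 2" 1 \<tau>] sk_add_7[of "- 1" 1 \<tau>]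
  by (simp_all add: sk_minus)

lemma sk_nonzero: "Im \<tau> > 0 \<Longrightarrow> \<not> 7 dvd k \<Longrightarrow> sk k \<tau> \<noteq> 0"
proof -
  assume "Im \<tau> > 0" "\<not> 7 dvd k"
  have "real_of_int k / 7 \<notin> \<int>"
  proof
    assume "real_of_int k / 7 \<in> \<int>"
    then obtain j where "real_of_int k / 7 = of_int j" by (elim Ints_cases)
    hence "real_of_int k = of_int (7 * j)" by simp
    hence "k = 7 * j" unfolding of_int_eq_iff .
    thus False using \<open>\<not> 7 dvd k\<close> by simp
  qed
  thus ?thesis unfolding sk_def using \<open>Im \<tau> > 0\<close> by (intro kl_nonzero) auto
qed

lemma sk_123_nonzero: "Im \<tau> > 0 \<Longrightarrow> sk 1 \<tau> \<noteq> 0" "Im \<tau> > 0 \<Longrightarrow> sk 2 \<tau> \<noteq> 0" "Im \<tau> > 0 \<Longrightarrow> sk 3 \<tau> \<noteq> 0"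
  by (intro sk_nonzero; simp)+

lemma sk_holomorphic: "sk k holomorphic_on uhp"
proof -
  have "(kl (of_int k / 7) 0 \<circ> (\<lambda>\<tau>. 7 * \<tau>)) holomorphic_on uhp"
    by (rule holomorphic_on_compose_gen[OF _ kl_holomorphic]) (auto simp: uhp_def intro!: holomorphic_intros)
  thus ?thesis by (simp add: sk_def[abs_def] o_def)
qed

lemma phi_holomorphic: "phi1 holomorphic_on uhp" "phi2 holomorphic_on uhp"
proof -
  have "(\<lambda>\<tau>. sk 3 \<tau> / sk 2 \<tau>) holomorphic_on uhp" "(\<lambda>\<tau>. sk 2 \<tau> / sk 1 \<tau>) holomorphic_on uhp"
    by (intro holomorphic_intros sk_holomorphic; use sk_123_nonzero in \<open>auto simp: uhp_def\<close>)+
  thus "phi1 holomorphic_on uhp" "phi2 holomorphic_on uhp" by (simp_all add: phi1_eq[abs_def] phi2_eq[abs_def])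
qed

lemma phi_scaled_holomorphic:
  assumes "c > 0"
  shows "(\<lambda>\<tau>. phi1 (of_real c * \<tau>)) holomorphic_on uhp" "(\<lambda>\<tau>. phi2 (of_real c * \<tau>)) holomorphic_on uhp"
proof -
  have "(phi1 \<circ> (\<lambda>\<tau>. of_real c * \<tau>)) holomorphic_on uhp" "(phi2 \<circ> (\<lambda>\<tau>. of_real c * \<tau>)) holomorphic_on uhp"
    using assms by (auto intro!: holomorphic_on_compose_gen[OF _ phi_holomorphic(1)] holomorphic_on_compose_gen[OF _ phi_holomorphic(2)]
        holomorphic_intros simp: uhp_def)
  thus "(\<lambda>\<tau>. phi1 (of_real c * \<tau>)) holomorphic_on uhp" "(\<lambda>\<tau>. phi2 (of_real c * \<tau>)) holomorphic_on uhp" by (simp_all add: o_def)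
qed

lemma phi_nonzero: "Im \<tau> > 0 \<Longrightarrow> phi1 \<tau> \<noteq> 0" "Im \<tau> > 0 \<Longrightarrow> phi2 \<tau> \<noteq> 0"
  using sk_123_nonzero by (simp_all add: phi1_eq phi2_eq)

text \<open>\<open>7 * A \<tau>\<close> is the image of \<open>7 * \<tau>\<close> under the matrix
  with entries \<open>a\<close>, \<open>7 * b\<close>, \<open>c / 7\<close>, \<open>d\<close>. It
  multiplies the index \<open>k\<close> by \<open>a\<close> and produces the integral second
  characteristic \<open>k * b\<close>, which is then removed.\<close>

lemma sk_Gamma0:
  fixes A :: "int ^ 2 ^ 2"
  assumes A: "A \<in> SL2Z" and c: "7 dvd A $ 2 $ 1" and \<tau>: "\<tau> \<in> uhp"
  obtains C where "C \<noteq> 0" "\<And>k. sk k (moebius_act A \<tau>) =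
     C * (exp (of_real pi * \<i> * of_real (of_int (k * A $ 1 $ 2) + of_int (k * A $ 1 $ 2 * (k * A $ 1 $ 1)) / 7)) * sk (k * A $ 1 $ 1) \<tau>)"
proof -
  define a b d where "a = A $ 1 $ 1" and "b = A $ 1 $ 2" and "d = A $ 2 $ 2"
  obtain c' where c': "A $ 2 $ 1 = 7 * c'" using c by (elim dvdE)
  have det: "a * d - (7 * b) * c' = 1" using A by (simp add: SL2Z_iff a_def b_def d_def c')
  have im: "Im (7 * \<tau>) > 0" using \<tau> by (simp add: uhp_def)
  have eq: "(of_int a * (7 * \<tau>) + of_int (7 * b)) / (of_int c' * (7 * \<tau>) + of_int d) = 7 * moebius_act A \<tau>"
    by (simp add: moebius_act_def a_def b_def d_def c' algebra_simps)
  obtain C where C: "C \<noteq> 0" "\<And>\<alpha> \<beta>. kl \<alpha> \<beta> (7 * moebius_act A \<tau>) =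
     C * kl (\<alpha> * of_int a + \<beta> * of_int c') (\<alpha> * of_int (7 * b) + \<beta> * of_int d) (7 * \<tau>)"
    using kl_modular[OF det im] unfolding eq by blast
  show ?thesis
  proof (rule that[OF C(1)])
    fix k
    have "sk k (moebius_act A \<tau>) = C * kl (of_int (k * a) / 7) (of_int (k * b)) (7 * \<tau>)"
      unfolding sk_def C(2) by simp
    also have "kl (of_int (k * a) / 7) (of_int (k * b)) (7 * \<tau>) =
        (- 1) powi (k * b) * exp (of_real pi * \<i> * of_real (of_int (k * b) * (of_int (k * a) / 7))) * sk (k * a) \<tau>"
      using kl_add_int[of "of_int (k * a) / 7" 0 0 "k * b" "7 * \<tau>"] by (simp add: sk_def)
    also have "(- 1) powi (k * b) * exp (of_real pi * \<i> * of_real (of_int (k * b) * (of_int (k * a) / 7))) =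
        exp (of_real pi * \<i> * of_real (of_int (k * b) + of_int (k * b * (k * a)) / 7))"
      unfolding exp_pi_i_times_int[symmetric] exp_add[symmetric]
      by (rule arg_cong[where f = exp]) (simp add: distrib_left)
    finally show "sk k (moebius_act A \<tau>) =
     C * (exp (of_real pi * \<i> * of_real (of_int (k * A $ 1 $ 2) + of_int (k * A $ 1 $ 2 * (k * A $ 1 $ 1)) / 7)) * sk (k * A $ 1 $ 1) \<tau>)"
      by (simp add: a_def b_def)
  qed
qed

section \<open>The group Gamma_1(7) and the roots of unity it produces\<close>

definition Gamma1_7 :: "(int ^ 2 ^ 2) set" where
  "Gamma1_7 = {A \<in> SL2Z. 7 dvd A $ 1 $ 1 - 1 \<and> 7 dvd A $ 2 $ 1}"

lemma Gamma1_7_D: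
  fixes A :: "int ^ 2 ^ 2"
  assumes "A \<in> Gamma1_7"
  shows "A \<in> SL2Z" "7 dvd A $ 1 $ 1 - 1" "7 dvd A $ 2 $ 1" "7 dvd A $ 2 $ 2 - 1"
proof -
  show *: "A \<in> SL2Z" "7 dvd A $ 1 $ 1 - 1" "7 dvd A $ 2 $ 1" using assms by (auto simp: Gamma1_7_def)
  have "A $ 2 $ 2 - 1 = A $ 1 $ 2 * A $ 2 $ 1 - (A $ 1 $ 1 - 1) * A $ 2 $ 2"
    using *(1) by (simp add: SL2Z_iff algebra_simps)
  thus "7 dvd A $ 2 $ 2 - 1" using *(2,3) by simp
qed

lemma Gamma1_7_subset: "Gamma1_7 \<subseteq> SL2Z" using Gamma1_7_D by blast

lemma Gamma1_7_mult:
  assumes A: "A \<in> Gamma1_7" and B: "B \<in> Gamma1_7"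
  shows "A ** B \<in> Gamma1_7"
proof -
  note a = Gamma1_7_D[OF A] and b = Gamma1_7_D[OF B]
  have "(A ** B) $ 1 $ 1 - 1 = (A $ 1 $ 1 - 1) * B $ 1 $ 1 + (B $ 1 $ 1 - 1) + A $ 1 $ 2 * B $ 2 $ 1"
    by (simp add: matmul_entry algebra_simps)
  moreover have "7 dvd (A $ 1 $ 1 - 1) * B $ 1 $ 1 + (B $ 1 $ 1 - 1) + A $ 1 $ 2 * B $ 2 $ 1"
    using a b by (intro dvd_add dvd_mult dvd_mult2)
  ultimately have "7 dvd (A ** B) $ 1 $ 1 - 1" by (simp only:)
  thus ?thesis using a b by (simp add: Gamma1_7_def SL2Z_mult matmul_entry)
qed

lemma Gamma1_7_minv: "A \<in> Gamma1_7 \<Longrightarrow> minv A \<in> Gamma1_7"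
proof -
  assume A: "A \<in> Gamma1_7"
  note D = Gamma1_7_D[OF A]
  have "7 dvd minv A $ 1 $ 1 - 1" "7 dvd minv A $ 2 $ 1" unfolding minv_entries dvd_minus_iff by (rule D(4), rule D(3))
  thus ?thesis unfolding Gamma1_7_def using SL2Z_minv[OF D(1)] by blast
qed

lemma Gamma_entries:
  "A \<in> \<Gamma>(N) \<longleftrightarrow> A \<in> SL2Z \<and> int N dvd A $ 1 $ 1 - 1 \<and> int N dvd A $ 1 $ 2 \<and> int N dvd A $ 2 $ 1 \<and> int N dvd A $ 2 $ 2 - 1"
  unfolding Gamma_iff mcong_def forall_2 cong_iff_dvd_diff mat1_entries by simp

lemma Gamma_7_iff: "(A :: int ^ 2 ^ 2) \<in> \<Gamma>(7) \<longleftrightarrow> A \<in> Gamma1_7 \<and> 7 dvd A $ 1 $ 2"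
proof
  assume "A \<in> \<Gamma>(7)"
  thus "A \<in> Gamma1_7 \<and> 7 dvd A $ 1 $ 2" by (simp add: Gamma_entries Gamma1_7_def)
next
  assume A: "A \<in> Gamma1_7 \<and> 7 dvd A $ 1 $ 2"
  thus "A \<in> \<Gamma>(7)" using Gamma1_7_D[of A] by (simp add: Gamma_entries)
qed

text \<open>By the determinant the diagonal entries are odd as soon as the upper right entry is
  even.\<close>

lemma Gamma_14_iff: "(A :: int ^ 2 ^ 2) \<in> \<Gamma>(14) \<longleftrightarrow> A \<in> \<Gamma>(7) \<and> even (A $ 1 $ 2) \<and> even (A $ 2 $ 1)"
proof -
  have 14: "14 dvd x \<longleftrightarrow> 7 dvd x \<and> 2 dvd x" for x :: int by presburger
  have "odd (A $ 1 $ 1) \<and> odd (A $ 2 $ 2)" if "A \<in> SL2Z" "even (A $ 1 $ 2)"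
  proof -
    have "odd (A $ 1 $ 1 * A $ 2 $ 2 - A $ 1 $ 2 * A $ 2 $ 1)" using that by (simp add: SL2Z_iff)
    thus ?thesis using that(2) by auto
  qed
  thus ?thesis by (auto simp: Gamma_entries 14)
qed

text \<open>Up to sign the factor is \<open>exp (\<pi> i b k ^ 2 / 7)\<close>. Adding
  \<open>\<pi> i b k ^ 2\<close> to the exponent turns it into a 7th root of unity, 4 being the
  inverse of 2 modulo 7; what has to be checked is that all signs cancel.\<close>

lemma sk_Gamma1:
  fixes A :: "int ^ 2 ^ 2"
  assumes A: "A \<in> Gamma1_7" and \<tau>: "\<tau> \<in> uhp"
  obtains C where "C \<noteq> 0" "\<And>k. sk k (moebius_act A \<tau>) = C * zeta7 (4 * A $ 1 $ 2 * k\<^sup>2) * sk k \<tau>"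
proof -
  note AD = Gamma1_7_D[OF A]
  define b where "b = A $ 1 $ 2"
  obtain m where m: "A $ 1 $ 1 = 1 + 7 * m" using AD(2) by (metis add.commute diff_add_cancel dvdE)
  \<comment> \<open>If \<open>m\<close> is odd and \<open>b\<close> even, then
    \<open>a = 1 + 7 * m\<close> and \<open>b\<close> are both even, against the
    determinant.\<close>
  have par: "even (m * (1 + b))"
  proof (rule ccontr)
    assume "odd (m * (1 + b))"
    hence "odd m" "even b" by auto
    moreover have "(1 + 7 * m) * A $ 2 $ 2 - b * A $ 2 $ 1 = 1" using AD(1) by (simp add: SL2Z_iff m b_def)
    ultimately show False by (metis even_add even_diff even_mult_iff odd_one odd_numeral)
  qed
  obtain C where C: "C \<noteq> 0" "\<And>k. sk k (moebius_act A \<tau>) =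
     C * (exp (of_real pi * \<i> * of_real (of_int (k * b) + of_int (k * b * (k * (1 + 7 * m))) / 7)) * sk (k * (1 + 7 * m)) \<tau>)"
    using sk_Gamma0[OF AD(1,3) \<tau>] unfolding m b_def by metis
  show ?thesis
  proof (rule that[OF C(1)])
    fix k :: int
    have "even (k * b + k\<^sup>2 * b * m + k * m - b * k\<^sup>2)"
      using par by (cases "even k") auto
    then obtain j where j: "k * b + k\<^sup>2 * b * m + k * m - b * k\<^sup>2 = 2 * j" by (elim evenE)
    have jc: "of_int (k * b) + of_int (k * b * (k * (1 + 7 * m))) / 7 + of_int (k * m) = 2 * of_int j + 8 * of_int (b * k\<^sup>2) / (7::complex)"
    proof -
      have 1: "of_int (k * b * (k * (1 + 7 * m))) / (7::complex) = of_int (b * k\<^sup>2) / 7 + of_int (k\<^sup>2 * b * m)"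
        by (simp add: field_simps power2_eq_square)
      have "complex_of_int (k * b + k\<^sup>2 * b * m + k * m - b * k\<^sup>2) = of_int (2 * j)" unfolding j ..
      hence 2: "of_int (k * b) + of_int (k\<^sup>2 * b * m) + of_int (k * m) = 2 * of_int j + complex_of_int (b * k\<^sup>2)"
        by (simp only: of_int_add of_int_diff of_int_mult[of 2] of_int_numeral diff_eq_eq)
      have "of_int (k * b) + (of_int (b * k\<^sup>2) / 7 + of_int (k\<^sup>2 * b * m)) + of_int (k * m) =
          (of_int (k * b) + of_int (k\<^sup>2 * b * m) + of_int (k * m)) + complex_of_int (b * k\<^sup>2) / 7" by (simp only: add_ac)
      thus ?thesis unfolding 1 2 by simp
    qed
    have "exp (of_real pi * \<i> * of_real (of_int (k * b) + of_int (k * b * (k * (1 + 7 * m))) / 7)) * (- 1) powi (k * m) =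
        exp (of_real pi * \<i> * (of_int (k * b) + of_int (k * b * (k * (1 + 7 * m))) / 7 + of_int (k * m)))"
      unfolding exp_pi_i_times_int[symmetric] exp_add[symmetric] by (rule arg_cong[where f = exp]) (simp add: distrib_left)
    also have "\<dots> = exp (2 * of_real pi * \<i> * of_int j) * zeta7 (4 * b * k\<^sup>2)"
      unfolding jc zeta7_def exp_add[symmetric] by (rule arg_cong[where f = exp]) (simp add: algebra_simps)
    also have "exp (2 * of_real pi * \<i> * of_int j) = 1" using exp_integer_2pi[of "of_int j"] by (simp add: mult_ac)
    finally have e: "exp (of_real pi * \<i> * of_real (of_int (k * b) + of_int (k * b * (k * (1 + 7 * m))) / 7)) * (- 1) powi (k * m) = zeta7 (4 * b * k\<^sup>2)"
      by simp
    have "sk (k * (1 + 7 * m)) \<tau> = (- 1) powi (k * m) * sk k \<tau>"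
      using sk_add_7[of k "k * m" \<tau>] by (simp add: algebra_simps)
    thus "sk k (moebius_act A \<tau>) = C * zeta7 (4 * A $ 1 $ 2 * k\<^sup>2) * sk k \<tau>"
      unfolding C(2) b_def[symmetric] e[symmetric] by (simp only: mult.assoc)
  qed
qed

text \<open>The exponent is \<open>4 * (3 ^ 2 - 2 ^ 2) = 20\<close>, congruent to -1 modulo
  7.\<close>

lemma phi1_Gamma1:
  fixes A :: "int ^ 2 ^ 2"
  assumes A: "A \<in> Gamma1_7" and \<tau>: "\<tau> \<in> uhp"
  shows "phi1 (moebius_act A \<tau>) = zeta7 (- A $ 1 $ 2) * phi1 \<tau>"
proof -
  obtain C where C: "C \<noteq> 0" "\<And>k. sk k (moebius_act A \<tau>) = C * zeta7 (4 * A $ 1 $ 2 * k\<^sup>2) * sk k \<tau>"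
    using sk_Gamma1[OF assms] by blast
  have "zeta7 (4 * A $ 1 $ 2 * 3\<^sup>2) = zeta7 (- A $ 1 $ 2) * zeta7 (4 * A $ 1 $ 2 * 2\<^sup>2)"
    unfolding zeta7_add[symmetric] by (rule zeta7_cong) simp
  thus ?thesis unfolding phi1_eq C(2) using C(1) by simp
qed

text \<open>The exponent is \<open>4 * (2 ^ 2 - 1 ^ 2) = 12\<close>, congruent to 5 modulo
  7.\<close>

lemma phi2_Gamma1:
  fixes A :: "int ^ 2 ^ 2"
  assumes A: "A \<in> Gamma1_7" and \<tau>: "\<tau> \<in> uhp"
  shows "phi2 (moebius_act A \<tau>) = zeta7 (5 * A $ 1 $ 2) * phi2 \<tau>"
proof -
  obtain C where C: "C \<noteq> 0" "\<And>k. sk k (moebius_act A \<tau>) = C * zeta7 (4 * A $ 1 $ 2 * k\<^sup>2) * sk k \<tau>"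
    using sk_Gamma1[OF assms] by blast
  have "zeta7 (4 * A $ 1 $ 2 * 2\<^sup>2) = zeta7 (5 * A $ 1 $ 2) * zeta7 (4 * A $ 1 $ 2 * 1\<^sup>2)"
    unfolding zeta7_add[symmetric] by (rule zeta7_cong) simp
  thus ?thesis unfolding phi2_eq C(2) using C(1) by simp
qed

text \<open>Hermite normal form: the integral matrix that sends \<tau> to
  \<open>7 * n * A \<tau>\<close> has determinant \<open>7 * n\<close> and factors as a matrix of
  determinant 1 times an upper triangular one with diagonal \<open>p\<close>, \<open>m\<close>. The
  former is absorbed by the Klein form, the latter rescales the variable.\<close>

lemma sk_any_cusp:
  fixes A :: "int ^ 2 ^ 2"
  assumes A: "A \<in> SL2Z" and n: "n > 0"
  obtains a b c d r :: int and p m :: nat where "a * d - b * c = 1" "p > 0" "m > 0" "int p * int m = 7 * int n"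
    "a * int p = 7 * int n * A $ 1 $ 1" "c * int p = A $ 2 $ 1"
    "\<And>\<tau>. \<tau> \<in> uhp \<Longrightarrow> \<exists>C. C \<noteq> 0 \<and> (\<forall>k. sk k (of_nat n * moebius_act A \<tau>) =
        C * kl (of_int (k * a) / 7) (of_int (k * b) / 7) ((of_nat p * \<tau> + of_int r) / of_nat m))"
proof -
  define M11 M12 where "M11 = 7 * int n * A $ 1 $ 1" and "M12 = 7 * int n * A $ 1 $ 2"
  define M21 M22 where "M21 = A $ 2 $ 1" and "M22 = A $ 2 $ 2"
  \<comment> \<open>This becomes \<open>p\<close>: dividing the first column by its gcd gives the
    first column of the unimodular factor.\<close>
  define g where "g = gcd M11 M21"
  have detA: "A $ 1 $ 1 * A $ 2 $ 2 - A $ 1 $ 2 * A $ 2 $ 1 = 1" using A by (simp add: SL2Z_iff)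
  have detM: "M11 * M22 - M12 * M21 = 7 * int n"
    unfolding M11_def M12_def M21_def M22_def using arg_cong[OF detA, of "\<lambda>x. 7 * int n * x"] by (simp add: algebra_simps)
  have g0: "g > 0"
  proof -
    have "M11 \<noteq> 0 \<or> M21 \<noteq> 0" using detM n by auto
    thus ?thesis by (simp add: g_def)
  qed
  obtain a where a: "M11 = g * a" by (metis g_def gcd_dvd1 dvdE)
  obtain c where c: "M21 = g * c" by (metis g_def gcd_dvd2 dvdE)
  obtain u v where "u * M11 + v * M21 = g" using bezout_int[of M11 M21] unfolding g_def by metis
  hence "g * (u * a + v * c) = g * 1" by (simp add: a c algebra_simps)
  hence uv: "u * a + v * c = 1" using g0 by simp
  define b d where "b = - v" and "d = u"
  have det: "a * d - b * c = 1" using uv by (simp add: b_def d_def algebra_simps)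
  define r where "r = d * M12 - b * M22"
  define m where "m = a * M22 - c * M12"
  have gm: "g * m = 7 * int n" using detM by (simp add: m_def a c algebra_simps)
  hence m0: "m > 0" using g0 n by (metis of_nat_0_less_iff zero_less_mult_pos zero_less_numeral zero_less_mult_iff)
  have r1: "a * r + b * m = M12"
  proof -
    have "a * r + b * m = (a * d - b * c) * M12" by (simp add: r_def m_def algebra_simps)
    thus ?thesis by (simp add: det)
  qed
  have r2: "c * r + d * m = M22"
  proof -
    have "c * r + d * m = (a * d - b * c) * M22" by (simp add: r_def m_def algebra_simps)
    thus ?thesis by (simp add: det)
  qed
  show ?thesis
  proof (rule that[of a d b c "nat g" "nat m" r])
    show "int (nat g) * int (nat m) = 7 * int n" using gm g0 m0 by simp
    show "a * int (nat g) = 7 * int n * A $ 1 $ 1" using g0 a by (simp add: M11_def mult.commute)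
    show "c * int (nat g) = A $ 2 $ 1" using g0 c by (simp add: M21_def mult.commute)
    fix \<tau> assume \<tau>: "\<tau> \<in> uhp"
    define \<sigma> where "\<sigma> = (of_nat (nat g) * \<tau> + of_int r) / of_nat (nat m)"
    have gc: "(of_nat (nat g) :: complex) = of_int g" "(of_nat (nat m) :: complex) = of_int m" using g0 m0 by auto
    have im: "Im \<sigma> > 0" unfolding \<sigma>_def using \<tau> g0 m0 by (simp add: uhp_def Im_divide_of_nat)
    have sm: "\<sigma> * of_int m = of_int g * \<tau> + of_int r" unfolding \<sigma>_def gc using m0 by simp
    have lin: "(of_int x * \<sigma> + of_int y) * of_int m = of_int (x * g) * \<tau> + of_int (x * r + y * m)" for x y :: int
    proof -
      have "(of_int x * \<sigma> + of_int y) * of_int m = of_int x * (\<sigma> * of_int m) + of_int y * of_int m" by (simp add: algebra_simps)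
      thus ?thesis unfolding sm by (simp add: algebra_simps)
    qed
    have "(of_int a * \<sigma> + of_int b) / (of_int c * \<sigma> + of_int d) =
        ((of_int a * \<sigma> + of_int b) * of_int m) / ((of_int c * \<sigma> + of_int d) * of_int m)" using m0 by simp
    also have "\<dots> = (of_int M11 * \<tau> + of_int M12) / (of_int M21 * \<tau> + of_int M22)"
      unfolding lin r1 r2 by (simp add: a c mult.commute)
    also have "\<dots> = 7 * (of_nat n * moebius_act A \<tau>)"
      by (simp add: M11_def M12_def M21_def M22_def moebius_act_def algebra_simps)
    finally have eq: "(of_int a * \<sigma> + of_int b) / (of_int c * \<sigma> + of_int d) = 7 * (of_nat n * moebius_act A \<tau>)" .
    obtain C where C: "C \<noteq> 0" "\<And>\<alpha> \<beta>. kl \<alpha> \<beta> (7 * (of_nat n * moebius_act A \<tau>)) =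
       C * kl (\<alpha> * of_int a + \<beta> * of_int c) (\<alpha> * of_int b + \<beta> * of_int d) \<sigma>"
      using kl_modular[OF det im] unfolding eq by blast
    have "sk k (of_nat n * moebius_act A \<tau>) = C * kl (of_int (k * a) / 7) (of_int (k * b) / 7) \<sigma>" for k
      unfolding sk_def C(2) by simp
    thus "\<exists>C. C \<noteq> 0 \<and> (\<forall>k. sk k (of_nat n * moebius_act A \<tau>) =
        C * kl (of_int (k * a) / 7) (of_int (k * b) / 7) ((of_nat (nat g) * \<tau> + of_int r) / of_nat (nat m)))"
      using C(1) unfolding \<sigma>_def by blast
  qed (use g0 m0 det in auto)
qed

lemma sk_ratio_mero_ioo:
  assumes A: "A \<in> SL2Z" and n: "n > 0"
  shows "mero_ioo (\<lambda>\<tau>. sk j (of_nat n * moebius_act A \<tau>) / sk k (of_nat n * moebius_act A \<tau>))"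
proof -
  obtain a b c d r :: int and p m :: nat where *: "p > 0" "m > 0"
    "\<And>\<tau>. \<tau> \<in> uhp \<Longrightarrow> \<exists>C. C \<noteq> 0 \<and> (\<forall>k. sk k (of_nat n * moebius_act A \<tau>) =
        C * kl (of_int (k * a) / 7) (of_int (k * b) / 7) ((of_nat p * \<tau> + of_int r) / of_nat m))"
    using sk_any_cusp[OF A n] by metis
  have "mero_ioo (\<lambda>\<tau>. kl (of_int (j * a) / 7) (of_int (j * b) / 7) ((of_nat p * \<tau> + of_int r) / of_nat m) /
      kl (of_int (k * a) / 7) (of_int (k * b) / 7) ((of_nat p * \<tau> + of_int r) / of_nat m))"
    by (intro mero_ioo_divide mero_ioo_linear[OF kl_mero_ioo *(1,2)])
  thus ?thesis
  proof (rule mero_ioo_cong)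
    show "\<forall>\<^sub>F \<tau> in ioo. kl (of_int (j * a) / 7) (of_int (j * b) / 7) ((of_nat p * \<tau> + of_int r) / of_nat m) /
      kl (of_int (k * a) / 7) (of_int (k * b) / 7) ((of_nat p * \<tau> + of_int r) / of_nat m) =
      sk j (of_nat n * moebius_act A \<tau>) / sk k (of_nat n * moebius_act A \<tau>)"
      unfolding eventually_ioo
    proof (intro exI[of _ 1] conjI allI impI)
      fix \<tau> :: complex assume "Im \<tau> > 1"
      hence "\<tau> \<in> uhp" by (simp add: uhp_def)
      then obtain C where "C \<noteq> 0" "\<And>k. sk k (of_nat n * moebius_act A \<tau>) =
        C * kl (of_int (k * a) / 7) (of_int (k * b) / 7) ((of_nat p * \<tau> + of_int r) / of_nat m)" using *(3) by blast
      thus "kl (of_int (j * a) / 7) (of_int (j * b) / 7) ((of_nat p * \<tau> + of_int r) / of_nat m) /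
        kl (of_int (k * a) / 7) (of_int (k * b) / 7) ((of_nat p * \<tau> + of_int r) / of_nat m) =
        sk j (of_nat n * moebius_act A \<tau>) / sk k (of_nat n * moebius_act A \<tau>)" by simp
    qed simp
  qed
qed

section \<open>The quotients as elements of the function field\<close>

definition Phi1 :: "nat \<Rightarrow> mero_uhp" where "Phi1 n = mero_of (\<lambda>\<tau>. phi1 (of_nat n * \<tau>))"
definition Phi2 :: mero_uhp where "Phi2 = mero_of phi2"

lemma phi1_nat_holomorphic: "n > 0 \<Longrightarrow> (\<lambda>\<tau>. phi1 (of_nat n * \<tau>)) holomorphic_on uhp"
  using phi_scaled_holomorphic(1)[of "real n"] by simp

lemma eval_Phi:
  assumes "\<tau> \<in> uhp"
  shows "n > 0 \<Longrightarrow> eval_mero (Phi1 n) \<tau> = phi1 (of_nat n * \<tau>)" "eval_mero Phi2 \<tau> = phi2 \<tau>"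
  unfolding Phi1_def Phi2_def using assms phi_holomorphic phi1_nat_holomorphic by (auto simp: eval_mero_of_holomorphic)

lemma eval_Phi_holomorphic: "n > 0 \<Longrightarrow> eval_mero (Phi1 n) holomorphic_on uhp" "eval_mero Phi2 holomorphic_on uhp"
  using phi1_nat_holomorphic[of n] phi_holomorphic(2) eval_Phi by (auto elim!: holomorphic_transform)

lemma cusps_Phi1: "n > 0 \<Longrightarrow> cusps (Phi1 n)"
  unfolding cusps_def
proof
  fix A assume n: "n > 0" and A: "A \<in> SL2Z"
  show "mero_ioo (eval_mero (act A (Phi1 n)))"
    by (rule mero_ioo_cong[OF sk_ratio_mero_ioo[OF A n, of 3 2]])
       (unfold eventually_ioo, rule exI[of _ 1], use n A in \<open>auto simp: eval_act eval_Phi moebius_facts phi1_eq uhp_def\<close>)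
qed

lemma cusps_Phi2: "cusps Phi2"
  unfolding cusps_def
proof
  fix A assume A: "A \<in> SL2Z"
  have "mero_ioo (\<lambda>\<tau>. sk 2 (moebius_act A \<tau>) / sk 1 (moebius_act A \<tau>))" using sk_ratio_mero_ioo[OF A, of 1 2 1] by simp
  thus "mero_ioo (eval_mero (act A Phi2))"
    by (rule mero_ioo_cong)
       (unfold eventually_ioo, rule exI[of _ 1], use A in \<open>auto simp: eval_act eval_Phi moebius_facts phi2_eq uhp_def\<close>)
qed

lemma cusps_power: "cusps f \<Longrightarrow> cusps (f ^ n)"
  by (induction n) (auto intro: cusps_mult simp: cusps_const[of 1, unfolded mero_const_1])

lemma eval_power_hol:
  assumes "eval_mero f holomorphic_on uhp"
  shows "eval_mero (f ^ n) holomorphic_on uhp" "z \<in> uhp \<Longrightarrow> eval_mero (f ^ n) z = eval_mero f z ^ n"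
proof -
  have "eval_mero (f ^ n) holomorphic_on uhp \<and> (\<forall>z\<in>uhp. eval_mero (f ^ n) z = eval_mero f z ^ n)"
    using eval_const_holomorphic[of 1] assms
    by (induction n) (auto simp: eval_hol_ops eval_const[of _ 1, unfolded mero_const_1] mero_const_1)
  thus "eval_mero (f ^ n) holomorphic_on uhp" "z \<in> uhp \<Longrightarrow> eval_mero (f ^ n) z = eval_mero f z ^ n" by auto
qed

lemma eval_upsilon_psi:
  assumes "\<tau> \<in> uhp"
  shows "eval_mero \<upsilon> \<tau> = sk 2 \<tau> ^ 2 * sk 3 \<tau> / sk 1 \<tau> ^ 3" "eval_mero \<psi> \<tau> = sk 2 \<tau> * sk 3 \<tau> / sk 1 \<tau> ^ 2"
proof -
  have e: "(\<lambda>\<tau>. theta_a 2 \<tau> ^ 2 * theta_a 3 \<tau> / theta_a 1 \<tau> ^ 3) = (\<lambda>\<tau>. sk 2 \<tau> ^ 2 * sk 3 \<tau> / sk 1 \<tau> ^ 3)"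
    "(\<lambda>\<tau>. - (theta_a 2 \<tau> * theta_a 3 \<tau>) / theta_a 1 \<tau> ^ 2) = (\<lambda>\<tau>. sk 2 \<tau> * sk 3 \<tau> / sk 1 \<tau> ^ 2)"
    by (auto simp: theta_a_eq_sk power_mult_distrib power3_eq_cube power2_eq_square mult_ac)
  have h: "(\<lambda>\<tau>. sk 2 \<tau> ^ 2 * sk 3 \<tau> / sk 1 \<tau> ^ 3) holomorphic_on uhp"
    "(\<lambda>\<tau>. sk 2 \<tau> * sk 3 \<tau> / sk 1 \<tau> ^ 2) holomorphic_on uhp"
    by (intro holomorphic_intros sk_holomorphic; use sk_123_nonzero in \<open>simp add: uhp_def\<close>)+
  show "eval_mero \<upsilon> \<tau> = sk 2 \<tau> ^ 2 * sk 3 \<tau> / sk 1 \<tau> ^ 3" "eval_mero \<psi> \<tau> = sk 2 \<tau> * sk 3 \<tau> / sk 1 \<tau> ^ 2"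
    unfolding upsilon_def psi_def e using h assms by (simp_all add: eval_mero_of_holomorphic)
qed

lemma upsilon_psi_Phi: "\<upsilon> = Phi1 1 * Phi2 ^ 3" "\<psi> = Phi1 1 * Phi2 ^ 2"
proof -
  have *: "eval_mero (Phi1 1 * Phi2 ^ n) \<tau> = phi1 \<tau> * phi2 \<tau> ^ n" if "\<tau> \<in> uhp" for n \<tau>
    using that eval_Phi(1)[OF that, of 1] eval_Phi(2)[OF that] eval_Phi_holomorphic(1)[of 1]
      eval_power_hol[OF eval_Phi_holomorphic(2)] by (simp add: eval_hol_ops del: One_nat_def)
  have nz: "sk 1 \<tau> \<noteq> 0" "sk 2 \<tau> \<noteq> 0" if "\<tau> \<in> uhp" for \<tau> using sk_123_nonzero that by (auto simp: uhp_def)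
  show "\<upsilon> = Phi1 1 * Phi2 ^ 3"
  proof (rule mero_eqI)
    fix \<tau> assume \<tau>: "\<tau> \<in> uhp"
    show "eval_mero \<upsilon> \<tau> = eval_mero (Phi1 1 * Phi2 ^ 3) \<tau>"
      unfolding *[OF \<tau>] eval_upsilon_psi[OF \<tau>] phi1_eq phi2_eq using nz[OF \<tau>]
      by (simp add: field_simps power2_eq_square power3_eq_cube)
  qed
  show "\<psi> = Phi1 1 * Phi2 ^ 2"
  proof (rule mero_eqI)
    fix \<tau> assume \<tau>: "\<tau> \<in> uhp"
    show "eval_mero \<psi> \<tau> = eval_mero (Phi1 1 * Phi2 ^ 2) \<tau>"
      unfolding *[OF \<tau>] eval_upsilon_psi[OF \<tau>] phi1_eq phi2_eq using nz[OF \<tau>]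
      by (simp add: field_simps power2_eq_square)
  qed
qed

lemma upsilon_psi_holomorphic: "eval_mero \<upsilon> holomorphic_on uhp" "eval_mero \<psi> holomorphic_on uhp"
  unfolding upsilon_psi_Phi by (intro eval_hol_ops eval_power_hol eval_Phi_holomorphic; simp)+

lemma cusps_upsilon_psi: "cusps \<upsilon>" "cusps \<psi>"
  unfolding upsilon_psi_Phi by (intro cusps_mult cusps_power cusps_Phi1 cusps_Phi2; simp)+

lemma act_Phi_Gamma1:
  fixes A :: "int ^ 2 ^ 2"
  assumes A: "A \<in> Gamma1_7"
  shows "act A (Phi1 1) = mero_const (zeta7 (- A $ 1 $ 2)) * Phi1 1" "act A Phi2 = mero_const (zeta7 (5 * A $ 1 $ 2)) * Phi2"
  by (rule mero_eqI; use Gamma1_7_D(1)[OF A] eval_Phi_holomorphic(1)[of 1] eval_Phi_holomorphic(2) eval_const_holomorphic A in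
      \<open>simp add: eval_act eval_Phi moebius_facts phi1_Gamma1 phi2_Gamma1 eval_hol_ops eval_const del: One_nat_def\<close>)+

lemma mero_const_power: "mero_const c ^ n = mero_const (c ^ n)"
  by (induction n) (simp_all add: mero_const_1 mero_const_mult)

text \<open>The root of unity of \<open>Phi1 1 * Phi2 ^ n\<close> has exponent
  \<open>(5 * n - 1) * b\<close>: this is \<open>14 * b\<close> for \<upsilon> with
  \<open>n = 3\<close>, and \<open>9 * b\<close> for \<psi> with \<open>n = 2\<close>.\<close>

lemma act_upsilon_psi_Gamma1:
  fixes A :: "int ^ 2 ^ 2"
  assumes A: "A \<in> Gamma1_7"
  shows "act A \<upsilon> = \<upsilon>" "act A \<psi> = mero_const (zeta7 (2 * A $ 1 $ 2)) * \<psi>"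
proof -
  note S = Gamma1_7_D(1)[OF A]
  have "act A (Phi1 1 * Phi2 ^ n) = mero_const (zeta7 (- A $ 1 $ 2 + int n * (5 * A $ 1 $ 2))) * (Phi1 1 * Phi2 ^ n)" for n
  proof -
    have "act A (Phi1 1 * Phi2 ^ n) = mero_const (zeta7 (- A $ 1 $ 2)) * Phi1 1 * (mero_const (zeta7 (int n * (5 * A $ 1 $ 2))) * Phi2 ^ n)"
      by (simp only: act_mult[OF S] act_power[OF S] act_Phi_Gamma1[OF A] power_mult_distrib mero_const_power zeta7_power)
    thus ?thesis unfolding zeta7_add mero_const_mult by (simp only: mult_ac)
  qed
  note * = this[of 3] this[of 2]
  have "zeta7 (- A $ 1 $ 2 + int 3 * (5 * A $ 1 $ 2)) = 1" "zeta7 (- A $ 1 $ 2 + int 2 * (5 * A $ 1 $ 2)) = zeta7 (2 * A $ 1 $ 2)"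
    by (simp add: zeta7_eq_1_iff, rule zeta7_cong, simp)
  thus "act A \<upsilon> = \<upsilon>" "act A \<psi> = mero_const (zeta7 (2 * A $ 1 $ 2)) * \<psi>"
    unfolding upsilon_psi_Phi using * by (simp_all add: mero_const_1)
qed

section \<open>The Hauptmodul of level 7\<close>

text \<open>The denominator 56 is that of the exponents of the theta series: \<open>sk 1\<close>,
  \<open>sk 2\<close>, \<open>sk 3\<close> have the leading exponents 25, 9 and 1, the squares
  \<open>(7 - 2 * k) ^ 2\<close>, over 56.\<close>

definition ex56 :: "int \<Rightarrow> complex \<Rightarrow> complex" where
  "ex56 x \<tau> = exp (2 * of_real pi * \<i> * \<tau> * of_int x / 56)"

lemma ex56_nonzero [simp]: "ex56 x \<tau> \<noteq> 0" by (simp add: ex56_def)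

lemma ex56_add: "ex56 (x + y) \<tau> = ex56 x \<tau> * ex56 y \<tau>"
  unfolding ex56_def exp_add[symmetric] by (rule arg_cong[where f = exp]) (simp add: algebra_simps add_divide_distrib)

lemma ex56_0 [simp]: "ex56 0 \<tau> = 1" by (simp add: ex56_def)

lemma ex56_power: "ex56 x \<tau> ^ n = ex56 (int n * x) \<tau>"
  by (induction n) (simp_all add: ex56_add algebra_simps)

lemma ex56_minus: "ex56 (- x) \<tau> = inverse (ex56 x \<tau>)"
  using ex56_add[of x "- x" \<tau>] by (simp add: field_simps)

lemma ex56_qx: "ex56 56 \<tau> = qx 1 \<tau>" by (simp add: ex56_def qx_def mult_ac)

lemma ex56_tendsto_0: "x > 0 \<Longrightarrow> (ex56 x \<longlongrightarrow> 0) ioo"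
proof -
  assume x: "x > 0"
  have "(qx 56 \<longlongrightarrow> 0) ioo" using qx_tendsto_0[of 56] by (simp add: filterlim_at)
  hence "((\<lambda>\<tau>. qx 56 \<tau> ^ nat x) \<longlongrightarrow> 0 ^ nat x) ioo" by (intro tendsto_intros)
  moreover have "(\<lambda>\<tau>. qx 56 \<tau> ^ nat x) = ex56 x"
    unfolding qx_def ex56_def exp_of_nat_mult[symmetric] using x by (intro ext arg_cong[where f = exp]) (simp add: mult_ac)
  moreover have "0 ^ nat x = (0::complex)" using x by simp
  ultimately show ?thesis by simp
qed

lemma sk_leading:
  assumes "k \<in> {1, 2, 3::int}"
  shows "((\<lambda>\<tau>. sk k \<tau> * ex56 (- ((7 - 2 * k)\<^sup>2)) \<tau>) \<longlongrightarrow> - \<i>) ioo"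
proof -
  have "filterlim (\<lambda>\<tau>. 7 * \<tau>) ioo ioo" using filterlim_ioo_linear[of 7 1 0] by simp
  from filterlim_compose[OF kl_leading[OF assms] this]
  have "((\<lambda>\<tau>. sk k \<tau> * exp (- (of_real pi * \<i> * (7 * \<tau>) * of_int ((7 - 2 * k)\<^sup>2) / 196))) \<longlongrightarrow> - \<i>) ioo"
    by (simp add: sk_def)
  also have "(\<lambda>\<tau>. exp (- (of_real pi * \<i> * (7 * \<tau>) * of_int ((7 - 2 * k)\<^sup>2) / 196))) = ex56 (- ((7 - 2 * k)\<^sup>2))"
    unfolding ex56_def by (intro ext arg_cong[where f = exp]) simp
  finally show ?thesis by (simp add: fun_eq_iff)
qed

lemma sk_leading_123:
  "((\<lambda>\<tau>. sk 1 \<tau> * ex56 (- 25) \<tau>) \<longlongrightarrow> - \<i>) ioo" "((\<lambda>\<tau>. sk 2 \<tau> * ex56 (- 9) \<tau>) \<longlongrightarrow> - \<i>) ioo"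
  "((\<lambda>\<tau>. sk 3 \<tau> * ex56 (- 1) \<tau>) \<longlongrightarrow> - \<i>) ioo"
  using sk_leading[of 1] sk_leading[of 2] sk_leading[of 3] by simp_all

lemma monomial_leading:
  assumes i: "((\<lambda>\<tau>. sk i \<tau> * ex56 (- x) \<tau>) \<longlongrightarrow> - \<i>) ioo" and j: "((\<lambda>\<tau>. sk j \<tau> * ex56 (- y) \<tau>) \<longlongrightarrow> - \<i>) ioo"
    and k: "((\<lambda>\<tau>. sk k \<tau> * ex56 (- z) \<tau>) \<longlongrightarrow> - \<i>) ioo"
  shows "((\<lambda>\<tau>. sk i \<tau> ^ 2 * sk j \<tau> / sk k \<tau> ^ 3 * ex56 (3 * z - 2 * x - y) \<tau>) \<longlongrightarrow> 1) ioo"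
proof -
  have "((\<lambda>\<tau>. (sk i \<tau> * ex56 (- x) \<tau>) ^ 2 * (sk j \<tau> * ex56 (- y) \<tau>) / (sk k \<tau> * ex56 (- z) \<tau>) ^ 3) \<longlongrightarrow> (- \<i>) ^ 2 * (- \<i>) / (- \<i>) ^ 3) ioo"
    by (intro tendsto_intros i j k) simp
  moreover have "(sk i \<tau> * ex56 (- x) \<tau>) ^ 2 * (sk j \<tau> * ex56 (- y) \<tau>) / (sk k \<tau> * ex56 (- z) \<tau>) ^ 3 =
      sk i \<tau> ^ 2 * sk j \<tau> / sk k \<tau> ^ 3 * ex56 (3 * z - 2 * x - y) \<tau>" for \<tau>
  proof -
    have "ex56 (3 * z - 2 * x - y) \<tau> = ex56 (int 2 * (- x)) \<tau> * ex56 (- y) \<tau> * ex56 (int 3 * z) \<tau>"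
      unfolding ex56_add[symmetric] by (rule arg_cong2[where f = ex56]) auto
    also have "\<dots> = ex56 (- x) \<tau> ^ 2 * ex56 (- y) \<tau> / ex56 (- z) \<tau> ^ 3"
      unfolding ex56_power[symmetric] ex56_minus[of z] by (simp add: power_inverse field_simps)
    finally show ?thesis by (simp add: power_mult_distrib)
  qed
  ultimately show ?thesis by (simp add: power2_eq_square power3_eq_cube)
qed

text \<open>If 7 does not divide \<open>c\<close>, the gcd \<open>p\<close> is 1 and the first
  characteristics are the integers \<open>k * A $ 1 $ 1\<close>. After their removal all three forms
  have the same leading factor \<open>exp (\<pi> i \<sigma> / 4)\<close>, so the quotient of degree
  zero converges.\<close>

lemma upsilon_tendsto_noncusp:
  assumes A: "A \<in> SL2Z" and c: "\<not> 7 dvd (A :: int ^ 2 ^ 2) $ 2 $ 1"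
  shows "\<exists>L. (eval_mero (act A \<upsilon>) \<longlongrightarrow> L) ioo"
proof -
  obtain a b c' d r :: int and p m :: nat where *: "a * d - b * c' = 1" "p > 0" "m > 0" "int p * int m = 7 * int 1"
    "a * int p = 7 * int 1 * A $ 1 $ 1" "c' * int p = A $ 2 $ 1"
    "\<And>\<tau>. \<tau> \<in> uhp \<Longrightarrow> \<exists>C. C \<noteq> 0 \<and> (\<forall>k. sk k (of_nat 1 * moebius_act A \<tau>) =
        C * kl (of_int (k * a) / 7) (of_int (k * b) / 7) ((of_nat p * \<tau> + of_int r) / of_nat m))"
    using sk_any_cusp[OF A, of 1] by (metis zero_less_one)
  have "\<not> 7 dvd int p" using c *(6) by (metis dvd_mult)
  moreover have "int p dvd 7" using *(4) by (metis dvd_triv_left mult.right_neutral of_nat_1)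
  moreover have "int p \<le> 7" using \<open>int p dvd 7\<close> zdvd_imp_le by fastforce
  ultimately have p: "p = 1"
  proof -
    have "int p \<in> {1..7}" using \<open>int p \<le> 7\<close> *(2) by auto
    hence "int p \<in> {1,2,3,4,5,6,7}" by (simp add: atLeastAtMost_iff) presburger
    thus ?thesis using \<open>\<not> 7 dvd int p\<close> \<open>int p dvd 7\<close> by auto
  qed
  have m: "m = 7" using *(4) p by simp
  have a: "a = 7 * A $ 1 $ 1" using *(5) p by simp
  \<comment> \<open>This keeps the second characteristics \<open>k * b / 7\<close> off the integers,
    where the leading coefficient would vanish.\<close>
  have b7: "\<not> 7 dvd b"
  proof
    assume "7 dvd b"
    hence "7 dvd a * d - b * c'" using a by simp
    thus False using *(1) by simp
  qed
  define \<beta> where "\<beta> k = real_of_int (k * b) / 7" for k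
  have \<beta>: "\<beta> k \<notin> \<int>" if "k \<in> {1,2,3}" for k
  proof
    assume "\<beta> k \<in> \<int>"
    then obtain j where "\<beta> k = of_int j" by (elim Ints_cases)
    hence "real_of_int (k * b) = of_int (7 * j)" by (simp add: \<beta>_def)
    hence "k * b = 7 * j" unfolding of_int_eq_iff .
    moreover have "7 dvd k * b \<Longrightarrow> 7 dvd b" using that by (auto; presburger)
    ultimately show False using b7 by simp
  qed
  define w where "w k = (- 1) powi (k * A $ 1 $ 1) * exp (of_real pi * \<i> * of_real (- (of_int (k * A $ 1 $ 1) * \<beta> k)))" for k
  have wnz: "w k \<noteq> 0" for k by (simp add: w_def)
  define \<sigma> where "\<sigma> \<tau> = (of_nat 1 * \<tau> + of_int r) / of_nat 7" for \<tau> :: complex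
  have kl_eq: "kl (of_int (k * a) / 7) (of_int (k * b) / 7) t = w k * kl 0 (\<beta> k) t" for k t
    using kl_add_int[of 0 "k * A $ 1 $ 1" "\<beta> k" 0 t] by (simp add: a w_def \<beta>_def)
  have lim: "\<exists>c. c \<noteq> 0 \<and> ((\<lambda>\<tau>. kl 0 (\<beta> k) (\<sigma> \<tau>) * exp (- (of_real pi * \<i> * \<sigma> \<tau> / 4))) \<longlongrightarrow> c) ioo" if k: "k \<in> {1,2,3}" for k
  proof -
    obtain c where c: "c \<noteq> 0" "((\<lambda>\<tau>. kl 0 (\<beta> k) \<tau> * exp (- (of_real pi * \<i> * \<tau> / 4))) \<longlongrightarrow> c) ioo"
      using kl_zero_leading[OF \<beta>[OF k]] by blast
    have "filterlim \<sigma> ioo ioo" unfolding \<sigma>_def[abs_def] by (rule filterlim_ioo_linear) auto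
    thus ?thesis using c filterlim_compose[OF c(2)] by blast
  qed
  obtain c1 where c1: "c1 \<noteq> 0" "((\<lambda>\<tau>. kl 0 (\<beta> 1) (\<sigma> \<tau>) * exp (- (of_real pi * \<i> * \<sigma> \<tau> / 4))) \<longlongrightarrow> c1) ioo" using lim[of 1] by auto
  obtain c2 where c2: "((\<lambda>\<tau>. kl 0 (\<beta> 2) (\<sigma> \<tau>) * exp (- (of_real pi * \<i> * \<sigma> \<tau> / 4))) \<longlongrightarrow> c2) ioo" using lim[of 2] by auto
  obtain c3 where c3: "((\<lambda>\<tau>. kl 0 (\<beta> 3) (\<sigma> \<tau>) * exp (- (of_real pi * \<i> * \<sigma> \<tau> / 4))) \<longlongrightarrow> c3) ioo" using lim[of 3] by auto
  define kX where "kX k \<tau> = kl 0 (\<beta> k) (\<sigma> \<tau>) * exp (- (of_real pi * \<i> * \<sigma> \<tau> / 4))" for k \<tau>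
  have "((\<lambda>\<tau>. w 2 ^ 2 * w 3 / w 1 ^ 3 * (kX 2 \<tau> ^ 2 * kX 3 \<tau> / kX 1 \<tau> ^ 3)) \<longlongrightarrow> w 2 ^ 2 * w 3 / w 1 ^ 3 * (c2 ^ 2 * c3 / c1 ^ 3)) ioo"
    unfolding kX_def by (intro tendsto_intros c1 c2 c3) (use c1 in simp)
  moreover have "eventually (\<lambda>\<tau>. w 2 ^ 2 * w 3 / w 1 ^ 3 * (kX 2 \<tau> ^ 2 * kX 3 \<tau> / kX 1 \<tau> ^ 3) = eval_mero (act A \<upsilon>) \<tau>) ioo"
    unfolding eventually_ioo
  proof (intro exI[of _ 1] conjI allI impI)
    fix \<tau> :: complex assume "Im \<tau> > 1"
    hence \<tau>: "\<tau> \<in> uhp" by (simp add: uhp_def)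
    obtain C where C: "C \<noteq> 0" "\<And>k. sk k (moebius_act A \<tau>) = C * (w k * kl 0 (\<beta> k) (\<sigma> \<tau>))"
      using *(7)[OF \<tau>] unfolding p m kl_eq \<sigma>_def[symmetric] by auto
    define e where "e = exp (- (of_real pi * \<i> * \<sigma> \<tau> / 4))"
    have "e \<noteq> 0" by (simp add: e_def)
    hence C': "sk k (moebius_act A \<tau>) = (C / e) * (w k * kX k \<tau>)" for k by (simp add: C(2) kX_def e_def)
    have "eval_mero (act A \<upsilon>) \<tau> = sk 2 (moebius_act A \<tau>) ^ 2 * sk 3 (moebius_act A \<tau>) / sk 1 (moebius_act A \<tau>) ^ 3"
      using A \<tau> by (simp add: eval_act eval_upsilon_psi moebius_facts)
    also have "\<dots> = (C / e) ^ 3 * (w 2 ^ 2 * w 3 * (kX 2 \<tau> ^ 2 * kX 3 \<tau>)) / ((C / e) ^ 3 * (w 1 ^ 3 * kX 1 \<tau> ^ 3))"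
      unfolding C' by (simp only: power_mult_distrib power3_eq_cube power2_eq_square mult_ac)
    also have "\<dots> = w 2 ^ 2 * w 3 / w 1 ^ 3 * (kX 2 \<tau> ^ 2 * kX 3 \<tau> / kX 1 \<tau> ^ 3)"
      using C(1) \<open>e \<noteq> 0\<close> by simp
    finally show "w 2 ^ 2 * w 3 / w 1 ^ 3 * (kX 2 \<tau> ^ 2 * kX 3 \<tau> / kX 1 \<tau> ^ 3) = eval_mero (act A \<upsilon>) \<tau>" by simp
  qed simp
  ultimately have "(eval_mero (act A \<upsilon>) \<longlongrightarrow> w 2 ^ 2 * w 3 / w 1 ^ 3 * (c2 ^ 2 * c3 / c1 ^ 3)) ioo" by (rule Lim_transform_eventually)
  thus ?thesis by blast
qed

text \<open>\<open>- A\<close> acts like \<open>A\<close>, but \<open>Gamma1_7\<close> does not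
  contain the negative of the identity; both signs have to be considered when the cusp infinity is
  recognised.\<close>

definition mneg :: "int ^ 2 ^ 2 \<Rightarrow> int ^ 2 ^ 2" where
  "mneg A = mat2 (- (A $ 1 $ 1)) (- (A $ 1 $ 2)) (- (A $ 2 $ 1)) (- (A $ 2 $ 2))"

lemma act_neg:
  assumes "A \<in> SL2Z"
  shows "mneg A \<in> SL2Z" "act A f = act (mneg A) f"
proof -
  show S: "mneg A \<in> SL2Z" using assms by (simp add: SL2Z_iff mneg_def)
  have "moebius_act (mneg A) z = moebius_act A z" for z
  proof -
    have "moebius_act (mneg A) z =
        (- (of_int (A $ 1 $ 1) * z + of_int (A $ 1 $ 2))) / (- (of_int (A $ 2 $ 1) * z + of_int (A $ 2 $ 2)))"
      by (simp add: moebius_act_def mneg_def)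
    also have "\<dots> = moebius_act A z" unfolding moebius_act_def by (simp only: divide_minus_left divide_minus_right minus_minus)
    finally show ?thesis .
  qed
  thus "act A f = act (mneg A) f"
    by (intro mero_eqI) (simp add: eval_act assms S)
qed

text \<open>For 7 dividing \<open>c\<close> only \<open>r = a mod 7\<close> matters. The residues 1
  and 6 give the cusp infinity. The others multiply the indices by \<open>r\<close>, which up to
  sign permutes 1, 2, 3 cyclically and changes the monomial into one without a pole.\<close>

lemma upsilon_cusp_behaviour:
  fixes A :: "int ^ 2 ^ 2"
  assumes A: "A \<in> SL2Z"
  shows "(\<forall>f\<in>\<A>\<^sub>0 Gamma1_7. act A f = f) \<or> (\<exists>L. (eval_mero (act A \<upsilon>) \<longlongrightarrow> L) ioo)"
proof (cases "7 dvd A $ 2 $ 1")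
  case False
  thus ?thesis using upsilon_tendsto_noncusp[OF A] by blast
next
  case c: True
  define a where "a = A $ 1 $ 1"
  define q where "q = a div 7"
  define r where "r = a mod 7"
  have aq: "a = r + 7 * q" by (simp add: q_def r_def)
  have "\<not> 7 dvd a"
  proof
    assume "7 dvd a"
    hence "7 dvd a * A $ 2 $ 2 - A $ 1 $ 2 * A $ 2 $ 1" using c by simp
    thus False using A by (simp add: SL2Z_iff a_def)
  qed
  hence r0: "r \<noteq> 0" by (auto simp: r_def dvd_eq_mod_eq_0)
  have rr: "r \<in> {1, 2, 3, 4, 5, 6}"
  proof -
    have "0 \<le> r" "r < 7" by (simp_all add: r_def)
    thus ?thesis using r0 by (simp, presburger)
  qed
  show ?thesis
  proof (cases "r \<in> {1, 6}")
    case True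
    have "act A f = f" if f: "f \<in> \<A>\<^sub>0 Gamma1_7" for f
    proof (cases "r = 1")
      case True
      hence "A \<in> Gamma1_7" using A c aq by (simp add: Gamma1_7_def a_def)
      thus ?thesis using f modular_functions_iff[OF Gamma1_7_subset] by blast
    next
      case False
      hence "r = 6" using \<open>r \<in> {1, 6}\<close> by simp
      hence "- a - 1 = 7 * (- q - 1)" using aq by simp
      hence "7 dvd - a - 1" by (metis dvd_triv_left)
      hence "mneg A \<in> Gamma1_7"
        using act_neg(1)[OF A] c by (simp add: Gamma1_7_def a_def mneg_def)
      thus ?thesis using f act_neg(2)[OF A, of f] modular_functions_iff[OF Gamma1_7_subset] by simp
    qed
    thus ?thesis by blast
  next
    case False
    define e where "e k = exp (of_real pi * \<i> * of_real (of_int (k * A $ 1 $ 2) + of_int (k * A $ 1 $ 2 * (k * A $ 1 $ 1)) / 7))" for k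
    define K where "K = e 2 ^ 2 * e 3 / e 1 ^ 3"
    have ev: "eval_mero (act A \<upsilon>) \<tau> = K * (sk (2 * r) \<tau> ^ 2 * sk (3 * r) \<tau> / sk r \<tau> ^ 3)" if \<tau>: "\<tau> \<in> uhp" for \<tau>
    proof -
      obtain C where C: "C \<noteq> 0" "\<And>k. sk k (moebius_act A \<tau>) = C * (e k * sk (k * a) \<tau>)"
        using sk_Gamma0[OF A c \<tau>] unfolding e_def a_def by blast
      have sa: "sk (k * a) \<tau> = (- 1) powi (k * q) * sk (k * r) \<tau>" for k
        using sk_add_7[of "k * r" "k * q" \<tau>] by (simp add: aq algebra_simps)
      define g where "g = (- 1 :: complex) powi q"
      have g: "g \<noteq> 0" by (simp add: g_def)
      have sg: "sk (2 * a) \<tau> = g ^ 2 * sk (2 * r) \<tau>" "sk (3 * a) \<tau> = g ^ 3 * sk (3 * r) \<tau>" "sk (1 * a) \<tau> = g * sk r \<tau>"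
        unfolding sa g_def by (cases "even q"; simp)+
      have "eval_mero (act A \<upsilon>) \<tau> = sk 2 (moebius_act A \<tau>) ^ 2 * sk 3 (moebius_act A \<tau>) / sk 1 (moebius_act A \<tau>) ^ 3"
        using A \<tau> by (simp add: eval_act eval_upsilon_psi moebius_facts)
      also have "\<dots> = (C ^ 3 * g ^ 3) * (e 2 ^ 2 * e 3 * (sk (2 * r) \<tau> ^ 2 * sk (3 * r) \<tau>)) / ((C ^ 3 * g ^ 3) * (e 1 ^ 3 * sk r \<tau> ^ 3))"
      proof -
        have g2: "g * g = 1" unfolding g_def by (cases "even q") auto
        have "sk 1 (moebius_act A \<tau>) = C * (e 1 * (g * sk r \<tau>))" "sk 2 (moebius_act A \<tau>) = C * (e 2 * sk (2 * r) \<tau>)"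
          "sk 3 (moebius_act A \<tau>) = C * (e 3 * (g * sk (3 * r) \<tau>))"
          unfolding C(2) sg power2_eq_square power3_eq_cube g2 by simp_all
        moreover have "g ^ 3 = g" using g2 by (simp add: power3_eq_cube)
        ultimately show ?thesis by (simp only: power_mult_distrib) (simp add: power2_eq_square power3_eq_cube mult_ac)
      qed
      also have "\<dots> = K * (sk (2 * r) \<tau> ^ 2 * sk (3 * r) \<tau> / sk r \<tau> ^ 3)"
        using C(1) g by (simp add: K_def)
      finally show ?thesis .
    qed
    have s89: "sk 8 \<tau> = - sk 1 \<tau>" "sk 9 \<tau> = - sk 2 \<tau>" "sk 10 \<tau> = - sk 3 \<tau>" "sk 12 \<tau> = - sk 2 \<tau>" "sk 15 \<tau> = sk 1 \<tau>" for \<tau>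
      using sk_add_7[of 1 1 \<tau>] sk_add_7[of 2 1 \<tau>] sk_add_7[of 3 1 \<tau>] sk_add_7[of 5 1 \<tau>] sk_add_7[of 1 2 \<tau>] by (simp_all add: sk_reduce)
    \<comment> \<open>The leading exponents over 56 are \<open>2 * 1 + 25 - 3 * 9 = 0\<close> here
      and \<open>2 * 25 + 9 - 3 * 1 = 56\<close> for the other monomial: a nonzero limit and a
      simple zero.\<close>
    have U1: "((\<lambda>\<tau>. sk 3 \<tau> ^ 2 * sk 1 \<tau> / sk 2 \<tau> ^ 3) \<longlongrightarrow> 1) ioo"
      using monomial_leading[OF sk_leading_123(3,1,2)] by simp
    have "((\<lambda>\<tau>. sk 1 \<tau> ^ 2 * sk 2 \<tau> / sk 3 \<tau> ^ 3 * ex56 (- 56) \<tau> * ex56 56 \<tau>) \<longlongrightarrow> 1 * 0) ioo"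
      using monomial_leading[OF sk_leading_123(1,2,3)] by (intro tendsto_intros ex56_tendsto_0) simp_all
    hence U2: "((\<lambda>\<tau>. sk 1 \<tau> ^ 2 * sk 2 \<tau> / sk 3 \<tau> ^ 3) \<longlongrightarrow> 0) ioo" by (simp add: ex56_minus mult.assoc)
    have "r \<in> {2, 3, 4, 5}" using rr False by auto
    hence "\<exists>L. ((\<lambda>\<tau>. sk (2 * r) \<tau> ^ 2 * sk (3 * r) \<tau> / sk r \<tau> ^ 3) \<longlongrightarrow> L) ioo"
    proof (elim insertE emptyE)
      assume "r = 2" thus ?thesis using U1 by (auto simp: sk_reduce)
    next
      assume "r = 5" thus ?thesis using U1 by (auto simp: sk_reduce s89)
    next
      assume "r = 3" thus ?thesis using tendsto_minus[OF U2] by (auto simp: sk_reduce s89)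
    next
      assume "r = 4" thus ?thesis using tendsto_minus[OF U2] by (auto simp: sk_reduce s89)
    qed
    then obtain L where "((\<lambda>\<tau>. sk (2 * r) \<tau> ^ 2 * sk (3 * r) \<tau> / sk r \<tau> ^ 3) \<longlongrightarrow> L) ioo" by blast
    hence "((\<lambda>\<tau>. K * (sk (2 * r) \<tau> ^ 2 * sk (3 * r) \<tau> / sk r \<tau> ^ 3)) \<longlongrightarrow> K * L) ioo" by (intro tendsto_intros)
    hence "(eval_mero (act A \<upsilon>) \<longlongrightarrow> K * L) ioo"
      by (rule Lim_transform_eventually) (unfold eventually_ioo, rule exI[of _ 1], use ev in \<open>auto simp: uhp_def\<close>)
    thus ?thesis by blast
  qed
qed

text \<open>The leading exponent is \<open>(2 * 9 + 1 - 3 * 25) / 56 = - 1\<close>, so the pole at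
  infinity is simple.\<close>

lemma upsilon_pole: "((\<lambda>\<tau>. eval_mero \<upsilon> \<tau> * qx 1 \<tau>) \<longlongrightarrow> 1) ioo"
proof (rule Lim_transform_eventually)
  show "((\<lambda>\<tau>. sk 2 \<tau> ^ 2 * sk 3 \<tau> / sk 1 \<tau> ^ 3 * ex56 56 \<tau>) \<longlongrightarrow> 1) ioo"
    using monomial_leading[OF sk_leading_123(2,3,1)] by simp
  show "\<forall>\<^sub>F \<tau> in ioo. sk 2 \<tau> ^ 2 * sk 3 \<tau> / sk 1 \<tau> ^ 3 * ex56 56 \<tau> = eval_mero \<upsilon> \<tau> * qx 1 \<tau>"
    unfolding eventually_ioo by (rule exI[of _ 1]) (simp add: eval_upsilon_psi uhp_def ex56_qx)
qed

section \<open>Generators for Gamma_1(7) and for level 7\<close>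

lemma Gamma_subset_Gamma1_7: "\<Gamma>(7) \<subseteq> Gamma1_7" "\<Gamma>(14) \<subseteq> Gamma1_7"
  using Gamma_7_iff Gamma_14_iff by auto

lemma upsilon_Gamma1: "\<upsilon> \<in> \<A>\<^sub>0 Gamma1_7"
  using modular_functions_iff[OF Gamma1_7_subset] act_upsilon_psi_Gamma1(1) cusps_upsilon_psi by blast

interpretation upsilon: hauptmodul Gamma1_7 7 \<upsilon>
proof
  show "mat2 1 1 0 1 \<in> Gamma1_7" by (simp add: Gamma1_7_def SL2Z_iff)
  show "\<exists>l. l \<noteq> 0 \<and> ((\<lambda>\<tau>. eval_mero \<upsilon> \<tau> * qx 1 \<tau>) \<longlongrightarrow> l) ioo" using upsilon_pole by (intro exI[of _ 1]) simp
qed (use Gamma1_7_subset Gamma_subset_Gamma1_7 upsilon_Gamma1 upsilon_psi_holomorphic upsilon_cusp_behaviour in auto)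

lemma congruence_group_Gamma1_7:
  assumes "N = 7 \<or> N = 14"
  obtains R where "congruence_group Gamma1_7 N R"
proof -
  have "N > 0" using assms by auto
  from finite_mcong_reps[OF this, of Gamma1_7]
  obtain R where "finite R" "R \<subseteq> Gamma1_7" "\<And>A. A \<in> Gamma1_7 \<Longrightarrow> \<exists>!B. B \<in> R \<and> mcong N A B" by blast
  hence "congruence_group Gamma1_7 N R"
    using assms Gamma1_7_subset Gamma_subset_Gamma1_7 Gamma1_7_mult Gamma1_7_minv by unfold_locales auto
  thus ?thesis using that by blast
qed

lemma modular_functions_Gamma1_7_subset:
  assumes "C_subfield L" "\<upsilon> \<in> L"
  shows "\<A>\<^sub>0 Gamma1_7 \<subseteq> L"
proof
  fix f assume "f \<in> \<A>\<^sub>0 Gamma1_7"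
  then obtain p q where "f = peval p \<upsilon> / peval q \<upsilon>" using upsilon.hauptmodul_generates by metis
  thus "f \<in> L" using assms by (simp add: C_subfieldD peval_C_subfield)
qed

lemma psi_nonzero: "\<psi> \<noteq> 0"
proof
  assume "\<psi> = 0"
  hence "eval_mero \<psi> \<i> = 0" using eval_const[of \<i> 0] by (simp add: mero_const_0 uhp_def)
  thus False using sk_123_nonzero[of \<i>] by (simp add: eval_upsilon_psi uhp_def)
qed

lemma psi_fixed_imp:
  assumes "A \<in> Gamma1_7" "act A \<psi> = \<psi>"
  shows "A \<in> \<Gamma>(7)"
proof -
  have "mero_const (zeta7 (2 * A $ 1 $ 2)) * \<psi> = 1 * \<psi>" using act_upsilon_psi_Gamma1(2)[OF assms(1)] assms(2) by simp
  hence "mero_const (zeta7 (2 * A $ 1 $ 2)) = mero_const 1" using psi_nonzero unfolding mult_cancel_right mero_const_1 by simp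
  hence "7 dvd 2 * A $ 1 $ 2" by (simp add: mero_const_eq_iff zeta7_eq_1_iff)
  hence "7 dvd A $ 1 $ 2" by presburger
  thus ?thesis using assms(1) by (simp add: Gamma_7_iff)
qed

lemma psi_upsilon_Gamma7: "\<psi> \<in> \<A>\<^sub>0 \<Gamma>(7)" "\<upsilon> \<in> \<A>\<^sub>0 \<Gamma>(7)"
proof -
  show "\<upsilon> \<in> \<A>\<^sub>0 \<Gamma>(7)" using upsilon_Gamma1 modular_functions_antimono[OF Gamma_subset_Gamma1_7(1)] by blast
  have "act A \<psi> = \<psi>" if "A \<in> \<Gamma>(7)" for A
  proof -
    have A: "A \<in> Gamma1_7" "7 dvd A $ 1 $ 2" using that Gamma_7_iff by auto
    have "zeta7 (2 * A $ 1 $ 2) = 1" using A(2) by (simp add: zeta7_eq_1_iff)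
    thus ?thesis using act_upsilon_psi_Gamma1(2)[OF A(1)] by (simp add: mero_const_1)
  qed
  thus "\<psi> \<in> \<A>\<^sub>0 \<Gamma>(7)" using cusps_upsilon_psi by (simp add: modular_functions_iff[OF Gamma_subset])
qed

text \<open>Here \<psi> itself is the primitive element: \<open>Gamma1_7\<close> multiplies it by a
  7th root of unity, which is trivial exactly on \<open>\<Gamma>(7)\<close>.\<close>

theorem modular_functions_Gamma7: "\<A>\<^sub>0 \<Gamma>(7) = \<complex>({\<psi>, \<upsilon>})"
proof
  show "\<complex>({\<psi>, \<upsilon>}) \<subseteq> \<A>\<^sub>0 \<Gamma>(7)"
    by (rule adjoin_C_least[OF modular_functions_C_subfield[OF Gamma_subset]]) (use psi_upsilon_Gamma7 in auto)
  obtain R where "congruence_group Gamma1_7 7 R" using congruence_group_Gamma1_7[of 7] by blast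
  then interpret congruence_group Gamma1_7 7 R .
  have gen: "\<psi> \<in> \<complex>({\<psi>, \<upsilon>})" "\<upsilon> \<in> \<complex>({\<psi>, \<upsilon>})" using adjoin_C_superset[of "{\<psi>, \<upsilon>}"] by auto
  show "\<A>\<^sub>0 \<Gamma>(7) \<subseteq> \<complex>({\<psi>, \<upsilon>})"
  proof
    fix f assume "f \<in> \<A>\<^sub>0 \<Gamma>(7)"
    thus "f \<in> \<complex>({\<psi>, \<upsilon>})"
      by (rule primitive_element_generates[OF _ psi_upsilon_Gamma7(1) psi_fixed_imp adjoin_C_C_subfield
            modular_functions_Gamma1_7_subset[OF adjoin_C_C_subfield gen(2)] gen(1)])
  qed
qed

section \<open>Theta relations behind the cubic\<close>

text \<open>The exponential in the normalisation of the Klein form. Being Gaussian in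
  \<open>k\<close>, it obeys the parallelogram law \<open>Ea_prod\<close>, so the addition formula
  carries over to \<open>sk\<close>.\<close>

definition Ea :: "int \<Rightarrow> complex \<Rightarrow> complex" where
  "Ea k \<tau> = exp (of_real pi * \<i> * of_int (k\<^sup>2) * \<tau> / 7)"

lemma Ea_nonzero [simp]: "Ea k \<tau> \<noteq> 0" by (simp add: Ea_def)

lemma sk_th: "sk k \<tau> = Ea k \<tau> * th (of_int k * \<tau>) (7 * \<tau>)"
proof -
  have "of_real (of_int k / 7) * (7 * \<tau>) + of_real 0 = of_int k * \<tau>" by simp
  moreover have "exp (of_real pi * \<i> * of_real (of_int k / 7) * (of_int k * \<tau>)) = Ea k \<tau>"
    unfolding Ea_def by (rule arg_cong[where f = exp]) (simp add: power2_eq_square)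
  ultimately show ?thesis unfolding sk_def kl_def by (simp only:)
qed

text \<open>\<open>As\<close> and \<open>Bs\<close> are the two even theta functions of the addition
  formula, at the doubled modulus \<open>14 * \<tau>\<close>. They make
  \<open>sk (x + y) * sk (x - y)\<close> the determinant of the vectors with indices
  \<open>x\<close> and \<open>y\<close>.\<close>

definition As :: "int \<Rightarrow> complex \<Rightarrow> complex" where
  "As x \<tau> = Ea x \<tau> ^ 2 * jt 0 (2 * (of_int x * \<tau>)) (2 * (7 * \<tau>))"

definition Bs :: "int \<Rightarrow> complex \<Rightarrow> complex" where
  "Bs x \<tau> = Ea x \<tau> ^ 2 * jt (1/2) (2 * (of_int x * \<tau>)) (2 * (7 * \<tau>))"

text \<open>Up to a constant the Klein form of characteristic \<open>(k/7, 1/2)\<close>; by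
  duplication it links the values at \<tau> and \<open>2 * \<tau>\<close>.\<close>

definition Tk :: "int \<Rightarrow> complex \<Rightarrow> complex" where
  "Tk k \<tau> = Ea k \<tau> * th (of_int k * \<tau> + 1/2) (7 * \<tau>)"

lemma Ea_prod: "Ea (x + y) \<tau> * Ea (x - y) \<tau> = Ea x \<tau> ^ 2 * Ea y \<tau> ^ 2"
  unfolding Ea_def exp_of_nat_mult[symmetric] exp_add[symmetric]
  by (rule arg_cong[where f = exp]) (simp add: power2_eq_square algebra_simps add_divide_distrib[symmetric])

lemma sk_prod:
  assumes "Im \<tau> > 0"
  shows "sk (x + y) \<tau> * sk (x - y) \<tau> = As x \<tau> * Bs y \<tau> - Bs x \<tau> * As y \<tau>"
proof -
  have "sk (x + y) \<tau> * sk (x - y) \<tau> = (Ea (x + y) \<tau> * Ea (x - y) \<tau>) *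
      (th (of_int x * \<tau> + of_int y * \<tau>) (7 * \<tau>) * th (of_int x * \<tau> - of_int y * \<tau>) (7 * \<tau>))"
    unfolding sk_th by (simp add: algebra_simps)
  also have "\<dots> = As x \<tau> * Bs y \<tau> - Bs x \<tau> * As y \<tau>"
    using assms unfolding Ea_prod by (subst th_product) (simp_all add: As_def Bs_def algebra_simps)
  finally show ?thesis .
qed

lemma jt_add_1: "jt 0 (z + 1) \<tau> = jt 0 z \<tau>" "jt (1/2) (z + 1) \<tau> = - jt (1/2) z \<tau>"
  using jt_add_int[of 0 z 1 \<tau>] jt_add_int[of "1/2" z 1 \<tau>] by simp_all

text \<open>The translation by 1/2 moves the doubled argument by 1, which changes the sign of
  \<open>jt (1/2)\<close> only; the determinant becomes a permanent.\<close>

lemma Tk_prod: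
  assumes "Im \<tau> > 0"
  shows "Tk (x + y) \<tau> * Tk (x - y) \<tau> = As x \<tau> * Bs y \<tau> + Bs x \<tau> * As y \<tau>"
proof -
  have "Tk (x + y) \<tau> * Tk (x - y) \<tau> = (Ea (x + y) \<tau> * Ea (x - y) \<tau>) *
      (th ((of_int x * \<tau> + 1/2) + of_int y * \<tau>) (7 * \<tau>) * th ((of_int x * \<tau> + 1/2) - of_int y * \<tau>) (7 * \<tau>))"
    unfolding Tk_def by (simp add: algebra_simps)
  also have "th ((of_int x * \<tau> + 1/2) + of_int y * \<tau>) (7 * \<tau>) * th ((of_int x * \<tau> + 1/2) - of_int y * \<tau>) (7 * \<tau>) =
      jt 0 (2 * (of_int x * \<tau>)) (2 * (7 * \<tau>)) * jt (1/2) (2 * (of_int y * \<tau>)) (2 * (7 * \<tau>)) +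
      jt (1/2) (2 * (of_int x * \<tau>)) (2 * (7 * \<tau>)) * jt 0 (2 * (of_int y * \<tau>)) (2 * (7 * \<tau>))"
    using assms jt_add_1[of "2 * (of_int x * \<tau>)" "2 * (7 * \<tau>)"] by (subst th_product) (simp_all add: distrib_left)
  finally show ?thesis unfolding Ea_prod by (simp add: As_def Bs_def algebra_simps)
qed

lemma jt_As_shift:
  assumes "jt (a + 1) (2 * (of_int x * \<tau>)) (2 * (7 * \<tau>)) = jt a (2 * (of_int x * \<tau>)) (2 * (7 * \<tau>))"
  shows "Ea (x + 7) \<tau> ^ 2 * jt a (2 * (of_int (x + 7) * \<tau>)) (2 * (7 * \<tau>)) = Ea x \<tau> ^ 2 * jt a (2 * (of_int x * \<tau>)) (2 * (7 * \<tau>))"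
proof -
  have "jt a (2 * (of_int (x + 7) * \<tau>)) (2 * (7 * \<tau>)) = jt a (2 * (of_int x * \<tau>) + of_real 1 * (2 * (7 * \<tau>))) (2 * (7 * \<tau>))"
    by (simp add: algebra_simps)
  also have "\<dots> = exp (- (of_real pi * \<i> * (of_real 1)\<^sup>2 * (2 * (7 * \<tau>))) - 2 * of_real pi * \<i> * of_real 1 * (2 * (of_int x * \<tau>))) *
      jt (a + 1) (2 * (of_int x * \<tau>)) (2 * (7 * \<tau>))" by (rule jt_shift)
  finally have 1: "jt a (2 * (of_int (x + 7) * \<tau>)) (2 * (7 * \<tau>)) =
     exp (- (of_real pi * \<i> * (of_real 1)\<^sup>2 * (2 * (7 * \<tau>))) - 2 * of_real pi * \<i> * of_real 1 * (2 * (of_int x * \<tau>))) *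
      jt a (2 * (of_int x * \<tau>)) (2 * (7 * \<tau>))" unfolding assms .
  have "Ea (x + 7) \<tau> ^ 2 * exp (- (of_real pi * \<i> * (of_real 1)\<^sup>2 * (2 * (7 * \<tau>))) - 2 * of_real pi * \<i> * of_real 1 * (2 * (of_int x * \<tau>))) = Ea x \<tau> ^ 2"
    unfolding Ea_def exp_of_nat_mult[symmetric] exp_add[symmetric]
    by (rule arg_cong[where f = exp]) (simp add: power2_eq_square algebra_simps add_divide_distrib)
  thus ?thesis unfolding 1 by (simp add: mult.assoc[symmetric])
qed

lemma As_periodic: "As (x + 7) \<tau> = As x \<tau>" and Bs_periodic: "Bs (x + 7) \<tau> = Bs x \<tau>"
  using jt_As_shift[of 0 x \<tau>] jt_As_shift[of "1/2" x \<tau>] jt_char_add_int[of 0 1] jt_char_add_int[of "1/2" 1]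
  by (simp_all add: As_def Bs_def)

lemma As_even: "As (- x) \<tau> = As x \<tau>" and Bs_even: "Bs (- x) \<tau> = Bs x \<tau>"
  using jt_zero_even[of "2 * (of_int x * \<tau>)"] jt_half_even[of "2 * (of_int x * \<tau>)"]
  by (simp_all add: As_def Bs_def Ea_def)

lemma As_4: "As 4 \<tau> = As 3 \<tau>" and Bs_4: "Bs 4 \<tau> = Bs 3 \<tau>"
  using As_periodic[of "- 3" \<tau>] As_even[of 3 \<tau>] Bs_periodic[of "- 3" \<tau>] Bs_even[of 3 \<tau>] by simp_all

lemma Tk_even: "Tk (- k) \<tau> = Tk k \<tau>"
proof -
  have "th (of_int (- k) * \<tau> + 1/2) (7 * \<tau>) = th (- (of_int k * \<tau> - 1/2)) (7 * \<tau>)" by simp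
  also have "\<dots> = - th (of_int k * \<tau> - 1/2) (7 * \<tau>)" by (rule th_minus)
  also have "\<dots> = th (of_int k * \<tau> - 1/2 + of_int 0 * (7 * \<tau>) + of_int 1) (7 * \<tau>)"
    unfolding th_quasi by simp
  finally show ?thesis by (simp add: Tk_def Ea_def add.commute)
qed

lemma Tk_periodic: "Tk (k + 7) \<tau> = Tk k \<tau>"
proof -
  have "th (of_int (k + 7) * \<tau> + 1/2) (7 * \<tau>) = th ((of_int k * \<tau> + 1/2) + of_int 1 * (7 * \<tau>) + of_int 0) (7 * \<tau>)"
    by (simp add: algebra_simps)
  also have "\<dots> = - exp (- (of_real pi * \<i> * (7 * \<tau>)) - 2 * of_real pi * \<i> * (of_int k * \<tau> + 1/2)) * th (of_int k * \<tau> + 1/2) (7 * \<tau>)"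
    unfolding th_quasi by simp
  also have "- exp (- (of_real pi * \<i> * (7 * \<tau>)) - 2 * of_real pi * \<i> * (of_int k * \<tau> + 1/2)) =
      exp (of_real pi * \<i>) * exp (- (of_real pi * \<i> * (7 * \<tau>)) - 2 * of_real pi * \<i> * (of_int k * \<tau> + 1/2))" by simp
  finally have 1: "th (of_int (k + 7) * \<tau> + 1/2) (7 * \<tau>) =
     exp (of_real pi * \<i>) * exp (- (of_real pi * \<i> * (7 * \<tau>)) - 2 * of_real pi * \<i> * (of_int k * \<tau> + 1/2)) * th (of_int k * \<tau> + 1/2) (7 * \<tau>)" .
  have "Ea (k + 7) \<tau> * (exp (of_real pi * \<i>) * exp (- (of_real pi * \<i> * (7 * \<tau>)) - 2 * of_real pi * \<i> * (of_int k * \<tau> + 1/2))) = Ea k \<tau>"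
    unfolding Ea_def exp_add[symmetric]
    by (rule arg_cong[where f = exp]) (simp add: power2_eq_square algebra_simps add_divide_distrib)
  thus ?thesis unfolding Tk_def 1 by (simp only: mult.assoc[symmetric])
qed

lemma Tk_reduce: "Tk 4 \<tau> = Tk 3 \<tau>" "Tk 6 \<tau> = Tk 1 \<tau>"
  using Tk_periodic[of "- 3" \<tau>] Tk_even[of 3 \<tau>] Tk_periodic[of "- 1" \<tau>] Tk_even[of 1 \<tau>] by simp_all

text \<open>The last factor does not depend on \<open>k\<close>, so it cancels in the quotients at
  \<open>2 * \<tau>\<close>.\<close>

lemma sk_double:
  assumes "Im \<tau> > 0"
  shows "sk k \<tau> * Tk k \<tau> = sk k (2 * \<tau>) * (- jt 0 (1/2) (2 * (7 * \<tau>)))"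
proof -
  have "sk k \<tau> * Tk k \<tau> = Ea k \<tau> ^ 2 * (th (of_int k * \<tau>) (7 * \<tau>) * th (of_int k * \<tau> + 1/2) (7 * \<tau>))"
    unfolding sk_th Tk_def by (simp add: power2_eq_square)
  also have "th (of_int k * \<tau>) (7 * \<tau>) * th (of_int k * \<tau> + 1/2) (7 * \<tau>) = th (2 * (of_int k * \<tau>)) (2 * (7 * \<tau>)) * (- jt 0 (1/2) (2 * (7 * \<tau>)))"
    by (rule th_duplication) (use assms in simp)
  also have "th (2 * (of_int k * \<tau>)) (2 * (7 * \<tau>)) = th (of_int k * (2 * \<tau>)) (7 * (2 * \<tau>))" by (simp add: mult_ac)
  also have "Ea k \<tau> ^ 2 = Ea k (2 * \<tau>)"
    unfolding Ea_def exp_of_nat_mult[symmetric] by (rule arg_cong[where f = exp]) simp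
  finally show ?thesis unfolding sk_th by (simp add: mult.assoc)
qed

text \<open>At \<open>\<tau> / 2\<close> the doubled modulus is again \<open>7 * \<tau>\<close>;
  this is the bridge between the values at \<tau> and at \<open>\<tau> / 2\<close>.\<close>

lemma Bs_half: "Bs x (\<tau> / 2) = - Tk x \<tau>"
proof -
  have "Ea x (\<tau> / 2) ^ 2 = Ea x \<tau>"
    unfolding Ea_def exp_of_nat_mult[symmetric] by (rule arg_cong[where f = exp]) simp
  moreover have "th (of_int x * \<tau> + 1/2) (7 * \<tau>) = jt (1/2) (of_int x * \<tau> + 1) (7 * \<tau>)" by (simp add: th_def algebra_simps)
  ultimately show ?thesis unfolding Bs_def Tk_def using jt_add_1(2)[of "of_int x * \<tau>" "7 * \<tau>"] by simp
qed

lemma Tk_nonzero: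
  assumes "Im \<tau> > 0" "k \<in> {1, 2, 3}"
  shows "Tk k \<tau> \<noteq> 0"
proof -
  have "kl (of_int k / 7) (1/2) (7 * \<tau>) \<noteq> 0"
  proof (rule kl_nonzero)
    have "(1/2 :: real) \<notin> \<int>"
    proof
      assume "(1/2 :: real) \<in> \<int>"
      then obtain j where "(1/2 :: real) = of_int j" by (elim Ints_cases)
      hence "real_of_int 1 = of_int (2 * j)" by simp
      hence "1 = 2 * j" unfolding of_int_eq_iff .
      thus False by presburger
    qed
    thus "of_int k / 7 \<notin> \<int> \<or> (1/2 :: real) \<notin> \<int>" by blast
  qed (use assms in simp)
  thus ?thesis by (simp add: kl_def Tk_def)
qed

text \<open>All relations below are Pluecker relations for the vectors \<open>(As k, Bs k)\<close>.\<close>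

lemma sk_products:
  assumes "Im \<tau> > 0"
  shows "sk 1 \<tau> * sk 3 \<tau> = As 2 \<tau> * Bs 1 \<tau> - Bs 2 \<tau> * As 1 \<tau>"
    "sk 1 \<tau> * sk 2 \<tau> = As 3 \<tau> * Bs 2 \<tau> - Bs 3 \<tau> * As 2 \<tau>"
    "sk 2 \<tau> * sk 3 \<tau> = As 3 \<tau> * Bs 1 \<tau> - Bs 3 \<tau> * As 1 \<tau>"
    "sk 1 \<tau> ^ 2 = As 1 \<tau> * Bs 0 \<tau> - Bs 1 \<tau> * As 0 \<tau>"
    "sk 2 \<tau> ^ 2 = As 2 \<tau> * Bs 0 \<tau> - Bs 2 \<tau> * As 0 \<tau>"
    "sk 3 \<tau> ^ 2 = As 3 \<tau> * Bs 0 \<tau> - Bs 3 \<tau> * As 0 \<tau>"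
  \<comment> \<open>The instance 4, 2 yields \<open>sk 6 * sk 2\<close>, that is
    \<open>sk 1 * sk 2\<close>, with \<open>As 4\<close> and \<open>Bs 4\<close> reduced to index
    3.\<close>
  using sk_prod[OF assms, of 2 1] sk_prod[OF assms, of 4 2] sk_prod[OF assms, of 3 1]
    sk_prod[OF assms, of 1 0] sk_prod[OF assms, of 2 0] sk_prod[OF assms, of 3 0]
  by (simp_all add: sk_reduce As_4 Bs_4 power2_eq_square mult.commute)

lemma Tk_products:
  assumes "Im \<tau> > 0"
  shows "Tk 1 \<tau> * Tk 3 \<tau> = As 2 \<tau> * Bs 1 \<tau> + Bs 2 \<tau> * As 1 \<tau>"
    "Tk 2 \<tau> * Tk 3 \<tau> = As 3 \<tau> * Bs 1 \<tau> + Bs 3 \<tau> * As 1 \<tau>"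
    "Tk 1 \<tau> ^ 2 = As 1 \<tau> * Bs 0 \<tau> + Bs 1 \<tau> * As 0 \<tau>"
    "Tk 2 \<tau> ^ 2 = As 2 \<tau> * Bs 0 \<tau> + Bs 2 \<tau> * As 0 \<tau>"
    "Tk 3 \<tau> ^ 2 = As 3 \<tau> * Bs 0 \<tau> + Bs 3 \<tau> * As 0 \<tau>"
  using Tk_prod[OF assms, of 2 1] Tk_prod[OF assms, of 3 1]
    Tk_prod[OF assms, of 1 0] Tk_prod[OF assms, of 2 0] Tk_prod[OF assms, of 3 0]
  by (simp_all add: Tk_reduce power2_eq_square mult.commute)

text \<open>The Klein quartic, parametrised by \<open>sk 1\<close>, \<open>sk 2\<close>,
  \<open>sk 3\<close>. It yields both the relation between \<psi> and \<upsilon> and the fact that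
  \<upsilon> omits the value 1.\<close>

lemma klein_quartic:
  assumes "Im \<tau> > 0"
  shows "sk 2 \<tau> ^ 2 * (sk 2 \<tau> * sk 3 \<tau>) - sk 1 \<tau> ^ 2 * (sk 1 \<tau> * sk 2 \<tau>) = sk 3 \<tau> ^ 2 * (sk 1 \<tau> * sk 3 \<tau>)"
  unfolding sk_products[OF assms] by (simp add: algebra_simps)

lemma theta_relation_a:
  assumes "Im \<tau> > 0"
  shows "(sk 1 \<tau> * sk 3 \<tau>) * Tk 3 \<tau> ^ 2 + (sk 1 \<tau> * sk 2 \<tau>) * Tk 1 \<tau> ^ 2 = (sk 2 \<tau> * sk 3 \<tau>) * Tk 2 \<tau> ^ 2"
  unfolding sk_products[OF assms] Tk_products[OF assms] by (simp add: algebra_simps)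

lemma theta_relation_b:
  assumes "Im \<tau> > 0"
  shows "(sk 1 \<tau> * sk 2 \<tau>) * Tk 1 \<tau> ^ 2 - sk 3 \<tau> ^ 2 * (Tk 1 \<tau> * Tk 3 \<tau>) + sk 2 \<tau> ^ 2 * (Tk 2 \<tau> * Tk 3 \<tau>) = 0"
  unfolding sk_products[OF assms] Tk_products[OF assms] by (simp add: algebra_simps)

text \<open>Up to sign the \<open>Tk k\<close> are the second coordinates of the vectors at
  \<open>\<tau> / 2\<close>, and three vectors in the plane satisfy a linear relation whose
  coefficients are their determinants.\<close>

lemma theta_relation_half:
  assumes "Im \<tau> > 0"
  shows "(sk 1 (\<tau> / 2) * sk 3 (\<tau> / 2)) * Tk 3 \<tau> + (sk 1 (\<tau> / 2) * sk 2 (\<tau> / 2)) * Tk 1 \<tau> = (sk 2 (\<tau> / 2) * sk 3 (\<tau> / 2)) * Tk 2 \<tau>"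
proof -
  have im: "Im (\<tau> / 2) > 0" using assms by simp
  have T: "Tk k \<tau> = - Bs k (\<tau> / 2)" for k by (simp add: Bs_half)
  show ?thesis unfolding sk_products[OF im] T by (simp add: algebra_simps)
qed

text \<open>\<open>T1\<close> is eliminated between the relations a and b after dividing by powers
  of \<open>s1\<close> and \<open>T3\<close>. The elimination leads to an equation of degree four
  for \<open>g\<close>, of which the cubic is a factor.\<close>

lemma cubic_from_theta_relations:
  fixes s1 s2 s3 T1 T2 T3 :: complex
  assumes nz: "s1 \<noteq> 0" "s2 \<noteq> 0" "s3 \<noteq> 0" "T3 \<noteq> 0"
    and K: "s2 ^ 2 * (s2 * s3) - s1 ^ 2 * (s1 * s2) = s3 ^ 2 * (s1 * s3)"
    and a: "(s1 * s3) * T3 ^ 2 + (s1 * s2) * T1 ^ 2 = (s2 * s3) * T2 ^ 2"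
    and b: "(s1 * s2) * T1 ^ 2 - s3 ^ 2 * (T1 * T3) + s2 ^ 2 * (T2 * T3) = 0"
    and u: "u = s2 ^ 2 * s3 / s1 ^ 3" and g: "g = s3 * T2 / (s2 * T3)"
  shows "(g + 1) * (u * g ^ 3 + u * g ^ 2 - (u ^ 2 - 1) * g + (u - 1) ^ 2) = 0"
proof -
  define p q m r where "p = s2 / s1" and "q = s3 / s1" and "m = T1 / T3" and "r = T2 / T3"
  have s: "s2 = p * s1" "s3 = q * s1" "T1 = m * T3" "T2 = r * T3" using nz by (simp_all add: p_def q_def m_def r_def)
  have pq: "p \<noteq> 0" "q \<noteq> 0" using nz by (simp_all add: p_def q_def)
  have "s1 ^ 4 * (p ^ 3 * q - p) = s1 ^ 4 * q ^ 3" using K unfolding s by (simp add: eval_nat_numeral algebra_simps)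
  hence K': "p ^ 3 * q - p = q ^ 3" using nz by simp
  have "(s1 ^ 2 * T3 ^ 2) * (q + p * m ^ 2) = (s1 ^ 2 * T3 ^ 2) * (p * q * r ^ 2)" using a unfolding s by (simp add: eval_nat_numeral algebra_simps)
  hence a': "q + p * m ^ 2 = p * q * r ^ 2" using nz by simp
  have "(s1 ^ 2 * T3 ^ 2) * (p * m ^ 2 - q ^ 2 * m + p ^ 2 * r) = 0" using b unfolding s by (simp add: eval_nat_numeral algebra_simps)
  hence b': "p * m ^ 2 - q ^ 2 * m + p ^ 2 * r = 0" using nz by simp
  have gr: "q * r = p * g" unfolding g s using nz pq by (simp add: field_simps)
  have u': "u = p ^ 2 * q" unfolding u s using nz by (simp add: field_simps eval_nat_numeral)
  \<comment> \<open>The difference of the two relations is free of \<open>m ^ 2\<close>, so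
    \<open>m\<close> becomes rational in \<open>r\<close>.\<close>
  have "p ^ 2 * r + p * q * r ^ 2 - q - q ^ 2 * m = (p * m ^ 2 - q ^ 2 * m + p ^ 2 * r) - (q + p * m ^ 2 - p * q * r ^ 2)"
    by (simp add: algebra_simps)
  hence m1: "q ^ 2 * m = p ^ 2 * r + p * q * r ^ 2 - q" unfolding a' b' by simp
  have "q ^ 3 * m = q * (q ^ 2 * m)" by (simp add: eval_nat_numeral)
  also have "\<dots> = p ^ 2 * (q * r) + p * (q * r) ^ 2 - q ^ 2" unfolding m1 by (simp add: eval_nat_numeral algebra_simps)
  also have "\<dots> = p ^ 3 * (g ^ 2 + g) - q ^ 2" unfolding gr by (simp add: eval_nat_numeral algebra_simps)
  finally have m2: "q ^ 3 * m = p ^ 3 * (g ^ 2 + g) - q ^ 2" .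
  \<comment> \<open>The power \<open>q ^ 6\<close> lets \<open>m\<close> and \<open>r\<close> occur
    only as \<open>q ^ 3 * m\<close> and \<open>q * r = p * g\<close>.\<close>
  have "q ^ 6 * (q + p * m ^ 2) = q ^ 6 * (p * q * r ^ 2)" unfolding a' ..
  hence "q ^ 7 + p * (q ^ 3 * m) ^ 2 = p * q ^ 5 * (q * r) ^ 2" by (simp add: eval_nat_numeral algebra_simps)
  hence F: "q ^ 7 + p * (p ^ 3 * (g ^ 2 + g) - q ^ 2) ^ 2 - p ^ 3 * q ^ 5 * g ^ 2 = 0"
    unfolding m2 gr by (simp add: eval_nat_numeral algebra_simps)
  \<comment> \<open>By the Klein quartic \<open>p * (u - 1) = q ^ 3\<close>; the factor
    \<open>p ^ 5\<close> allows every \<open>u - 1\<close> in the cubic to be replaced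
    accordingly.\<close>
  define w where "w = u - 1"
  have pw: "p * w = q ^ 3" unfolding w_def u' K'[symmetric] by (simp add: eval_nat_numeral algebra_simps)
  have "p ^ 5 * (u * g ^ 3 + u * g ^ 2 - (u ^ 2 - 1) * g + (u - 1) ^ 2) =
     p ^ 5 * u * (g ^ 3 + g ^ 2) - (p ^ 3 * (p * w) ^ 2 + 2 * p ^ 4 * (p * w)) * g + p ^ 3 * (p * w) ^ 2"
    unfolding w_def by (simp add: eval_nat_numeral algebra_simps)
  also have "\<dots> = p ^ 7 * q * (g ^ 3 + g ^ 2) - (p ^ 3 * q ^ 6 + 2 * p ^ 4 * q ^ 3) * g + p ^ 3 * q ^ 6"
    unfolding pw u' by (simp add: eval_nat_numeral algebra_simps)
  finally have X: "p ^ 5 * (u * g ^ 3 + u * g ^ 2 - (u ^ 2 - 1) * g + (u - 1) ^ 2) =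
      p ^ 7 * q * (g ^ 3 + g ^ 2) - (p ^ 3 * q ^ 6 + 2 * p ^ 4 * q ^ 3) * g + p ^ 3 * q ^ 6" .
  have "p ^ 5 * ((g + 1) * (u * g ^ 3 + u * g ^ 2 - (u ^ 2 - 1) * g + (u - 1) ^ 2)) =
      (g + 1) * (p ^ 7 * q * (g ^ 3 + g ^ 2) - (p ^ 3 * q ^ 6 + 2 * p ^ 4 * q ^ 3) * g + p ^ 3 * q ^ 6)"
    unfolding X[symmetric] by (simp only: mult_ac)
  also have "\<dots> = q * (q ^ 7 + p * (p ^ 3 * (g ^ 2 + g) - q ^ 2) ^ 2 - p ^ 3 * q ^ 5 * g ^ 2) - q ^ 5 * (q ^ 3 - (p ^ 3 * q - p))"
    by (simp add: eval_nat_numeral algebra_simps)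
  also have "\<dots> = 0" unfolding F K' by simp
  finally show ?thesis using pq by simp
qed

lemma eval_g1: "\<tau> \<in> uhp \<Longrightarrow> eval_mero g1 \<tau> = phi1 \<tau> ^ 2 / phi1 (2 * \<tau>)"
  and g1_holomorphic: "eval_mero g1 holomorphic_on uhp"
  and eval_g2: "\<tau> \<in> uhp \<Longrightarrow> eval_mero g2 \<tau> = phi1 \<tau> * phi1 (\<tau> / 2) * phi1 (2 * \<tau>) - phi1 (2 * \<tau>) / phi2 \<tau>"
  and g2_holomorphic: "eval_mero g2 holomorphic_on uhp"
  and eval_g3: "\<tau> \<in> uhp \<Longrightarrow> eval_mero g3 \<tau> = - phi1 \<tau> * phi1 (\<tau> / 2) * phi1 (2 * \<tau>) - phi1 \<tau> ^ 2 * phi2 \<tau> / phi2 (2 * \<tau>)"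
  and g3_holomorphic: "eval_mero g3 holomorphic_on uhp"
proof -
  have p2: "(\<lambda>\<tau>. phi1 (2 * \<tau>)) holomorphic_on uhp" "(\<lambda>\<tau>. phi2 (2 * \<tau>)) holomorphic_on uhp"
    using phi_scaled_holomorphic[of 2] by simp_all
  have ph: "(\<lambda>\<tau>. phi1 (\<tau> / 2)) holomorphic_on uhp" using phi_scaled_holomorphic(1)[of "1/2"] by simp
  have nz: "phi1 (2 * \<tau>) \<noteq> 0" "phi2 (2 * \<tau>) \<noteq> 0" "phi2 \<tau> \<noteq> 0" if "\<tau> \<in> uhp" for \<tau>
    using that phi_nonzero[of "2 * \<tau>"] phi_nonzero[of \<tau>] by (auto simp: uhp_def)
  have h1: "(\<lambda>\<tau>. phi1 \<tau> ^ 2 / phi1 (2 * \<tau>)) holomorphic_on uhp"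
    by (intro holomorphic_intros p2 phi_holomorphic nz)
  have h2: "(\<lambda>\<tau>. phi1 \<tau> * phi1 (\<tau> / 2) * phi1 (2 * \<tau>) - phi1 (2 * \<tau>) / phi2 \<tau>) holomorphic_on uhp"
    by (intro holomorphic_intros p2 ph phi_holomorphic nz)
  have h3: "(\<lambda>\<tau>. - phi1 \<tau> * phi1 (\<tau> / 2) * phi1 (2 * \<tau>) - phi1 \<tau> ^ 2 * phi2 \<tau> / phi2 (2 * \<tau>)) holomorphic_on uhp"
    by (intro holomorphic_intros p2 ph phi_holomorphic nz)
  show e1: "\<tau> \<in> uhp \<Longrightarrow> eval_mero g1 \<tau> = phi1 \<tau> ^ 2 / phi1 (2 * \<tau>)" for \<tau>
    unfolding g1_def by (rule eval_mero_of_holomorphic[OF h1])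
  show e2: "\<tau> \<in> uhp \<Longrightarrow> eval_mero g2 \<tau> = phi1 \<tau> * phi1 (\<tau> / 2) * phi1 (2 * \<tau>) - phi1 (2 * \<tau>) / phi2 \<tau>" for \<tau>
    unfolding g2_def by (rule eval_mero_of_holomorphic[OF h2])
  show e3: "\<tau> \<in> uhp \<Longrightarrow> eval_mero g3 \<tau> = - phi1 \<tau> * phi1 (\<tau> / 2) * phi1 (2 * \<tau>) - phi1 \<tau> ^ 2 * phi2 \<tau> / phi2 (2 * \<tau>)" for \<tau>
    unfolding g3_def by (rule eval_mero_of_holomorphic[OF h3])
  show "eval_mero g1 holomorphic_on uhp" by (rule holomorphic_transform[OF h1]) (simp add: e1)
  show "eval_mero g2 holomorphic_on uhp" by (rule holomorphic_transform[OF h2]) (simp add: e2)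
  show "eval_mero g3 holomorphic_on uhp" by (rule holomorphic_transform[OF h3]) (simp add: e3)
qed

lemma phi_double:
  assumes "Im \<tau> > 0"
  shows "phi1 (2 * \<tau>) = sk 3 \<tau> * Tk 3 \<tau> / (sk 2 \<tau> * Tk 2 \<tau>)" "phi2 (2 * \<tau>) = sk 2 \<tau> * Tk 2 \<tau> / (sk 1 \<tau> * Tk 1 \<tau>)"
proof -
  define D where "D = - jt 0 (1/2) (2 * (7 * \<tau>))"
  have D: "sk k \<tau> * Tk k \<tau> = sk k (2 * \<tau>) * D" for k unfolding D_def by (rule sk_double[OF assms])
  have "sk 1 \<tau> * Tk 1 \<tau> \<noteq> 0" using sk_123_nonzero[OF assms] Tk_nonzero[OF assms] by simp
  hence "D \<noteq> 0" unfolding D by auto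
  thus "phi1 (2 * \<tau>) = sk 3 \<tau> * Tk 3 \<tau> / (sk 2 \<tau> * Tk 2 \<tau>)" "phi2 (2 * \<tau>) = sk 2 \<tau> * Tk 2 \<tau> / (sk 1 \<tau> * Tk 1 \<tau>)"
    unfolding D phi1_eq phi2_eq by simp_all
qed

lemma eval_g1_theta:
  assumes "\<tau> \<in> uhp"
  shows "eval_mero g1 \<tau> = sk 3 \<tau> * Tk 2 \<tau> / (sk 2 \<tau> * Tk 3 \<tau>)"
proof -
  have im: "Im \<tau> > 0" using assms by (simp add: uhp_def)
  show ?thesis unfolding eval_g1[OF assms] phi_double[OF im] phi1_eq[of \<tau>]
    using sk_123_nonzero[OF im] Tk_nonzero[OF im] by (simp add: field_simps power2_eq_square)
qed

text \<open>The relation at \<open>\<tau> / 2\<close> contracts the two terms of the definition into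
  one product, the form in which \<open>g3\<close> is met as a translate of
  \<open>g1\<close>.\<close>

lemma eval_g3_theta:
  assumes "\<tau> \<in> uhp"
  shows "eval_mero g3 \<tau> = - (phi1 \<tau> ^ 2 * (sk 3 (\<tau> / 2) / sk 1 (\<tau> / 2)))"
proof -
  have im: "Im \<tau> > 0" "Im (\<tau> / 2) > 0" using assms by (simp_all add: uhp_def)
  define c1 c2 c3 where "c1 = sk 1 (\<tau> / 2)" and "c2 = sk 2 (\<tau> / 2)" and "c3 = sk 3 (\<tau> / 2)"
  define s1 s2 s3 where "s1 = sk 1 \<tau>" and "s2 = sk 2 \<tau>" and "s3 = sk 3 \<tau>"
  define T1 T2 T3 where "T1 = Tk 1 \<tau>" and "T2 = Tk 2 \<tau>" and "T3 = Tk 3 \<tau>"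
  have nz: "c1 \<noteq> 0" "c2 \<noteq> 0" "c3 \<noteq> 0" "s1 \<noteq> 0" "s2 \<noteq> 0" "s3 \<noteq> 0" "T1 \<noteq> 0" "T2 \<noteq> 0" "T3 \<noteq> 0"
    using sk_123_nonzero[OF im(1)] sk_123_nonzero[OF im(2)] Tk_nonzero[OF im(1)]
    by (simp_all add: c1_def c2_def c3_def s1_def s2_def s3_def T1_def T2_def T3_def)
  have rel: "(c1 * c3) * T3 + (c1 * c2) * T1 = (c2 * c3) * T2"
    using theta_relation_half[OF im(1)] by (simp add: c1_def c2_def c3_def T1_def T2_def T3_def)
  have "eval_mero g3 \<tau> = - (s3 / s2) * (c3 / c2) * (s3 * T3 / (s2 * T2)) - (s3 / s2) ^ 2 * (s2 / s1) / (s2 * T2 / (s1 * T1))"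
    unfolding eval_g3[OF assms] phi_double[OF im(1)] phi1_eq[of \<tau>] phi1_eq[of "\<tau> / 2"] phi2_eq[of \<tau>]
    by (simp add: c1_def c2_def c3_def s1_def s2_def s3_def T1_def T2_def T3_def)
  also have "\<dots> = - ((s3 / s2) ^ 2 * (((c1 * c3) * T3 + (c1 * c2) * T1) / (c1 * c2 * T2)))"
    using nz by (simp add: field_simps power2_eq_square)
  also have "\<dots> = - ((s3 / s2) ^ 2 * (c3 / c1))" unfolding rel using nz by simp
  finally show ?thesis by (simp add: phi1_eq c1_def c3_def s2_def s3_def)
qed

text \<open>The terms with \<open>\<tau> / 2\<close> in \<open>g2\<close> and \<open>g3\<close>
  cancel. What remains beside -1 is a combination of the relations a and b divided by
  \<open>s2 ^ 2 * T2 * T3\<close>.\<close>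

lemma g_sum: "g1 + g2 + g3 = - 1"
proof (rule mero_eqI)
  fix \<tau> assume \<tau>: "\<tau> \<in> uhp"
  have im: "Im \<tau> > 0" using \<tau> by (simp add: uhp_def)
  define s1 s2 s3 where "s1 = sk 1 \<tau>" and "s2 = sk 2 \<tau>" and "s3 = sk 3 \<tau>"
  define T1 T2 T3 where "T1 = Tk 1 \<tau>" and "T2 = Tk 2 \<tau>" and "T3 = Tk 3 \<tau>"
  have nz: "s1 \<noteq> 0" "s2 \<noteq> 0" "s3 \<noteq> 0" "T1 \<noteq> 0" "T2 \<noteq> 0" "T3 \<noteq> 0"
    using sk_123_nonzero[OF im(1)] Tk_nonzero[OF im(1)]
    by (simp_all add: s1_def s2_def s3_def T1_def T2_def T3_def)
  have a: "(s1 * s3) * T3 ^ 2 + (s1 * s2) * T1 ^ 2 = (s2 * s3) * T2 ^ 2"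
    and b: "(s1 * s2) * T1 ^ 2 - s3 ^ 2 * (T1 * T3) + s2 ^ 2 * (T2 * T3) = 0"
    using theta_relation_a[OF im] theta_relation_b[OF im] by (simp_all add: s1_def s2_def s3_def T1_def T2_def T3_def)
  have c: "s3 * s2 * T2 ^ 2 - s1 * s3 * T3 ^ 2 - s3 ^ 2 * T1 * T3 + s2 ^ 2 * T2 * T3 = 0"
  proof -
    have "s3 * s2 * T2 ^ 2 - s1 * s3 * T3 ^ 2 - s3 ^ 2 * T1 * T3 + s2 ^ 2 * T2 * T3 =
      ((s2 * s3) * T2 ^ 2 - ((s1 * s3) * T3 ^ 2 + (s1 * s2) * T1 ^ 2)) +
      ((s1 * s2) * T1 ^ 2 - s3 ^ 2 * (T1 * T3) + s2 ^ 2 * (T2 * T3))" by (simp add: algebra_simps)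
    thus ?thesis unfolding a b by simp
  qed
  have "eval_mero g1 \<tau> + eval_mero g2 \<tau> + eval_mero g3 \<tau> =
      s3 * T2 / (s2 * T3) - (s3 * T3 / (s2 * T2)) / (s2 / s1) - (s3 / s2) ^ 2 * (s2 / s1) / (s2 * T2 / (s1 * T1))"
    unfolding eval_g1_theta[OF \<tau>] eval_g2[OF \<tau>] eval_g3[OF \<tau>] phi_double[OF im(1)] phi1_eq[of \<tau>] phi2_eq[of \<tau>]
    by (simp add: s1_def s2_def s3_def T1_def T2_def T3_def)
  also have "\<dots> = (s3 * s2 * T2 ^ 2 - s1 * s3 * T3 ^ 2 - s3 ^ 2 * T1 * T3 + s2 ^ 2 * T2 * T3) / (s2 ^ 2 * T2 * T3) - 1"
    using nz by (simp add: field_simps power2_eq_square)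
  finally have sum: "eval_mero g1 \<tau> + eval_mero g2 \<tau> + eval_mero g3 \<tau> = - 1" unfolding c by simp
  have "eval_mero (- 1) \<tau> = - 1"
  proof -
    have "eval_mero (mero_const 0 - mero_const 1) \<tau> = - 1"
      using \<tau> eval_const_holomorphic by (subst eval_hol_ops(7)) (simp_all add: eval_const)
    thus ?thesis by (simp add: mero_const_0 mero_const_1)
  qed
  thus "eval_mero (g1 + g2 + g3) \<tau> = eval_mero (- 1) \<tau>"
    using sum \<tau> g1_holomorphic g2_holomorphic g3_holomorphic by (simp add: eval_hol_ops)
qed

text \<open>The leading exponents cancel: \<open>phi1\<close> has -8/56, so its square and
  \<open>phi1 (2 * \<tau>)\<close> both have -16/56. The limit excludes \<open>g1 = - 1\<close> and
  separates \<open>g1\<close> from \<open>g3\<close>.\<close>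

lemma g1_tendsto: "(eval_mero g1 \<longlongrightarrow> 1) ioo"
proof -
  have p: "((\<lambda>\<tau>. phi1 \<tau> * ex56 8 \<tau>) \<longlongrightarrow> 1) ioo"
  proof -
    have "((\<lambda>\<tau>. (sk 3 \<tau> * ex56 (- 1) \<tau>) / (sk 2 \<tau> * ex56 (- 9) \<tau>)) \<longlongrightarrow> (- \<i>) / (- \<i>)) ioo"
      by (intro tendsto_intros sk_leading_123) simp
    moreover have "(sk 3 \<tau> * ex56 (- 1) \<tau>) / (sk 2 \<tau> * ex56 (- 9) \<tau>) = phi1 \<tau> * ex56 8 \<tau>" for \<tau>
    proof -
      have "ex56 (- 1) \<tau> = ex56 8 \<tau> * ex56 (- 9) \<tau>" unfolding ex56_add[symmetric] by simp
      thus ?thesis by (simp add: phi1_eq)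
    qed
    ultimately show ?thesis by simp
  qed
  have "filterlim (\<lambda>\<tau>. 2 * \<tau>) ioo ioo" using filterlim_ioo_linear[of 2 1 0] by simp
  hence p2: "((\<lambda>\<tau>. phi1 (2 * \<tau>) * ex56 8 (2 * \<tau>)) \<longlongrightarrow> 1) ioo" by (rule filterlim_compose[OF p])
  have "((\<lambda>\<tau>. (phi1 \<tau> * ex56 8 \<tau>) ^ 2 / (phi1 (2 * \<tau>) * ex56 8 (2 * \<tau>))) \<longlongrightarrow> 1 ^ 2 / 1) ioo"
    by (intro tendsto_intros p p2) simp
  moreover have "eventually (\<lambda>\<tau>. (phi1 \<tau> * ex56 8 \<tau>) ^ 2 / (phi1 (2 * \<tau>) * ex56 8 (2 * \<tau>)) = eval_mero g1 \<tau>) ioo"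
    unfolding eventually_ioo
  proof (intro exI[of _ 1] conjI allI impI)
    fix \<tau> :: complex assume "Im \<tau> > 1"
    hence \<tau>: "\<tau> \<in> uhp" by (simp add: uhp_def)
    have "ex56 8 (2 * \<tau>) = ex56 8 \<tau> ^ 2" unfolding ex56_power unfolding ex56_def by (rule arg_cong[where f = exp]) simp
    thus "(phi1 \<tau> * ex56 8 \<tau>) ^ 2 / (phi1 (2 * \<tau>) * ex56 8 (2 * \<tau>)) = eval_mero g1 \<tau>"
      unfolding eval_g1[OF \<tau>] by (simp add: power_mult_distrib)
  qed simp
  ultimately show ?thesis using Lim_transform_eventually by fastforce
qed

text \<open>The leading exponent is \<open>- 16 - 12 = - 28\<close> over 56: 16 from the square of
  \<open>phi1\<close>, and 12 as half of \<open>25 - 1\<close>.\<close>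

lemma g3_pole: "((\<lambda>\<tau>. eval_mero g3 \<tau> * ex56 28 \<tau>) \<longlongrightarrow> - 1) ioo"
proof -
  have p: "((\<lambda>\<tau>. (sk 3 \<tau> * ex56 (- 1) \<tau>) / (sk 2 \<tau> * ex56 (- 9) \<tau>)) \<longlongrightarrow> (- \<i>) / (- \<i>)) ioo"
    by (intro tendsto_intros sk_leading_123) simp
  have h: "((\<lambda>\<tau>. (sk 3 \<tau> * ex56 (- 1) \<tau>) / (sk 1 \<tau> * ex56 (- 25) \<tau>)) \<longlongrightarrow> (- \<i>) / (- \<i>)) ioo"
    by (intro tendsto_intros sk_leading_123) simp
  have "filterlim (\<lambda>\<tau>. \<tau> / 2) ioo ioo" using filterlim_ioo_linear[of 1 2 0] by simp
  from filterlim_compose[OF h this]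
  have h2: "((\<lambda>\<tau>. (sk 3 (\<tau>/2) * ex56 (- 1) (\<tau>/2)) / (sk 1 (\<tau>/2) * ex56 (- 25) (\<tau>/2))) \<longlongrightarrow> (- \<i>) / (- \<i>)) ioo" .
  have "((\<lambda>\<tau>. - (((sk 3 \<tau> * ex56 (- 1) \<tau>) / (sk 2 \<tau> * ex56 (- 9) \<tau>)) ^ 2 *
      ((sk 3 (\<tau>/2) * ex56 (- 1) (\<tau>/2)) / (sk 1 (\<tau>/2) * ex56 (- 25) (\<tau>/2))))) \<longlongrightarrow> - (((- \<i>) / (- \<i>)) ^ 2 * ((- \<i>) / (- \<i>)))) ioo"
    by (intro tendsto_minus tendsto_mult tendsto_power p h2)
  moreover have "eventually (\<lambda>\<tau>. - (((sk 3 \<tau> * ex56 (- 1) \<tau>) / (sk 2 \<tau> * ex56 (- 9) \<tau>)) ^ 2 *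
      ((sk 3 (\<tau>/2) * ex56 (- 1) (\<tau>/2)) / (sk 1 (\<tau>/2) * ex56 (- 25) (\<tau>/2)))) = eval_mero g3 \<tau> * ex56 28 \<tau>) ioo"
    unfolding eventually_ioo
  proof (intro exI[of _ 1] conjI allI impI)
    fix \<tau> :: complex assume "Im \<tau> > 1"
    hence \<tau>: "\<tau> \<in> uhp" by (simp add: uhp_def)
    have 1: "ex56 (- 1) \<tau> = ex56 8 \<tau> * ex56 (- 9) \<tau>" unfolding ex56_add[symmetric] by simp
    have 2: "ex56 (- 1) (\<tau>/2) = ex56 24 (\<tau>/2) * ex56 (- 25) (\<tau>/2)" unfolding ex56_add[symmetric] by simp
    have 3: "ex56 24 (\<tau>/2) = ex56 12 \<tau>" unfolding ex56_def by (rule arg_cong[where f = exp]) simp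
    have 4: "ex56 8 \<tau> ^ 2 * ex56 12 \<tau> = ex56 28 \<tau>" unfolding ex56_power ex56_add[symmetric] by simp
    show "- (((sk 3 \<tau> * ex56 (- 1) \<tau>) / (sk 2 \<tau> * ex56 (- 9) \<tau>)) ^ 2 *
      ((sk 3 (\<tau>/2) * ex56 (- 1) (\<tau>/2)) / (sk 1 (\<tau>/2) * ex56 (- 25) (\<tau>/2)))) = eval_mero g3 \<tau> * ex56 28 \<tau>"
      unfolding eval_g3_theta[OF \<tau>] phi1_eq 4[symmetric] 1 2 3 by (simp add: power_divide power_mult_distrib)
  qed simp
  ultimately show ?thesis using Lim_transform_eventually by fastforce
qed

lemma g1_neq_g3: "g1 \<noteq> g3"
proof
  assume "g1 = g3"
  hence "((\<lambda>\<tau>. eval_mero g1 \<tau> * ex56 28 \<tau>) \<longlongrightarrow> - 1) ioo" using g3_pole by simp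
  moreover have "((\<lambda>\<tau>. eval_mero g1 \<tau> * ex56 28 \<tau>) \<longlongrightarrow> 1 * 0) ioo"
    by (intro tendsto_intros g1_tendsto ex56_tendsto_0) simp
  ultimately show False using tendsto_unique[OF ioo_neq_bot] by fastforce
qed

section \<open>The cubic and level 14\<close>

lemma eval_one: "eval_mero 1 holomorphic_on uhp" "z \<in> uhp \<Longrightarrow> eval_mero 1 z = 1"
  using eval_const_holomorphic[of 1] eval_const[of z 1] by (simp_all add: mero_const_1)

lemma eval_zero: "z \<in> uhp \<Longrightarrow> eval_mero 0 z = 0"
  using eval_const[of z 0] by (simp add: mero_const_0)

lemma two_neq_zero_mero: "(2 :: mero_uhp) \<noteq> 0"
proof -
  have "(2 :: mero_uhp) = mero_const 2"
    using mero_const_add[of 1 1] by (simp add: mero_const_1)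
  thus ?thesis using mero_const_eq_iff[of 2 0] by (simp add: mero_const_0)
qed

text \<open>The Klein quartic says \<open>\<upsilon> - 1 = s3 ^ 3 / (s1 ^ 2 * s2)\<close>; the rest
  compares monomials in functions without zeros.\<close>

lemma upsilon_pointwise:
  assumes "\<tau> \<in> uhp"
  shows "eval_mero \<upsilon> \<tau> \<noteq> 0" "eval_mero \<upsilon> \<tau> \<noteq> 1" "eval_mero \<psi> \<tau> ^ 7 = eval_mero \<upsilon> \<tau> ^ 4 * (eval_mero \<upsilon> \<tau> - 1)"
    "eval_mero \<psi> \<tau> \<noteq> 0"
proof -
  have im: "Im \<tau> > 0" using assms by (simp add: uhp_def)
  note nz = sk_123_nonzero[OF im]
  define s1 s2 s3 where "s1 = sk 1 \<tau>" and "s2 = sk 2 \<tau>" and "s3 = sk 3 \<tau>"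
  have nz': "s1 \<noteq> 0" "s2 \<noteq> 0" "s3 \<noteq> 0" using nz by (simp_all add: s1_def s2_def s3_def)
  have K: "s2 ^ 2 * (s2 * s3) - s1 ^ 2 * (s1 * s2) = s3 ^ 2 * (s1 * s3)"
    using klein_quartic[OF im] by (simp add: s1_def s2_def s3_def)
  have u: "eval_mero \<upsilon> \<tau> = s2 ^ 2 * s3 / s1 ^ 3" and p: "eval_mero \<psi> \<tau> = s2 * s3 / s1 ^ 2"
    using eval_upsilon_psi[OF assms] by (simp_all add: s1_def s2_def s3_def)
  have "eval_mero \<upsilon> \<tau> - 1 = (s2 ^ 2 * (s2 * s3) - s1 ^ 2 * (s1 * s2)) / (s1 ^ 3 * s2)"
    unfolding u using nz' by (simp add: field_simps eval_nat_numeral)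
  also have "\<dots> = s3 ^ 3 / (s1 ^ 2 * s2)" unfolding K using nz' by (simp add: field_simps eval_nat_numeral)
  finally have u1: "eval_mero \<upsilon> \<tau> - 1 = s3 ^ 3 / (s1 ^ 2 * s2)" .
  have "eval_mero \<upsilon> \<tau> - 1 \<noteq> 0" unfolding u1 using nz' by simp
  thus "eval_mero \<upsilon> \<tau> \<noteq> 1" by simp
  show "eval_mero \<upsilon> \<tau> \<noteq> 0" "eval_mero \<psi> \<tau> \<noteq> 0" unfolding u p using nz' by simp_all
  show "eval_mero \<psi> \<tau> ^ 7 = eval_mero \<upsilon> \<tau> ^ 4 * (eval_mero \<upsilon> \<tau> - 1)"
    unfolding u1 unfolding u p using nz' by (simp add: field_simps eval_nat_numeral)
qed

lemma upsilon_neq: "\<upsilon> \<noteq> 0" "\<upsilon> \<noteq> 1" "\<upsilon> - 1 \<noteq> 0"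
proof -
  have i: "\<i> \<in> uhp" by (simp add: uhp_def)
  show "\<upsilon> \<noteq> 0" using upsilon_pointwise(1)[OF i] eval_zero[OF i] by auto
  show "\<upsilon> \<noteq> 1" using upsilon_pointwise(2)[OF i] eval_one(2)[OF i] by auto
  thus "\<upsilon> - 1 \<noteq> 0" by simp
qed

text \<open>\<open>u\<close> times the value of the cubic at \<open>t\<close>: the form without
  denominators, which is also the second equation of the model.\<close>

definition cub :: "'a :: comm_ring_1 \<Rightarrow> 'a \<Rightarrow> 'a" where
  "cub u t = u * t ^ 3 + u * t ^ 2 - (u ^ 2 - 1) * t + (u - 1) ^ 2"

text \<open>The theta relations give the product with \<open>g1 + 1\<close>, which can be cancelled
  in the field because \<open>g1\<close> tends to 1 at infinity.\<close>

lemma cub_g1: "cub \<upsilon> g1 = 0"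
proof -
  have "(g1 + 1) * cub \<upsilon> g1 = 0"
  proof (rule mero_eqI)
    fix \<tau> assume \<tau>: "\<tau> \<in> uhp"
    have im: "Im \<tau> > 0" using \<tau> by (simp add: uhp_def)
    have "(eval_mero g1 \<tau> + 1) * (eval_mero \<upsilon> \<tau> * eval_mero g1 \<tau> ^ 3 + eval_mero \<upsilon> \<tau> * eval_mero g1 \<tau> ^ 2
        - (eval_mero \<upsilon> \<tau> ^ 2 - 1) * eval_mero g1 \<tau> + (eval_mero \<upsilon> \<tau> - 1) ^ 2) = 0"
      by (rule cubic_from_theta_relations[OF sk_123_nonzero[OF im] Tk_nonzero[OF im] klein_quartic[OF im]
            theta_relation_a[OF im] theta_relation_b[OF im] eval_upsilon_psi(1)[OF \<tau>] eval_g1_theta[OF \<tau>]]) simp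
    thus "eval_mero ((g1 + 1) * cub \<upsilon> g1) \<tau> = eval_mero 0 \<tau>"
      using \<tau> upsilon_psi_holomorphic g1_holomorphic eval_one
      by (simp add: cub_def eval_hol_ops eval_power_hol eval_zero)
  qed
  moreover have "g1 + 1 \<noteq> 0"
  proof
    assume "g1 + 1 = 0"
    hence "g1 = mero_const 0 - mero_const 1" by (simp add: mero_const_0 mero_const_1 eq_neg_iff_add_eq_0)
    moreover have "eval_mero (mero_const 0 - mero_const 1) \<tau> = - 1" if "\<tau> \<in> uhp" for \<tau>
      using that by (simp add: eval_hol_ops(7)[OF eval_const_holomorphic eval_const_holomorphic] eval_const)
    ultimately have "eval_mero g1 \<tau> = - 1" if "\<tau> \<in> uhp" for \<tau> using that by simp
    hence "\<forall>\<^sub>F \<tau> in ioo. eval_mero g1 \<tau> = - 1"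
      unfolding eventually_ioo by (intro exI[of _ 1]) (auto simp: uhp_def)
    hence "((\<lambda>_. - 1 :: complex) \<longlongrightarrow> 1) ioo" by (rule Lim_transform_eventually[OF g1_tendsto])
    hence "(- 1 :: complex) = 1" using tendsto_unique[OF ioo_neq_bot] tendsto_const by blast
    thus False by simp
  qed
  ultimately show ?thesis by simp
qed

lemma act_cub: "A \<in> Gamma1_7 \<Longrightarrow> act A (cub \<upsilon> f) = cub \<upsilon> (act A f)"
  using Gamma1_7_D(1)[of A] act_upsilon_psi_Gamma1(1)[of A]
  by (simp add: cub_def act_add act_mult act_diff act_power)

text \<open>\<open>2 * A \<tau>\<close> is the image of \<open>2 * \<tau>\<close> under the matrix
  with entries \<open>a\<close>, \<open>2 * b\<close>, \<open>c / 2\<close>, \<open>d\<close>, again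
  in \<open>Gamma1_7\<close>; numerator and denominator of \<open>g1\<close> acquire the same factor
  \<open>zeta7 (- (2 * b))\<close>.\<close>

lemma act_g1_even:
  fixes A :: "int ^ 2 ^ 2"
  assumes A: "A \<in> Gamma1_7" and c: "even (A $ 2 $ 1)"
  shows "act A g1 = g1"
proof (rule mero_eqI)
  fix \<tau> assume \<tau>: "\<tau> \<in> uhp"
  note AD = Gamma1_7_D[OF A]
  obtain c' where c': "A $ 2 $ 1 = 2 * c'" using c by (elim evenE)
  define A' where "A' = mat2 (A $ 1 $ 1) (2 * A $ 1 $ 2) c' (A $ 2 $ 2)"
  have "7 dvd c'" using AD(3) c' by presburger
  hence A': "A' \<in> Gamma1_7" using AD c' by (simp add: Gamma1_7_def A'_def SL2Z_iff algebra_simps)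
  have \<tau>2: "2 * \<tau> \<in> uhp" using \<tau> by (simp add: uhp_def)
  have "2 * moebius_act A \<tau> = moebius_act A' (2 * \<tau>)"
    by (simp add: moebius_act_def A'_def c' algebra_simps)
  hence "phi1 (2 * moebius_act A \<tau>) = zeta7 (- (2 * A $ 1 $ 2)) * phi1 (2 * \<tau>)"
    using phi1_Gamma1[OF A' \<tau>2] by (simp add: A'_def)
  moreover have "(zeta7 (- A $ 1 $ 2))\<^sup>2 = zeta7 (- (2 * A $ 1 $ 2))" by (simp add: zeta7_power)
  ultimately show "eval_mero (act A g1) \<tau> = eval_mero g1 \<tau>"
    using \<tau> AD(1) by (simp add: eval_act eval_g1 moebius_facts phi1_Gamma1[OF A \<tau>] power_mult_distrib)
qed

text \<open>The matrices of \<open>Gamma1_7\<close> with even lower left entry form a subgroup of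
  index 3. Its cosets are told apart by the bottom row modulo 2: \<open>(0, 1)\<close> for the
  identity, \<open>(1, 1)\<close> for \<open>B1\<close>, \<open>(1, 0)\<close> for
  \<open>B2\<close>. Right multiplication by \<open>T7\<close> keeps the first and exchanges the
  other two.\<close>

definition B1 :: "int ^ 2 ^ 2" where "B1 = mat2 1 0 7 1"
definition B2 :: "int ^ 2 ^ 2" where "B2 = mat2 1 1 7 8"
definition T7 :: "int ^ 2 ^ 2" where "T7 = mat2 1 7 0 1"

lemma B_T_Gamma1: "B1 \<in> Gamma1_7" "B2 \<in> Gamma1_7" "T7 \<in> Gamma1_7"
  by (simp_all add: B1_def B2_def T7_def Gamma1_7_def SL2Z_iff)

lemmas B_T_SL2Z = B_T_Gamma1[THEN Gamma1_7_D(1)]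

lemma act_B2_g1: "act B2 g1 = g3"
proof (rule mero_eqI)
  fix \<tau> assume \<tau>: "\<tau> \<in> uhp"
  \<comment> \<open>\<open>2 * B2 \<tau>\<close> equals \<open>A' (\<tau> / 2)\<close>. With its
    upper left entry 2, \<open>A'\<close> doubles the indices: 3 becomes 6, equivalent to 1, and 2
    becomes 4, equivalent to 3.\<close>
  define A' where "A' = mat2 2 1 7 4"
  have A': "A' \<in> SL2Z" "7 dvd A' $ 2 $ 1" by (simp_all add: A'_def SL2Z_iff)
  have h: "\<tau> / 2 \<in> uhp" "Im (\<tau> / 2) > 0" using \<tau> by (simp_all add: uhp_def)
  obtain C where C: "C \<noteq> 0" "\<And>k. sk k (moebius_act A' (\<tau> / 2)) =
     C * (exp (of_real pi * \<i> * of_real (of_int (k * A' $ 1 $ 2) + of_int (k * A' $ 1 $ 2 * (k * A' $ 1 $ 1)) / 7)) * sk (k * A' $ 1 $ 1) (\<tau> / 2))"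
    by (rule sk_Gamma0[OF A' h(1)]) blast
  \<comment> \<open>The exponents differ by \<open>1 + 10 / 7\<close> times \<pi> i, which gives the
    factor \<open>- zeta7 5\<close>.\<close>
  have e: "exp (of_real pi * \<i> * (3 + 18 / 7)) = - zeta7 5 * exp (of_real pi * \<i> * (2 + 8 / 7))"
  proof -
    have "exp (of_real pi * \<i> * (3 + 18 / 7)) = exp (of_real pi * \<i>) * zeta7 5 * exp (of_real pi * \<i> * (2 + 8 / 7))"
      unfolding zeta7_def exp_add[symmetric] by (rule arg_cong[where f = exp]) (simp add: algebra_simps)
    thus ?thesis by simp
  qed
  have "phi1 (moebius_act A' (\<tau> / 2)) = - zeta7 5 * (sk 1 (\<tau> / 2) / sk 3 (\<tau> / 2))"
  proof -
    have "sk 3 (moebius_act A' (\<tau> / 2)) = C * (exp (of_real pi * \<i> * (3 + 18 / 7)) * sk 1 (\<tau> / 2))"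
      "sk 2 (moebius_act A' (\<tau> / 2)) = C * (exp (of_real pi * \<i> * (2 + 8 / 7)) * sk 3 (\<tau> / 2))"
      unfolding C(2) by (simp_all add: A'_def sk_reduce)
    thus ?thesis unfolding phi1_eq e using C(1) by simp
  qed
  moreover have "2 * moebius_act B2 \<tau> = moebius_act A' (\<tau> / 2)"
  proof -
    have "7 * \<tau> + 8 \<noteq> 0" using moebius_facts(1)[OF B_T_SL2Z(2) \<tau>] by (simp add: B2_def)
    moreover have "7 * (\<tau> / 2) + 4 \<noteq> 0" using moebius_facts(1)[OF A'(1) h(1)] by (simp add: A'_def)
    ultimately show ?thesis by (simp add: moebius_act_def A'_def B2_def field_simps)
  qed
  moreover have "phi1 (moebius_act B2 \<tau>) ^ 2 = zeta7 5 * phi1 \<tau> ^ 2"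
  proof -
    have "zeta7 (- 1) ^ 2 = zeta7 5" unfolding zeta7_power by (rule zeta7_cong) simp
    thus ?thesis using phi1_Gamma1[OF B_T_Gamma1(2) \<tau>] by (simp add: B2_def power_mult_distrib)
  qed
  ultimately show "eval_mero (act B2 g1) \<tau> = eval_mero g3 \<tau>"
    using \<tau> B_T_SL2Z(2) sk_123_nonzero[OF h(2)]
    by (simp add: eval_act eval_g1 moebius_facts eval_g3_theta)
qed

lemma act_g1_coset:
  fixes A B :: "int ^ 2 ^ 2"
  assumes A: "A \<in> Gamma1_7" and B: "B \<in> Gamma1_7" and c: "even (A $ 2 $ 1 * B $ 2 $ 2 - A $ 2 $ 2 * B $ 2 $ 1)"
  shows "act A g1 = act B g1"
proof -
  have "A ** minv B \<in> Gamma1_7" using A B Gamma1_7_mult Gamma1_7_minv by blast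
  moreover have "even ((A ** minv B) $ 2 $ 1)" using c by (simp add: matmul_entry)
  ultimately have "act (A ** minv B) g1 = g1" by (rule act_g1_even)
  moreover have "act A g1 = act ((A ** minv B) ** B) g1" using B Gamma1_7_D(1) by (simp add: mult_minv_cancel)
  moreover have "act ((A ** minv B) ** B) g1 = act B (act (A ** minv B) g1)"
    using A B Gamma1_7_subset by (intro act_comp SL2Z_mult SL2Z_minv) auto
  ultimately show ?thesis by simp
qed

lemma act_g1_cases:
  fixes A :: "int ^ 2 ^ 2"
  assumes A: "A \<in> Gamma1_7"
  shows "odd (A $ 2 $ 1) \<Longrightarrow> odd (A $ 2 $ 2) \<Longrightarrow> act A g1 = act B1 g1"
    "odd (A $ 2 $ 1) \<Longrightarrow> even (A $ 2 $ 2) \<Longrightarrow> act A g1 = g3"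
proof -
  show "act A g1 = act B1 g1" if "odd (A $ 2 $ 1)" "odd (A $ 2 $ 2)"
    by (rule act_g1_coset[OF A B_T_Gamma1(1)]) (use that in \<open>simp add: B1_def\<close>)
  show "act A g1 = g3" if "odd (A $ 2 $ 1)" "even (A $ 2 $ 2)"
    unfolding act_B2_g1[symmetric] by (rule act_g1_coset[OF A B_T_Gamma1(2)]) (use that in \<open>simp add: B2_def\<close>)
qed

lemma act_products_g1:
  "act T7 g1 = g1" "act T7 (act B1 g1) = g3" "act T7 g3 = act B1 g1"
  "act B1 (act B1 g1) = g1" "act B1 g3 = g3" "act B2 (act B1 g1) = g1" "act B2 g3 = act B1 g1"
proof -
  note G = B_T_Gamma1 Gamma1_7_mult
  note E = matmul_entry B1_def B2_def T7_def
  show "act T7 g1 = g1" by (rule act_g1_even) (simp_all add: G, simp add: E)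
  have "act (B1 ** T7) g1 = g3" by (rule act_g1_cases(2)) (simp_all add: G, simp_all add: E)
  thus "act T7 (act B1 g1) = g3" by (simp add: act_comp B_T_SL2Z)
  have "act (B2 ** T7) g1 = act B1 g1" by (rule act_g1_cases(1)) (simp_all add: G, simp_all add: E)
  thus "act T7 g3 = act B1 g1" by (simp add: act_comp B_T_SL2Z act_B2_g1)
  have "act (B1 ** B1) g1 = g1" by (rule act_g1_even) (simp_all add: G, simp add: E)
  thus "act B1 (act B1 g1) = g1" by (simp add: act_comp B_T_SL2Z)
  have "act (B2 ** B1) g1 = g3" by (rule act_g1_cases(2)) (simp_all add: G, simp_all add: E)
  thus "act B1 g3 = g3" by (simp add: act_comp B_T_SL2Z act_B2_g1)
  have "act (B1 ** B2) g1 = g1" by (rule act_g1_even) (simp_all add: G, simp add: E)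
  thus "act B2 (act B1 g1) = g1" by (simp add: act_comp B_T_SL2Z)
  have "act (B2 ** B2) g1 = act B1 g1" by (rule act_g1_cases(1)) (simp_all add: G, simp_all add: E)
  thus "act B2 g3 = act B1 g1" by (simp add: act_comp B_T_SL2Z act_B2_g1)
qed

text \<open>Divided differences: dividing by \<open>x - y\<close> and \<open>z - y\<close> and then
  by \<open>x - z\<close> leaves the sum of the roots, and the other symmetric functions follow by
  substitution.\<close>

lemma cubic_three_roots:
  fixes x y z c d :: "'a :: field"
  assumes "x \<noteq> y" "y \<noteq> z" "x \<noteq> z"
    and "x ^ 3 + x ^ 2 + c * x + d = 0" "y ^ 3 + y ^ 2 + c * y + d = 0" "z ^ 3 + z ^ 2 + c * z + d = 0"
  shows "x + y + z = - 1" "x * y + y * z + x * z = c" "x * y * z = - d"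
proof -
  have "(x - y) * (x\<^sup>2 + x * y + y\<^sup>2 + x + y + c) = (x ^ 3 + x ^ 2 + c * x + d) - (y ^ 3 + y ^ 2 + c * y + d)"
    by (simp add: algebra_simps eval_nat_numeral)
  hence 1: "x\<^sup>2 + x * y + y\<^sup>2 + x + y + c = 0" using assms by simp
  have "(z - y) * (z\<^sup>2 + z * y + y\<^sup>2 + z + y + c) = (z ^ 3 + z ^ 2 + c * z + d) - (y ^ 3 + y ^ 2 + c * y + d)"
    by (simp add: algebra_simps eval_nat_numeral)
  hence 2: "z\<^sup>2 + z * y + y\<^sup>2 + z + y + c = 0" using assms by simp
  have "(x - z) * (x + y + z + 1) = (x\<^sup>2 + x * y + y\<^sup>2 + x + y + c) - (z\<^sup>2 + z * y + y\<^sup>2 + z + y + c)"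
    by (simp add: algebra_simps eval_nat_numeral)
  hence "x + y + z + 1 = 0" unfolding 1 2 using assms by simp
  thus s: "x + y + z = - 1" by (simp add: eq_neg_iff_add_eq_0)
  hence z: "z = - 1 - x - y" by (simp add: algebra_simps)
  have c: "c = - (x\<^sup>2 + x * y + y\<^sup>2 + x + y)" using 1 by (simp add: algebra_simps eq_neg_iff_add_eq_0)
  show "x * y + y * z + x * z = c" unfolding z c by (simp add: algebra_simps eval_nat_numeral)
  have d: "d = - (x ^ 3 + x ^ 2 + c * x)" using assms(4) by (simp add: algebra_simps eq_neg_iff_add_eq_0)
  show "x * y * z = - d" unfolding d z c by (simp add: algebra_simps eval_nat_numeral)
qed

text \<open>\<open>act T7\<close> and \<open>act B1\<close> carry these inequalities to
  \<open>g1 \<noteq> g3\<close>.\<close>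

lemma g_distinct_aux: "g1 \<noteq> act B1 g1" "act B1 g1 \<noteq> g3"
proof -
  show "g1 \<noteq> act B1 g1" using act_products_g1(1,2) g1_neq_g3 by metis
  show "act B1 g1 \<noteq> g3" using act_products_g1(4,5) g1_neq_g3 by metis
qed

lemma cub_monic:
  fixes u t :: "'a :: field"
  assumes "u \<noteq> 0"
  shows "cub u t = u * (t ^ 3 + t ^ 2 + (- ((u ^ 2 - 1) / u)) * t + (u - 1) ^ 2 / u)"
  using assms by (simp add: cub_def field_simps)

lemma cub_g_aux: "cub \<upsilon> (act B1 g1) = 0" "cub \<upsilon> g3 = 0"
  using act_cub[OF B_T_Gamma1(1), of g1] act_cub[OF B_T_Gamma1(2), of g1] B_T_SL2Z
  by (simp_all add: cub_g1 act_B2_g1)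

text \<open>The conjugate of \<open>g1\<close> under \<open>B1\<close> is the third root of the
  cubic, so it is -1 minus the other two, and \<open>g_sum\<close> identifies it with
  \<open>g2\<close>. The defining formula of \<open>g2\<close> is never transformed
  directly.\<close>

lemma act_B1_g1: "act B1 g1 = g2"
  and g_symmetric: "g1 * g2 + g2 * g3 + g1 * g3 = - ((\<upsilon> ^ 2 - 1) / \<upsilon>)" "g1 * g2 * g3 = - ((\<upsilon> - 1) ^ 2 / \<upsilon>)"
proof -
  note three = cubic_three_roots[OF g_distinct_aux g1_neq_g3, of "- ((\<upsilon> ^ 2 - 1) / \<upsilon>)" "(\<upsilon> - 1) ^ 2 / \<upsilon>"]
  have roots: "g1 ^ 3 + g1 ^ 2 + (- ((\<upsilon> ^ 2 - 1) / \<upsilon>)) * g1 + (\<upsilon> - 1) ^ 2 / \<upsilon> = 0"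
    "act B1 g1 ^ 3 + act B1 g1 ^ 2 + (- ((\<upsilon> ^ 2 - 1) / \<upsilon>)) * act B1 g1 + (\<upsilon> - 1) ^ 2 / \<upsilon> = 0"
    "g3 ^ 3 + g3 ^ 2 + (- ((\<upsilon> ^ 2 - 1) / \<upsilon>)) * g3 + (\<upsilon> - 1) ^ 2 / \<upsilon> = 0"
    using cub_g1 cub_g_aux unfolding cub_monic[OF upsilon_neq(1)] using upsilon_neq(1) by simp_all
  have "g1 + act B1 g1 + g3 = g1 + g2 + g3" unfolding three(1)[OF roots] g_sum ..
  thus *: "act B1 g1 = g2" by simp
  show "g1 * g2 + g2 * g3 + g1 * g3 = - ((\<upsilon> ^ 2 - 1) / \<upsilon>)" "g1 * g2 * g3 = - ((\<upsilon> - 1) ^ 2 / \<upsilon>)"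
    using three(2,3)[OF roots] unfolding * .
qed

lemmas act_g = act_products_g1[unfolded act_B1_g1]
lemmas g_distinct = g_distinct_aux[unfolded act_B1_g1] g1_neq_g3

lemma P_upsilon_factorization: "P\<^sub>\<upsilon> = [:- g1, 1:] * [:- g2, 1:] * [:- g3, 1:]"
proof -
  have "[:- g1, 1:] * [:- g2, 1:] * [:- g3, 1:] = [:- (g1 * g2 * g3), g1 * g2 + g2 * g3 + g1 * g3, - (g1 + g2 + g3), 1:]"
    by (simp add: algebra_simps)
  thus ?thesis unfolding P_upsilon_def g_symmetric g_sum by simp
qed

section \<open>The discriminant and its square root\<close>

lemma cubic_discriminant_factored:
  fixes x y z :: "'a :: comm_ring_1"
  assumes "p = [:- x, 1:] * [:- y, 1:] * [:- z, 1:]"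
  shows "cubic_discriminant p = ((x - y) * (y - z) * (z - x))\<^sup>2"
proof -
  have "p = [:- (x * y * z), x * y + y * z + x * z, - (x + y + z), 1:]"
    unfolding assms by (simp add: algebra_simps)
  hence *: "poly.coeff p 3 = 1" "poly.coeff p 2 = - (x + y + z)" "poly.coeff p 1 = x * y + y * z + x * z" "poly.coeff p 0 = - (x * y * z)"
    by (simp_all add: eval_nat_numeral)
  show ?thesis unfolding cubic_discriminant_def Let_def * by (simp add: algebra_simps eval_nat_numeral)
qed

lemma delta_discriminant:
  "2 * (\<upsilon> - 1) / \<upsilon>\<^sup>2 * \<delta> = (g1 - g2) * (g2 - g3) * (g3 - g1)"
  "(2 * (\<upsilon> - 1) / \<upsilon>\<^sup>2 * \<delta>)\<^sup>2 = cubic_discriminant P\<^sub>\<upsilon>"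
proof -
  show *: "2 * (\<upsilon> - 1) / \<upsilon>\<^sup>2 * \<delta> = (g1 - g2) * (g2 - g3) * (g3 - g1)"
  proof -
    have "2 * (\<upsilon> - 1) / \<upsilon>\<^sup>2 * (\<upsilon>\<^sup>2 / (2 * (\<upsilon> - 1))) = 1" using upsilon_neq two_neq_zero_mero by simp
    thus ?thesis unfolding delta_def by (metis mult.assoc mult_1_left)
  qed
  show "(2 * (\<upsilon> - 1) / \<upsilon>\<^sup>2 * \<delta>)\<^sup>2 = cubic_discriminant P\<^sub>\<upsilon>"
    unfolding * cubic_discriminant_factored[OF P_upsilon_factorization] ..
qed

lemma discriminant_identity:
  fixes u :: "'a :: field"
  assumes "u \<noteq> 0"
  shows "u ^ 3 * cubic_discriminant [: (u - 1)\<^sup>2 / u, - ((u\<^sup>2 - 1) / u), 1, 1 :] = 4 * (u - 1) ^ 3 * (u ^ 3 - 8 * u\<^sup>2 + 5 * u + 1)"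
proof -
  \<comment> \<open>The numerators of the coefficients, so that \<open>u ^ 3\<close> clears all
    denominators at once.\<close>
  define D C where "D = (u - 1)\<^sup>2" and "C = - (u\<^sup>2 - 1)"
  have "cubic_discriminant [: (u - 1)\<^sup>2 / u, - ((u\<^sup>2 - 1) / u), 1, 1 :] =
      (C / u)\<^sup>2 - 4 * (C / u) ^ 3 - 4 * (D / u) - 27 * (D / u)\<^sup>2 + 18 * (C / u) * (D / u)"
  proof -
    have "- ((u\<^sup>2 - 1) / u) = C / u" unfolding C_def by (rule minus_divide_left)
    thus ?thesis unfolding D_def[symmetric] by (simp add: cubic_discriminant_def Let_def eval_nat_numeral)
  qed
  also have "u ^ 3 * \<dots> = u * C\<^sup>2 - 4 * C ^ 3 - 4 * u\<^sup>2 * D - 27 * u * D\<^sup>2 + 18 * u * C * D"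
    using assms by (simp add: field_simps eval_nat_numeral)
  also have "\<dots> = 4 * (u - 1) ^ 3 * (u ^ 3 - 8 * u\<^sup>2 + 5 * u + 1)"
    unfolding D_def C_def by (simp add: algebra_simps eval_nat_numeral)
  finally show ?thesis .
qed

text \<open>The discriminant is \<open>4 * (\<upsilon> - 1) ^ 3 / \<upsilon> ^ 3\<close> times the
  last factor; the normalisation of \<delta> contributes
  \<open>\<upsilon> ^ 4 / (4 * (\<upsilon> - 1) ^ 2)\<close> and leaves a polynomial.\<close>

lemma delta_square: "\<delta>\<^sup>2 = \<upsilon> * (\<upsilon> - 1) * (\<upsilon> ^ 3 - 8 * \<upsilon>\<^sup>2 + 5 * \<upsilon> + 1)"
proof -
  have nz: "4 * (\<upsilon> - 1)\<^sup>2 \<noteq> 0" using upsilon_neq two_neq_zero_mero mult_eq_0_iff[of "2 :: mero_uhp" 2] by simp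
  have "4 * (\<upsilon> - 1)\<^sup>2 * \<delta>\<^sup>2 = \<upsilon> ^ 4 * (2 * (\<upsilon> - 1) / \<upsilon>\<^sup>2 * \<delta>)\<^sup>2"
  proof -
    have "\<upsilon> ^ 4 * (2 * (\<upsilon> - 1) / \<upsilon>\<^sup>2 * \<delta>)\<^sup>2 = (\<upsilon> ^ 4 / (\<upsilon>\<^sup>2)\<^sup>2) * ((2 * (\<upsilon> - 1))\<^sup>2 * \<delta>\<^sup>2)"
      by (simp add: power_mult_distrib power_divide)
    moreover have "\<upsilon> ^ 4 / (\<upsilon>\<^sup>2)\<^sup>2 = 1" using upsilon_neq by simp
    moreover have "(2 * (\<upsilon> - 1))\<^sup>2 = 4 * (\<upsilon> - 1)\<^sup>2" unfolding power_mult_distrib by simp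
    ultimately show ?thesis by simp
  qed
  also have "\<dots> = \<upsilon> * (\<upsilon> ^ 3 * cubic_discriminant P\<^sub>\<upsilon>)" unfolding delta_discriminant(2) by (simp add: eval_nat_numeral)
  also have "\<dots> = 4 * (\<upsilon> - 1)\<^sup>2 * (\<upsilon> * (\<upsilon> - 1) * (\<upsilon> ^ 3 - 8 * \<upsilon>\<^sup>2 + 5 * \<upsilon> + 1))"
    unfolding P_upsilon_def discriminant_identity[OF upsilon_neq(1)] by (simp add: power2_eq_square power3_eq_cube mult_ac)
  finally show ?thesis unfolding mult_cancel_left using nz by simp
qed

section \<open>The field of level 14\<close>

lemma cusps_g1: "cusps g1"
proof -
  have "g1 = Phi1 1 ^ 2 / Phi1 2"
  proof (rule mero_eqI)
    fix \<tau> assume \<tau>: "\<tau> \<in> uhp"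
    have "phi1 (2 * \<tau>) \<noteq> 0" using phi_nonzero(1)[of "2 * \<tau>"] \<tau> by (simp add: uhp_def)
    hence "eval_mero (Phi1 2) \<tau> \<noteq> 0" using eval_Phi(1)[OF \<tau>, of 2] by simp
    moreover have "eval_mero (Phi1 1 ^ 2) holomorphic_on uhp" using eval_power_hol(1)[OF eval_Phi_holomorphic(1)[of 1]] by simp
    ultimately have "eval_mero (Phi1 1 ^ 2 / Phi1 2) \<tau> = eval_mero (Phi1 1 ^ 2) \<tau> / eval_mero (Phi1 2) \<tau>"
      using eval_hol_ops(8)[OF _ eval_Phi_holomorphic(1)[of 2] \<tau>] by simp
    also have "\<dots> = eval_mero (Phi1 1) \<tau> ^ 2 / eval_mero (Phi1 2) \<tau>"
      using eval_power_hol(2)[OF eval_Phi_holomorphic(1)[of 1] \<tau>] by simp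
    finally show "eval_mero g1 \<tau> = eval_mero (Phi1 1 ^ 2 / Phi1 2) \<tau>"
      using eval_g1[OF \<tau>] eval_Phi(1)[OF \<tau>, of 1] eval_Phi(1)[OF \<tau>, of 2] by simp
  qed
  moreover have "cusps (Phi1 1 ^ 2 / Phi1 2)" by (intro cusps_divide cusps_power cusps_Phi1) simp_all
  ultimately show ?thesis by simp
qed

lemma generators_Gamma14: "\<upsilon> \<in> \<A>\<^sub>0 \<Gamma>(14)" "\<psi> \<in> \<A>\<^sub>0 \<Gamma>(14)" "g1 \<in> \<A>\<^sub>0 \<Gamma>(14)" "g2 \<in> \<A>\<^sub>0 \<Gamma>(14)" "g3 \<in> \<A>\<^sub>0 \<Gamma>(14)" "\<delta> \<in> \<A>\<^sub>0 \<Gamma>(14)"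
proof -
  have sub: "\<Gamma>(14) \<subseteq> \<Gamma>(7)" using Gamma_14_iff by auto
  show u: "\<upsilon> \<in> \<A>\<^sub>0 \<Gamma>(14)" and "\<psi> \<in> \<A>\<^sub>0 \<Gamma>(14)"
    using psi_upsilon_Gamma7 modular_functions_antimono[OF sub] by auto
  have "act A g1 = g1" if "A \<in> \<Gamma>(14)" for A
    using that Gamma_14_iff Gamma_7_iff by (intro act_g1_even) auto
  thus 1: "g1 \<in> \<A>\<^sub>0 \<Gamma>(14)" using cusps_g1 by (simp add: modular_functions_iff[OF Gamma_subset])
  show 2: "g2 \<in> \<A>\<^sub>0 \<Gamma>(14)" using act_Gamma_closed[OF 1 B_T_SL2Z(1)] by (simp add: act_B1_g1)
  show 3: "g3 \<in> \<A>\<^sub>0 \<Gamma>(14)" using act_Gamma_closed[OF 1 B_T_SL2Z(2)] by (simp add: act_B2_g1)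
  note F = C_subfieldD[OF modular_functions_C_subfield[OF Gamma_subset[of 14]]]
  have "(2 :: mero_uhp) = 1 + 1" by simp
  hence "2 \<in> \<A>\<^sub>0 \<Gamma>(14)" using F(3,4) by metis
  thus "\<delta> \<in> \<A>\<^sub>0 \<Gamma>(14)" unfolding delta_def using u 1 2 3 by (intro F(3-)) auto
qed

text \<open>Fixing \<open>g1\<close> makes the lower left entry even. If the upper right entry were
  odd, the bottom row of \<open>B1 ** A\<close> would be \<open>(1, 0)\<close> modulo 2, and
  \<open>g2\<close> would be moved to \<open>g3\<close>.\<close>

lemma stabilizer_Gamma14:
  fixes A :: "int ^ 2 ^ 2"
  assumes A: "A \<in> Gamma1_7" and fix1: "act A \<psi> = \<psi>" "act A g1 = g1" "act A g2 = g2"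
  shows "A \<in> \<Gamma>(14)"
proof -
  note AD = Gamma1_7_D[OF A]
  have c: "even (A $ 2 $ 1)" using act_g1_cases[OF A] fix1(2) g_distinct act_B1_g1 by metis
  have det: "A $ 1 $ 1 * A $ 2 $ 2 - A $ 1 $ 2 * A $ 2 $ 1 = 1" using AD(1) by (simp add: SL2Z_iff)
  have ad: "odd (A $ 1 $ 1)" "odd (A $ 2 $ 2)"
  proof -
    have "odd (A $ 1 $ 1 * A $ 2 $ 2 - A $ 1 $ 2 * A $ 2 $ 1)" unfolding det by simp
    thus "odd (A $ 1 $ 1)" "odd (A $ 2 $ 2)" using c by auto
  qed
  have "even (A $ 1 $ 2)"
  proof (rule ccontr)
    assume b: "odd (A $ 1 $ 2)"
    have "act (B1 ** A) g1 = g3"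
      by (rule act_g1_cases(2)[OF Gamma1_7_mult[OF B_T_Gamma1(1) A]]) (use b c ad in \<open>simp_all add: matmul_entry B1_def\<close>)
    hence "act A g2 = g3" using AD(1) B_T_SL2Z by (simp add: act_comp act_B1_g1)
    thus False using fix1(3) g_distinct by simp
  qed
  thus ?thesis using c psi_fixed_imp[OF A fix1(1)] by (simp add: Gamma_14_iff)
qed

theorem modular_functions_Gamma14_g2: "\<A>\<^sub>0 \<Gamma>(14) = \<complex>({\<upsilon>, \<psi>, g1, g2})"
proof
  show "\<complex>({\<upsilon>, \<psi>, g1, g2}) \<subseteq> \<A>\<^sub>0 \<Gamma>(14)"
    by (rule adjoin_C_least[OF modular_functions_C_subfield[OF Gamma_subset]]) (use generators_Gamma14 in auto)
  obtain R where "congruence_group Gamma1_7 14 R" using congruence_group_Gamma1_7[of 14] by blast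
  then interpret congruence_group Gamma1_7 14 R .
  obtain c where c: "\<And>A. A \<in> Gamma1_7 \<Longrightarrow> act A (\<psi> + mero_const c * (g1 + mero_const c * g2)) = \<psi> + mero_const c * (g1 + mero_const c * g2) \<Longrightarrow> A \<in> \<Gamma>(14)"
    by (rule primitive_element_exists[OF generators_Gamma14(2,3,4) stabilizer_Gamma14]) blast+
  let ?L = "\<complex>({\<upsilon>, \<psi>, g1, g2})"
  note F = C_subfieldD[OF adjoin_C_C_subfield[of "{\<upsilon>, \<psi>, g1, g2}"]]
  have gen: "\<upsilon> \<in> ?L" "\<psi> \<in> ?L" "g1 \<in> ?L" "g2 \<in> ?L" using adjoin_C_superset[of "{\<upsilon>, \<psi>, g1, g2}"] by auto
  have \<theta>: "\<psi> + mero_const c * (g1 + mero_const c * g2) \<in> ?L" using gen by (intro F(1,4,5))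
  have \<theta>': "\<psi> + mero_const c * (g1 + mero_const c * g2) \<in> \<A>\<^sub>0 \<Gamma>(14)"
    using generators_Gamma14 by (intro C_subfieldD(1,4,5)[OF modular_functions_C_subfield[OF Gamma_subset]])
  show "\<A>\<^sub>0 \<Gamma>(14) \<subseteq> ?L"
  proof
    fix f assume "f \<in> \<A>\<^sub>0 \<Gamma>(14)"
    thus "f \<in> ?L"
      by (rule primitive_element_generates[OF _ \<theta>' c adjoin_C_C_subfield modular_functions_Gamma1_7_subset[OF adjoin_C_C_subfield gen(1)] \<theta>])
  qed
qed

text \<open>The factor \<open>e\<close> of the difference product is symmetric in \<open>g2\<close>
  and \<open>g3\<close>, hence rational in \<open>g1\<close> and \<upsilon>. Dividing it out of
  \<delta> gives \<open>g2 - g3\<close>, while \<open>g2 + g3 = - 1 - g1\<close>.\<close>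

theorem modular_functions_Gamma14_delta: "\<A>\<^sub>0 \<Gamma>(14) = \<complex>({\<upsilon>, \<psi>, g1, \<delta>})"
proof
  show "\<complex>({\<upsilon>, \<psi>, g1, \<delta>}) \<subseteq> \<A>\<^sub>0 \<Gamma>(14)"
    by (rule adjoin_C_least[OF modular_functions_C_subfield[OF Gamma_subset]]) (use generators_Gamma14 in auto)
  let ?L = "\<complex>({\<upsilon>, \<psi>, g1, \<delta>})"
  note F = C_subfieldD[OF adjoin_C_C_subfield[of "{\<upsilon>, \<psi>, g1, \<delta>}"]]
  have gen: "\<upsilon> \<in> ?L" "\<psi> \<in> ?L" "g1 \<in> ?L" "\<delta> \<in> ?L" using adjoin_C_superset[of "{\<upsilon>, \<psi>, g1, \<delta>}"] by auto
  have "(2 :: mero_uhp) = 1 + 1" by simp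
  hence two: "2 \<in> ?L" using F(3,4) by metis
  define s where "s = - 1 - g1"
  define e where "e = (g1 - g2) * (g3 - g1)"
  have s: "g2 + g3 = s" unfolding s_def g_sum[symmetric] by simp
  have sL: "s \<in> ?L" unfolding s_def using gen by (intro F(3,7,8))
  have "e = - (g1\<^sup>2 - g1 * (g2 + g3) + ((g1 * g2 + g2 * g3 + g1 * g3) - g1 * (g2 + g3)))"
    unfolding e_def by (simp add: algebra_simps power2_eq_square)
  also have "\<dots> \<in> ?L" unfolding s g_symmetric using gen sL by (intro F(3-8,10))
  finally have eL: "e \<in> ?L" .
  have "e \<noteq> 0" using g_distinct by (simp add: e_def)
  moreover have "(g2 - g3) * e = 2 * (\<upsilon> - 1) / \<upsilon>\<^sup>2 * \<delta>" unfolding delta_discriminant e_def by (simp add: mult_ac)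
  ultimately have "g2 - g3 = 2 * (\<upsilon> - 1) / \<upsilon>\<^sup>2 * \<delta> / e" by (metis nonzero_mult_div_cancel_right)
  also have "\<dots> \<in> ?L" using gen two eL by (intro F(3,5-8,10))
  finally have dL: "g2 - g3 \<in> ?L" .
  have "g2 = (s + (g2 - g3)) / 2" unfolding s[symmetric] using two_neq_zero_mero by simp
  also have "\<dots> \<in> ?L" using sL dL two by (intro F(4,6))
  finally have "g2 \<in> ?L" .
  thus "\<A>\<^sub>0 \<Gamma>(14) \<subseteq> ?L" unfolding modular_functions_Gamma14_g2
    using gen by (intro adjoin_C_least adjoin_C_C_subfield) auto
qed

theorem splitting_field_P_upsilon: "splitting_field_over (\<A>\<^sub>0 \<Gamma>(7)) P\<^sub>\<upsilon> (\<A>\<^sub>0 \<Gamma>(14))"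
proof -
  have "subfield (\<A>\<^sub>0 \<Gamma>(7)) mero_field" unfolding modular_functions_Gamma7 adjoin_C_def
    by (rule field.generate_field_is_subfield[OF field_from_type_algebra]) (simp add: mero_field_simps)
  moreover have "P\<^sub>\<upsilon> \<noteq> 0" unfolding P_upsilon_def by simp
  moreover have "set (coeffs P\<^sub>\<upsilon>) \<subseteq> \<A>\<^sub>0 \<Gamma>(7)"
  proof -
    note F = C_subfieldD[OF modular_functions_C_subfield[OF Gamma_subset[of 7]]]
    have "(\<upsilon> - 1)\<^sup>2 / \<upsilon> \<in> \<A>\<^sub>0 \<Gamma>(7)" "- ((\<upsilon>\<^sup>2 - 1) / \<upsilon>) \<in> \<A>\<^sub>0 \<Gamma>(7)" "1 \<in> \<A>\<^sub>0 \<Gamma>(7)"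
      using psi_upsilon_Gamma7 by (intro F(3-); simp)+
    thus ?thesis by (simp add: P_upsilon_def cCons_def)
  qed
  moreover have "\<exists>rs. set rs \<subseteq> \<A>\<^sub>0 \<Gamma>(14) \<and> P\<^sub>\<upsilon> = Polynomial.smult (Polynomial.lead_coeff P\<^sub>\<upsilon>) (\<Prod>r\<leftarrow>rs. [:- r, 1:]) \<and>
      \<A>\<^sub>0 \<Gamma>(14) = generate_field mero_field (\<A>\<^sub>0 \<Gamma>(7) \<union> set rs)"
  proof (intro exI[of _ "[g1, g2, g3]"] conjI equalityI)
    show "set [g1, g2, g3] \<subseteq> \<A>\<^sub>0 \<Gamma>(14)" using generators_Gamma14 by simp
    have "Polynomial.lead_coeff P\<^sub>\<upsilon> = 1" unfolding P_upsilon_def by simp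
    thus "P\<^sub>\<upsilon> = Polynomial.smult (Polynomial.lead_coeff P\<^sub>\<upsilon>) (\<Prod>r\<leftarrow>[g1, g2, g3]. [:- r, 1:])"
      using P_upsilon_factorization by (simp only: list.map prod_list.Cons prod_list.Nil smult_1_left mult_1_right mult.assoc)
    have sub: "\<Gamma>(14) \<subseteq> \<Gamma>(7)" using Gamma_14_iff by auto
    let ?H = "\<A>\<^sub>0 \<Gamma>(7) \<union> set [g1, g2, g3]"
    show "generate_field mero_field ?H \<subseteq> \<A>\<^sub>0 \<Gamma>(14)"
      by (rule generate_field_least[OF modular_functions_C_subfield[OF Gamma_subset]])
        (use modular_functions_antimono[OF sub] generators_Gamma14 in auto)
    have "range mero_const \<subseteq> ?H" using C_subfieldD(1)[OF modular_functions_C_subfield[OF Gamma_subset[of 7]]] by auto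
    hence C: "C_subfield (generate_field mero_field ?H)" by (rule generate_field_C_subfield)
    have "h \<in> generate_field mero_field ?H" if "h \<in> ?H" for h using that by (rule generate_field.incl)
    hence "{\<upsilon>, \<psi>, g1, g2} \<subseteq> generate_field mero_field ?H" using psi_upsilon_Gamma7 by simp
    thus "\<A>\<^sub>0 \<Gamma>(14) \<subseteq> generate_field mero_field ?H"
      unfolding modular_functions_Gamma14_g2 by (rule adjoin_C_least[OF C])
  qed
  ultimately show ?thesis unfolding splitting_field_over_def by blast
qed

section \<open>Affine varieties with a generic point\<close>

text \<open>One evaluation for two coefficient maps: the identity gives values at complex points,
  \<open>mero_const\<close> gives values at a tuple of meromorphic functions.\<close>

definition gev :: "(complex \<Rightarrow> 'a :: comm_ring_1) \<Rightarrow> ('n :: finite \<Rightarrow> 'a) \<Rightarrow> 'n cpoly \<Rightarrow> 'a" where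
  "gev \<phi> x p = (\<Sum>m\<in>Poly_Mapping.keys p. \<phi> (Poly_Mapping.lookup p m) * (\<Prod>i\<in>UNIV. x i ^ Poly_Mapping.lookup m i))"

locale coeff_hom =
  fixes \<phi> :: "complex \<Rightarrow> 'a :: comm_ring_1"
  assumes hom_add: "\<phi> (a + b) = \<phi> a + \<phi> b" and hom_mult: "\<phi> (a * b) = \<phi> a * \<phi> b" and hom_one: "\<phi> 1 = 1"
begin

lemma hom_zero: "\<phi> 0 = 0"
  using hom_add[of 0 0] by simp

lemma gev_superset:
  assumes "finite S" "Poly_Mapping.keys p \<subseteq> S"
  shows "gev \<phi> x p = (\<Sum>m\<in>S. \<phi> (Poly_Mapping.lookup p m) * (\<Prod>i\<in>UNIV. x i ^ Poly_Mapping.lookup m i))"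
  unfolding gev_def using assms by (intro sum.mono_neutral_left) (auto simp: in_keys_iff hom_zero)

lemma gev_add: "gev \<phi> x (p + q) = gev \<phi> x p + gev \<phi> x q"
proof -
  let ?S = "Poly_Mapping.keys p \<union> Poly_Mapping.keys q"
  have "finite ?S" "Poly_Mapping.keys (p + q) \<subseteq> ?S" "Poly_Mapping.keys p \<subseteq> ?S" "Poly_Mapping.keys q \<subseteq> ?S"
    using keys_add[of p q] by auto
  thus ?thesis by (simp add: gev_superset[of ?S] lookup_add hom_add sum.distrib distrib_right)
qed

lemma gev_zero [simp]: "gev \<phi> x 0 = 0" by (simp add: gev_def)

lemma gev_diff: "gev \<phi> x (p - q) = gev \<phi> x p - gev \<phi> x q"
  using gev_add[of x "p - q" q] by (simp add: algebra_simps)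

lemma gev_sum: "gev \<phi> x (sum f I) = (\<Sum>i\<in>I. gev \<phi> x (f i))"
  by (induction I rule: infinite_finite_induct) (simp_all add: gev_add)

lemma gev_single: "gev \<phi> x (Poly_Mapping.single m c) = \<phi> c * (\<Prod>i\<in>UNIV. x i ^ Poly_Mapping.lookup m i)"
  by (subst gev_superset[of "{m}"]) (auto split: if_splits)

lemma cpoly_eq_sum: "p = (\<Sum>m\<in>Poly_Mapping.keys p. Poly_Mapping.single m (Poly_Mapping.lookup p m))"
proof (rule poly_mapping_eqI)
  fix m
  show "Poly_Mapping.lookup p m = Poly_Mapping.lookup (\<Sum>m\<in>Poly_Mapping.keys p. Poly_Mapping.single m (Poly_Mapping.lookup p m)) m"
    by (simp add: lookup_sum lookup_single when_def in_keys_iff)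
qed

lemma gev_mult: "gev \<phi> x (p * q) = gev \<phi> x p * gev \<phi> x q"
proof -
  have "p * q = (\<Sum>m\<in>Poly_Mapping.keys p. Poly_Mapping.single m (Poly_Mapping.lookup p m)) *
      (\<Sum>m\<in>Poly_Mapping.keys q. Poly_Mapping.single m (Poly_Mapping.lookup q m))"
    using cpoly_eq_sum[of p] cpoly_eq_sum[of q] by simp
  also have "\<dots> = (\<Sum>m\<in>Poly_Mapping.keys p. \<Sum>n\<in>Poly_Mapping.keys q.
      Poly_Mapping.single (m + n) (Poly_Mapping.lookup p m * Poly_Mapping.lookup q n))"
    by (simp add: sum_product mult_single)
  finally show ?thesis
    by (simp add: gev_sum gev_single gev_def[of \<phi> x p] gev_def[of \<phi> x q] sum_product hom_mult lookup_add power_add prod.distrib mult_ac)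
qed

lemma gev_const: "gev \<phi> x (cpoly_const c) = \<phi> c"
  by (simp add: cpoly_const_def gev_single)

lemma gev_one [simp]: "gev \<phi> x 1 = 1"
  using gev_const[of x 1] by (simp add: cpoly_const_def hom_one)

lemma gev_power: "gev \<phi> x (p ^ n) = gev \<phi> x p ^ n"
  by (induction n) (simp_all add: gev_mult)

lemma gev_var: "gev \<phi> x (cpoly_var i) = x i"
proof -
  have "(\<Prod>j\<in>UNIV. x j ^ Poly_Mapping.lookup (Poly_Mapping.single i 1) j) = (\<Prod>j\<in>UNIV. if j = i then x j else 1)"
    by (rule prod.cong) (auto simp: lookup_single when_def)
  thus ?thesis by (simp add: cpoly_var_def gev_single hom_one)
qed

end

interpretation ce: coeff_hom "\<lambda>c :: complex. c" by unfold_locales simp_all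

interpretation me: coeff_hom mero_const
  by unfold_locales (simp_all add: mero_const_add mero_const_mult mero_const_1)

lemma cpoly_eval_gev: "cpoly_eval p x = gev (\<lambda>c. c) (($) x) p"
  by (simp add: cpoly_eval_def gev_def)

lemmas cpoly_eval_simps = ce.gev_add ce.gev_mult ce.gev_diff ce.gev_const ce.gev_var ce.gev_one ce.gev_zero ce.gev_power

definition mev :: "mero_uhp ^ 'n :: finite \<Rightarrow> 'n cpoly \<Rightarrow> mero_uhp" where
  "mev x p = gev mero_const (($) x) p"

lemma mev_simps:
  "mev x (p + q) = mev x p + mev x q" "mev x (p * q) = mev x p * mev x q" "mev x (p - q) = mev x p - mev x q"
  "mev x (cpoly_const c) = mero_const c" "mev x (cpoly_var i) = x $ i" "mev x 1 = 1" "mev x 0 = 0"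
  by (simp_all add: mev_def me.gev_add me.gev_mult me.gev_diff me.gev_const me.gev_var)

lemma mev_C_subfield:
  fixes x :: "mero_uhp ^ 'n :: finite"
  assumes K: "C_subfield K" and "\<And>i. x $ i \<in> K"
  shows "mev x p \<in> K"
proof -
  have "(\<Prod>i\<in>I. (x $ i) ^ f i) \<in> K" for I f
    by (induction I rule: infinite_finite_induct) (simp_all add: C_subfieldD[OF K] assms(2))
  thus ?thesis unfolding mev_def gev_def by (intro C_subfield_sum[OF K] C_subfieldD(5)[OF K] C_subfieldD(1)[OF K])
qed

lemma eval_mev:
  fixes x :: "mero_uhp ^ 'n :: finite"
  assumes hol: "\<And>i. eval_mero (x $ i) holomorphic_on uhp"
  shows "eval_mero (mev x p) holomorphic_on uhp"
    "z \<in> uhp \<Longrightarrow> eval_mero (mev x p) z = cpoly_eval p (\<chi> i. eval_mero (x $ i) z)"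
proof -
  have P: "eval_mero (\<Prod>i\<in>I. (x $ i) ^ f i) holomorphic_on uhp \<and>
      (\<forall>z\<in>uhp. eval_mero (\<Prod>i\<in>I. (x $ i) ^ f i) z = (\<Prod>i\<in>I. eval_mero (x $ i) z ^ f i))" for I f
    by (induction I rule: infinite_finite_induct) (simp_all add: eval_one eval_hol_ops eval_power_hol hol)
  have S: "eval_mero (\<Sum>m\<in>S. mero_const (c m) * (\<Prod>i\<in>UNIV. (x $ i) ^ f m i)) holomorphic_on uhp \<and>
      (\<forall>z\<in>uhp. eval_mero (\<Sum>m\<in>S. mero_const (c m) * (\<Prod>i\<in>UNIV. (x $ i) ^ f m i)) z =
        (\<Sum>m\<in>S. c m * (\<Prod>i\<in>UNIV. eval_mero (x $ i) z ^ f m i)))" for S :: "('n \<Rightarrow>\<^sub>0 nat) set" and c f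
  proof (induction S rule: infinite_finite_induct)
    case (insert m S)
    show ?case using insert P eval_const_holomorphic by (simp add: eval_hol_ops eval_const)
  qed (use eval_const_holomorphic[of 0] eval_zero in \<open>simp_all add: mero_const_0\<close>)
  show "eval_mero (mev x p) holomorphic_on uhp" unfolding mev_def gev_def using S by blast
  show "eval_mero (mev x p) z = cpoly_eval p (\<chi> i. eval_mero (x $ i) z)" if "z \<in> uhp"
    unfolding mev_def gev_def cpoly_eval_def using S that by simp
qed

section \<open>Zariski closed sets and dimension one\<close>

lemma zariski_closed_vanishing:
  assumes "zariski_closed W" "\<not> V \<subseteq> W"
  obtains p where "p \<notin> vanishing_ideal V" "\<And>v. v \<in> W \<Longrightarrow> cpoly_eval p v = 0"
  using assms unfolding zariski_closed_def vanishing_ideal_def by blast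

lemma zariski_closed_singleton: "zariski_closed {a :: complex ^ 'n :: finite}"
  unfolding zariski_closed_def
  by (rule exI[of _ "range (\<lambda>i. cpoly_var i - cpoly_const (a $ i))"])
    (auto simp: cpoly_eval_gev cpoly_eval_simps vec_eq_iff)

lemma zariski_closed_Un:
  assumes "zariski_closed A" "zariski_closed B"
  shows "zariski_closed (A \<union> B)"
proof -
  obtain S T where S: "A = {x. \<forall>p\<in>S. cpoly_eval p x = 0}" and T: "B = {x. \<forall>p\<in>T. cpoly_eval p x = 0}"
    using assms unfolding zariski_closed_def by blast
  have "A \<union> B = {x. \<forall>r\<in>(\<lambda>(p, q). p * q) ` (S \<times> T). cpoly_eval r x = 0}"
    unfolding S T by (auto simp: cpoly_eval_gev cpoly_eval_simps)
  thus ?thesis unfolding zariski_closed_def by blast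
qed

lemma zariski_closed_finite: "finite F \<Longrightarrow> zariski_closed F"
proof (induction F rule: finite_induct)
  case empty
  show ?case unfolding zariski_closed_def by (rule exI[of _ "{1}"]) (simp add: cpoly_eval_gev)
next
  case (insert a F)
  thus ?case using zariski_closed_Un[OF zariski_closed_singleton[of a]] by simp
qed

lemma affine_variety_singleton: "affine_variety {a :: complex ^ 'n :: finite}"
  unfolding affine_variety_def using zariski_closed_singleton by auto

lemma affine_variety_finite:
  assumes "affine_variety C" "finite C"
  obtains a where "C = {a}"
proof -
  obtain a where a: "a \<in> C" using assms unfolding affine_variety_def by blast
  have "zariski_closed (C - {a})" using assms by (intro zariski_closed_finite) auto
  moreover have "C \<subseteq> {a} \<union> (C - {a})" by blast
  ultimately have "C \<subseteq> {a} \<or> C \<subseteq> C - {a}"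
    using assms(1) zariski_closed_singleton[of a] unfolding affine_variety_def by blast
  thus ?thesis using a that by blast
qed

text \<open>In a chain of three varieties the middle one would be a proper closed subset, hence
  finite, hence a single point, with no room for a smaller nonempty one. A point and
  \<open>V\<close> itself form the chain of length one.\<close>

lemma affine_curveI:
  assumes V: "affine_variety V" "infinite V"
    and fin: "\<And>W. zariski_closed W \<Longrightarrow> W \<subset> V \<Longrightarrow> finite W"
  shows "affine_curve V"
proof -
  have "zariski_dim V = 1" unfolding zariski_dim_def
  proof (rule antisym)
    show "Sup {enat n | n. \<exists>C. (\<forall>i\<le>n. affine_variety (C i) \<and> C i \<subseteq> V) \<and> (\<forall>i<n. C i \<subset> C (Suc i))} \<le> 1"
    proof (rule Sup_least, clarify)
      fix n C assume C: "\<forall>i\<le>n. affine_variety (C i) \<and> C i \<subseteq> V" "\<forall>i<n. C i \<subset> C (Suc i)"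
      have "n \<le> 1"
      proof (rule ccontr)
        assume "\<not> n \<le> 1"
        hence n: "0 < n" "1 < n" "Suc 0 \<le> n" "Suc (Suc 0) \<le> n" by auto
        have c: "C 0 \<subset> C (Suc 0)" "C (Suc 0) \<subset> C (Suc (Suc 0))" "C (Suc (Suc 0)) \<subseteq> V" "C 0 \<noteq> {}" "affine_variety (C (Suc 0))"
          using C n unfolding affine_variety_def by auto
        have "finite (C (Suc 0))"
          by (rule fin) (use c in \<open>auto simp: affine_variety_def\<close>)
        then obtain a where "C (Suc 0) = {a}" using affine_variety_finite[OF c(5)] by blast
        thus False using c(1,4) by (auto simp: psubset_eq subset_singleton_iff)
      qed
      thus "enat n \<le> 1" by (simp add: one_enat_def)
    qed
    obtain a where a: "a \<in> V" using V(1) unfolding affine_variety_def by blast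
    have "\<exists>C. (\<forall>i\<le>1. affine_variety (C i) \<and> C i \<subseteq> V) \<and> (\<forall>i<1. C i \<subset> C (Suc i))"
    proof (intro exI[of _ "\<lambda>i. if i = (0 :: nat) then {a} else V"] conjI allI impI)
      fix i :: nat assume "i < 1"
      have "{a} \<noteq> V" using V(2) by auto
      thus "(if i = 0 then {a} else V) \<subset> (if Suc i = 0 then {a} else V)" using a \<open>i < 1\<close> by auto
    qed (use V a affine_variety_singleton in auto)
    thus "1 \<le> Sup {enat n | n. \<exists>C. (\<forall>i\<le>n. affine_variety (C i) \<and> C i \<subseteq> V) \<and> (\<forall>i<n. C i \<subset> C (Suc i))}"
      unfolding one_enat_def by (intro Sup_upper) blast
  qed
  thus ?thesis using V unfolding affine_curve_def by blast
qed

text \<open>The polynomials vanishing on \<open>V\<close> are the kernel of the evaluation at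
  \<open>x\<close>, a prime ideal because the values lie in a field.\<close>

locale generic_point =
  fixes V :: "(complex ^ 'n :: finite) set" and x :: "mero_uhp ^ 'n"
  assumes vanishing_iff: "p \<in> vanishing_ideal V \<longleftrightarrow> mev x p = 0"
begin

lemma irreducible:
  assumes "zariski_closed V"
  shows "affine_variety V"
  unfolding affine_variety_def
proof (intro conjI allI impI)
  show "V \<noteq> {}"
  proof
    assume "V = {}"
    hence "mev x 1 = 0" using vanishing_iff[of 1] by (simp add: vanishing_ideal_def)
    thus False by (simp add: mev_simps)
  qed
  fix A B assume AB: "zariski_closed A" "zariski_closed B" "V \<subseteq> A \<union> B"
  show "V \<subseteq> A \<or> V \<subseteq> B"
  proof (rule ccontr)
    assume "\<not> (V \<subseteq> A \<or> V \<subseteq> B)"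
    then obtain p q where p: "p \<notin> vanishing_ideal V" "\<And>v. v \<in> A \<Longrightarrow> cpoly_eval p v = 0"
      and q: "q \<notin> vanishing_ideal V" "\<And>v. v \<in> B \<Longrightarrow> cpoly_eval q v = 0"
      using AB zariski_closed_vanishing by (metis (no_types, lifting))
    have "p * q \<in> vanishing_ideal V"
      using AB(3) p(2) q(2) by (auto simp: vanishing_ideal_def cpoly_eval_gev cpoly_eval_simps)
    thus False using p(1) q(1) by (simp add: vanishing_iff mev_simps)
  qed
qed (rule assms)

definition fracs :: "mero_uhp set" where
  "fracs = {mev x p / mev x q | p q. mev x q \<noteq> 0}"

text \<open>The fibre of the value map over \<open>t\<close>. For \<open>t\<close> in
  \<open>fracs\<close> these fibres are exactly the equivalence classes of fractions on
  \<open>V\<close>.\<close>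

definition cls :: "mero_uhp \<Rightarrow> ('n cpoly \<times> 'n cpoly) set" where
  "cls t = {(p, q). mev x q \<noteq> 0 \<and> mev x p / mev x q = t}"

lemma fracsI: "mev x q \<noteq> 0 \<Longrightarrow> mev x p / mev x q \<in> fracs" by (auto simp: fracs_def)

lemma ratfun_eq_cls: "mev x q \<noteq> 0 \<Longrightarrow> ratfun V p q = cls (mev x p / mev x q)"
  by (auto simp: ratfun_def ratfun_rel_def cls_def vanishing_iff mev_simps field_simps)

lemma fracs_C_subfield: "C_subfield fracs"
  unfolding C_subfield_def
proof (intro conjI ballI subsetI)
  fix t assume "t \<in> range mero_const"
  then obtain c where "t = mero_const c" by blast
  thus "t \<in> fracs" using fracsI[of 1 "cpoly_const c"] by (simp add: mev_simps)
next
  fix s t assume "s \<in> fracs" "t \<in> fracs"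
  then obtain p q p' q' where s: "s = mev x p / mev x q" "mev x q \<noteq> 0" and t: "t = mev x p' / mev x q'" "mev x q' \<noteq> 0"
    unfolding fracs_def by blast
  have "s + t = mev x (p * q' + p' * q) / mev x (q * q')" unfolding s t using s(2) t(2) by (simp add: mev_simps add_frac_eq)
  thus "s + t \<in> fracs" using fracsI[of "q * q'" "p * q' + p' * q"] s(2) t(2) by (simp add: mev_simps(2))
  have "s * t = mev x (p * p') / mev x (q * q')" using s t by (simp add: mev_simps)
  thus "s * t \<in> fracs" using fracsI[of "q * q'" "p * p'"] s(2) t(2) by (simp add: mev_simps(2))
  show "s / t \<in> fracs"
  proof (cases "mev x p' = 0")
    case True
    thus ?thesis using fracsI[of 1 0] t by (simp add: mev_simps)
  next
    case False
    have "s / t = mev x (p * q') / mev x (q * p')" using s t by (simp add: mev_simps)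
    thus ?thesis using fracsI[of "q * p'" "p * q'"] s(2) False by (simp add: mev_simps(2))
  qed
qed

lemma fracs_eq_adjoin: "fracs = \<complex>(range (($) x))"
proof
  show "\<complex>(range (($) x)) \<subseteq> fracs"
  proof (rule adjoin_C_least[OF fracs_C_subfield], clarify)
    fix i show "x $ i \<in> fracs" using fracsI[of 1 "cpoly_var i"] by (simp add: mev_simps)
  qed
  have "mev x p \<in> \<complex>(range (($) x))" for p
    by (rule mev_C_subfield[OF adjoin_C_C_subfield]) (use adjoin_C_superset[of "range (($) x)"] in auto)
  thus "fracs \<subseteq> \<complex>(range (($) x))"
    unfolding fracs_def using C_subfieldD(6)[OF adjoin_C_C_subfield] by blast
qed

lemma cls_nonempty: "t \<in> fracs \<Longrightarrow> cls t \<noteq> {}" by (auto simp: fracs_def cls_def)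

lemma cls_inj: "inj_on cls fracs"
proof (rule inj_onI)
  fix s t assume "s \<in> fracs" "cls s = cls t"
  then obtain p q where "(p, q) \<in> cls s" "(p, q) \<in> cls t" using cls_nonempty[of s] by auto
  thus "s = t" by (auto simp: cls_def)
qed

lemma cls_add: "s \<in> fracs \<Longrightarrow> t \<in> fracs \<Longrightarrow> add (function_field V) (cls s) (cls t) = cls (s + t)"
proof -
  assume "s \<in> fracs" "t \<in> fracs"
  moreover have "ratfun V (p * q' + p' * q) (q * q') = cls (s + t)" if "(p, q) \<in> cls s" "(p', q') \<in> cls t" for p q p' q'
  proof -
    have nz: "mev x q \<noteq> 0" "mev x q' \<noteq> 0" and st: "s = mev x p / mev x q" "t = mev x p' / mev x q'" using that by (auto simp: cls_def)
    have "mev x (p * q' + p' * q) / mev x (q * q') = s + t" unfolding st using nz by (simp add: mev_simps field_simps)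
    thus ?thesis using nz by (subst ratfun_eq_cls) (simp_all add: mev_simps)
  qed
  ultimately show ?thesis using cls_nonempty[of s] cls_nonempty[of t] unfolding function_field_def by fastforce
qed

lemma cls_mult: "s \<in> fracs \<Longrightarrow> t \<in> fracs \<Longrightarrow> mult (function_field V) (cls s) (cls t) = cls (s * t)"
proof -
  assume "s \<in> fracs" "t \<in> fracs"
  moreover have "ratfun V (p * p') (q * q') = cls (s * t)" if "(p, q) \<in> cls s" "(p', q') \<in> cls t" for p q p' q'
  proof -
    have nz: "mev x q \<noteq> 0" "mev x q' \<noteq> 0" and st: "s = mev x p / mev x q" "t = mev x p' / mev x q'" using that by (auto simp: cls_def)
    have "mev x (p * p') / mev x (q * q') = s * t" unfolding st by (simp add: mev_simps)
    thus ?thesis using nz by (subst ratfun_eq_cls) (simp_all add: mev_simps)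
  qed
  ultimately show ?thesis using cls_nonempty[of s] cls_nonempty[of t] unfolding function_field_def by fastforce
qed

lemma carrier_function_field: "carrier (function_field V) = cls ` fracs"
proof -
  have "carrier (function_field V) = {ratfun V p q | p q. mev x q \<noteq> 0}"
  proof -
    have "carrier (function_field V) = {ratfun V p q | p q. q \<notin> vanishing_ideal V}"
      unfolding function_field_def quotient_def ratfun_def by auto
    thus ?thesis unfolding vanishing_iff .
  qed
  also have "\<dots> = {cls (mev x p / mev x q) | p q. mev x q \<noteq> 0}" by (rule Collect_cong) (metis ratfun_eq_cls)
  also have "\<dots> = cls ` fracs" unfolding fracs_def by blast
  finally show ?thesis .
qed

text \<open>The isomorphism is the inverse of \<open>cls\<close>, which sends a function to the
  class of all fractions representing it.\<close>

theorem affine_modelI: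
  assumes "affine_curve V"
  shows "affine_model \<complex>(range (($) x)) V x"
proof -
  define h where "h = inv_into fracs cls"
  have h: "h (cls t) = t" if "t \<in> fracs" for t unfolding h_def using that cls_inj by simp
  note F = C_subfieldD[OF fracs_C_subfield]
  have one: "one (function_field V) = cls 1"
    using ratfun_eq_cls[of 1 1] by (simp add: function_field_def mev_simps)
  have "h \<in> ring_iso (function_field V) (mero_field\<lparr>carrier := fracs\<rparr>)"
    unfolding ring_iso_def
  proof (intro CollectI conjI ring_hom_memI)
    fix S assume "S \<in> carrier (function_field V)"
    then obtain s where s: "s \<in> fracs" "S = cls s" unfolding carrier_function_field by blast
    show "h S \<in> carrier (mero_field\<lparr>carrier := fracs\<rparr>)" using s h by simp
    fix T assume "T \<in> carrier (function_field V)"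
    then obtain t where t: "t \<in> fracs" "T = cls t" unfolding carrier_function_field by blast
    show "h (S \<otimes>\<^bsub>function_field V\<^esub> T) = h S \<otimes>\<^bsub>mero_field\<lparr>carrier := fracs\<rparr>\<^esub> h T"
      using s t h F by (simp add: cls_mult mero_field_simps)
    show "h (S \<oplus>\<^bsub>function_field V\<^esub> T) = h S \<oplus>\<^bsub>mero_field\<lparr>carrier := fracs\<rparr>\<^esub> h T"
      using s t h F by (simp add: cls_add mero_field_simps)
  next
    show "h \<one>\<^bsub>function_field V\<^esub> = \<one>\<^bsub>mero_field\<lparr>carrier := fracs\<rparr>\<^esub>"
      using h F(3) by (simp add: one mero_field_simps)
    show "bij_betw h (carrier (function_field V)) (carrier (mero_field\<lparr>carrier := fracs\<rparr>))"
      unfolding carrier_function_field h_def using cls_inj by (simp add: bij_betw_inv_into inj_on_imp_bij_betw)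
  qed
  moreover have "h (ratfun V (cpoly_const c) 1) = mero_const c" for c
    using h[OF F(1)[of c]] ratfun_eq_cls[of 1 "cpoly_const c"] by (simp add: mev_simps)
  moreover have "h (ratfun V (cpoly_var i) 1) = x $ i" for i
    using h[of "x $ i"] ratfun_eq_cls[of 1 "cpoly_var i"] fracsI[of 1 "cpoly_var i"] by (simp add: mev_simps)
  ultimately show ?thesis unfolding affine_model_def fracs_eq_adjoin[symmetric] using assms by blast
qed

end

section \<open>The affine model\<close>

lemma vector_4 [simp]:
  "(vector [a, b, c, d] :: 'a :: zero ^ 4) $ 1 = a" "(vector [a, b, c, d] :: 'a :: zero ^ 4) $ 2 = b"
  "(vector [a, b, c, d] :: 'a :: zero ^ 4) $ 3 = c" "(vector [a, b, c, d] :: 'a :: zero ^ 4) $ 4 = d"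
  unfolding vector_def by simp_all

lemma mero_const_of_nat: "mero_const (of_nat n) = of_nat n"
  by (induction n) (simp_all add: mero_const_0 mero_const_1 mero_const_add)

lemma mero_const_numeral: "mero_const (numeral n) = numeral n"
  using mero_const_of_nat[of "numeral n"] by simp

lemma eval_numeral: "eval_mero (numeral n) holomorphic_on uhp" "z \<in> uhp \<Longrightarrow> eval_mero (numeral n) z = numeral n"
  using eval_const_holomorphic[of "numeral n"] eval_const[of z "numeral n"] by (simp_all add: mero_const_numeral)

lemma eval_uminus_hol: "eval_mero f holomorphic_on uhp \<Longrightarrow> z \<in> uhp \<Longrightarrow> eval_mero (- f) z = - eval_mero f z"
  using eval_hol_ops(7)[OF eval_const_holomorphic[of 0], of f z] eval_const[of z 0] by (simp add: mero_const_0)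

lemmas hol_eval = upsilon_psi_holomorphic g1_holomorphic g2_holomorphic g3_holomorphic eval_one eval_numeral
  eval_hol_ops(1-3,5-7) eval_power_hol

lemma delta_holomorphic: "eval_mero \<delta> holomorphic_on uhp"
proof -
  have "eval_mero (\<upsilon>\<^sup>2 / (2 * (\<upsilon> - 1))) holomorphic_on uhp"
    by (rule eval_hol_ops(4)) (simp_all add: hol_eval upsilon_pointwise)
  thus ?thesis unfolding delta_def by (rule eval_hol_ops(2)) (simp add: hol_eval)
qed

text \<open>Identities in the field hold at every single point because the functions are
  holomorphic; multiplication by \<upsilon> beforehand removes the denominators.\<close>

lemma generators_pointwise:
  assumes \<tau>: "\<tau> \<in> uhp"
  shows "cub (eval_mero \<upsilon> \<tau>) t = eval_mero \<upsilon> \<tau> * ((t - eval_mero g1 \<tau>) * (t - eval_mero g2 \<tau>) * (t - eval_mero g3 \<tau>))"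
    "eval_mero \<delta> \<tau> ^ 2 = eval_mero \<upsilon> \<tau> * (eval_mero \<upsilon> \<tau> - 1) * (eval_mero \<upsilon> \<tau> ^ 3 - 8 * eval_mero \<upsilon> \<tau> ^ 2 + 5 * eval_mero \<upsilon> \<tau> + 1)"
proof -
  have "eval_mero (\<delta>\<^sup>2) \<tau> = eval_mero (\<upsilon> * (\<upsilon> - 1) * (\<upsilon> ^ 3 - 8 * \<upsilon>\<^sup>2 + 5 * \<upsilon> + 1)) \<tau>" unfolding delta_square ..
  thus "eval_mero \<delta> \<tau> ^ 2 = eval_mero \<upsilon> \<tau> * (eval_mero \<upsilon> \<tau> - 1) * (eval_mero \<upsilon> \<tau> ^ 3 - 8 * eval_mero \<upsilon> \<tau> ^ 2 + 5 * eval_mero \<upsilon> \<tau> + 1)"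
    using \<tau> by (simp add: hol_eval delta_holomorphic)
  define x a b c where "x = eval_mero \<upsilon> \<tau>" and "a = eval_mero g1 \<tau>" and "b = eval_mero g2 \<tau>" and "c = eval_mero g3 \<tau>"
  have "eval_mero (g1 + g2 + g3) \<tau> = eval_mero (- 1) \<tau>" unfolding g_sum ..
  hence e1: "a + b + c = - 1" using \<tau> by (simp add: hol_eval eval_uminus_hol a_def b_def c_def)
  have "\<upsilon> * (g1 * g2 + g2 * g3 + g1 * g3) = 1 - \<upsilon> ^ 2" unfolding g_symmetric using upsilon_neq by simp
  hence "eval_mero (\<upsilon> * (g1 * g2 + g2 * g3 + g1 * g3)) \<tau> = eval_mero (1 - \<upsilon> ^ 2) \<tau>" by simp
  hence e2: "x * (a * b + b * c + a * c) = 1 - x ^ 2" using \<tau> by (simp add: hol_eval a_def b_def c_def x_def)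
  have "\<upsilon> * (g1 * g2 * g3) + (\<upsilon> - 1) ^ 2 = 0" unfolding g_symmetric using upsilon_neq by simp
  hence "eval_mero (\<upsilon> * (g1 * g2 * g3) + (\<upsilon> - 1) ^ 2) \<tau> = 0" using \<tau> by (simp add: eval_zero)
  hence e3: "x * (a * b * c) + (x - 1) ^ 2 = 0" using \<tau> by (simp add: hol_eval a_def b_def c_def x_def)
  have "x * ((t - a) * (t - b) * (t - c)) = x * t ^ 3 - x * (a + b + c) * t ^ 2 + (x * (a * b + b * c + a * c)) * t - x * (a * b * c)"
    by (simp add: algebra_simps eval_nat_numeral)
  also have "x * (a * b * c) = - ((x - 1) ^ 2)" using e3 by (simp add: eq_neg_iff_add_eq_0)
  also have "x * t ^ 3 - x * (a + b + c) * t ^ 2 + (x * (a * b + b * c + a * c)) * t - - ((x - 1) ^ 2) = cub x t"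
    unfolding e1 e2 cub_def by (simp add: algebra_simps)
  finally show "cub (eval_mero \<upsilon> \<tau>) t = eval_mero \<upsilon> \<tau> * ((t - eval_mero g1 \<tau>) * (t - eval_mero g2 \<tau>) * (t - eval_mero g3 \<tau>))"
    by (simp add: a_def b_def c_def x_def)
qed

lemma X14_model_iff:
  "v \<in> X14_model \<longleftrightarrow> v $ 2 ^ 7 = v $ 1 ^ 4 * (v $ 1 - 1) \<and> cub (v $ 1) (v $ 3) = 0 \<and>
     (v $ 4)\<^sup>2 = v $ 1 * (v $ 1 - 1) * (v $ 1 ^ 3 - 8 * (v $ 1)\<^sup>2 + 5 * v $ 1 + 1)"
  by (simp add: X14_model_def Let_def cub_def)

definition gens :: "mero_uhp ^ 4" where "gens = vector [\<upsilon>, \<psi>, g1, \<delta>]"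

definition pt :: "complex \<Rightarrow> complex ^ 4" where "pt \<tau> = (\<chi> i. eval_mero (gens $ i) \<tau>)"

lemma pt_entries: "pt \<tau> $ 1 = eval_mero \<upsilon> \<tau>" "pt \<tau> $ 2 = eval_mero \<psi> \<tau>" "pt \<tau> $ 3 = eval_mero g1 \<tau>" "pt \<tau> $ 4 = eval_mero \<delta> \<tau>"
  by (simp_all add: pt_def gens_def)

lemma gens_holomorphic: "eval_mero (gens $ i) holomorphic_on uhp"
  using exhaust_4[of i] upsilon_psi_holomorphic g1_holomorphic delta_holomorphic by (auto simp: gens_def)

lemma pt_in_model: "\<tau> \<in> uhp \<Longrightarrow> pt \<tau> \<in> X14_model"
  by (simp add: X14_model_iff pt_entries generators_pointwise upsilon_pointwise(3))

lemma act_T7_delta: "act T7 \<delta> = - \<delta>"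
proof -
  have 2: "act T7 2 = 2" using B_T_SL2Z(3) act_const[of T7 2] by (simp add: mero_const_numeral)
  have "act T7 \<delta> = \<upsilon>\<^sup>2 / (2 * (\<upsilon> - 1)) * ((g1 - g3) * (g3 - g2) * (g2 - g1))"
    unfolding delta_def using B_T_SL2Z(3)
    by (simp add: act_mult act_divide act_diff act_power act_g 2 act_upsilon_psi_Gamma1(1)[OF B_T_Gamma1(3)])
  also have "(g1 - g3) * (g3 - g2) * (g2 - g1) = - ((g1 - g2) * (g2 - g3) * (g3 - g1))" by (simp add: algebra_simps)
  finally show ?thesis by (simp add: delta_def)
qed

text \<open>Translations by multiples of 4 do not move the roots of the cubic. Since
  \<open>2 * 4 = 8\<close> is 1 modulo 7, the \<open>k\<close>-th one multiplies \<psi> by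
  \<open>zeta7 k\<close>, so all 7th roots of unity occur.\<close>

lemma act_translation:
  defines "T \<equiv> \<lambda>k. mat2 1 (4 * k) 0 1"
  shows "T k \<in> Gamma1_7" "act (T k) g1 = g1" "act (T k) \<delta> = \<delta>"
proof -
  show G: "T k \<in> Gamma1_7" by (simp add: T_def Gamma1_7_def SL2Z_iff)
  note S = Gamma1_7_D(1)[OF G]
  show g1: "act (T k) g1 = g1" by (rule act_g1_even[OF G]) (simp add: T_def)
  have "act (B1 ** T k) g1 = act B1 g1"
    by (rule act_g1_cases(1)[OF Gamma1_7_mult[OF B_T_Gamma1(1) G]]) (simp_all add: matmul_entry B1_def T_def)
  hence g2: "act (T k) g2 = g2" by (simp add: act_comp B_T_SL2Z S act_B1_g1)
  have "act (B2 ** T k) g1 = g3"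
    by (rule act_g1_cases(2)[OF Gamma1_7_mult[OF B_T_Gamma1(2) G]]) (simp_all add: matmul_entry B2_def T_def)
  hence g3: "act (T k) g3 = g3" by (simp add: act_comp B_T_SL2Z S act_B2_g1)
  have 2: "act (T k) 2 = 2" using S act_const[of "T k" 2] by (simp add: mero_const_numeral)
  show "act (T k) \<delta> = \<delta>" unfolding delta_def using S
    by (simp add: act_mult act_divide act_diff act_power g1 g2 g3 2 act_upsilon_psi_Gamma1(1)[OF G])
qed

text \<open>The coordinates are adjusted one at a time: \<open>g1\<close> by \<open>B1\<close> or
  \<open>B2\<close>, then the sign of \<delta> by \<open>T7\<close>, which fixes \<open>g1\<close>,
  then \<psi> by a translation that fixes both. The value of \<upsilon> never changes.\<close>

lemma fibre_in_image:
  fixes v :: "complex ^ 4"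
  assumes v: "v \<in> X14_model" and \<tau>: "\<tau> \<in> uhp" and x: "v $ 1 = eval_mero \<upsilon> \<tau>"
  shows "\<exists>\<tau>'\<in>uhp. v = pt \<tau>'"
proof -
  have move: "moebius_act A t \<in> uhp \<and> eval_mero \<upsilon> (moebius_act A t) = eval_mero \<upsilon> t \<and>
      (\<forall>f. eval_mero f (moebius_act A t) = eval_mero (act A f) t)" if "A \<in> Gamma1_7" "t \<in> uhp" for A t
    using that Gamma1_7_D(1)[OF that(1)] act_upsilon_psi_Gamma1(1)[OF that(1)] eval_act[of A t] moebius_facts(2)[of A t] by metis
  have "(v $ 3 - eval_mero g1 \<tau>) * (v $ 3 - eval_mero g2 \<tau>) * (v $ 3 - eval_mero g3 \<tau>) = 0"
    using v generators_pointwise(1)[OF \<tau>, of "v $ 3"] upsilon_pointwise(1)[OF \<tau>] by (simp add: X14_model_iff x)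
  hence "v $ 3 = eval_mero g1 \<tau> \<or> v $ 3 = eval_mero g2 \<tau> \<or> v $ 3 = eval_mero g3 \<tau>" by auto
  hence "\<exists>t\<in>uhp. eval_mero \<upsilon> t = v $ 1 \<and> eval_mero g1 t = v $ 3"
    using move[OF B_T_Gamma1(1) \<tau>] move[OF B_T_Gamma1(2) \<tau>] \<tau> x act_B1_g1 act_B2_g1 by metis
  then obtain t where t: "t \<in> uhp" "eval_mero \<upsilon> t = v $ 1" "eval_mero g1 t = v $ 3" by blast
  have "(v $ 4)\<^sup>2 = (eval_mero \<delta> t)\<^sup>2" using v unfolding generators_pointwise(2)[OF t(1)] t(2) X14_model_iff by simp
  hence "v $ 4 = eval_mero \<delta> t \<or> v $ 4 = - eval_mero \<delta> t" by (simp add: power2_eq_iff)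
  moreover have "eval_mero (- \<delta>) t = - eval_mero \<delta> t" using eval_uminus_hol[OF delta_holomorphic t(1)] .
  ultimately have "\<exists>t\<in>uhp. eval_mero \<upsilon> t = v $ 1 \<and> eval_mero g1 t = v $ 3 \<and> eval_mero \<delta> t = v $ 4"
    using move[OF B_T_Gamma1(3) t(1)] t act_g(1) act_T7_delta by metis
  then obtain s where s: "s \<in> uhp" "eval_mero \<upsilon> s = v $ 1" "eval_mero g1 s = v $ 3" "eval_mero \<delta> s = v $ 4" by blast
  have "(v $ 2 / eval_mero \<psi> s) ^ 7 = 1"
    using v upsilon_pointwise(3)[OF s(1)] upsilon_pointwise(1,2,4)[OF s(1)] by (simp add: power_divide X14_model_iff s)
  hence "v $ 2 / eval_mero \<psi> s \<in> {z. z ^ 7 = 1}" by simp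
  then obtain k where "v $ 2 / eval_mero \<psi> s = exp (2 * of_real pi * \<i> * of_nat k / of_nat 7)"
    using complex_roots_unity[of 7] by auto
  also have "\<dots> = zeta7 (int k)" unfolding zeta7_def by simp
  also have "\<dots> = zeta7 (2 * (4 * int k))" by (rule zeta7_cong) simp
  finally have y: "v $ 2 = zeta7 (2 * (4 * int k)) * eval_mero \<psi> s" using upsilon_pointwise(4)[OF s(1)] by (simp add: field_simps)
  note T = act_translation[of "int k"]
  let ?s = "moebius_act (mat2 1 (4 * int k) 0 1) s"
  have "eval_mero \<psi> ?s = eval_mero (mero_const (zeta7 (2 * (4 * int k))) * \<psi>) s"
    using move[OF T(1) s(1)] act_upsilon_psi_Gamma1(2)[OF T(1)] by simp
  also have "\<dots> = v $ 2" unfolding y using s(1)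
    by (simp add: eval_hol_ops(6)[OF eval_const_holomorphic upsilon_psi_holomorphic(2)] eval_const)
  finally have "v = pt ?s" using move[OF T(1) s(1)] T(2,3) s act_upsilon_psi_Gamma1(1)[OF T(1)]
    by (simp add: vec_eq_iff forall_4 pt_entries)
  thus ?thesis using move[OF T(1) s(1)] by blast
qed

text \<open>Otherwise \<open>1 / (\<upsilon> - x)\<close> is holomorphic and bounded on the upper
  half-plane together with its conjugates; Liouville's theorem makes it constant, and \<upsilon>
  with it.\<close>

lemma upsilon_dense:
  assumes "e > 0"
  shows "\<exists>\<tau>\<in>uhp. norm (eval_mero \<upsilon> \<tau> - x) < e"
proof (rule ccontr)
  assume "\<not> ?thesis"
  hence far: "norm (eval_mero \<upsilon> \<tau> - x) \<ge> e" if "\<tau> \<in> uhp" for \<tau> using that by (meson not_less)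
  define d where "d = \<upsilon> - mero_const x"
  have dh: "eval_mero d holomorphic_on uhp" and de: "\<And>\<tau>. \<tau> \<in> uhp \<Longrightarrow> eval_mero d \<tau> = eval_mero \<upsilon> \<tau> - x"
    using upsilon_psi_holomorphic(1) eval_const_holomorphic[of x] by (simp_all add: d_def eval_hol_ops eval_const)
  have dnz: "eval_mero d \<tau> \<noteq> 0" if "\<tau> \<in> uhp" for \<tau> using far[OF that] assms de[OF that] by auto
  define f where "f = 1 / d"
  have fh: "eval_mero f holomorphic_on uhp" unfolding f_def using eval_hol_ops(4)[OF eval_one(1) dh dnz] .
  have fe: "eval_mero f \<tau> = 1 / (eval_mero \<upsilon> \<tau> - x)" if "\<tau> \<in> uhp" for \<tau>
    unfolding f_def using eval_hol_ops(8)[OF eval_one(1) dh that dnz[OF that]] de[OF that] eval_one(2)[OF that] by simp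
  have fA: "f \<in> \<A>\<^sub>0 Gamma1_7"
    unfolding f_def d_def by (intro C_subfieldD(1,3,6,8)[OF upsilon.AG_field] upsilon_Gamma1)
  hence "f \<in> \<A>\<^sub>0 \<Gamma>(7)" using modular_functions_antimono[OF Gamma_subset_Gamma1_7(1)] by blast
  moreover have "\<exists>B. eventually (\<lambda>\<tau>. norm (eval_mero (act A f) \<tau>) \<le> B) ioo" if A: "A \<in> SL2Z" for A
  proof (intro exI[of _ "1 / e"], unfold eventually_ioo, intro exI[of _ 1] conjI allI impI)
    fix \<tau> :: complex assume "1 < Im \<tau>"
    hence "\<tau> \<in> uhp" by (simp add: uhp_def)
    hence "moebius_act A \<tau> \<in> uhp" "eval_mero (act A f) \<tau> = eval_mero f (moebius_act A \<tau>)" using A by (simp_all add: moebius_facts eval_act)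
    thus "norm (eval_mero (act A f) \<tau>) \<le> 1 / e"
      using far[of "moebius_act A \<tau>"] assms by (simp add: fe norm_divide frac_le)
  qed simp
  ultimately obtain c where c: "f = mero_const c" using modular_Liouville[of f 7] fh by auto
  have "d \<noteq> 0" using dnz[of \<i>] eval_zero[of \<i>] by (auto simp: uhp_def)
  hence df: "d * mero_const c = 1" unfolding c[symmetric] f_def by simp
  hence "c \<noteq> 0" by (auto simp: mero_const_0)
  hence "mero_const c * mero_const (1 / c) = 1" unfolding mero_const_mult[symmetric] by (simp add: mero_const_1)
  hence "d = mero_const (1 / c)" using df by (metis mult.assoc mult_1_left mult_1_right)
  hence "\<upsilon> = mero_const (x + 1 / c)" unfolding d_def mero_const_add by (simp add: algebra_simps)
  hence "peval [:- (x + 1 / c), 1:] \<upsilon> = mero_const (- (x + 1 / c) + (x + 1 / c))"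
    unfolding mero_const_add[of "- (x + 1 / c)"] by (simp add: mero_const_1 del: minus_add_distrib)
  hence "peval [:- (x + 1 / c), 1:] \<upsilon> = 0" by (simp add: mero_const_0)
  thus False using upsilon.peval_u_nonzero[of "[:- (x + 1 / c), 1:]"] by simp
qed

text \<open>The absolute value of a monic polynomial at \<open>c\<close> is the product of the
  distances from \<open>c\<close> to its roots, so a nearest root satisfies the bound. The induction
  splits off one linear factor at a time.\<close>

lemma nearest_root:
  fixes p :: "complex poly"
  assumes "Polynomial.degree p = n" "n > 0" "Polynomial.lead_coeff p = 1"
  shows "\<exists>r. poly p r = 0 \<and> norm (c - r) ^ n \<le> norm (poly p c)"
  using assms
proof (induction n arbitrary: p)
  case (Suc n)
  have "\<not> constant (poly p)" using Suc.prems by (simp add: constant_degree)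
  then obtain r where r: "poly p r = 0" using fundamental_theorem_of_algebra by blast
  then obtain q where q: "p = [:- r, 1:] * q" by (metis poly_eq_0_iff_dvd dvdE)
  have "q \<noteq> 0" using q Suc.prems by auto
  hence dq1: "Polynomial.degree q = n"
    using Suc.prems unfolding q by (simp add: degree_mult_eq del: mult_pCons_left)
  have "Polynomial.lead_coeff p = Polynomial.lead_coeff q" unfolding q lead_coeff_mult by simp
  hence dq: "Polynomial.degree q = n" "Polynomial.lead_coeff q = 1" using Suc.prems dq1 by simp_all
  have pc: "norm (poly p c) = norm (c - r) * norm (poly q c)" unfolding q poly_mult norm_mult by simp
  show ?case
  proof (cases "n = 0")
    case True
    then obtain a where "q = [:a:]" using dq(1) degree_0_id by metis
    thus ?thesis using r pc dq True by (intro exI[of _ r]) simp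
  next
    case False
    then obtain s where s: "poly q s = 0" "norm (c - s) ^ n \<le> norm (poly q c)" using Suc.IH[OF dq(1) _ dq(2)] by blast
    show ?thesis
    proof (cases "norm (c - r) \<le> norm (c - s)")
      case True
      have "norm (c - r) ^ n \<le> norm (poly q c)" using power_mono[OF True, of n] s(2) by simp
      thus ?thesis using r pc by (intro exI[of _ r]) (simp add: mult_left_mono)
    next
      case False
      hence "norm (c - s) * norm (c - s) ^ n \<le> norm (c - r) * norm (poly q c)" using s(2) by (intro mult_mono) auto
      moreover have "poly p s = 0" unfolding q using s by simp
      ultimately show ?thesis using pc by (intro exI[of _ s]) simp
    qed
  qed
qed simp

lemma roots_continuous:
  fixes P :: "nat \<Rightarrow> complex poly"
  assumes P: "\<And>n. Polynomial.degree (P n) = k" "k > 0" "\<And>n. Polynomial.lead_coeff (P n) = 1"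
    and lim: "(\<lambda>n. poly (P n) c) \<longlonglongrightarrow> 0"
  obtains r where "\<And>n. poly (P n) (r n) = 0" "r \<longlonglongrightarrow> c"
proof -
  have "\<forall>n. \<exists>r. poly (P n) r = 0 \<and> norm (c - r) ^ k \<le> norm (poly (P n) c)" using nearest_root[OF P(1,2,3)] by blast
  then obtain r where r: "\<And>n. poly (P n) (r n) = 0" "\<And>n. norm (c - r n) ^ k \<le> norm (poly (P n) c)" by metis
  have "(\<lambda>n. root k (norm (poly (P n) c))) \<longlonglongrightarrow> root k (norm (0 :: complex))"
    by (intro tendsto_real_root tendsto_norm lim)
  hence lim': "(\<lambda>n. root k (norm (poly (P n) c))) \<longlonglongrightarrow> 0" by simp
  have "norm (r n - c) \<le> root k (norm (poly (P n) c))" for n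
  proof -
    have "root k (norm (c - r n) ^ k) \<le> root k (norm (poly (P n) c))" using r(2) P(2) by simp
    thus ?thesis using P(2) by (simp add: real_root_power_cancel norm_minus_commute)
  qed
  hence "(\<lambda>n. r n - c) \<longlonglongrightarrow> 0" by (intro Lim_null_comparison[OF _ lim']) simp
  thus ?thesis using that r(1) LIM_zero_cancel by blast
qed

text \<open>The leading coefficient is \<open>x n\<close>, and dividing by it works unless
  \<open>x0 = 0\<close>. In that case the only finite root in the limit is -1, and the reversed
  polynomial has leading coefficient \<open>(x n - 1) ^ 2\<close>, which stays away from 0 near the
  limit.\<close>

lemma cub_root_continuous:
  assumes x: "x \<longlonglongrightarrow> x0" "\<And>n. x n \<noteq> 0" "\<And>n. x n \<noteq> 1" and z0: "cub x0 z0 = (0 :: complex)"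
  obtains z where "\<And>n. cub (x n) (z n) = 0" "z \<longlonglongrightarrow> z0"
proof (cases "x0 = 0")
  case False
  let ?P = "\<lambda>n. [: (x n - 1)\<^sup>2 / x n, - ((x n ^ 2 - 1) / x n), 1, 1 :]"
  have ev: "poly (?P n) t = cub (x n) t / x n" for n t
    using x(2)[of n] by (simp add: cub_def field_simps eval_nat_numeral)
  have "(\<lambda>n. poly (?P n) z0) \<longlonglongrightarrow> cub x0 z0 / x0"
    unfolding ev unfolding cub_def by (intro tendsto_intros x(1) False)
  hence lim: "(\<lambda>n. poly (?P n) z0) \<longlonglongrightarrow> 0" using z0 by simp
  obtain r where "\<And>n. poly (?P n) (r n) = 0" "r \<longlonglongrightarrow> z0"
    by (rule roots_continuous[of ?P 3 z0]) (use lim in auto)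
  thus ?thesis using that[of r] x(2) unfolding ev by simp
next
  case True
  have z0': "z0 = - 1" using z0 by (simp add: cub_def True eq_neg_iff_add_eq_0)
  \<comment> \<open>Near \<open>x = 0\<close> two of the roots escape to infinity, so the reversed polynomial is used.\<close>
  let ?P = "\<lambda>n. [: x n / (x n - 1)\<^sup>2, x n / (x n - 1)\<^sup>2, - ((x n ^ 2 - 1) / (x n - 1)\<^sup>2), 1 :]"
  have ev: "poly (?P n) t = (x n + x n * t - (x n ^ 2 - 1) * t ^ 2 + (x n - 1)\<^sup>2 * t ^ 3) / (x n - 1)\<^sup>2" for n t
  proof -
    have "poly [:a / D, a / D, - (b / D), 1:] t = (a + a * t - b * t ^ 2 + D * t ^ 3) / D" if "D \<noteq> 0" for a b D :: complex
      using that by (simp add: field_simps eval_nat_numeral)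
    thus ?thesis using x(3)[of n] by simp
  qed
  have "(\<lambda>n. poly (?P n) (- 1)) \<longlonglongrightarrow> (x0 + x0 * (- 1) - (x0 ^ 2 - 1) * (- 1) ^ 2 + (x0 - 1)\<^sup>2 * (- 1) ^ 3) / (x0 - 1)\<^sup>2"
    unfolding ev by (intro tendsto_intros x(1)) (simp add: True)
  hence lim: "(\<lambda>n. poly (?P n) (- 1)) \<longlonglongrightarrow> 0" by (simp add: True)
  obtain r where r: "\<And>n. poly (?P n) (r n) = 0" "r \<longlonglongrightarrow> - 1"
    by (rule roots_continuous[of ?P 3 "- 1"]) (use lim in auto)
  have num: "x n + x n * r n - (x n ^ 2 - 1) * r n ^ 2 + (x n - 1)\<^sup>2 * r n ^ 3 = 0" for n
    using r(1)[of n] x(3)[of n] unfolding ev divide_eq_0_iff by simp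
  have rnz: "r n \<noteq> 0" for n using num[of n] x(2)[of n] by auto
  have "cub (x n) (1 / r n) = 0" for n
  proof -
    have "r n ^ 3 * cub (x n) (1 / r n) = x n + x n * r n - (x n ^ 2 - 1) * r n ^ 2 + (x n - 1)\<^sup>2 * r n ^ 3"
      using rnz[of n] by (simp add: cub_def field_simps eval_nat_numeral)
    thus ?thesis using num[of n] rnz[of n] by simp
  qed
  moreover have "(\<lambda>n. 1 / r n) \<longlonglongrightarrow> 1 / (- 1)" by (intro tendsto_intros r(2)) simp
  ultimately show ?thesis using that[of "\<lambda>n. 1 / r n"] z0' by simp
qed

text \<open>Given the first coordinate, the equations for the other three are separate polynomials
  in one variable, so each of them can be followed on its own while the first approaches its limit
  through values of \<upsilon>.\<close>

lemma model_approximation: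
  fixes v0 :: "complex ^ 4"
  assumes v0: "v0 \<in> X14_model"
  obtains v :: "nat \<Rightarrow> complex ^ 4" where "\<And>n. v n \<in> X14_model" "\<And>n. \<exists>\<tau>\<in>uhp. v n $ 1 = eval_mero \<upsilon> \<tau>" "v \<longlonglongrightarrow> v0"
proof -
  have "\<forall>n. \<exists>\<tau>\<in>uhp. norm (eval_mero \<upsilon> \<tau> - v0 $ 1) < inverse (real (Suc n))" using upsilon_dense by simp
  then obtain \<tau> where \<tau>: "\<And>n. \<tau> n \<in> uhp" "\<And>n. norm (eval_mero \<upsilon> (\<tau> n) - v0 $ 1) < inverse (real (Suc n))" by metis
  define x where "x n = eval_mero \<upsilon> (\<tau> n)" for n
  have "(\<lambda>n. x n - v0 $ 1) \<longlonglongrightarrow> 0"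
    by (rule Lim_null_comparison[OF _ LIMSEQ_inverse_real_of_nat]) (use \<tau>(2) in \<open>auto simp: x_def less_imp_le\<close>)
  hence x: "x \<longlonglongrightarrow> v0 $ 1" by (rule LIM_zero_cancel)
  have xn: "x n \<noteq> 0" "x n \<noteq> 1" for n using upsilon_pointwise[OF \<tau>(1)] by (simp_all add: x_def)
  have v0': "v0 $ 2 ^ 7 = v0 $ 1 ^ 4 * (v0 $ 1 - 1)" "cub (v0 $ 1) (v0 $ 3) = 0"
     "(v0 $ 4)\<^sup>2 = v0 $ 1 * (v0 $ 1 - 1) * (v0 $ 1 ^ 3 - 8 * (v0 $ 1)\<^sup>2 + 5 * v0 $ 1 + 1)" using v0 by (simp_all add: X14_model_iff)
  obtain z where z: "\<And>n. cub (x n) (z n) = 0" "z \<longlonglongrightarrow> v0 $ 3"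
    by (rule cub_root_continuous[OF x xn v0'(2)]) blast
  let ?F = "\<lambda>n. [:- (x n ^ 4 * (x n - 1)), 0, 0, 0, 0, 0, 0, 1:]"
  have F: "poly (?F n) t = t ^ 7 - x n ^ 4 * (x n - 1)" for n t by (simp add: eval_nat_numeral)
  have "(\<lambda>n. poly (?F n) (v0 $ 2)) \<longlonglongrightarrow> v0 $ 2 ^ 7 - v0 $ 1 ^ 4 * (v0 $ 1 - 1)" unfolding F by (intro tendsto_intros x)
  hence "(\<lambda>n. poly (?F n) (v0 $ 2)) \<longlonglongrightarrow> 0" unfolding v0'(1) by simp
  then obtain y where y: "\<And>n. poly (?F n) (y n) = 0" "y \<longlonglongrightarrow> v0 $ 2"
    by (rule roots_continuous[of ?F 7, rotated 3]) auto
  let ?G = "\<lambda>n. [:- (x n * (x n - 1) * (x n ^ 3 - 8 * (x n)\<^sup>2 + 5 * x n + 1)), 0, 1:]"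
  have G: "poly (?G n) t = t\<^sup>2 - x n * (x n - 1) * (x n ^ 3 - 8 * (x n)\<^sup>2 + 5 * x n + 1)" for n t by (simp add: power2_eq_square)
  have "(\<lambda>n. poly (?G n) (v0 $ 4)) \<longlonglongrightarrow> (v0 $ 4)\<^sup>2 - v0 $ 1 * (v0 $ 1 - 1) * (v0 $ 1 ^ 3 - 8 * (v0 $ 1)\<^sup>2 + 5 * v0 $ 1 + 1)"
    unfolding G by (intro tendsto_intros x)
  hence "(\<lambda>n. poly (?G n) (v0 $ 4)) \<longlonglongrightarrow> 0" unfolding v0'(3) by simp
  then obtain w where w: "\<And>n. poly (?G n) (w n) = 0" "w \<longlonglongrightarrow> v0 $ 4"
    by (rule roots_continuous[of ?G 2, rotated 3]) auto
  define v :: "nat \<Rightarrow> complex ^ 4" where "v n = vector [x n, y n, z n, w n]" for n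
  have "v n \<in> X14_model" for n
    using y(1)[of n] z(1)[of n] w(1)[of n] unfolding F G by (simp add: X14_model_iff v_def)
  moreover have "\<exists>\<tau>\<in>uhp. v n $ 1 = eval_mero \<upsilon> \<tau>" for n using \<tau>(1)[of n] by (auto simp: v_def x_def)
  moreover have "v \<longlonglongrightarrow> v0"
  proof (rule vec_tendstoI)
    fix i :: 4
    show "(\<lambda>n. v n $ i) \<longlonglongrightarrow> v0 $ i" using exhaust_4[of i] x y(2) z(2) w(2) by (auto simp: v_def)
  qed
  ultimately show ?thesis using that by blast
qed

interpretation X14: generic_point X14_model gens
proof
  fix p :: "4 cpoly"
  note ev = eval_mev[of gens, OF gens_holomorphic, folded pt_def]
  show "p \<in> vanishing_ideal X14_model \<longleftrightarrow> mev gens p = 0"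
  proof
    assume p: "p \<in> vanishing_ideal X14_model"
    show "mev gens p = 0"
    proof (rule mero_eqI)
      fix \<tau> assume "\<tau> \<in> uhp"
      thus "eval_mero (mev gens p) \<tau> = eval_mero 0 \<tau>"
        using p pt_in_model[of \<tau>] by (simp add: ev(2) eval_zero vanishing_ideal_def)
    qed
  next
    assume p: "mev gens p = 0"
    show "p \<in> vanishing_ideal X14_model" unfolding vanishing_ideal_def
    proof (intro CollectI ballI)
      fix v0 assume "v0 \<in> X14_model"
      then obtain v :: "nat \<Rightarrow> complex ^ 4" where v: "\<And>n. v n \<in> X14_model" "\<And>n. \<exists>\<tau>\<in>uhp. v n $ 1 = eval_mero \<upsilon> \<tau>" "v \<longlonglongrightarrow> v0"
        using model_approximation by metis
      \<comment> \<open>The approximating points are images of points of the upper half-plane, where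
        \<open>p\<close> vanishes by assumption; continuity extends this to
        \<open>v0\<close>.\<close>
      have zero: "cpoly_eval p (v n) = 0" for n
      proof -
        obtain t where "t \<in> uhp" "v n = pt t" using fibre_in_image[OF v(1)] v(2) by metis
        thus ?thesis using ev(2)[of t p] p eval_zero by simp
      qed
      have "(\<lambda>n. cpoly_eval p (v n)) \<longlonglongrightarrow> cpoly_eval p v0"
        unfolding cpoly_eval_def by (intro tendsto_intros tendsto_vec_nth v(3))
      thus "cpoly_eval p v0 = 0" unfolding zero by (simp add: LIMSEQ_const_iff)
    qed
  qed
qed

lemma zariski_closed_X14: "zariski_closed X14_model"
proof -
  define a :: "4 cpoly" where "a = cpoly_var 1"
  define S where "S = {cpoly_var 2 ^ 7 - a ^ 4 * (a - 1), a * cpoly_var 3 ^ 3 + a * cpoly_var 3 ^ 2 - (a ^ 2 - 1) * cpoly_var 3 + (a - 1) ^ 2,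
     cpoly_var 4 ^ 2 - a * (a - 1) * (a ^ 3 - cpoly_const 8 * a ^ 2 + cpoly_const 5 * a + 1)}"
  have "X14_model = {v. \<forall>p\<in>S. cpoly_eval p v = 0}"
    unfolding S_def a_def by (auto simp: X14_model_iff cpoly_eval_gev cpoly_eval_simps cub_def)
  thus ?thesis unfolding zariski_closed_def by blast
qed

lemma cpoly_of_poly:
  obtains e :: "4 cpoly" where "mev gens e = peval n \<upsilon>" "\<And>v. cpoly_eval e v = poly n (v $ 1)"
proof -
  have "\<exists>e :: 4 cpoly. mev gens e = peval n \<upsilon> \<and> (\<forall>v. cpoly_eval e v = poly n (v $ 1))"
  proof (induction n)
    case 0
    show ?case by (rule exI[of _ 0]) (simp add: mev_simps cpoly_eval_gev)
  next
    case (pCons a n)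
    then obtain e :: "4 cpoly" where e: "mev gens e = peval n \<upsilon>" "\<And>v. cpoly_eval e v = poly n (v $ 1)" by blast
    show ?case
      by (rule exI[of _ "cpoly_const a + cpoly_var 1 * e"])
        (use e in \<open>simp add: mev_simps gens_def cpoly_eval_gev cpoly_eval_simps\<close>)
  qed
  thus ?thesis using that by blast
qed

text \<open>Coefficients of level Gamma_1(7) are rational in \<upsilon>; after multiplication by
  their denominators everything comes from polynomials in the coordinates.\<close>

lemma clear_denominators:
  assumes "\<And>i. poly.coeff q i \<in> \<A>\<^sub>0 Gamma1_7"
  shows "\<exists>n r. n \<noteq> 0 \<and> peval n \<upsilon> * poly q (mev gens p) = mev gens r"
  using assms
proof (induction q)
  case 0
  show ?case by (rule exI[of _ 1], rule exI[of _ 0]) (simp add: mev_simps)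
next
  case (pCons a q)
  have "poly.coeff q i \<in> \<A>\<^sub>0 Gamma1_7" for i using pCons.prems[of "Suc i"] by simp
  then obtain n r where n: "n \<noteq> 0" "peval n \<upsilon> * poly q (mev gens p) = mev gens r" using pCons.IH by blast
  have "a \<in> \<A>\<^sub>0 Gamma1_7" using pCons.prems[of 0] by simp
  then obtain s t where st: "peval t \<upsilon> \<noteq> 0" "a = peval s \<upsilon> / peval t \<upsilon>" using upsilon.hauptmodul_generates by metis
  obtain en where en: "mev gens en = peval n \<upsilon>" using cpoly_of_poly by metis
  obtain es where es: "mev gens es = peval s \<upsilon>" using cpoly_of_poly by metis
  obtain et where et: "mev gens et = peval t \<upsilon>" using cpoly_of_poly by metis
  have "t \<noteq> 0" using st by auto
  have "peval (n * t) \<upsilon> * poly (pCons a q) (mev gens p) =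
      peval n \<upsilon> * (peval t \<upsilon> * a) + peval t \<upsilon> * mev gens p * (peval n \<upsilon> * poly q (mev gens p))"
    by (simp add: peval_mult algebra_simps)
  also have "peval t \<upsilon> * a = peval s \<upsilon>" using st by simp
  finally have "peval (n * t) \<upsilon> * poly (pCons a q) (mev gens p) = mev gens (en * es + et * p * r)"
    unfolding n(2) by (simp add: mev_simps en es et)
  thus ?case using n(1) \<open>t \<noteq> 0\<close> by (intro exI[of _ "n * t"] exI) auto
qed

lemma gens_Gamma14: "gens $ i \<in> \<A>\<^sub>0 \<Gamma>(14)"
  using exhaust_4[of i] generators_Gamma14 by (auto simp: gens_def)

text \<open>The norm of \<open>p\<close> is a nonzero rational function of \<upsilon>. Cleared of
  denominators it is a polynomial in the first coordinate and a multiple of \<open>p\<close> on the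
  curve, so the zeros of \<open>p\<close> lie above its finitely many roots.\<close>

lemma norm_polynomial:
  assumes "mev gens p \<noteq> 0"
  obtains n where "n \<noteq> 0" "\<And>v. v \<in> X14_model \<Longrightarrow> cpoly_eval p v = 0 \<Longrightarrow> poly n (v $ 1) = 0"
proof -
  obtain R where "congruence_group Gamma1_7 14 R" using congruence_group_Gamma1_7[of 14] by blast
  then interpret congruence_group Gamma1_7 14 R .
  have "mev gens p \<in> \<A>\<^sub>0 \<Gamma>(14)" by (rule mev_C_subfield[OF AN_field gens_Gamma14])
  then obtain q c where q: "\<And>i. poly.coeff q i \<in> \<A>\<^sub>0 Gamma1_7" "c \<in> \<A>\<^sub>0 Gamma1_7" "c \<noteq> 0" "mev gens p * poly q (mev gens p) = c"
    using norm_relation[OF _ assms] by metis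
  obtain s t where st: "peval t \<upsilon> \<noteq> 0" "c = peval s \<upsilon> / peval t \<upsilon>" using q(2) upsilon.hauptmodul_generates by metis
  obtain n r where n: "n \<noteq> 0" "peval n \<upsilon> * poly q (mev gens p) = mev gens r" using clear_denominators[OF q(1)] by blast
  obtain et where et: "mev gens et = peval t \<upsilon>" using cpoly_of_poly by metis
  obtain e where e: "mev gens e = peval (n * s) \<upsilon>" "\<And>v. cpoly_eval e v = poly (n * s) (v $ 1)" using cpoly_of_poly by metis
  have "s \<noteq> 0" using st(2) q(3) by auto
  have "mev gens (p * r * et) = peval n \<upsilon> * (mev gens p * poly q (mev gens p)) * peval t \<upsilon>"
    by (simp add: mev_simps et n(2)[symmetric])
  also have "\<dots> = mev gens e" unfolding q(4) st(2) e(1) peval_mult using st(1) by simp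
  finally have "p * r * et - e \<in> vanishing_ideal X14_model" by (simp add: X14.vanishing_iff mev_simps)
  hence "poly (n * s) (v $ 1) = cpoly_eval p v * cpoly_eval r v * cpoly_eval et v" if "v \<in> X14_model" for v
    using that e(2)[of v] by (simp add: vanishing_ideal_def cpoly_eval_gev cpoly_eval_simps)
  thus ?thesis using that[of "n * s"] n(1) \<open>s \<noteq> 0\<close> by simp
qed

lemma finite_fibres:
  assumes "finite S"
  shows "finite {v \<in> X14_model. v $ 1 \<in> S}"
proof -
  define F where "F a = {t. poly [:- (a ^ 4 * (a - 1)), 0, 0, 0, 0, 0, 0, 1:] t = 0}" for a :: complex
  define H where "H a = {t. poly [:(a - 1)\<^sup>2, - (a\<^sup>2 - 1), a, a:] t = 0}" for a :: complex
  define G where "G a = {t. poly [:- (a * (a - 1) * (a ^ 3 - 8 * a\<^sup>2 + 5 * a + 1)), 0, 1:] t = 0}" for a :: complex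
  have fin: "finite (F a)" "finite (H a)" "finite (G a)" for a
  proof -
    \<comment> \<open>Even at \<open>a = 0\<close>, where the top coefficients vanish, the constant
      term is 1.\<close>
    have "[:(a - 1)\<^sup>2, - (a\<^sup>2 - 1), a, a:] \<noteq> 0" by auto
    thus "finite (F a)" "finite (H a)" "finite (G a)" unfolding F_def H_def G_def by (intro poly_roots_finite; simp)+
  qed
  have "{v \<in> X14_model. v $ 1 \<in> S} \<subseteq> (\<Union>a\<in>S. (\<lambda>(y, z, w). vector [a, y, z, w]) ` (F a \<times> H a \<times> G a))"
  proof
    fix v assume v: "v \<in> {v \<in> X14_model. v $ 1 \<in> S}"
    have "v = vector [v $ 1, v $ 2, v $ 3, v $ 4]" by (simp add: vec_eq_iff forall_4)
    moreover have "v $ 2 \<in> F (v $ 1)" "v $ 3 \<in> H (v $ 1)" "v $ 4 \<in> G (v $ 1)"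
      using v by (simp_all add: F_def H_def G_def X14_model_iff cub_def eval_nat_numeral algebra_simps)
    ultimately have "v \<in> (\<lambda>(y, z, w). vector [v $ 1, y, z, w]) ` (F (v $ 1) \<times> H (v $ 1) \<times> G (v $ 1))" by force
    thus "v \<in> (\<Union>a\<in>S. (\<lambda>(y, z, w). vector [a, y, z, w]) ` (F a \<times> H a \<times> G a))" using v by blast
  qed
  moreover have "finite (\<Union>a\<in>S. (\<lambda>(y, z, w). vector [a, y, z, w]) ` (F a \<times> H a \<times> G a) :: (complex ^ 4) set)"
    using assms fin by (intro finite_UN_I finite_imageI finite_cartesian_product)
  ultimately show ?thesis by (rule finite_subset)
qed

text \<open>Finitely many points would leave finitely many values for \<upsilon> and hence an
  algebraic equation over the constants.\<close>

lemma infinite_X14: "infinite X14_model"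
proof
  assume fin: "finite X14_model"
  define S where "S = (\<lambda>v. v $ 1) ` X14_model"
  have S: "finite S" unfolding S_def using fin by simp
  define q where "q = (\<Prod>a\<in>S. [:- a, 1:])"
  have "peval q \<upsilon> = 0"
  proof (rule mero_eqI)
    fix \<tau> assume \<tau>: "\<tau> \<in> uhp"
    have "eval_mero \<upsilon> \<tau> \<in> S" unfolding S_def using pt_in_model[OF \<tau>] pt_entries(1)[of \<tau>] by (metis imageI)
    hence "poly q (eval_mero \<upsilon> \<tau>) = 0" unfolding q_def poly_prod using S by (intro prod_zero) auto
    thus "eval_mero (peval q \<upsilon>) \<tau> = eval_mero 0 \<tau>"
      using \<tau> by (simp add: eval_peval[OF upsilon_psi_holomorphic(1)] eval_zero)
  qed
  moreover have "q \<noteq> 0" unfolding q_def using S by (simp add: prod_zero_iff)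
  ultimately show False using upsilon.peval_u_nonzero by blast
qed

lemma affine_curve_X14: "affine_curve X14_model"
proof (rule affine_curveI[OF X14.irreducible[OF zariski_closed_X14] infinite_X14])
  fix W :: "(complex ^ 4) set" assume W: "zariski_closed W" "W \<subset> X14_model"
  then obtain p where p: "p \<notin> vanishing_ideal X14_model" "\<And>v. v \<in> W \<Longrightarrow> cpoly_eval p v = 0"
    using zariski_closed_vanishing[of W X14_model] by blast
  then obtain n where n: "n \<noteq> 0" "\<And>v. v \<in> X14_model \<Longrightarrow> cpoly_eval p v = 0 \<Longrightarrow> poly n (v $ 1) = 0"
    using norm_polynomial[of p] unfolding X14.vanishing_iff by metis
  have "finite {v \<in> X14_model. v $ 1 \<in> {a. poly n a = 0}}" using n(1) by (intro finite_fibres poly_roots_finite)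
  moreover have "W \<subseteq> {v \<in> X14_model. v $ 1 \<in> {a. poly n a = 0}}" using W(2) p(2) n(2) by auto
  ultimately show "finite W" by (rule rev_finite_subset)
qed

lemma affine_model_X14: "affine_model (\<A>\<^sub>0 \<Gamma>(14)) X14_model (vector [\<upsilon>, \<psi>, g1, \<delta>])"
proof -
  have "range (($) gens) = {\<upsilon>, \<psi>, g1, \<delta>}" unfolding UNIV_4 by (simp add: gens_def)
  thus ?thesis using X14.affine_modelI[OF affine_curve_X14]
    unfolding modular_functions_Gamma14_delta by (simp add: gens_def)
qed

theorem theorem1p2:
  shows "\<A>\<^sub>0 \<Gamma>(7) = \<complex>({\<psi>, \<upsilon>}) \<and>
         splitting_field_over (\<A>\<^sub>0 \<Gamma>(7)) P\<^sub>\<upsilon> (\<A>\<^sub>0 \<Gamma>(14)) \<and>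
         P\<^sub>\<upsilon> = [:- g1, 1:] * [:- g2, 1:] * [:- g3, 1:] \<and>
         (2 * (\<upsilon> - 1) / \<upsilon>\<^sup>2 * \<delta>)\<^sup>2 = cubic_discriminant P\<^sub>\<upsilon> \<and>
         \<A>\<^sub>0 \<Gamma>(14) = \<complex>({\<upsilon>, \<psi>, g1, \<delta>}) \<and>
         \<A>\<^sub>0 \<Gamma>(14) = \<complex>({\<upsilon>, \<psi>, g1, g2}) \<and>
         affine_model (\<A>\<^sub>0 \<Gamma>(14)) X14_model (vector [\<upsilon>, \<psi>, g1, \<delta>])"
  using modular_functions_Gamma7 splitting_field_P_upsilon P_upsilon_factorization delta_discriminant(2)
    modular_functions_Gamma14_delta modular_functions_Gamma14_g2 affine_model_X14 by blast

end
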